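(* Let $k\ge 1$, let $\theta_1,\dots,\theta_k\in[0,2\pi)$ be distinct, let $m_1,\dots,m_k$ be strictly positive integers, and let $\eta$ be the probability measure on $\partial\mathbb{D}$ $$d\eta(\theta)=Z_\eta^{-1}\prod_{j=1}^k[1-\cos(\theta-\theta_j)]^{m_j}\,\frac{d\theta}{2\pi},$$ where $Z_\eta$ is the normalization constant. Let $V(e^{i\theta})=2\int\log|e^{i\theta}-e^{i\psi}|\,d\eta(\psi)$, which is a Laurent polynomial, of degree $d$, without constant term, and let $F_-$ and $G$ be the polynomials from the decomposition of $\operatorname{Tr}(V(U_N))$ described in the context. For $\alpha\in\mathbb{D}^\infty$ define $$S(\alpha)=F_-(\alpha_0,\dots,\alpha_{d-1})+\lim_{N\to\infty}\sum_{j=0}^N\left[G(\alpha_j,\dots,\alpha_{j+d})-\log(1-|\alpha_j|^2)\right],$$ where the limit exists in $(-\infty,+\infty]$, so that $S(\alpha)$ may be $+\infty$. Then for any probability measure $\mu$ on $\partial\mathbb{D}$ with infinite support, $$H(\eta\,|\,\mu)=S(\alpha(\mu))-S(\alpha(\eta)),$$ where $\alpha(\mu)$ and $\alpha(\eta)$ denote the sequences of Verblunsky coefficients of $\mu$ and $\eta$.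
   Context: $\mathbb{D}$ is the open unit disk in $\mathbb{C}$ and $\mathbb{D}^\infty=\prod_{j=0}^\infty\mathbb{D}$. Verblunsky coefficients: for a probability measure $\mu$ on $\partial\mathbb{D}$, let $\Phi_n$ be its monic orthogonal polynomials (if $\mu$ has exactly $N$ points in its support, $\Phi_n$ is defined for $n\le N$, with $\Phi_N$ the monic polynomial of degree $N$ vanishing at these points). The coefficients $\alpha_n$ are defined by $\Phi_{n+1}(z)=z\Phi_n(z)-\overline{\alpha}_n\Phi_n^*(z)$, $\Phi_0\equiv1$, $\Phi_n^*(z)=z^n\overline{\Phi_n(1/\bar z)}$. By Verblunsky's theorem this gives a bijection between measures of infinite support and $\mathbb{D}^\infty$, and between $N$-point measures and $\{(\alpha_0,\dots,\alpha_{N-1}):\alpha_0,\dots,\alpha_{N-2}\in\mathbb{D},\ \alpha_{N-1}\in\partial\mathbb{D}\}$. For probability measures $\nu,\mu$, $H(\nu|\mu)=\int\log\left(\frac{d\nu}{d\mu}\right)d\nu$ if $\nu$ is absolutely continuous with respect to $\mu$, and $H(\nu|\mu)=\infty$ otherwise. The degree of a Laurent polynomial $V(z)=\sum_{\ell=-d}^d c_\ell z^\ell$ is $d$ if $c_d\ne0$ and/or $c_{-d}\neq0$. CMV matrix: for $(\alpha_0,\dots,\alpha_{N-1})\in\mathbb{D}^{N-1}\times\partial\mathbb{D}$, with associated $N$-point measure $\mu_N$, $U_N$ is the $N\times N$ unitary matrix of multiplication by $z$ on $L^2(\partial\mathbb{D},d\mu_N)$ in the orthonormal basis obtained by applying Gram–Schmidt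 to $1,z,z^{-1},z^2,z^{-2},\dots$ (first $N$ elements). Decomposition: for a Laurent polynomial $V$ of degree $d$ without constant term, there exist polynomials $F_-,F_+$ (in $d$ successive $\alpha_j$'s and $\bar\alpha_j$'s) and $G$ (in $d+1$ successive $\alpha_j$'s and $\bar\alpha_j$'s), not depending on $N$, with $G(0,\dots,0)=0$ and, for all $N>d$, $$\operatorname{Tr}(V(U_N))=F_-(\alpha_0,\dots,\alpha_{d-1})+F_+(\alpha_{N-d},\dots,\alpha_{N-1})+\sum_{j=0}^{N-1-d}G(\alpha_j,\dots,\alpha_{j+d}).$$ Dependence on the $\bar\alpha_j$ is suppressed in the notation. Fix one such choice of $F_\pm,G$. *)

theory Defs
  imports
    "HOL-Probability.Probability"
    "HOL-Library.Poly_Mapping"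
    "HOL-Computational_Algebra.Polynomial"
    "Jordan_Normal_Form.Matrix"
begin

section \<open>Probability measures on the unit circle\<close>

definition circle_borel :: "complex measure" where
  "circle_borel = restrict_space borel (sphere 0 1)"

definition circle_prob :: "complex measure \<Rightarrow> bool" where
  "circle_prob \<mu> \<longleftrightarrow> prob_space \<mu> \<and> sets \<mu> = sets circle_borel"

definition circle_support :: "complex measure \<Rightarrow> complex set" where
  "circle_support \<mu> =
     {z \<in> sphere 0 1. \<forall>U. open U \<and> z \<in> U \<longrightarrow> emeasure \<mu> (U \<inter> sphere 0 1) > 0}"

text \<open>The measure \<open>w(\<theta>) d\<theta>/2\<pi>\<close>, normalized to total mass one and transported to the
  circle by \<open>\<theta> \<mapsto> e\<^sup>i\<^sup>\<theta>\<close>; the uniform measure below is \<open>d\<theta>/2\<pi>\<close>.\<close>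

definition circle_weight_measure :: "(real \<Rightarrow> real) \<Rightarrow> complex measure" where
  "circle_weight_measure w =
     (let L = uniform_measure lborel {0..<2 * pi}; Z = (\<integral>t. w t \<partial>L)
      in distr (density L (\<lambda>t. ennreal (w t / Z))) circle_borel cis)"

definition cos_weight :: "nat \<Rightarrow> (nat \<Rightarrow> real) \<Rightarrow> (nat \<Rightarrow> nat) \<Rightarrow> real \<Rightarrow> real" where
  "cos_weight k \<theta> m t = (\<Prod>j = 1..k. (1 - cos (t - \<theta> j)) ^ m j)"

text \<open>Relative entropy \<open>H(\<nu>|\<mu>)\<close> with values in the extended reals. The library's
  \<open>KL_divergence\<close> is a Bochner integral, hence \<open>0\<close> for a non-integrable logarithm; here the
  integral is taken in the extended sense, as positive part minus negative part (\<open>ennreal\<close>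
  sends negative reals to \<open>0\<close>). For probability measures the negative part is finite.\<close>

definition relative_entropy :: "'a measure \<Rightarrow> 'a measure \<Rightarrow> ereal" where
  "relative_entropy \<nu> \<mu> =
     (if absolutely_continuous \<mu> \<nu> then
        enn2ereal (\<integral>\<^sup>+x. ennreal (ln (enn2real (RN_deriv \<mu> \<nu> x))) \<partial>\<nu>)
        - enn2ereal (\<integral>\<^sup>+x. ennreal (- ln (enn2real (RN_deriv \<mu> \<nu> x))) \<partial>\<nu>)
      else \<infinity>)"


section \<open>Orthogonal polynomials and Verblunsky coefficients\<close>

definition L2_inner :: "complex measure \<Rightarrow> (complex \<Rightarrow> complex) \<Rightarrow> (complex \<Rightarrow> complex) \<Rightarrow> complex" where
  "L2_inner \<mu> f g = (\<integral>z. cnj (f z) * g z \<partial>\<mu>)"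

definition monic_OP :: "complex measure \<Rightarrow> nat \<Rightarrow> complex poly" where
  "monic_OP \<mu> n =
     (if finite (circle_support \<mu>) \<and> n = card (circle_support \<mu>)
      then (\<Prod>z\<in>circle_support \<mu>. [:- z, 1:])
      else (THE p. degree p = n \<and> lead_coeff p = 1 \<and>
                   (\<forall>j<n. L2_inner \<mu> (\<lambda>z. z ^ j) (poly p) = 0)))"

text \<open>\<open>p\<^sup>*(z) = z\<^sup>n cnj (p (1 / cnj z))\<close> as a polynomial, see \<open>poly_szego_dual\<close>.\<close>

definition szego_dual :: "nat \<Rightarrow> complex poly \<Rightarrow> complex poly" where
  "szego_dual n p = (\<Sum>i\<le>n. monom (cnj (coeff p (n - i))) i)"

lemma poly_szego_dual:
  assumes "degree p \<le> n" and "z \<noteq> 0"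
  shows "poly (szego_dual n p) z = z ^ n * cnj (poly p (1 / cnj z))"
proof -
  have "poly p (1 / cnj z) = (\<Sum>i\<le>n. coeff p i * (1 / cnj z) ^ i)"
    unfolding poly_altdef
    by (rule sum.mono_neutral_left) (use assms in \<open>auto simp: coeff_eq_0\<close>)
  then have "z ^ n * cnj (poly p (1 / cnj z)) = (\<Sum>i\<le>n. cnj (coeff p i) * (z ^ n * (1 / z) ^ i))"
    by (simp add: sum_distrib_left mult_ac)
  also have "\<dots> = (\<Sum>i\<le>n. cnj (coeff p i) * z ^ (n - i))"
    by (intro sum.cong) (use assms in \<open>auto simp: power_diff power_one_over\<close>)
  also have "\<dots> = (\<Sum>i\<le>n. cnj (coeff p (n - i)) * z ^ i)"
    by (rule sum.reindex_bij_witness[of _ "\<lambda>i. n - i" "\<lambda>i. n - i"]) auto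
  finally show ?thesis
    by (simp add: szego_dual_def poly_sum poly_monom)
qed

text \<open>For an \<open>N\<close>-point measure only the coefficients with index below \<open>N\<close> are meaningful.\<close>

definition verblunsky :: "complex measure \<Rightarrow> nat \<Rightarrow> complex" where
  "verblunsky \<mu> n =
     (THE a. monic_OP \<mu> (Suc n) =
               monom 1 1 * monic_OP \<mu> n - Polynomial.smult (cnj a) (szego_dual n (monic_OP \<mu> n)))"

text \<open>The inverse of Verblunsky's bijection for \<open>N\<close>-point measures.\<close>

definition finite_verblunsky_measure :: "nat \<Rightarrow> (nat \<Rightarrow> complex) \<Rightarrow> complex measure" where
  "finite_verblunsky_measure N \<alpha> =
     (THE \<mu>. circle_prob \<mu> \<and> finite (circle_support \<mu>) \<and> card (circle_support \<mu>) = N \<and>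
              (\<forall>j<N. verblunsky \<mu> j = \<alpha> j))"


section \<open>CMV matrices\<close>

text \<open>The exponents of \<open>1, z, z\<^sup>-\<^sup>1, z\<^sup>2, z\<^sup>-\<^sup>2, \<dots>\<close>\<close>

definition cmv_exponent :: "nat \<Rightarrow> int" where
  "cmv_exponent n = (if odd n then int (Suc n div 2) else - int (n div 2))"

fun cmv_basis :: "complex measure \<Rightarrow> nat \<Rightarrow> complex \<Rightarrow> complex" where
  "cmv_basis \<mu> n =
     (let e = (\<lambda>z. z powi cmv_exponent n);
          r = (\<lambda>z. e z - (\<Sum>i<n. L2_inner \<mu> (cmv_basis \<mu> i) e * cmv_basis \<mu> i z))
      in (\<lambda>z. r z / csqrt (L2_inner \<mu> r r)))"

declare cmv_basis.simps [simp del]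

definition cmv_matrix :: "nat \<Rightarrow> (nat \<Rightarrow> complex) \<Rightarrow> complex mat" where
  "cmv_matrix N \<alpha> =
     (let \<mu> = finite_verblunsky_measure N \<alpha>
      in mat N N (\<lambda>(i, j). L2_inner \<mu> (cmv_basis \<mu> i) (\<lambda>z. z * cmv_basis \<mu> j z)))"

definition matrix_inverse :: "complex mat \<Rightarrow> complex mat" where
  "matrix_inverse A =
     (THE B. B \<in> carrier_mat (dim_row A) (dim_row A) \<and> inverts_mat A B \<and> inverts_mat B A)"

definition mat_powi :: "complex mat \<Rightarrow> int \<Rightarrow> complex mat" where
  "mat_powi A l = (if l \<ge> 0 then A ^\<^sub>m nat l else matrix_inverse A ^\<^sub>m nat (- l))"

definition mat_trace :: "complex mat \<Rightarrow> complex" where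
  "mat_trace A = (\<Sum>i<dim_row A. A $$ (i, i))"


section \<open>Laurent polynomials\<close>

text \<open>The term \<open>c\<^sub>l z\<^sup>l\<close> is stored as the value \<open>c\<^sub>l\<close> at the exponent \<open>l\<close>.\<close>

type_synonym laurent_poly = "int \<Rightarrow>\<^sub>0 complex"

definition laurent_eval :: "laurent_poly \<Rightarrow> complex \<Rightarrow> complex" where
  "laurent_eval V z = (\<Sum>l\<in>Poly_Mapping.keys V. Poly_Mapping.lookup V l * z powi l)"

definition laurent_eval_mat :: "laurent_poly \<Rightarrow> complex mat \<Rightarrow> complex mat" where
  "laurent_eval_mat V A =
     mat (dim_row A) (dim_row A)
       (\<lambda>ij. \<Sum>l\<in>Poly_Mapping.keys V. Poly_Mapping.lookup V l * mat_powi A l $$ ij)"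

definition laurent_degree :: "laurent_poly \<Rightarrow> nat" where
  "laurent_degree V = Max (insert 0 ((\<lambda>l. nat \<bar>l\<bar>) ` Poly_Mapping.keys V))"

definition log_potential :: "complex measure \<Rightarrow> complex \<Rightarrow> real" where
  "log_potential \<eta> z = 2 * (\<integral>w. ln (cmod (z - w)) \<partial>\<eta>)"


section \<open>Polynomials in the coefficients and their conjugates\<close>

text \<open>A polynomial in \<open>\<alpha>\<^sub>0, \<alpha>\<^sub>1, \<dots>\<close> and their conjugates, as a finite combination of exponent
  vectors: the variable \<open>Inl i\<close> stands for \<open>\<alpha>\<^sub>i\<close> and \<open>Inr i\<close> for its conjugate.\<close>

type_synonym conj_poly = "(nat + nat \<Rightarrow>\<^sub>0 nat) \<Rightarrow>\<^sub>0 complex"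

definition conj_poly_eval :: "conj_poly \<Rightarrow> (nat \<Rightarrow> complex) \<Rightarrow> complex" where
  "conj_poly_eval P \<alpha> =
     (\<Sum>e\<in>Poly_Mapping.keys P. Poly_Mapping.lookup P e *
        (\<Prod>v\<in>Poly_Mapping.keys e. case_sum \<alpha> (\<lambda>i. cnj (\<alpha> i)) v ^ Poly_Mapping.lookup e v))"

definition conj_poly_in :: "nat \<Rightarrow> conj_poly \<Rightarrow> bool" where
  "conj_poly_in n P \<longleftrightarrow>
     (\<forall>e\<in>Poly_Mapping.keys P. Poly_Mapping.keys e \<subseteq> Inl ` {..<n} \<union> Inr ` {..<n})"

definition trace_decomposition ::
  "laurent_poly \<Rightarrow> conj_poly \<Rightarrow> conj_poly \<Rightarrow> conj_poly \<Rightarrow> bool" where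
  "trace_decomposition V F\<^sub>m F\<^sub>p G \<longleftrightarrow>
     (let d = laurent_degree V in
        conj_poly_in d F\<^sub>m \<and> conj_poly_in d F\<^sub>p \<and> conj_poly_in (d + 1) G \<and>
        conj_poly_eval G (\<lambda>_. 0) = 0 \<and>
        (\<forall>N>d. \<forall>\<alpha>. (\<forall>j<N - 1. \<alpha> j \<in> ball 0 1) \<and> \<alpha> (N - 1) \<in> sphere 0 1 \<longrightarrow>
           mat_trace (laurent_eval_mat V (cmv_matrix N \<alpha>)) =
             conj_poly_eval F\<^sub>m \<alpha> + conj_poly_eval F\<^sub>p (\<lambda>i. \<alpha> (N - d + i)) +
             (\<Sum>j = 0..N - 1 - d. conj_poly_eval G (\<lambda>i. \<alpha> (j + i)))))"

text \<open>The polynomials of a decomposition have complex coefficients, while the functional below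
  has real values. For \<open>V\<close> real on the circle the trace is real, so the real parts of a
  decomposition form a decomposition again; \<open>Re\<close> is the identity on real-valued ones.\<close>

definition S_partial :: "conj_poly \<Rightarrow> (nat \<Rightarrow> complex) \<Rightarrow> nat \<Rightarrow> real" where
  "S_partial G \<alpha> N =
     (\<Sum>j = 0..N. Re (conj_poly_eval G (\<lambda>i. \<alpha> (j + i))) - ln (1 - (cmod (\<alpha> j))\<^sup>2))"

definition S_functional :: "conj_poly \<Rightarrow> conj_poly \<Rightarrow> (nat \<Rightarrow> complex) \<Rightarrow> ereal" where
  "S_functional F\<^sub>m G \<alpha> =
     ereal (Re (conj_poly_eval F\<^sub>m \<alpha>)) + lim (\<lambda>N. ereal (S_partial G \<alpha> N))"

end

theory Submission
  imports
    Defs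
    "HOL-Complex_Analysis.Complex_Analysis"
    "HOL-Computational_Algebra.Fundamental_Theorem_Algebra"
    "Jordan_Normal_Form.Determinant"
begin

text \<open>The relative entropy \<open>H(\<nu>|\<mu>)\<close> is the supremum of \<open>\<integral>G d\<nu> - \<integral>e\<^sup>G d\<mu> + 1\<close> over continuous \<open>G\<close>. In
  this form it is lower semicontinuous in \<open>\<mu>\<close> and changes by \<open>- \<integral>g d\<nu>\<close> when \<open>\<mu>\<close> is multiplied by \<open>e\<^sup>g\<close>.
  The measure with coefficients \<open>\<alpha>\<close> is the weak limit of the Bernstein--Szego measures
  \<open>|\<phi>\<^sub>n|\<^sup>-\<^sup>2 d\<theta>/2\<pi>\<close>, where \<open>\<phi>\<^sub>n\<close> is the normalized \<open>\<Phi>\<^sub>n\<close>, and their relative entropies are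
  \<open>H(\<eta>|d\<theta>/2\<pi>) + \<integral>log |\<phi>\<^sub>n|\<^sup>2 d\<eta>\<close>.

  The integral of \<open>log |\<Phi>\<^sub>n|\<^sup>2\<close> is the sum of \<open>2 \<integral>log |a - w| d\<eta>(w)\<close> over the zeros \<open>a\<close> of \<open>\<Phi>\<^sub>n\<close>, thus a
  combination of power sums of these zeros. The zeros of the last polynomial for the coefficients
  \<open>\<alpha>\<^sub>0, \<dots>, \<alpha>\<^sub>n\<^sub>-\<^sub>1, 0, \<dots>, 0, 1\<close>, with many zeros inserted, have the same power sums and are the
  eigenvalues of a CMV matrix. So the integral is a trace \<open>Tr V(U\<^sub>N)\<close>, and the decomposition
  expresses it by \<open>F\<^sub>-\<close> and the partial sums of \<open>G\<close>, up to a constant and to boundary terms.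

  If \<open>H(\<eta>|\<mu>) = \<infinity>\<close>, lower semicontinuity makes the partial sums diverge, as the boundary terms are
  bounded. If \<open>H(\<eta>|\<mu>)\<close> is finite, the entropy of \<open>f d\<theta>/2\<pi>\<close> relative to \<open>|\<phi>\<^sub>n|\<^sup>2 d\<mu>\<close>, for densities \<open>f\<close> close
  to \<open>1\<close>, is asymptotically at most that relative to \<open>d\<theta>/2\<pi>\<close>, so \<open>|\<phi>\<^sub>n|\<^sup>2 d\<mu>\<close> converges weakly to
  \<open>d\<theta>/2\<pi>\<close>. By lower semicontinuity again, \<open>\<integral>log |\<phi>\<^sub>n|\<^sup>2 d\<eta>\<close> tends to \<open>H(\<eta>|\<mu>) - H(\<eta>|d\<theta>/2\<pi>)\<close>, and
  \<open>\<alpha>\<^sub>n\<close> tends to \<open>0\<close>, so that the boundary terms vanish in the limit.\<close>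

section \<open>Measures on the unit circle\<close>

text \<open>The limit in \<open>S\<close> is claimed for every sequence in the disk, so the argument
  starts from coefficients and not from a measure. In its dual form the entropy sees the reference
  measure only through integrals of continuous functions; hence the functional \<open>bs_lim\<close>
  can stand for the measure, and no measure is built from it.

  The obstacle is that the density of \<eta> vanishes at the points \<open>cis (\<theta> j)\<close>.
  The entropy of the uniform density relative to \<mu> may be infinite although
  \<open>H(\<eta>|\<mu>)\<close> is finite, so arguments with the uniform density have to go through
  densities bounded by multiples of that of \<eta>.

  The zeros of \<open>\<Phi>\<^sub>n\<close> lie inside the disk, where the potential of \<eta> is
  the harmonic extension of \<open>V\<close> and not \<open>V\<close> itself; this is why they have
  to be traded for eigenvalues on the circle.

  The constants of the trace formula and \<open>H(\<eta>|d\<theta>/2\<pi>)\<close> do not depend on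
  the coefficients and are never evaluated: \<open>H(\<eta>|\<eta>) = 0\<close> identifies their sum
  with \<open>- S(\<alpha>(\<eta>))\<close>.\<close>

lemma space_circle_borel [simp]: "space circle_borel = sphere 0 1"
  by (simp add: circle_borel_def space_restrict_space)

lemma circle_probD:
  assumes "circle_prob \<mu>"
  shows "prob_space \<mu>" "sets \<mu> = sets circle_borel" "space \<mu> = sphere 0 1"
  using assms sets_eq_imp_space_eq[of \<mu> circle_borel] by (auto simp: circle_prob_def)

lemma continuous_imp_borel_measurable_circle:
  assumes "continuous_on (sphere 0 1) f"
  shows "f \<in> borel_measurable circle_borel"
  unfolding circle_borel_def using assms by (rule borel_measurable_continuous_on_restrict)

lemma continuous_imp_borel_measurable:
  assumes "circle_prob \<mu>" "continuous_on (sphere 0 1) f"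
  shows "f \<in> borel_measurable \<mu>"
  using continuous_imp_borel_measurable_circle[OF assms(2)] circle_probD(2)[OF assms(1)]
  by (simp cong: measurable_cong_sets)

lemma continuous_on_circle_bounded:
  fixes f :: "complex \<Rightarrow> 'a::real_normed_vector"
  assumes "continuous_on (sphere 0 1) f"
  obtains B where "B > 0" "\<And>z. z \<in> sphere 0 1 \<Longrightarrow> norm (f z) \<le> B"
proof -
  have "compact (f ` sphere 0 1)"
    using assms by (intro compact_continuous_image) auto
  then have "bounded (f ` sphere 0 1)" by (rule compact_imp_bounded)
  then show ?thesis using that unfolding bounded_pos by blast
qed

lemma integrable_bounded_circle:
  fixes f :: "complex \<Rightarrow> 'a::{banach, second_countable_topology}"
  assumes "circle_prob \<mu>" "f \<in> borel_measurable \<mu>" "\<And>z. z \<in> sphere 0 1 \<Longrightarrow> norm (f z) \<le> B"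
  shows "integrable \<mu> f"
proof -
  interpret prob_space \<mu> using assms(1) by (rule circle_probD)
  show ?thesis
    by (rule integrable_const_bound[of _ B]) (use assms circle_probD[OF assms(1)] in auto)
qed

lemma integrable_continuous_circle:
  fixes f :: "complex \<Rightarrow> 'a::{banach, second_countable_topology}"
  assumes "circle_prob \<mu>" "continuous_on (sphere 0 1) f"
  shows "integrable \<mu> f"
proof -
  obtain B where "\<And>z. z \<in> sphere 0 1 \<Longrightarrow> norm (f z) \<le> B"
    using continuous_on_circle_bounded[OF assms(2)] by metis
  then show ?thesis
    using assms continuous_imp_borel_measurable by (intro integrable_bounded_circle) auto
qed

lemma integral_circle_mono:
  fixes f g :: "complex \<Rightarrow> real"
  assumes "circle_prob \<mu>" "continuous_on (sphere 0 1) f" "continuous_on (sphere 0 1) g"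
    and "\<And>z. z \<in> sphere 0 1 \<Longrightarrow> f z \<le> g z"
  shows "(\<integral>z. f z \<partial>\<mu>) \<le> (\<integral>z. g z \<partial>\<mu>)"
  by (rule integral_mono) (use assms circle_probD[OF assms(1)] in \<open>auto intro: integrable_continuous_circle\<close>)

lemma integral_circle_cong:
  assumes "circle_prob \<mu>" "\<And>z. z \<in> sphere 0 1 \<Longrightarrow> f z = g z"
  shows "(\<integral>z. f z \<partial>\<mu>) = (\<integral>z. g z \<partial>\<mu>)"
  by (rule Bochner_Integration.integral_cong) (use assms circle_probD[OF assms(1)] in auto)

lemma integral_circle_const [simp]:
  fixes c :: "'a::{banach, second_countable_topology}"
  assumes "circle_prob \<mu>"
  shows "(\<integral>z. c \<partial>\<mu>) = c"
proof -
  interpret prob_space \<mu> using assms by (rule circle_probD)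
  show ?thesis by (simp add: prob_space)
qed

section \<open>Normalized arc length and densities against it\<close>

definition arc_measure :: "complex measure" where
  "arc_measure = distr (uniform_measure lborel {0..<2 * pi}) circle_borel cis"

lemma cis_measurable_circle [measurable]: "cis \<in> measurable borel circle_borel"
  unfolding circle_borel_def
  by (intro measurable_restrict_space2 borel_measurable_continuous_onI continuous_on_cis continuous_on_id) auto

lemma cis_measurable_circle':
  "cis \<in> measurable (uniform_measure lborel {0..<2 * pi}) circle_borel"
  using cis_measurable_circle by (simp add: measurable_def)

lemma prob_space_angle: "prob_space (uniform_measure lborel {0..<2 * pi})"
  by (intro prob_space_uniform_measure) auto

lemma circle_prob_arc: "circle_prob arc_measure"
  unfolding arc_measure_def circle_prob_def
  using prob_space.prob_space_distr[OF prob_space_angle cis_measurable_circle'] by simp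

lemma integral_angle:
  fixes f :: "real \<Rightarrow> 'a::{banach, second_countable_topology}"
  assumes [measurable]: "f \<in> borel_measurable borel"
  shows "(\<integral>t. f t \<partial>uniform_measure lborel {0..<2 * pi}) =
    (\<integral>t. (indicator {0..<2 * pi} t / (2 * pi)) *\<^sub>R f t \<partial>lborel)"
proof -
  have "uniform_measure lborel {0..<2 * pi} = density lborel (\<lambda>t. ennreal (indicator {0..<2 * pi} t / (2 * pi)))"
    unfolding uniform_measure_def
    by (intro density_cong) (auto simp: divide_ennreal indicator_def simp flip: ennreal_1)
  then show ?thesis by (simp add: integral_density)
qed

lemma integral_arc_measure:
  fixes f :: "complex \<Rightarrow> 'a::{banach, second_countable_topology}"
  assumes "f \<in> borel_measurable circle_borel"
  shows "(\<integral>z. f z \<partial>arc_measure) = (\<integral>t. f (cis t) \<partial>uniform_measure lborel {0..<2 * pi})"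
  unfolding arc_measure_def by (rule integral_distr[OF cis_measurable_circle' assms])

lemma circle_prob_density:
  assumes "circle_prob \<mu>" "continuous_on (sphere 0 1) h" "\<And>z. z \<in> sphere 0 1 \<Longrightarrow> h z \<ge> 0"
    and "(\<integral>z. h z \<partial>\<mu>) = 1"
  shows "circle_prob (density \<mu> (\<lambda>z. ennreal (h z)))"
proof -
  have m: "h \<in> borel_measurable \<mu>"
    using assms continuous_imp_borel_measurable by blast
  have "emeasure (density \<mu> (\<lambda>z. ennreal (h z))) (space \<mu>) = (\<integral>\<^sup>+z. ennreal (h z) \<partial>\<mu>)"
    using m by (subst emeasure_density) (auto intro!: nn_integral_cong)
  also have "\<dots> = ennreal (\<integral>z. h z \<partial>\<mu>)"
    using assms circle_probD[OF assms(1)]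
    by (intro nn_integral_eq_integral integrable_continuous_circle AE_I2) auto
  finally show ?thesis
    using assms unfolding circle_prob_def
    by (auto intro!: prob_spaceI)
qed

lemma integral_density_circle:
  fixes f :: "complex \<Rightarrow> 'a::{banach, second_countable_topology}"
  assumes "circle_prob \<mu>" "continuous_on (sphere 0 1) h" "\<And>z. z \<in> sphere 0 1 \<Longrightarrow> h z \<ge> 0"
    and "continuous_on (sphere 0 1) f"
  shows "(\<integral>z. f z \<partial>density \<mu> (\<lambda>z. ennreal (h z))) = (\<integral>z. h z *\<^sub>R f z \<partial>\<mu>)"
  by (rule integral_density)
    (use assms circle_probD[OF assms(1)] continuous_imp_borel_measurable[OF assms(1)] in auto)

text \<open>The weight depends on the angle only through \<open>cis\<close>, so taking the density
  commutes with the push-forward. From here on, points of the circle replace angles.\<close>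

lemma circle_weight_measure_eq:
  assumes "continuous_on (sphere 0 1) h"
  shows "circle_weight_measure (\<lambda>t. h (cis t)) = density arc_measure (\<lambda>z. ennreal (h z / (\<integral>z. h z \<partial>arc_measure)))"
proof -
  have m: "h \<in> borel_measurable circle_borel"
    using assms(1) by (rule continuous_imp_borel_measurable_circle)
  then show ?thesis
    unfolding circle_weight_measure_def Let_def integral_arc_measure[OF m, symmetric]
    unfolding arc_measure_def by (subst density_distr) (auto simp: cis_measurable_circle')
qed

section \<open>The Szego recursion\<close>

lemma coeff_szego_dual: "coeff (szego_dual n p) i = (if i \<le> n then cnj (coeff p (n - i)) else 0)"
  by (simp add: szego_dual_def coeff_sum if_distrib[of cnj] sum.delta)

lemma degree_szego_dual: "degree (szego_dual n p) \<le> n"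
  by (rule degree_le) (simp add: coeff_szego_dual)

lemma poly_szego_dual_circle:
  assumes "degree p \<le> n" "z \<in> sphere 0 1"
  shows "poly (szego_dual n p) z = z ^ n * cnj (poly p z)"
proof -
  have "z \<noteq> 0" "z * cnj z = 1" using assms(2) by (auto simp: complex_norm_square[symmetric])
  then have "1 / cnj z = z" by (simp add: field_simps)
  then show ?thesis using poly_szego_dual[OF assms(1) \<open>z \<noteq> 0\<close>] by simp
qed

lemma norm_poly_szego_dual_circle:
  assumes "degree p \<le> n" "z \<in> sphere 0 1"
  shows "cmod (poly (szego_dual n p) z) = cmod (poly p z)"
  using assms by (simp add: poly_szego_dual_circle norm_mult norm_power)

definition szego_step :: "complex \<Rightarrow> nat \<Rightarrow> complex poly \<Rightarrow> complex poly" where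
  "szego_step a n p = pCons 0 p - Polynomial.smult (cnj a) (szego_dual n p)"

lemma szego_step_altdef:
  "szego_step a n p = monom 1 1 * p - Polynomial.smult (cnj a) (szego_dual n p)"
  by (simp add: szego_step_def monom_Suc)

text \<open>Reversal at degree \<open>n + 1\<close> turns \<open>z p\<close> into
  \<open>p\<^sup>*\<close> and \<open>p\<^sup>*\<close> into \<open>z p\<close>, and conjugates the
  coefficient.\<close>

lemma szego_dual_step:
  assumes "degree p \<le> n"
  shows "szego_dual (Suc n) (szego_step a n p) = szego_dual n p - Polynomial.smult a (pCons 0 p)"
proof (rule poly_eqI)
  fix i
  show "coeff (szego_dual (Suc n) (szego_step a n p)) i
      = coeff (szego_dual n p - Polynomial.smult a (pCons 0 p)) i"
    using assms
    by (cases i) (auto simp: coeff_szego_dual szego_step_def coeff_pCons coeff_eq_0 Suc_diff_le split: nat.splits intro!: arg_cong[of _ _ "coeff p"])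
qed

lemma szego_step_monic:
  assumes "degree p = n" "lead_coeff p = 1"
  shows "degree (szego_step a n p) = Suc n" "lead_coeff (szego_step a n p) = 1"
proof -
  have "coeff (szego_step a n p) (Suc n) = 1"
    using assms by (simp add: szego_step_def coeff_pCons coeff_szego_dual)
  moreover have "degree (szego_step a n p) \<le> Suc n"
    using assms
    by (intro degree_le) (auto simp: szego_step_def coeff_pCons coeff_szego_dual coeff_eq_0 split: nat.splits)
  ultimately show "degree (szego_step a n p) = Suc n"
    by (metis le_antisym le_degree one_neq_zero)
  with \<open>coeff (szego_step a n p) (Suc n) = 1\<close> show "lead_coeff (szego_step a n p) = 1" by simp
qed

text \<open>The recursion and its reversed form are linear in \<open>z p\<close> and
  \<open>p\<^sup>*\<close>; eliminating \<open>p\<^sup>*\<close> recovers \<open>z p\<close> from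
  the next polynomial and its dual. This lets orthogonality descend in
  \<open>orth_szego_step_inverse\<close>.\<close>

lemma szego_step_inverse:
  assumes "degree p \<le> n"
  shows "szego_step a n p + Polynomial.smult (cnj a) (szego_dual (Suc n) (szego_step a n p))
    = Polynomial.smult (1 - a * cnj a) (pCons 0 p)"
  unfolding szego_dual_step[OF assms]
  by (rule poly_eqI) (simp add: szego_step_def coeff_pCons algebra_simps split: nat.splits)

primrec szego_poly :: "(nat \<Rightarrow> complex) \<Rightarrow> nat \<Rightarrow> complex poly" where
  "szego_poly \<alpha> 0 = 1"
| "szego_poly \<alpha> (Suc n) = szego_step (\<alpha> n) n (szego_poly \<alpha> n)"

lemma degree_szego_poly [simp]: "degree (szego_poly \<alpha> n) = n"
  and lead_coeff_szego_poly: "lead_coeff (szego_poly \<alpha> n) = 1"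
  by (induction n) (use szego_step_monic in auto)

lemma szego_poly_nonzero [simp]: "szego_poly \<alpha> n \<noteq> 0"
  using lead_coeff_szego_poly[of \<alpha> n] by auto

lemma szego_poly_cong: "(\<And>j. j < n \<Longrightarrow> \<alpha> j = \<beta> j) \<Longrightarrow> szego_poly \<alpha> n = szego_poly \<beta> n"
  by (induction n) auto

text \<open>The step maps the pair \<open>u = z p\<close>, \<open>v = p\<^sup>*\<close> to
  \<open>u - cnj a v\<close>, \<open>v - a u\<close>, which multiplies the indefinite form
  \<open>|u|\<^sup>2 - |v|\<^sup>2\<close> by \<open>1 - |a|\<^sup>2\<close>.\<close>

lemma norm_szego_step_diff:
  assumes "degree p \<le> n"
  shows "(cmod (poly (szego_step a n p) z))\<^sup>2 - (cmod (poly (szego_dual (Suc n) (szego_step a n p)) z))\<^sup>2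
    = (1 - (cmod a)\<^sup>2) * ((cmod (z * poly p z))\<^sup>2 - (cmod (poly (szego_dual n p) z))\<^sup>2)"
proof -
  have *: "(cmod (u - cnj a * v))\<^sup>2 - (cmod (v - a * u))\<^sup>2 = (1 - (cmod a)\<^sup>2) * ((cmod u)\<^sup>2 - (cmod v)\<^sup>2)" for u v
    unfolding cmod_power2 by (simp add: algebra_simps power2_eq_square)
  show ?thesis
    unfolding szego_dual_step[OF assms] using *[of "z * poly p z" "poly (szego_dual n p) z"]
    by (simp add: szego_step_def mult.left_commute)
qed

text \<open>The inequality carries the induction. For \<open>|z| \<ge> 1\<close> it survives each
  step because the indefinite form of \<open>norm_szego_step_diff\<close> keeps its sign, and it
  excludes a zero, which would force \<open>|z \<Phi>\<^sub>n| = |\<alpha>\<^sub>n|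
  |\<Phi>\<^sub>n\<^sup>*| < |\<Phi>\<^sub>n|\<close>.\<close>

lemma szego_poly_outside:
  assumes "\<And>j. j < n \<Longrightarrow> cmod (\<alpha> j) < 1" "cmod z \<ge> 1"
  shows "poly (szego_poly \<alpha> n) z \<noteq> 0 \<and> cmod (poly (szego_dual n (szego_poly \<alpha> n)) z) \<le> cmod (poly (szego_poly \<alpha> n) z)"
  using assms(1)
proof (induction n)
  case 0
  then show ?case by (simp add: szego_dual_def)
next
  case (Suc n)
  let ?p = "szego_poly \<alpha> n" and ?q = "szego_dual n (szego_poly \<alpha> n)" and ?a = "\<alpha> n"
  have IH: "poly ?p z \<noteq> 0" "cmod (poly ?q z) \<le> cmod (poly ?p z)" and a: "cmod ?a < 1"
    using Suc.IH Suc.prems less_SucI by blast+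
  have le: "cmod (poly ?p z) \<le> cmod (z * poly ?p z)"
    using assms(2) by (simp add: norm_mult mult_le_cancel_right1)
  have "(cmod ?a)\<^sup>2 < 1" using a by (simp add: abs_square_less_1)
  moreover have "(cmod (poly ?q z))\<^sup>2 \<le> (cmod (z * poly ?p z))\<^sup>2"
    using IH le by (intro power_mono) auto
  ultimately have "0 \<le> (1 - (cmod ?a)\<^sup>2) * ((cmod (z * poly ?p z))\<^sup>2 - (cmod (poly ?q z))\<^sup>2)"
    by (intro mult_nonneg_nonneg) auto
  then have "(cmod (poly (szego_dual (Suc n) (szego_poly \<alpha> (Suc n))) z))\<^sup>2 \<le> (cmod (poly (szego_poly \<alpha> (Suc n)) z))\<^sup>2"
    unfolding szego_poly.simps norm_szego_step_diff[of ?p n ?a z, OF eq_refl[OF degree_szego_poly], symmetric] by linarith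
  then have "cmod (poly (szego_dual (Suc n) (szego_poly \<alpha> (Suc n))) z) \<le> cmod (poly (szego_poly \<alpha> (Suc n)) z)"
    by (rule power2_le_imp_le) simp
  moreover have "poly (szego_poly \<alpha> (Suc n)) z \<noteq> 0"
  proof
    assume "poly (szego_poly \<alpha> (Suc n)) z = 0"
    then have "cmod (z * poly ?p z) = cmod ?a * cmod (poly ?q z)"
      by (simp add: szego_step_def norm_mult)
    also have "\<dots> \<le> cmod ?a * cmod (poly ?p z)" using IH by (intro mult_left_mono) auto
    also have "\<dots> < cmod (poly ?p z)" using a IH by simp
    finally show False using le by simp
  qed
  ultimately show ?case by simp
qed

text \<open>The mirror image inside the disk, with \<open>\<Phi>\<^sub>n\<close> and its dual
  exchanged. It makes the reciprocal of the dual holomorphic, as \<open>orth_bs_top\<close>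
  requires.\<close>

lemma szego_poly_inside:
  assumes "\<And>j. j < n \<Longrightarrow> cmod (\<alpha> j) < 1" "cmod z \<le> 1"
  shows "poly (szego_dual n (szego_poly \<alpha> n)) z \<noteq> 0 \<and> cmod (poly (szego_poly \<alpha> n) z) \<le> cmod (poly (szego_dual n (szego_poly \<alpha> n)) z)"
  using assms(1)
proof (induction n)
  case 0
  then show ?case by (simp add: szego_dual_def)
next
  case (Suc n)
  let ?p = "szego_poly \<alpha> n" and ?q = "szego_dual n (szego_poly \<alpha> n)" and ?a = "\<alpha> n"
  have IH: "poly ?q z \<noteq> 0" "cmod (poly ?p z) \<le> cmod (poly ?q z)" and a: "cmod ?a < 1"
    using Suc.IH Suc.prems less_SucI by blast+
  have "cmod (z * poly ?p z) \<le> cmod (poly ?p z)"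
    using assms(2) by (simp add: norm_mult mult_le_cancel_right2)
  with IH have le: "cmod (z * poly ?p z) \<le> cmod (poly ?q z)" by linarith
  have "(cmod ?a)\<^sup>2 < 1" using a by (simp add: abs_square_less_1)
  moreover have "(cmod (z * poly ?p z))\<^sup>2 \<le> (cmod (poly ?q z))\<^sup>2"
    using le by (intro power_mono) auto
  ultimately have "(1 - (cmod ?a)\<^sup>2) * ((cmod (z * poly ?p z))\<^sup>2 - (cmod (poly ?q z))\<^sup>2) \<le> 0"
    by (intro mult_nonneg_nonpos) auto
  then have "(cmod (poly (szego_poly \<alpha> (Suc n)) z))\<^sup>2 \<le> (cmod (poly (szego_dual (Suc n) (szego_poly \<alpha> (Suc n))) z))\<^sup>2"
    unfolding szego_poly.simps norm_szego_step_diff[of ?p n ?a z, OF eq_refl[OF degree_szego_poly], symmetric] by linarith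
  then have "cmod (poly (szego_poly \<alpha> (Suc n)) z) \<le> cmod (poly (szego_dual (Suc n) (szego_poly \<alpha> (Suc n))) z)"
    by (rule power2_le_imp_le) simp
  moreover have "poly (szego_dual (Suc n) (szego_poly \<alpha> (Suc n))) z \<noteq> 0"
  proof
    assume "poly (szego_dual (Suc n) (szego_poly \<alpha> (Suc n))) z = 0"
    then have "cmod (poly ?q z) = cmod ?a * cmod (z * poly ?p z)"
      by (simp add: szego_dual_step norm_mult)
    also have "\<dots> \<le> cmod ?a * cmod (poly ?q z)" using le by (intro mult_left_mono) auto
    also have "\<dots> < cmod (poly ?q z)" using a IH by simp
    finally show False by simp
  qed
  ultimately show ?case by simp
qed

section \<open>The dual form of the relative entropy\<close>

text \<open>Regularity of finite Borel measures, applied to the image of \<mu> under the inclusion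
  of the circle in the plane, so that \<open>K\<close> and \<open>U\<close> are closed and open in
  the plane and Urysohn's lemma applies to them.\<close>

lemma circle_set_approx:
  assumes \<mu>: "circle_prob \<mu>" and B: "B \<in> sets circle_borel" and "e > 0"
  obtains K U where "closed K" "open U" "K \<subseteq> B" "B \<subseteq> U"
    "measure \<mu> ((U - K) \<inter> sphere 0 1) < e"
proof -
  interpret prob_space \<mu> using \<mu> by (rule circle_probD)
  note s = circle_probD[OF \<mu>]
  have meas: "id \<in> measurable \<mu> borel"
    using s by (intro continuous_imp_borel_measurable[OF \<mu>] continuous_on_id')
  define M where "M = distr \<mu> borel id"
  interpret M: prob_space M unfolding M_def by (rule prob_space_distr[OF meas])
  have B': "B \<in> sets borel" "B \<subseteq> sphere 0 1"
    using B by (auto simp: circle_borel_def sets_restrict_space)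
  have eM: "measure M A = measure \<mu> (A \<inter> sphere 0 1)" if "A \<in> sets borel" for A
    unfolding M_def using that meas s by (subst measure_distr) auto
  have 1: "sets M = sets borel" "emeasure M (space M) \<noteq> \<infinity>"
    using M.emeasure_finite by (auto simp: M_def)
  have "emeasure M B < (emeasure M B + ennreal (e/2))"
    using \<open>e > 0\<close> M.emeasure_finite[of B] by (simp add: ennreal_add_left_cancel_less[of _ 0, simplified])
  then have "(INF U\<in>{U. B \<subseteq> U \<and> open U}. emeasure M U) < emeasure M B + ennreal (e/2)"
    using outer_regular[OF 1 B'(1)] by simp
  then obtain U where U: "B \<subseteq> U" "open U" "emeasure M U < emeasure M B + ennreal (e/2)"
    unfolding INF_less_iff by auto
  have "\<exists>K. K \<subseteq> B \<and> compact K \<and> emeasure M B < emeasure M K + ennreal (e/2)"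
  \<comment> \<open>For a null set \<open>emeasure M B - ennreal (e/2) < emeasure M B\<close> fails,
    because subtraction in \<open>ennreal\<close> is truncated at 0.\<close>
  proof (cases "emeasure M B = 0")
    case True then show ?thesis using \<open>e > 0\<close> by (intro exI[of _ "{}"]) auto
  next
    case False
    then have "emeasure M B - ennreal (e/2) < emeasure M B"
      using \<open>e > 0\<close> zero_less_measure_iff[of M B]
      by (auto simp: M.emeasure_eq_measure ennreal_minus intro!: ennreal_lessI)
    then have "emeasure M B - ennreal (e/2) < (SUP K\<in>{K. K \<subseteq> B \<and> compact K}. emeasure M K)"
      using inner_regular[OF 1 B'(1)] by simp
    then obtain K where "K \<subseteq> B" "compact K" "emeasure M B - ennreal (e/2) < emeasure M K"
      unfolding less_SUP_iff by auto
    moreover from this \<open>e > 0\<close> have "\<not> measure M K \<le> measure M B - e/2"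
      by (auto simp: M.emeasure_eq_measure ennreal_minus not_le[symmetric] intro: ennreal_leI)
    ultimately show ?thesis using \<open>e > 0\<close>
      by (intro exI[of _ K]) (auto simp: M.emeasure_eq_measure ennreal_less_iff simp flip: ennreal_plus)
  qed
  then obtain K where K: "K \<subseteq> B" "compact K" "emeasure M B < emeasure M K + ennreal (e/2)"
    by auto
  have KU: "K \<in> sets borel" "U \<in> sets borel" using K U by (auto intro: borel_compact)
  have "measure M U < measure M B + e/2" "measure M B < measure M K + e/2"
    using U(3) K(3) \<open>e > 0\<close>
    by (simp_all add: M.emeasure_eq_measure ennreal_less_iff flip: ennreal_plus)
  moreover have "measure M (U - K) = measure M U - measure M K"
    using K U KU 1 by (intro M.finite_measure_Diff) auto
  ultimately have "measure M (U - K) < e" by simp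
  moreover have "measure M (U - K) = measure \<mu> ((U - K) \<inter> sphere 0 1)"
    using KU by (intro eM) auto
  ultimately show ?thesis using that[of K U] K U compact_imp_closed by auto
qed

text \<open>One Urysohn function serves both measures: it is 1 on the union of the inner sets and 0
  off the intersection of the outer sets, hence wrong only on \<open>U - K\<close>, which lies in
  the small remainder for each measure.\<close>

lemma circle_indicator_approx:
  assumes \<mu>: "circle_prob \<mu>" and \<nu>: "circle_prob \<nu>" and B: "B \<in> sets circle_borel" and "e > 0"
  obtains u :: "complex \<Rightarrow> real" where "continuous_on UNIV u"
    "(\<integral>z. \<bar>indicator B z - u z\<bar> \<partial>\<mu>) \<le> e" "(\<integral>z. \<bar>indicator B z - u z\<bar> \<partial>\<nu>) \<le> e"
proof -
  obtain K1 U1 where 1: "closed K1" "open U1" "K1 \<subseteq> B" "B \<subseteq> U1"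
    "measure \<mu> ((U1 - K1) \<inter> sphere 0 1) < e"
    using circle_set_approx[OF \<mu> B \<open>e > 0\<close>] by metis
  obtain K2 U2 where 2: "closed K2" "open U2" "K2 \<subseteq> B" "B \<subseteq> U2"
    "measure \<nu> ((U2 - K2) \<inter> sphere 0 1) < e"
    using circle_set_approx[OF \<nu> B \<open>e > 0\<close>] by metis
  define K U where "K = K1 \<union> K2" and "U = U1 \<inter> U2"
  have "closed K" "closed (- U)" "K \<inter> - U = {}"
    using 1 2 by (auto simp: K_def U_def)
  then obtain u :: "complex \<Rightarrow> real" where u: "continuous_on UNIV u"
    "\<And>x. u x \<in> closed_segment 1 0" "\<And>x. x \<in> K \<Longrightarrow> u x = 1" "\<And>x. x \<in> - U \<Longrightarrow> u x = 0"
    using Urysohn by metis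
  have u01: "0 \<le> u x" "u x \<le> 1" for x
    using u(2)[of x] by (auto simp: closed_segment_eq_real_ivl split: if_splits)
  have le: "\<bar>indicator B z - u z\<bar> \<le> indicator ((U - K)) z" for z
    using u01[of z] u(3,4)[of z] 1 2 by (auto simp: indicator_def K_def U_def)
  have int: "(\<integral>z. \<bar>indicator B z - u z\<bar> \<partial>\<kappa>) \<le> e"
    if \<kappa>: "circle_prob \<kappa>" and m: "measure \<kappa> ((V - L) \<inter> sphere 0 1) < e"
      and VL: "U \<subseteq> V" "L \<subseteq> K" "open V" "closed L" for \<kappa> V L
  proof -
    interpret prob_space \<kappa> using \<kappa> by (rule circle_probD)
    note s = circle_probD[OF \<kappa>]
    have S: "(V - L) \<inter> sphere 0 1 \<in> sets \<kappa>"
      using VL s by (auto simp: circle_borel_def sets_restrict_space intro!: image_eqI[of _ _ "V - L"])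
    have mu: "u \<in> borel_measurable \<kappa>"
      using continuous_imp_borel_measurable[OF \<kappa>] u(1) continuous_on_subset by blast
    have mB: "B \<in> sets \<kappa>" using B s by simp
    have "(\<integral>z. \<bar>indicator B z - u z\<bar> \<partial>\<kappa>) \<le> (\<integral>z. indicator ((V - L) \<inter> sphere 0 1) z \<partial>\<kappa>)"
    proof (rule integral_mono)
      show "integrable \<kappa> (\<lambda>z. \<bar>indicator B z - u z\<bar>)"
        using mu mB u01 by (intro integrable_bounded_circle[OF \<kappa>, of _ 1]) (auto simp: indicator_def)
      show "integrable \<kappa> (indicator ((V - L) \<inter> sphere 0 1) :: _ \<Rightarrow> real)"
        using S emeasure_finite by (intro integrable_real_indicator) (auto simp: less_top[symmetric])
      fix z assume "z \<in> space \<kappa>"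
      then have "indicator (U - K) z \<le> (indicator ((V - L) \<inter> sphere 0 1) z :: real)"
        using VL s by (auto simp: indicator_def)
      then show "\<bar>indicator B z - u z\<bar> \<le> indicator ((V - L) \<inter> sphere 0 1) z"
        using le[of z] by linarith
    qed
    also have "\<dots> = measure \<kappa> ((V - L) \<inter> sphere 0 1)" using S by simp
    finally show ?thesis using m by simp
  qed
  show ?thesis
    using that[OF u(1)] int[OF \<mu> 1(5)] int[OF \<nu> 2(5)] 1 2 by (auto simp: K_def U_def)
qed

text \<open>Round \<open>g\<close> down to multiples of \<open>1/n\<close>, replace the indicators
  of the finitely many level sets by continuous functions, and clamp the result to the range from
  \<open>-b\<close> to \<open>b\<close>. Clamping brings it no further from \<open>g\<close>, and
  the bound controls the exponentials later.\<close>

lemma circle_bounded_approx: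
  fixes g :: "complex \<Rightarrow> real"
  assumes \<mu>: "circle_prob \<mu>" and \<nu>: "circle_prob \<nu>"
    and g: "g \<in> borel_measurable circle_borel" and b: "\<And>z. \<bar>g z\<bar> \<le> b" and "e > 0"
  obtains u :: "complex \<Rightarrow> real" where "continuous_on UNIV u" "\<And>z. \<bar>u z\<bar> \<le> b"
    "(\<integral>z. \<bar>g z - u z\<bar> \<partial>\<mu>) \<le> e" "(\<integral>z. \<bar>g z - u z\<bar> \<partial>\<nu>) \<le> e"
proof -
  have "b \<ge> 0" using b[of 0] by simp
  obtain n :: nat where n: "n > 0" "1 / n < e / 2"
    using \<open>e > 0\<close> by (metis half_gt_zero nat_approx_posE zero_less_Suc)
  define J where "J = {- \<lceil>n * b\<rceil> - 1 .. \<lceil>n * b\<rceil> + 1}"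
  define A where "A j = {z \<in> sphere 0 1. \<lfloor>n * g z\<rfloor> = j}" for j
  have A: "A j \<in> sets circle_borel" for j
  proof -
    have "(\<lambda>z. \<lfloor>n * g z\<rfloor>) \<in> measurable circle_borel (count_space UNIV)"
      using g by measurable
    from measurable_sets[OF this, of "{j}"] show ?thesis
      by (simp add: A_def vimage_def Int_def conj_commute)
  qed
  have inJ: "\<lfloor>n * g z\<rfloor> \<in> J" for z
  proof -
    have "\<bar>n * g z\<bar> \<le> n * b" using b[of z] by (simp add: abs_mult mult_left_mono)
    then have "n * g z \<le> n * b" "- (n * b) \<le> n * g z" by linarith+
    then show ?thesis unfolding J_def by (auto simp: floor_le_iff le_floor_iff; linarith)
  qed
  define s where "s z = (\<Sum>j\<in>J. (j / n) * indicator (A j) z)" for z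
  have s_eq: "s z = \<lfloor>n * g z\<rfloor> / n" if "z \<in> sphere 0 1" for z
  proof -
    have "s z = (\<Sum>j\<in>J. if j = \<lfloor>n * g z\<rfloor> then j / n else 0)"
      unfolding s_def using that by (intro sum.cong) (auto simp: A_def)
    also have "\<dots> = \<lfloor>n * g z\<rfloor> / n" using inJ[of z] by (simp add: J_def)
    finally show ?thesis .
  qed
  have gs: "\<bar>g z - s z\<bar> \<le> e / 2" if "z \<in> sphere 0 1" for z
  proof -
    have "\<bar>n * g z - \<lfloor>n * g z\<rfloor>\<bar> \<le> 1" by linarith
    then have "\<bar>n * g z - \<lfloor>n * g z\<rfloor>\<bar> / n \<le> 1 / n" using n by (intro divide_right_mono) auto
    also have "\<bar>n * g z - \<lfloor>n * g z\<rfloor>\<bar> / n = \<bar>g z - s z\<bar>"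
    proof -
      have "n * g z - \<lfloor>n * g z\<rfloor> = n * (g z - s z)"
        using n by (simp add: s_eq[OF that] right_diff_distrib)
      then show ?thesis using n by (simp add: abs_mult)
    qed
    finally show ?thesis using n by simp
  qed
  \<comment> \<open>Level \<open>j\<close> enters with the factor \<open>|j|/n\<close>, so a
    tolerance \<open>e / (2 c)\<close> for each indicator costs at most \<open>e/2\<close> in total.
    The summand 1 keeps \<open>c\<close> positive.\<close>
  define c where "c = (\<Sum>j\<in>J. real_of_int \<bar>j\<bar> / n) + 1"
  have "c > 0" unfolding c_def by (intro add_nonneg_pos sum_nonneg) auto
  have "e / (2 * c) > 0" using \<open>c > 0\<close> \<open>e > 0\<close> by simp
  have "\<exists>u :: complex \<Rightarrow> real. continuous_on UNIV u \<and> (\<integral>z. \<bar>indicator (A j) z - u z\<bar> \<partial>\<mu>) \<le> e / (2 * c)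
      \<and> (\<integral>z. \<bar>indicator (A j) z - u z\<bar> \<partial>\<nu>) \<le> e / (2 * c)" for j
    using circle_indicator_approx[OF \<mu> \<nu> A \<open>e / (2 * c) > 0\<close>, of j] by metis
  then obtain u :: "int \<Rightarrow> complex \<Rightarrow> real" where u: "\<And>j. continuous_on UNIV (u j)"
    "\<And>j. (\<integral>z. \<bar>indicator (A j) z - u j z\<bar> \<partial>\<mu>) \<le> e / (2 * c)"
    "\<And>j. (\<integral>z. \<bar>indicator (A j) z - u j z\<bar> \<partial>\<nu>) \<le> e / (2 * c)"
    by metis
  define G where "G z = (\<Sum>j\<in>J. (j / n) * u j z)" for z
  define H where "H z = max (- b) (min b (G z))" for z
  have contG: "continuous_on UNIV G" unfolding G_def by (intro continuous_intros u)
  have contH: "continuous_on UNIV H" unfolding H_def by (intro continuous_intros contG)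
  have Hb: "\<bar>H z\<bar> \<le> b" for z using \<open>b \<ge> 0\<close> by (auto simp: H_def)
  have bd: "(\<integral>z. \<bar>g z - H z\<bar> \<partial>\<kappa>) \<le> e"
    if \<kappa>: "circle_prob \<kappa>" and uk: "\<And>j. (\<integral>z. \<bar>indicator (A j) z - u j z\<bar> \<partial>\<kappa>) \<le> e / (2 * c)" for \<kappa>
  proof -
    interpret prob_space \<kappa> using \<kappa> by (rule circle_probD)
    note sp = circle_probD[OF \<kappa>]
    have cont: "continuous_on (sphere 0 1) f" if "continuous_on UNIV f" for f :: "complex \<Rightarrow> real"
      using that continuous_on_subset by blast
    have iu: "integrable \<kappa> (u j)" for j
      by (intro integrable_continuous_circle[OF \<kappa>] cont u)
    have iA: "integrable \<kappa> (indicator (A j) :: _ \<Rightarrow> real)" for j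
      using A sp emeasure_finite by (intro integrable_real_indicator) (auto simp: less_top[symmetric])
    have mg: "g \<in> borel_measurable \<kappa>" using g sp by (simp cong: measurable_cong_sets)
    have ig: "integrable \<kappa> g" using integrable_bounded_circle[OF \<kappa> mg, of b] b by auto
    have iH: "integrable \<kappa> H" by (intro integrable_continuous_circle[OF \<kappa>] cont contH)
    have "(\<integral>z. \<bar>g z - H z\<bar> \<partial>\<kappa>) \<le> (\<integral>z. e/2 + (\<Sum>j\<in>J. (\<bar>j\<bar> / n) * \<bar>indicator (A j) z - u j z\<bar>) \<partial>\<kappa>)"
    proof (rule integral_mono)
      show "integrable \<kappa> (\<lambda>z. \<bar>g z - H z\<bar>)" using ig iH by auto
      show "integrable \<kappa> (\<lambda>z. e/2 + (\<Sum>j\<in>J. (\<bar>j\<bar> / n) * \<bar>indicator (A j) z - u j z\<bar>))"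
        using iu iA by (intro Bochner_Integration.integrable_add integrable_const Bochner_Integration.integrable_sum
          integrable_mult_right integrable_abs Bochner_Integration.integrable_diff) auto
      fix z assume "z \<in> space \<kappa>"
      then have z: "z \<in> sphere 0 1" using sp by simp
      have "\<bar>g z - H z\<bar> \<le> \<bar>g z - G z\<bar>" using b[of z] unfolding H_def by linarith
      also have "\<dots> \<le> \<bar>g z - s z\<bar> + \<bar>s z - G z\<bar>" by simp
      also have "\<bar>s z - G z\<bar> = \<bar>\<Sum>j\<in>J. (j / n) * (indicator (A j) z - u j z)\<bar>"
        by (simp add: s_def G_def sum_subtractf[symmetric] right_diff_distrib)
      also have "\<dots> \<le> (\<Sum>j\<in>J. \<bar>(j / n) * (indicator (A j) z - u j z)\<bar>)" by (rule sum_abs)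
      also have "\<dots> = (\<Sum>j\<in>J. (\<bar>j\<bar> / n) * \<bar>indicator (A j) z - u j z\<bar>)"
        by (simp add: abs_mult)
      finally show "\<bar>g z - H z\<bar> \<le> e/2 + (\<Sum>j\<in>J. (\<bar>j\<bar> / n) * \<bar>indicator (A j) z - u j z\<bar>)"
        using gs[OF z] by simp
    qed
    also have "\<dots> = e/2 + (\<Sum>j\<in>J. (\<bar>j\<bar> / n) * (\<integral>z. \<bar>indicator (A j) z - u j z\<bar> \<partial>\<kappa>))"
    proof -
      have i: "integrable \<kappa> (\<lambda>z. (\<bar>j\<bar> / n) * \<bar>indicator (A j) z - u j z\<bar>)" for j
        using iu iA by (intro integrable_mult_right integrable_abs Bochner_Integration.integrable_diff) auto
      show ?thesis
        by (subst Bochner_Integration.integral_add)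
          (use i in \<open>auto simp: prob_space Bochner_Integration.integral_sum intro!: Bochner_Integration.integrable_sum\<close>)
    qed
    also have "\<dots> \<le> e/2 + (\<Sum>j\<in>J. (\<bar>j\<bar> / n) * (e / (2 * c)))"
      by (intro add_left_mono sum_mono mult_left_mono uk) auto
    also have "\<dots> = e/2 + (c - 1) * (e / (2 * c))"
      unfolding c_def by (simp only: sum_distrib_right[symmetric] add_diff_cancel_right')
    also have "\<dots> \<le> e/2 + c * (e / (2 * c))"
      using \<open>e > 0\<close> \<open>c > 0\<close> by (intro add_left_mono mult_right_mono) auto
    also have "\<dots> = e" using \<open>c > 0\<close> by simp
    finally show ?thesis .
  qed
  show ?thesis using that[OF contH Hb] bd[OF \<mu> u(2)] bd[OF \<nu> u(3)] by simp
qed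

text \<open>Taking \<open>- \<Lambda> (exp G) + 1\<close> in place of
  \<open>- ln (\<Lambda> (exp G))\<close> makes each term affine in \<open>\<Lambda>\<close>. A
  functional is allowed for \<open>\<Lambda>\<close> so that limits of integrals can be inserted.
  For integration against \<mu> the ideal test function is the logarithm of the density of
  \<nu>.\<close>

definition entropy_dual :: "complex measure \<Rightarrow> ((complex \<Rightarrow> real) \<Rightarrow> real) \<Rightarrow> ereal" where
  "entropy_dual \<nu> \<Lambda> =
     (SUP G\<in>{G. continuous_on (sphere 0 1) G}. ereal ((\<integral>z. G z \<partial>\<nu>) - \<Lambda> (\<lambda>z. exp (G z)) + 1))"

lemma entropy_dual_upper:
  "continuous_on (sphere 0 1) G \<Longrightarrow> ereal ((\<integral>z. G z \<partial>\<nu>) - \<Lambda> (\<lambda>z. exp (G z)) + 1) \<le> entropy_dual \<nu> \<Lambda>"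
  unfolding entropy_dual_def by (intro SUP_upper) auto

lemma exp_diff_le:
  fixes x y :: real
  assumes "\<bar>x\<bar> \<le> b" "\<bar>y\<bar> \<le> b"
  shows "\<bar>exp x - exp y\<bar> \<le> exp b * \<bar>x - y\<bar>"
proof -
  have *: "exp u - exp v \<le> exp b * (u - v)" if "v \<le> u" "u \<le> b" for u v :: real
  proof -
    have "1 - exp (v - u) \<le> u - v" using exp_ge_add_one_self[of "v - u"] by linarith
    then have "exp u * (1 - exp (v - u)) \<le> exp u * (u - v)" by (intro mult_left_mono) auto
    also have "\<dots> \<le> exp b * (u - v)" using that by (intro mult_right_mono) auto
    finally show ?thesis by (simp add: right_diff_distrib flip: exp_add)
  qed
  show ?thesis
  proof (cases "x \<le> y")
    case True then show ?thesis using *[of x y] assms by auto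
  next
    case False then show ?thesis using *[of y x] assms by auto
  qed
qed

text \<open>Continuous functions approximate \<open>g\<close> in the mean for \<mu> and \<nu> at
  once and with the same bound \<open>b\<close>, so the exponentials differ in the mean by at most
  \<open>exp b\<close> times as much. Indicators and truncated logarithms thereby become admissible
  test functions.\<close>

lemma entropy_dual_bounded_upper:
  fixes g :: "complex \<Rightarrow> real"
  assumes \<mu>: "circle_prob \<mu>" and \<nu>: "circle_prob \<nu>"
    and g: "g \<in> borel_measurable circle_borel" and b: "\<And>z. \<bar>g z\<bar> \<le> b"
  shows "ereal ((\<integral>z. g z \<partial>\<nu>) - (\<integral>z. exp (g z) \<partial>\<mu>) + 1) \<le> entropy_dual \<nu> (\<lambda>f. \<integral>z. f z \<partial>\<mu>)"
proof (rule ereal_le_epsilon2)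
  fix e :: real assume "e > 0"
  \<comment> \<open>The error \<open>d\<close> for \<nu> and the error \<open>exp b * d\<close> for
    \<mu> add up to \<open>e\<close>.\<close>
  define d where "d = e / (1 + exp b)"
  have pos: "1 + exp b > 0" using exp_gt_zero[of b] by linarith
  have "d > 0" using \<open>e > 0\<close> pos by (simp add: d_def)
  obtain u :: "complex \<Rightarrow> real" where u: "continuous_on UNIV u" "\<And>z. \<bar>u z\<bar> \<le> b"
    "(\<integral>z. \<bar>g z - u z\<bar> \<partial>\<mu>) \<le> d" "(\<integral>z. \<bar>g z - u z\<bar> \<partial>\<nu>) \<le> d"
    using circle_bounded_approx[OF \<mu> \<nu> g b \<open>d > 0\<close>] by metis
  have cu: "continuous_on (sphere 0 1) u" using u(1) continuous_on_subset by blast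
  have mg: "g \<in> borel_measurable \<mu>" "g \<in> borel_measurable \<nu>"
    using g circle_probD(2)[OF \<mu>] circle_probD(2)[OF \<nu>] by (simp_all cong: measurable_cong_sets)
  have i: "integrable \<mu> g" "integrable \<nu> g" "integrable \<mu> u" "integrable \<nu> u"
    using integrable_bounded_circle[OF \<mu> mg(1)] integrable_bounded_circle[OF \<nu> mg(2)] b
      integrable_continuous_circle[OF \<mu> cu] integrable_continuous_circle[OF \<nu> cu] by auto
  have ie: "integrable \<mu> (\<lambda>z. exp (g z))" "integrable \<mu> (\<lambda>z. exp (u z))"
  proof -
    show "integrable \<mu> (\<lambda>z. exp (g z))"
      using mg b by (intro integrable_bounded_circle[OF \<mu>, of _ "exp b"]) (auto intro: abs_le_D1)
    show "integrable \<mu> (\<lambda>z. exp (u z))"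
      by (intro integrable_continuous_circle[OF \<mu>] continuous_intros cu)
  qed
  have "(\<integral>z. g z \<partial>\<nu>) - (\<integral>z. u z \<partial>\<nu>) = (\<integral>z. g z - u z \<partial>\<nu>)" using i by simp
  also have "\<dots> \<le> (\<integral>z. \<bar>g z - u z\<bar> \<partial>\<nu>)" using i by (intro integral_mono) auto
  finally have 1: "(\<integral>z. g z \<partial>\<nu>) \<le> (\<integral>z. u z \<partial>\<nu>) + d" using u by linarith
  have "(\<integral>z. exp (u z) \<partial>\<mu>) - (\<integral>z. exp (g z) \<partial>\<mu>) = (\<integral>z. exp (u z) - exp (g z) \<partial>\<mu>)" using ie by simp
  also have "\<dots> \<le> (\<integral>z. exp b * \<bar>g z - u z\<bar> \<partial>\<mu>)"
    using i ie exp_diff_le[OF u(2) b] by (intro integral_mono) (auto simp: abs_minus_commute abs_le_iff)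
  also have "\<dots> = exp b * (\<integral>z. \<bar>g z - u z\<bar> \<partial>\<mu>)" by simp
  also have "\<dots> \<le> exp b * d" using u by (intro mult_left_mono) auto
  finally have 2: "(\<integral>z. exp (u z) \<partial>\<mu>) \<le> (\<integral>z. exp (g z) \<partial>\<mu>) + exp b * d" by simp
  have "d + exp b * d = e" using pos by (simp add: d_def field_simps flip: add_divide_distrib)
  then have "(\<integral>z. g z \<partial>\<nu>) - (\<integral>z. exp (g z) \<partial>\<mu>) + 1
      \<le> ((\<integral>z. u z \<partial>\<nu>) - (\<integral>z. exp (u z) \<partial>\<mu>) + 1) + e"
    using 1 2 by linarith
  then have "ereal ((\<integral>z. g z \<partial>\<nu>) - (\<integral>z. exp (g z) \<partial>\<mu>) + 1)
      \<le> ereal ((\<integral>z. u z \<partial>\<nu>) - (\<integral>z. exp (u z) \<partial>\<mu>) + 1) + ereal e"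
    by simp
  also have "\<dots> \<le> entropy_dual \<nu> (\<lambda>f. \<integral>z. f z \<partial>\<mu>) + ereal e"
    by (intro add_right_mono entropy_dual_upper cu)
  finally show "ereal ((\<integral>z. g z \<partial>\<nu>) - (\<integral>z. exp (g z) \<partial>\<mu>) + 1) \<le> entropy_dual \<nu> (\<lambda>f. \<integral>z. f z \<partial>\<mu>) + ereal e" .
qed

section \<open>Agreement of the dual form with the Radon-Nikodym form\<close>

lemma mult_ln_ge: "x * ln x \<ge> x - 1" if "x \<ge> 0" for x :: real
proof (cases "x = 0")
  case False
  with that have "x > 0" by simp
  have "ln (1 / x) \<le> 1 / x - 1" using \<open>x > 0\<close> by (intro ln_le_minus_one) auto
  then have "- ln x \<le> 1 / x - 1" using \<open>x > 0\<close> by (simp add: ln_div)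
  then have "x * (- ln x) \<le> x * (1 / x - 1)" using \<open>x > 0\<close> by (intro mult_left_mono) auto
  then show ?thesis using \<open>x > 0\<close> by (simp add: right_diff_distrib)
qed simp

text \<open>Legendre duality between \<open>x ln x - x\<close> and \<open>exp y\<close>: for
  \<open>x > 0\<close> it is \<open>1 + u \<le> exp u\<close> at
  \<open>u = y - ln x\<close>.\<close>

lemma young_exp:
  fixes x y :: real
  assumes "x \<ge> 0"
  shows "x * y - exp y \<le> x * ln x - x"
proof (cases "x = 0")
  case False
  with assms have "x > 0" by simp
  have "1 + (y - ln x) \<le> exp (y - ln x)" by (rule exp_ge_add_one_self)
  also have "\<dots> = exp y / x" using \<open>x > 0\<close> by (simp add: exp_diff)
  finally show ?thesis using \<open>x > 0\<close> by (simp add: field_simps)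
qed simp

text \<open>Radon-Nikodym densities agree almost everywhere, so any density \<open>p\<close>
  computes the entropy. The negative part is finite because
  \<open>- p ln p \<le> 1 - p \<le> 1\<close>, so the difference is never
  \<open>\<infinity> - \<infinity>\<close>.\<close>

lemma relative_entropy_eq:
  fixes p :: "'a \<Rightarrow> real"
  assumes "prob_space \<mu>" and [measurable]: "p \<in> borel_measurable \<mu>" and p: "\<And>x. p x \<ge> 0"
    and \<nu>: "\<nu> = density \<mu> (\<lambda>x. ennreal (p x))" and "prob_space \<nu>"
  shows "relative_entropy \<nu> \<mu> = enn2ereal (\<integral>\<^sup>+x. ennreal (ln (p x)) \<partial>\<nu>) - enn2ereal (\<integral>\<^sup>+x. ennreal (- ln (p x)) \<partial>\<nu>)"
    and "(\<integral>\<^sup>+x. ennreal (- ln (p x)) \<partial>\<nu>) < \<top>"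
proof -
  interpret \<mu>: prob_space \<mu> by fact
  interpret \<nu>: prob_space \<nu> by fact
  have ac: "absolutely_continuous \<mu> \<nu>" unfolding \<nu> by (intro absolutely_continuousI_density) measurable
  have "AE x in \<mu>. ennreal (p x) = RN_deriv \<mu> \<nu> x"
    by (rule \<mu>.RN_deriv_unique) (auto simp: \<nu>)
  then have "AE x in \<nu>. ennreal (p x) = RN_deriv \<mu> \<nu> x"
    by (rule absolutely_continuous_AE[rotated -1]) (use ac \<nu> in auto)
  then have *: "AE x in \<nu>. enn2real (RN_deriv \<mu> \<nu> x) = p x"
    by eventually_elim (metis enn2real_ennreal p)
  have "(\<integral>\<^sup>+x. ennreal (ln (enn2real (RN_deriv \<mu> \<nu> x))) \<partial>\<nu>) = (\<integral>\<^sup>+x. ennreal (ln (p x)) \<partial>\<nu>)"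
    "(\<integral>\<^sup>+x. ennreal (- ln (enn2real (RN_deriv \<mu> \<nu> x))) \<partial>\<nu>) = (\<integral>\<^sup>+x. ennreal (- ln (p x)) \<partial>\<nu>)"
    using * by (auto intro!: nn_integral_cong_AE elim!: eventually_mono)
  then show "relative_entropy \<nu> \<mu> = enn2ereal (\<integral>\<^sup>+x. ennreal (ln (p x)) \<partial>\<nu>) - enn2ereal (\<integral>\<^sup>+x. ennreal (- ln (p x)) \<partial>\<nu>)"
    unfolding relative_entropy_def using ac by simp
  have "(\<integral>\<^sup>+x. ennreal (- ln (p x)) \<partial>\<nu>) = (\<integral>\<^sup>+x. ennreal (p x) * ennreal (- ln (p x)) \<partial>\<mu>)"
    unfolding \<nu> by (subst nn_integral_density) auto
  also have "\<dots> \<le> (\<integral>\<^sup>+x. 1 \<partial>\<mu>)"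
  proof (rule nn_integral_mono)
    fix x
    have "p x * (- ln (p x)) \<le> 1" using mult_ln_ge[OF p, of x] p[of x] by simp
    then show "ennreal (p x) * ennreal (- ln (p x)) \<le> 1"
      using p[of x] by (simp add: ennreal_mult'[symmetric] flip: ennreal_1)
  qed
  also have "\<dots> = 1" by (simp add: \<mu>.emeasure_space_1)
  finally show "(\<integral>\<^sup>+x. ennreal (- ln (p x)) \<partial>\<nu>) < \<top>"
    using ennreal_one_less_top le_less_trans by blast
qed

lemma circle_RN_deriv:
  assumes "circle_prob \<mu>" "circle_prob \<nu>" "absolutely_continuous \<mu> \<nu>"
  obtains p :: "complex \<Rightarrow> real" where "p \<in> borel_measurable circle_borel" "\<And>x. p x \<ge> 0"
    "\<nu> = density \<mu> (\<lambda>x. ennreal (p x))"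
proof -
  interpret \<mu>: prob_space \<mu> using assms(1) by (rule circle_probD)
  interpret \<nu>: prob_space \<nu> using assms(2) by (rule circle_probD)
  have s: "sets \<nu> = sets \<mu>" using assms circle_probD by metis
  obtain D where D: "D \<in> borel_measurable \<mu>" "AE x in \<mu>. RN_deriv \<mu> \<nu> x = ennreal (D x)"
    "\<And>x. 0 \<le> D x"
    using \<mu>.real_RN_deriv[OF \<nu>.finite_measure_axioms assms(3) s] by metis
  have "density \<mu> (\<lambda>x. ennreal (D x)) = density \<mu> (RN_deriv \<mu> \<nu>)"
    using D by (intro density_cong) auto
  also have "\<dots> = \<nu>" by (rule \<mu>.density_RN_deriv[OF assms(3) s])
  finally show ?thesis
    using that[of D] D circle_probD(2)[OF assms(1)] by (simp cong: measurable_cong_sets)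
qed

text \<open>\<open>young_exp\<close> at \<open>x = p\<close>, \<open>y = G\<close>, integrated
  against \<mu>, bounds each term of the supremum by \<open>\<integral> ln p d\<nu>\<close>; the
  summand 1 of the dual form cancels \<open>\<integral> p d\<mu> = 1\<close>.\<close>

lemma entropy_dual_le_relative_entropy:
  assumes \<mu>: "circle_prob \<mu>" and \<nu>: "circle_prob \<nu>"
  shows "entropy_dual \<nu> (\<lambda>f. \<integral>z. f z \<partial>\<mu>) \<le> relative_entropy \<nu> \<mu>"
proof (cases "absolutely_continuous \<mu> \<nu>")
  case False
  then show ?thesis by (simp add: relative_entropy_def)
next
  case True
  interpret \<mu>: prob_space \<mu> using \<mu> by (rule circle_probD)
  interpret \<nu>: prob_space \<nu> using \<nu> by (rule circle_probD)
  obtain p where p': "p \<in> borel_measurable circle_borel" and p: "\<And>x. p x \<ge> 0"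
    and eq: "\<nu> = density \<mu> (\<lambda>x. ennreal (p x))"
    using circle_RN_deriv[OF \<mu> \<nu> True] by metis
  have pm [measurable]: "p \<in> borel_measurable \<mu>" "p \<in> borel_measurable \<nu>"
    using p' circle_probD(2)[OF \<mu>] circle_probD(2)[OF \<nu>] by (simp_all cong: measurable_cong_sets)
  note re = relative_entropy_eq[OF \<mu>.prob_space_axioms pm(1) p eq \<nu>.prob_space_axioms]
  show ?thesis
  proof (cases "(\<integral>\<^sup>+x. ennreal (ln (p x)) \<partial>\<nu>) = \<top>")
    case True
    then have "relative_entropy \<nu> \<mu> = \<infinity>"
      using re by (cases "\<integral>\<^sup>+x. ennreal (- ln (p x)) \<partial>\<nu>") (auto simp: top_ereal_def)
    then show ?thesis by simp
  next
    case False
    then have i: "integrable \<nu> (\<lambda>x. ln (p x))"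
      using re(2) by (auto simp: real_integrable_def less_top)
    have "relative_entropy \<nu> \<mu> = ereal (\<integral>x. ln (p x) \<partial>\<nu>)"
      unfolding re(1) real_lebesgue_integral_def[OF i] using False re(2)
      by (cases "\<integral>\<^sup>+x. ennreal (- ln (p x)) \<partial>\<nu>"; cases "\<integral>\<^sup>+x. ennreal (ln (p x)) \<partial>\<nu>")
        (auto simp: less_top)
    moreover have "(\<integral>z. G z \<partial>\<nu>) - (\<integral>z. exp (G z) \<partial>\<mu>) + 1 \<le> (\<integral>x. ln (p x) \<partial>\<nu>)"
      if G: "continuous_on (sphere 0 1) G" for G
    proof -
      have Gm [measurable]: "G \<in> borel_measurable \<mu>" using continuous_imp_borel_measurable[OF \<mu> G] .
      have "integrable \<nu> G" by (rule integrable_continuous_circle[OF \<nu> G])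
      then have ig: "integrable \<mu> (\<lambda>x. p x * G x)"
        unfolding eq by (subst (asm) integrable_density) (use p in auto)
      have il: "integrable \<mu> (\<lambda>x. p x * ln (p x))"
        using i unfolding eq by (subst (asm) integrable_density) (use p in auto)
      have "integrable \<nu> (\<lambda>x. 1 :: real)" by simp
      then have ip: "integrable \<mu> p"
        unfolding eq by (subst (asm) integrable_density) (use p in auto)
      have "(\<integral>x. (1::real) \<partial>\<nu>) = 1" by (simp add: \<nu>.prob_space)
      then have p1: "(\<integral>x. p x \<partial>\<mu>) = 1"
        unfolding eq by (subst (asm) integral_density) (use p in auto)
      have ie: "integrable \<mu> (\<lambda>x. exp (G x))"
        by (intro integrable_continuous_circle[OF \<mu>] continuous_intros G)
      have "(\<integral>x. p x * G x - exp (G x) \<partial>\<mu>) \<le> (\<integral>x. p x * ln (p x) - p x \<partial>\<mu>)"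
        using ig il ip ie young_exp[OF p] by (intro integral_mono) auto
      moreover have "(\<integral>x. p x * G x \<partial>\<mu>) = (\<integral>z. G z \<partial>\<nu>)"
        unfolding eq by (subst integral_density) (use p in auto)
      moreover have "(\<integral>x. p x * ln (p x) \<partial>\<mu>) = (\<integral>z. ln (p z) \<partial>\<nu>)"
        unfolding eq by (subst integral_density) (use p in auto)
      ultimately show ?thesis using ig il ip ie p1 by simp
    qed
    ultimately show ?thesis unfolding entropy_dual_def by (auto intro!: SUP_least)
  qed
qed

text \<open>The ideal test function \<open>ln p\<close> is unbounded, so \<open>p\<close> is clamped
  between \<open>1/(n+1)\<close> and \<open>n+1\<close>, and \<open>n\<close> tends to infinity. If
  \<nu> is not absolutely continuous, multiples of the indicator of a \<mu>-null set charged by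
  \<nu> make the supremum infinite.\<close>

lemma relative_entropy_le_entropy_dual:
  assumes \<mu>: "circle_prob \<mu>" and \<nu>: "circle_prob \<nu>"
  shows "relative_entropy \<nu> \<mu> \<le> entropy_dual \<nu> (\<lambda>f. \<integral>z. f z \<partial>\<mu>)" (is "_ \<le> ?E")
proof (cases "absolutely_continuous \<mu> \<nu>")
  case False
  interpret \<mu>: prob_space \<mu> using \<mu> by (rule circle_probD)
  interpret \<nu>: prob_space \<nu> using \<nu> by (rule circle_probD)
  obtain A where A: "A \<in> null_sets \<mu>" "A \<notin> null_sets \<nu>"
    using False unfolding absolutely_continuous_def by auto
  have As: "A \<in> sets circle_borel" "A \<in> sets \<mu>" "A \<in> sets \<nu>"
    using A circle_probD(2)[OF \<mu>] circle_probD(2)[OF \<nu>] by auto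
  then have a: "measure \<nu> A > 0" using A
    by (metis \<nu>.emeasure_eq_measure ennreal_0 measure_le_0_iff not_le null_setsI)
  have "ereal (n * measure \<nu> A) \<le> ?E" for n :: nat
  proof -
    define g :: "complex \<Rightarrow> real" where "g z = real n * indicator A z" for z
    have "g \<in> borel_measurable circle_borel" unfolding g_def using As(1)
      by (intro borel_measurable_times borel_measurable_const borel_measurable_indicator)
    then have "ereal ((\<integral>z. g z \<partial>\<nu>) - (\<integral>z. exp (g z) \<partial>\<mu>) + 1) \<le> ?E"
      by (rule entropy_dual_bounded_upper[OF \<mu> \<nu>, of _ n]) (auto simp: g_def indicator_def)
    moreover have "(\<integral>z. g z \<partial>\<nu>) = n * measure \<nu> A"
      unfolding g_def using As by simp
    moreover have "(\<integral>z. exp (g z) \<partial>\<mu>) = (\<integral>z. 1 \<partial>\<mu>)"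
    proof (rule integral_cong_AE)
      have "AE z in \<mu>. z \<notin> A" using A(1) by (rule AE_not_in)
      then show "AE z in \<mu>. exp (g z) = 1" by eventually_elim (simp add: g_def)
      have "g \<in> borel_measurable \<mu>" unfolding g_def using As(2)
        by (intro borel_measurable_times borel_measurable_const borel_measurable_indicator)
      then show "(\<lambda>z. exp (g z)) \<in> borel_measurable \<mu>" by measurable
    qed simp
    ultimately show ?thesis by (simp add: \<mu>.prob_space)
  qed
  then have "?E = \<infinity>"
  proof (intro ereal_top)
    fix B :: real
    obtain n :: nat where "B / measure \<nu> A < n" using reals_Archimedean2 by blast
    then have "B \<le> n * measure \<nu> A" using a by (simp add: field_simps)
    then show "ereal B \<le> ?E" using \<open>ereal (n * measure \<nu> A) \<le> ?E\<close> order_trans ereal_less_eq(3) by blast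
  qed
  then show ?thesis by simp
next
  case True
  interpret \<mu>: prob_space \<mu> using \<mu> by (rule circle_probD)
  interpret \<nu>: prob_space \<nu> using \<nu> by (rule circle_probD)
  obtain p where p'[measurable]: "p \<in> borel_measurable circle_borel" and p: "\<And>x. p x \<ge> 0"
    and eq: "\<nu> = density \<mu> (\<lambda>x. ennreal (p x))"
    using circle_RN_deriv[OF \<mu> \<nu> True] by metis
  have pm [measurable]: "p \<in> borel_measurable \<mu>" "p \<in> borel_measurable \<nu>"
    using p' circle_probD(2)[OF \<mu>] circle_probD(2)[OF \<nu>] by (simp_all cong: measurable_cong_sets)
  note re = relative_entropy_eq[OF \<mu>.prob_space_axioms pm(1) p eq \<nu>.prob_space_axioms]
  define c where "c n x = max (1 / Suc n) (min (p x) (Suc n))" for n :: nat and x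
  have cpos: "c n x > 0" for n x unfolding c_def by (simp add: less_max_iff_disj)
  have cbd: "1 / Suc n \<le> c n x" "c n x \<le> Suc n" for n x
    by (auto simp: c_def max_def min_def field_simps)
  have clim: "(\<lambda>n. c n x) \<longlonglongrightarrow> p x" for x
  proof -
    have "(\<lambda>n. max (1 / Suc n) (p x)) \<longlonglongrightarrow> max 0 (p x)"
      by (intro tendsto_max tendsto_const LIMSEQ_Suc[OF lim_1_over_n])
    moreover have "eventually (\<lambda>n. max (1 / Suc n) (p x) = c n x) sequentially"
    proof -
      obtain N :: nat where "p x < N" using reals_Archimedean2 by blast
      then have "\<And>n. n \<ge> N \<Longrightarrow> min (p x) (Suc n) = p x" by (auto simp: min_def)
      then show ?thesis unfolding c_def eventually_sequentially by metis
    qed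
    ultimately show ?thesis using p[of x] by (simp add: tendsto_cong max_def)
  qed
  have cm [measurable]: "c n \<in> borel_measurable circle_borel" "c n \<in> borel_measurable \<mu>" "c n \<in> borel_measurable \<nu>" for n
    unfolding c_def by measurable
  \<comment> \<open>\<open>P n\<close> increases to the positive part of the entropy,
    \<open>Q\<close> is its negative part and dominates that of the clamped logarithm, and
    \<open>r n\<close> is the error that clamping causes in
    \<open>\<integral> p d\<mu> = 1\<close>.\<close>
  define P where "P n = (\<integral>\<^sup>+x. ennreal (ln (min (p x) (Suc n))) \<partial>\<nu>)" for n
  define Q where "Q = (\<integral>\<^sup>+x. ennreal (- ln (p x)) \<partial>\<nu>)"
  define r where "r n = (\<integral>x. c n x \<partial>\<mu>) - 1" for n
  have "(\<lambda>n. \<integral>x. c n x \<partial>\<mu>) \<longlonglongrightarrow> (\<integral>x. p x \<partial>\<mu>)"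
  proof (rule integral_dominated_convergence[where w = "\<lambda>x. 1 + p x"])
    have "integrable \<nu> (\<lambda>x. 1 :: real)" by simp
    then have ip: "integrable \<mu> p"
      unfolding eq by (subst (asm) integrable_density) (use p in auto)
    then show "integrable \<mu> (\<lambda>x. 1 + p x)" by simp
    show "AE x in \<mu>. norm (c n x) \<le> 1 + p x" for n
      using p cpos by (auto simp: c_def max_def min_def field_simps add_nonneg_nonneg intro!: AE_I2)
  qed (use clim in auto)
  moreover have "(\<integral>x. p x \<partial>\<mu>) = 1"
  proof -
    have "(\<integral>x. (1::real) \<partial>\<nu>) = 1" by (simp add: \<nu>.prob_space)
    then show ?thesis unfolding eq by (subst (asm) integral_density) (use p in auto)
  qed
  ultimately have r: "r \<longlonglongrightarrow> 0" unfolding r_def by (auto intro!: tendsto_eq_intros)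
  have main: "enn2ereal (P n) - enn2ereal Q - ereal (r n) \<le> ?E" for n
  proof -
    define g where "g x = ln (c n x)" for x
    have gb: "\<bar>g x\<bar> \<le> ln (Suc n)" for x
    proof -
      have "ln (1 / Suc n) \<le> ln (c n x)" "ln (c n x) \<le> ln (Suc n)"
        using cbd[of n x] cpos[of n x] by (subst ln_le_cancel_iff; simp)+
      then show ?thesis unfolding g_def by (simp add: ln_div)
    qed
    have gm [measurable]: "g \<in> borel_measurable circle_borel" "g \<in> borel_measurable \<nu>"
      unfolding g_def by measurable
    have gi: "integrable \<nu> g"
      using gb by (intro integrable_bounded_circle[OF \<nu> gm(2), of "ln (Suc n)"]) auto
    have fin: "(\<integral>\<^sup>+x. ennreal (g x) \<partial>\<nu>) < \<top>" "(\<integral>\<^sup>+x. ennreal (- g x) \<partial>\<nu>) < \<top>"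
      using gi by (auto simp: real_integrable_def less_top)
    have "P n \<le> (\<integral>\<^sup>+x. ennreal (g x) \<partial>\<nu>)"
      unfolding P_def g_def
    proof (rule nn_integral_mono)
      fix x
      show "ennreal (ln (min (p x) (Suc n))) \<le> ennreal (ln (c n x))"
      proof (cases "p x = 0")
        case False
        then show ?thesis using p[of x] by (intro ennreal_leI) (auto simp: c_def less_max_iff_disj)
      qed (simp add: c_def)
    qed
    moreover have "(\<integral>\<^sup>+x. ennreal (- g x) \<partial>\<nu>) \<le> Q"
    proof -
      \<comment> \<open>At points with \<open>p x = 0\<close> the convention \<open>ln 0 = 0\<close>
        would break the comparison, since \<open>ln (c n x)\<close> may be negative there; these
        points form a \<nu>-null set.\<close>
      have "AE x in \<nu>. p x > 0"
        unfolding eq by (subst AE_density) (auto simp: ennreal_less_zero_iff)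
      then show ?thesis unfolding Q_def g_def
      proof (intro nn_integral_mono_AE, eventually_elim)
        fix x assume "p x > 0"
        show "ennreal (- ln (c n x)) \<le> ennreal (- ln (p x))"
        proof (cases "p x \<le> c n x")
          case True
          then show ?thesis using \<open>p x > 0\<close> cpos[of n x] by (intro ennreal_leI) simp
        next
          case False
          moreover have "1 / real (Suc n) \<le> real (Suc n)" using cbd[of n x] by linarith
          ultimately have "c n x = Suc n" unfolding c_def by linarith
          then have "ln (c n x) \<ge> 0" by simp
          then show ?thesis by (simp add: ennreal_neg)
        qed
      qed
    qed
    moreover have "Q < \<top>" using re(2) by (simp add: Q_def)
    ultimately have "enn2ereal (P n) - enn2ereal Q \<le> ereal (\<integral>x. g x \<partial>\<nu>)"
      unfolding real_lebesgue_integral_def[OF gi] using fin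
      by (cases "\<integral>\<^sup>+x. ennreal (g x) \<partial>\<nu>"; cases "\<integral>\<^sup>+x. ennreal (- g x) \<partial>\<nu>"; cases "P n"; cases Q)
        (auto simp: top_unique)
    then have "enn2ereal (P n) - enn2ereal Q - ereal (r n) \<le> ereal (\<integral>x. g x \<partial>\<nu>) - ereal (r n)"
      by (intro ereal_minus_mono) auto
    also have "\<dots> = ereal ((\<integral>z. g z \<partial>\<nu>) - (\<integral>z. exp (g z) \<partial>\<mu>) + 1)"
      unfolding r_def g_def using cpos by simp
    also have "\<dots> \<le> ?E"
      by (rule entropy_dual_bounded_upper[OF \<mu> \<nu> gm(1) gb])
    finally show ?thesis .
  qed
  have "P \<longlonglongrightarrow> (\<integral>\<^sup>+x. ennreal (ln (p x)) \<partial>\<nu>)"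
    unfolding P_def
  proof (rule nn_integral_LIMSEQ)
    show "incseq (\<lambda>n x. ennreal (ln (min (p x) (Suc n))))"
    proof (rule incseq_SucI, rule le_funI)
      fix n x
      show "ennreal (ln (min (p x) (Suc n))) \<le> ennreal (ln (min (p x) (Suc (Suc n))))"
      proof (cases "p x = 0")
        case False
        then show ?thesis using p[of x] by (intro ennreal_leI) auto
      qed simp
    qed
    show "(\<lambda>n. ennreal (ln (min (p x) (Suc n)))) \<longlonglongrightarrow> ennreal (ln (p x))" for x
    proof -
      obtain N :: nat where "p x < N" using reals_Archimedean2 by blast
      then have "\<And>n. n \<ge> N \<Longrightarrow> min (p x) (Suc n) = p x" by (auto simp: min_def)
      then show ?thesis by (intro tendsto_eventually) (metis (mono_tags, lifting) eventually_sequentially)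
    qed
  qed auto
  then have "(\<lambda>n. enn2ereal (P n)) \<longlonglongrightarrow> enn2ereal (\<integral>\<^sup>+x. ennreal (ln (p x)) \<partial>\<nu>)"
    by (rule tendsto_enn2erealI)
  then have "(\<lambda>n. enn2ereal (P n) - enn2ereal Q - ereal (r n)) \<longlonglongrightarrow>
      enn2ereal (\<integral>\<^sup>+x. ennreal (ln (p x)) \<partial>\<nu>) - enn2ereal Q - ereal 0"
    using re(2) r unfolding Q_def[symmetric]
    by (intro tendsto_diff_ereal_general tendsto_const) (auto simp: less_top[symmetric] top_ereal_def enn2ereal_eq_top_iff)
  then have "enn2ereal (\<integral>\<^sup>+x. ennreal (ln (p x)) \<partial>\<nu>) - enn2ereal Q - ereal 0 \<le> ?E"
    by (rule LIMSEQ_le_const2) (use main in auto)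
  then show ?thesis unfolding re(1) Q_def by simp
qed

lemma relative_entropy_eq_entropy_dual:
  assumes "circle_prob \<mu>" "circle_prob \<nu>"
  shows "relative_entropy \<nu> \<mu> = entropy_dual \<nu> (\<lambda>f. \<integral>z. f z \<partial>\<mu>)"
  using relative_entropy_le_entropy_dual[OF assms] entropy_dual_le_relative_entropy[OF assms] by (rule antisym)

section \<open>Bernstein--Szego measures\<close>

lemma integral_arc_continuous:
  fixes f :: "complex \<Rightarrow> complex"
  assumes "continuous_on (sphere 0 1) f"
  shows "(\<integral>z. f z \<partial>arc_measure) = integral {0..2 * pi} (\<lambda>t. f (cis t)) / (2 * pi)"
proof -
  have cont: "continuous_on UNIV (\<lambda>t. f (cis t))"
    by (rule continuous_on_compose2[OF assms]) (auto intro: continuous_on_cis continuous_on_id)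
  then have meas: "(\<lambda>t. f (cis t)) \<in> borel_measurable borel"
    by (rule borel_measurable_continuous_onI)
  have "(\<integral>z. f z \<partial>arc_measure) = (\<integral>t. f (cis t) \<partial>uniform_measure lborel {0..<2 * pi})"
    by (intro integral_arc_measure continuous_imp_borel_measurable_circle assms)
  also have "\<dots> = (\<integral>t. (indicator {0..<2 * pi} t / (2 * pi)) *\<^sub>R f (cis t) \<partial>lborel)"
    by (intro integral_angle meas)
  also have "\<dots> = (\<integral>t. (1 / (2 * pi)) *\<^sub>R (indicator {0..2 * pi} t *\<^sub>R f (cis t)) \<partial>lborel)"
  proof (rule integral_cong_AE)
    have "AE t in lborel. t \<noteq> 2 * pi" by (rule AE_lborel_singleton)
    then show "AE t in lborel. (indicator {0..<2 * pi} t / (2 * pi)) *\<^sub>R f (cis t)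
        = (1 / (2 * pi)) *\<^sub>R (indicator {0..2 * pi} t *\<^sub>R f (cis t))"
      by eventually_elim (auto simp: indicator_def)
  qed (use meas in measurable)
  also have "\<dots> = (1 / (2 * pi)) *\<^sub>R (\<integral>t. indicator {0..2 * pi} t *\<^sub>R f (cis t) \<partial>lborel)"
    by (rule integral_scaleR_right)
  also have "(\<integral>t. indicator {0..2 * pi} t *\<^sub>R f (cis t) \<partial>lborel) = integral {0..2 * pi} (\<lambda>t. f (cis t))"
    using set_borel_integral_eq_integral(2)[OF borel_integrable_atLeastAtMost', of 0 "2 * pi" "\<lambda>t. f (cis t)"]
      continuous_on_subset[OF cont]
    by (simp add: set_lebesgue_integral_def)
  finally show ?thesis by (simp add: scaleR_conv_of_real)
qed

text \<open>Cauchy's formula at the centre, where \<open>dz/z\<close> is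
  \<open>\<i> d\<theta>\<close> on the circle.\<close>

lemma arc_mean_value:
  assumes "continuous_on (cball 0 1) f" "f holomorphic_on ball 0 1"
  shows "(\<integral>z. f z \<partial>arc_measure) = f 0"
proof -
  have "((\<lambda>u. f u / (u - 0)) has_contour_integral (2 * of_real pi * \<i> * f 0)) (circlepath 0 1)"
    using Cauchy_integral_circlepath[OF assms, of 0] by simp
  then have "((\<lambda>t. \<i> * f (cis t)) has_integral (2 * of_real pi * \<i> * f 0)) {0..2 * pi}"
    unfolding circlepath_def by (subst (asm) has_contour_integral_part_circlepath_iff) (auto simp: mult_ac)
  then have "((\<lambda>t. (- \<i>) * (\<i> * f (cis t))) has_integral (- \<i>) * (2 * of_real pi * \<i> * f 0)) {0..2 * pi}"
    by (rule has_integral_mult_right)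
  then have "integral {0..2 * pi} (\<lambda>t. f (cis t)) = 2 * pi * f 0"
    by (intro integral_unique) (simp add: mult_ac)
  then show ?thesis
    using integral_arc_continuous[of f] continuous_on_subset[OF assms(1), of "sphere 0 1"] by auto
qed

lemma circle_cnj: "z \<in> sphere 0 1 \<Longrightarrow> cnj z * z = 1" "z \<in> sphere 0 1 \<Longrightarrow> z * cnj z = 1"
  by (simp_all add: complex_norm_square[symmetric] mult.commute[of "cnj z"])

lemma circle_power_cnj:
  assumes "z \<in> sphere 0 1" "i \<le> n"
  shows "cnj (z ^ i) * z ^ n = z ^ (n - i)"
proof -
  have "z ^ n = z ^ i * z ^ (n - i)" using assms(2) by (simp flip: power_add)
  then show ?thesis using circle_cnj[OF assms(1)] by (simp add: mult.assoc[symmetric] flip: power_mult_distrib)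
qed

section \<open>Inner products and orthogonality along the recursion\<close>

lemma L2_inner_add_right:
  assumes "circle_prob \<mu>" "continuous_on (sphere 0 1) f" "continuous_on (sphere 0 1) g" "continuous_on (sphere 0 1) h"
  shows "L2_inner \<mu> f (\<lambda>z. g z + c * h z) = L2_inner \<mu> f g + c * L2_inner \<mu> f h"
proof -
  have "L2_inner \<mu> f (\<lambda>z. g z + c * h z) = (\<integral>z. cnj (f z) * g z + c * (cnj (f z) * h z) \<partial>\<mu>)"
    unfolding L2_inner_def by (simp add: algebra_simps)
  also have "\<dots> = (\<integral>z. cnj (f z) * g z \<partial>\<mu>) + (\<integral>z. c * (cnj (f z) * h z) \<partial>\<mu>)"
    by (intro Bochner_Integration.integral_add integrable_continuous_circle[OF assms(1)] continuous_intros assms)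
  finally show ?thesis unfolding L2_inner_def by simp
qed

lemma L2_inner_commute:
  "L2_inner \<mu> f g = cnj (L2_inner \<mu> g f)"
proof -
  have "cnj (L2_inner \<mu> g f) = (\<integral>z. cnj (cnj (g z) * f z) \<partial>\<mu>)"
    unfolding L2_inner_def by (rule Bochner_Integration.integral_cnj[symmetric])
  then show ?thesis by (simp add: L2_inner_def mult.commute)
qed

lemma L2_inner_self:
  "L2_inner \<mu> f f = of_real (\<integral>z. (cmod (f z))\<^sup>2 \<partial>\<mu>)"
proof -
  have "(\<lambda>z. cnj (f z) * f z) = (\<lambda>z. complex_of_real ((cmod (f z))\<^sup>2))"
    by (auto simp: complex_norm_square simp del: of_real_power)
  then show ?thesis unfolding L2_inner_def by (simp only: integral_complex_of_real)
qed

lemma L2_inner_poly_left: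
  assumes "circle_prob \<mu>" "continuous_on (sphere 0 1) f"
  shows "L2_inner \<mu> (poly q) f = (\<Sum>i\<le>degree q. cnj (coeff q i) * L2_inner \<mu> (\<lambda>z. z ^ i) f)"
proof -
  have "L2_inner \<mu> (poly q) f = (\<integral>z. (\<Sum>i\<le>degree q. cnj (coeff q i) * (cnj (z ^ i) * f z)) \<partial>\<mu>)"
    unfolding L2_inner_def by (simp add: poly_altdef sum_distrib_right mult.assoc)
  also have "\<dots> = (\<Sum>i\<le>degree q. \<integral>z. cnj (coeff q i) * (cnj (z ^ i) * f z) \<partial>\<mu>)"
    by (intro Bochner_Integration.integral_sum integrable_continuous_circle[OF assms(1)] continuous_intros assms)
  finally show ?thesis unfolding L2_inner_def by simp
qed

definition orth :: "complex measure \<Rightarrow> nat \<Rightarrow> complex poly \<Rightarrow> bool" where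
  "orth \<mu> n p \<longleftrightarrow> (\<forall>j<n. L2_inner \<mu> (\<lambda>z. z ^ j) (poly p) = 0)"

lemma orthD: "orth \<mu> n p \<Longrightarrow> j < n \<Longrightarrow> L2_inner \<mu> (\<lambda>z. z ^ j) (poly p) = 0"
  by (simp add: orth_def)

lemma continuous_on_poly_circle [continuous_intros]:
  "continuous_on A (poly p)" for p :: "complex poly"
  using continuous_on_poly[OF continuous_on_id, of A p] by simp

lemma orth_poly:
  assumes "circle_prob \<mu>" "orth \<mu> n p" "degree q < n"
  shows "L2_inner \<mu> (poly q) (poly p) = 0"
  by (subst L2_inner_poly_left[OF assms(1)]) (use assms in \<open>auto intro!: sum.neutral continuous_intros orthD\<close>)

lemma L2_inner_pCons:
  assumes "circle_prob \<mu>"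
  shows "L2_inner \<mu> (\<lambda>z. z ^ Suc i) (poly (pCons 0 p)) = L2_inner \<mu> (\<lambda>z. z ^ i) (poly p)"
  unfolding L2_inner_def
proof (rule integral_circle_cong[OF assms])
  fix z :: complex assume "z \<in> sphere 0 1"
  then have "cnj (z ^ Suc i) * poly (pCons 0 p) z = (cnj z * z) * (cnj (z ^ i) * poly p z)"
    by (simp add: mult_ac)
  then show "cnj (z ^ Suc i) * poly (pCons 0 p) z = cnj (z ^ i) * poly p z"
    using circle_cnj[OF \<open>z \<in> sphere 0 1\<close>] by simp
qed

lemma L2_inner_smult: "L2_inner \<mu> f (poly (Polynomial.smult c p)) = c * L2_inner \<mu> f (poly p)"
  by (simp add: L2_inner_def mult.left_commute)

text \<open>On the circle \<open>p\<^sup>* = z\<^sup>n cnj p\<close>. Hence orthogonality of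
  \<open>p\<close> to \<open>1, ..., z\<^sup>n\<^sup>-\<^sup>1\<close> becomes orthogonality of the
  dual to \<open>z, ..., z\<^sup>n\<close>.\<close>

lemma L2_inner_szego_dual:
  assumes "circle_prob \<mu>" "degree p \<le> n" "i \<le> n"
  shows "L2_inner \<mu> (\<lambda>z. z ^ i) (poly (szego_dual n p)) = cnj (L2_inner \<mu> (\<lambda>z. z ^ (n - i)) (poly p))"
proof -
  have "L2_inner \<mu> (\<lambda>z. z ^ i) (poly (szego_dual n p)) = L2_inner \<mu> (poly p) (\<lambda>z. z ^ (n - i))"
    unfolding L2_inner_def
  proof (rule integral_circle_cong[OF assms(1)])
    fix z :: complex assume z: "z \<in> sphere 0 1"
    have "cnj (z ^ i) * poly (szego_dual n p) z = (cnj (z ^ i) * z ^ n) * cnj (poly p z)"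
      by (simp add: poly_szego_dual_circle[OF assms(2) z])
    then show "cnj (z ^ i) * poly (szego_dual n p) z = cnj (poly p z) * z ^ (n - i)"
      unfolding circle_power_cnj[OF z assms(3)] by (simp only: mult.commute)
  qed
  then show ?thesis using L2_inner_commute[of \<mu> "poly p" "\<lambda>z. z ^ (n - i)"] by simp
qed

lemma poly_fun_add_smult: "poly (p + Polynomial.smult c q) = (\<lambda>z. poly p z + c * poly q z)"
  by auto

text \<open>By \<open>szego_step_inverse\<close>, a nonzero multiple of \<open>z p\<close> is a
  combination of the next polynomial, orthogonal to \<open>1, ..., z\<^sup>n\<close>, and its dual,
  orthogonal to \<open>z, ..., z\<^sup>n\<^sup>+\<^sup>1\<close>. The common powers
  \<open>z, ..., z\<^sup>n\<close> give the claim after cancelling \<open>z\<close>.\<close>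

lemma orth_szego_step_inverse:
  assumes "circle_prob \<mu>" "degree p \<le> n" "cmod a < 1" "orth \<mu> (Suc n) (szego_step a n p)"
  shows "orth \<mu> n p"
  unfolding orth_def
proof (intro allI impI)
  fix i assume i: "i < n"
  let ?P = "szego_step a n p"
  have deg: "degree ?P \<le> Suc n"
    using assms(2) unfolding szego_step_def
    by (intro degree_diff_le) (auto intro: degree_szego_dual[THEN order_trans] degree_smult_le[THEN order_trans])
  have "(1 - a * cnj a) * L2_inner \<mu> (\<lambda>z. z ^ i) (poly p)
      = L2_inner \<mu> (\<lambda>z. z ^ Suc i) (poly (Polynomial.smult (1 - a * cnj a) (pCons 0 p)))"
    by (simp only: L2_inner_pCons[OF assms(1)] L2_inner_smult)
  also have "\<dots> = L2_inner \<mu> (\<lambda>z. z ^ Suc i) (poly ?P) + cnj a * L2_inner \<mu> (\<lambda>z. z ^ Suc i) (poly (szego_dual (Suc n) ?P))"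
    unfolding szego_step_inverse[OF assms(2), symmetric] poly_fun_add_smult
    by (intro L2_inner_add_right assms(1) continuous_intros)
  also have "\<dots> = 0"
    using i orthD[OF assms(4), of "Suc i"] orthD[OF assms(4), of "n - i"]
    by (subst L2_inner_szego_dual[OF assms(1) deg]) auto
  finally have "(1 - a * cnj a) * L2_inner \<mu> (\<lambda>z. z ^ i) (poly p) = 0" .
  moreover have "a * cnj a \<noteq> 1"
  proof -
    have "(cmod a)\<^sup>2 < 1" using assms(3) by (simp add: abs_square_less_1)
    moreover have "a * cnj a = of_real ((cmod a)\<^sup>2)" by (rule complex_norm_square[symmetric])
    ultimately show ?thesis by (metis less_irrefl of_real_eq_1_iff)
  qed
  ultimately show "L2_inner \<mu> (\<lambda>z. z ^ i) (poly p) = 0" by simp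
qed

text \<open>Pythagoras for \<open>z p = P + cnj a p\<^sup>*\<close>, where \<open>P\<close> is the
  next polynomial: the dual has degree at most \<open>n\<close> and so is orthogonal to
  \<open>P\<close>, and \<open>|p\<^sup>*| = |p|\<close> on the circle.\<close>

lemma norm_szego_step:
  assumes "circle_prob \<mu>" "degree p \<le> n" "orth \<mu> (Suc n) (szego_step a n p)"
  shows "(\<integral>z. (cmod (poly (szego_step a n p) z))\<^sup>2 \<partial>\<mu>) = (1 - (cmod a)\<^sup>2) * (\<integral>z. (cmod (poly p z))\<^sup>2 \<partial>\<mu>)"
proof -
  let ?P = "szego_step a n p" and ?q = "szego_dual n p"
  define r where "r z = Re (a * (cnj (poly ?q z) * poly ?P z))" for z
  have 0: "L2_inner \<mu> (poly ?q) (poly ?P) = 0"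
    using degree_szego_dual[of n p] by (intro orth_poly[OF assms(1,3)]) simp
  have "(\<integral>z. r z \<partial>\<mu>) = Re (\<integral>z. a * (cnj (poly ?q z) * poly ?P z) \<partial>\<mu>)"
    unfolding r_def by (intro integral_Re integrable_continuous_circle[OF assms(1)] continuous_intros)
  also have "\<dots> = 0" using 0 unfolding L2_inner_def by (subst integral_mult_right_zero) simp
  finally have R: "(\<integral>z. r z \<partial>\<mu>) = 0" .
  have *: "(cmod (u + cnj a * v))\<^sup>2 = ((cmod u)\<^sup>2 + (cmod a)\<^sup>2 * (cmod v)\<^sup>2) + 2 * Re (a * (cnj v * u))" for u v
    unfolding cmod_power2 by (simp add: algebra_simps power2_eq_square)
  have "(\<integral>z. (cmod (poly p z))\<^sup>2 \<partial>\<mu>)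
      = (\<integral>z. ((cmod (poly ?P z))\<^sup>2 + (cmod a)\<^sup>2 * (cmod (poly p z))\<^sup>2) + 2 * r z \<partial>\<mu>)"
  proof (rule integral_circle_cong[OF assms(1)])
    fix z :: complex assume z: "z \<in> sphere 0 1"
    have "z * poly p z = poly ?P z + cnj a * poly ?q z" by (simp add: szego_step_def)
    then have "cmod (poly p z) = cmod (poly ?P z + cnj a * poly ?q z)"
      using z by (metis mult_1 norm_mult dist_0_norm mem_sphere)
    then show "(cmod (poly p z))\<^sup>2 = ((cmod (poly ?P z))\<^sup>2 + (cmod a)\<^sup>2 * (cmod (poly p z))\<^sup>2) + 2 * r z"
      unfolding r_def using *[of "poly ?P z" "poly ?q z"] norm_poly_szego_dual_circle[OF assms(2) z] by metis
  qed
  also have "\<dots> = ((\<integral>z. (cmod (poly ?P z))\<^sup>2 \<partial>\<mu>) + (cmod a)\<^sup>2 * (\<integral>z. (cmod (poly p z))\<^sup>2 \<partial>\<mu>))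
      + 2 * (\<integral>z. r z \<partial>\<mu>)"
  proof -
    have "integrable \<mu> (\<lambda>z. (cmod (poly ?P z))\<^sup>2)" "integrable \<mu> (\<lambda>z. (cmod (poly p z))\<^sup>2)" "integrable \<mu> r"
      unfolding r_def by (intro integrable_continuous_circle[OF assms(1)] continuous_intros)+
    then show ?thesis by simp
  qed
  finally show ?thesis using R by (simp add: algebra_simps)
qed

text \<open>Orthogonality to \<open>z, ..., z\<^sup>n\<close> holds for every \<open>a\<close>,
  because \<open>z p\<close> and \<open>p\<^sup>*\<close> both have it; the last hypothesis
  expresses what remains, orthogonality to 1.\<close>

lemma orth_szego_step:
  assumes "circle_prob \<mu>" "degree p \<le> n" "orth \<mu> n p"
    and "L2_inner \<mu> (\<lambda>z. 1) (poly (pCons 0 p)) = cnj a * cnj (L2_inner \<mu> (\<lambda>z. z ^ n) (poly p))"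
  shows "orth \<mu> (Suc n) (szego_step a n p)"
  unfolding orth_def
proof (intro allI impI)
  fix j assume j: "j < Suc n"
  have "L2_inner \<mu> (\<lambda>z. z ^ j) (poly (szego_step a n p)) = L2_inner \<mu> (\<lambda>z. z ^ j) (poly (pCons 0 p + Polynomial.smult (- cnj a) (szego_dual n p)))"
    by (simp add: szego_step_def)
  also have "\<dots> = L2_inner \<mu> (\<lambda>z. z ^ j) (poly (pCons 0 p)) + (- cnj a) * L2_inner \<mu> (\<lambda>z. z ^ j) (poly (szego_dual n p))"
    unfolding poly_fun_add_smult by (intro L2_inner_add_right assms(1) continuous_intros)
  also have "L2_inner \<mu> (\<lambda>z. z ^ j) (poly (szego_dual n p)) = cnj (L2_inner \<mu> (\<lambda>z. z ^ (n - j)) (poly p))"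
    using j by (intro L2_inner_szego_dual[OF assms(1,2)]) simp
  finally have *: "L2_inner \<mu> (\<lambda>z. z ^ j) (poly (szego_step a n p)) = L2_inner \<mu> (\<lambda>z. z ^ j) (poly (pCons 0 p))
      - cnj a * cnj (L2_inner \<mu> (\<lambda>z. z ^ (n - j)) (poly p))" by (simp del: poly_pCons)
  show "L2_inner \<mu> (\<lambda>z. z ^ j) (poly (szego_step a n p)) = 0"
  proof (cases j)
    case 0
    then show ?thesis using * assms(4) by (simp del: poly_pCons)
  next
    case (Suc i)
    then show ?thesis unfolding * using j assms(3)
      by (auto simp: L2_inner_pCons[OF assms(1)] orth_def simp del: power_Suc poly_pCons)
  qed
qed

text \<open>Each \<open>P l\<close> is monic with integral 0 and so expresses the moment of order
  \<open>l\<close> by lower ones, in the same way for both measures.\<close>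

lemma moments_unique:
  assumes "circle_prob \<mu>" "circle_prob \<nu>"
    and "\<And>j. 0 < j \<Longrightarrow> j \<le> n \<Longrightarrow> orth \<mu> 1 (P j) \<and> orth \<nu> 1 (P j)"
    and "\<And>j. j \<le> n \<Longrightarrow> degree (P j) = j \<and> lead_coeff (P j) = 1" and "l \<le> n"
  shows "(\<integral>z. z ^ l \<partial>\<mu>) = (\<integral>z. z ^ l \<partial>\<nu>)"
  using assms(5)
proof (induction l rule: less_induct)
  case (less l)
  have eq: "(\<integral>z. z ^ l \<partial>\<kappa>) = - (\<Sum>i<l. coeff (P l) i * (\<integral>z. z ^ i \<partial>\<kappa>))"
    if "l > 0" "circle_prob \<kappa>" "orth \<kappa> 1 (P l)" for \<kappa>
  proof -
    have "0 = (\<integral>z. poly (P l) z \<partial>\<kappa>)"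
      using that(3) by (simp add: orth_def L2_inner_def)
    also have "\<dots> = (\<integral>z. (\<Sum>i\<le>l. coeff (P l) i * z ^ i) \<partial>\<kappa>)"
      using assms(4)[of l] less.prems by (simp add: poly_altdef)
    also have "\<dots> = (\<Sum>i\<le>l. \<integral>z. coeff (P l) i * z ^ i \<partial>\<kappa>)"
      by (intro Bochner_Integration.integral_sum integrable_continuous_circle[OF that(2)] continuous_intros)
    also have "\<dots> = (\<Sum>i\<le>l. coeff (P l) i * (\<integral>z. z ^ i \<partial>\<kappa>))" by simp
    also have "\<dots> = (\<Sum>i<l. coeff (P l) i * (\<integral>z. z ^ i \<partial>\<kappa>)) + (\<integral>z. z ^ l \<partial>\<kappa>)"
    proof -
      have "coeff (P l) l = 1" using assms(4)[of l] less.prems by metis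
      then show ?thesis by (simp add: lessThan_Suc_atMost[symmetric])
    qed
    finally show ?thesis by (simp add: eq_neg_iff_add_eq_0 add.commute)
  qed
  show ?case
  proof (cases "l = 0")
    case True
    then show ?thesis
      using integral_circle_const[OF assms(1), of "1::complex"] integral_circle_const[OF assms(2), of "1::complex"]
      by simp
  next
    case False
    then show ?thesis
      using eq[OF _ assms(1)] eq[OF _ assms(2)] assms(3)[of l] less by (auto intro!: sum.cong)
  qed
qed

text \<open>Normalized by dividing by the total mass, which \<open>bs_normalization\<close>
  evaluates afterwards as the reciprocal of \<open>rho_prod \<alpha> n\<close>.\<close>

definition bs_measure :: "(nat \<Rightarrow> complex) \<Rightarrow> nat \<Rightarrow> complex measure" where
  "bs_measure \<alpha> n = density arc_measure (\<lambda>z. ennreal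
     (1 / (cmod (poly (szego_poly \<alpha> n) z))\<^sup>2 / (\<integral>z. 1 / (cmod (poly (szego_poly \<alpha> n) z))\<^sup>2 \<partial>arc_measure)))"

text \<open>The squared norm of \<open>\<Phi>\<^sub>n\<close>, see
  \<open>norm_szego_poly_bs\<close>.\<close>

definition rho_prod :: "(nat \<Rightarrow> complex) \<Rightarrow> nat \<Rightarrow> real" where
  "rho_prod \<alpha> n = (\<Prod>j<n. 1 - (cmod (\<alpha> j))\<^sup>2)"

lemma rho_prod_pos: "(\<And>j. j < n \<Longrightarrow> cmod (\<alpha> j) < 1) \<Longrightarrow> rho_prod \<alpha> n > 0"
  unfolding rho_prod_def by (intro prod_pos) (auto simp: abs_square_less_1)

context
  fixes \<alpha> :: "nat \<Rightarrow> complex" and n :: nat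
  assumes \<alpha>: "\<And>j. j < n \<Longrightarrow> cmod (\<alpha> j) < 1"
begin

lemma szego_poly_circle_nonzero: "z \<in> sphere 0 1 \<Longrightarrow> poly (szego_poly \<alpha> n) z \<noteq> 0"
  using szego_poly_outside[OF \<alpha>, where z = z] by auto

lemma continuous_bs_density:
  "continuous_on (sphere 0 1) (\<lambda>z. 1 / (cmod (poly (szego_poly \<alpha> n) z))\<^sup>2)"
  using szego_poly_circle_nonzero by (intro continuous_intros) auto

lemma bs_normalization_pos: "(\<integral>z. 1 / (cmod (poly (szego_poly \<alpha> n) z))\<^sup>2 \<partial>arc_measure) > 0"
proof -
  obtain B where B: "B > 0" "\<And>z. z \<in> sphere 0 1 \<Longrightarrow> cmod (poly (szego_poly \<alpha> n) z) \<le> B"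
    using continuous_on_circle_bounded[of "poly (szego_poly \<alpha> n)"] continuous_on_poly_circle by metis
  have "0 < 1 / B\<^sup>2" using B by simp
  also have "\<dots> = (\<integral>z. 1 / B\<^sup>2 \<partial>arc_measure)"
    by (rule integral_circle_const[OF circle_prob_arc, symmetric])
  also have "\<dots> \<le> (\<integral>z. 1 / (cmod (poly (szego_poly \<alpha> n) z))\<^sup>2 \<partial>arc_measure)"
    using B szego_poly_circle_nonzero
    by (intro integral_circle_mono[OF circle_prob_arc] continuous_bs_density continuous_intros divide_left_mono power_mono)
      auto
  finally show ?thesis .
qed

lemma circle_prob_bs: "circle_prob (bs_measure \<alpha> n)"
  unfolding bs_measure_def
  using bs_normalization_pos
  by (intro circle_prob_density[OF circle_prob_arc] continuous_on_divide[OF continuous_bs_density continuous_on_const])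
    (auto simp del: divide_divide_eq_left)

lemma integral_bs_aux:
  fixes f :: "complex \<Rightarrow> 'a::{banach, second_countable_topology}"
  assumes "continuous_on (sphere 0 1) f"
  shows "(\<integral>z. f z \<partial>bs_measure \<alpha> n) = (1 / (\<integral>z. 1 / (cmod (poly (szego_poly \<alpha> n) z))\<^sup>2 \<partial>arc_measure))
    *\<^sub>R (\<integral>z. (1 / (cmod (poly (szego_poly \<alpha> n) z))\<^sup>2) *\<^sub>R f z \<partial>arc_measure)" (is "_ = (1 / ?c) *\<^sub>R _")
proof -
  have "(\<integral>z. f z \<partial>bs_measure \<alpha> n) = (\<integral>z. (1 / (cmod (poly (szego_poly \<alpha> n) z))\<^sup>2 / ?c) *\<^sub>R f z \<partial>arc_measure)"
    unfolding bs_measure_def using bs_normalization_pos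
    by (intro integral_density_circle[OF circle_prob_arc] continuous_on_divide[OF continuous_bs_density continuous_on_const] assms)
      auto
  also have "\<dots> = (\<integral>z. (1 / ?c) *\<^sub>R ((1 / (cmod (poly (szego_poly \<alpha> n) z))\<^sup>2) *\<^sub>R f z) \<partial>arc_measure)"
    by (intro integral_circle_cong[OF circle_prob_arc]) (simp add: mult.commute)
  finally show ?thesis by (simp only: integral_scaleR_right)
qed

text \<open>On the circle \<open>cnj z\<^sup>i \<Phi>\<^sub>n / |\<Phi>\<^sub>n|\<^sup>2 =
  z\<^sup>n\<^sup>-\<^sup>i / \<Phi>\<^sub>n\<^sup>*\<close>, which is holomorphic in the disk
  because the dual has no zeros there; its mean is its value 0 at the origin.\<close>

lemma orth_bs_top: "orth (bs_measure \<alpha> n) n (szego_poly \<alpha> n)"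
  unfolding orth_def
proof (intro allI impI)
  fix i assume i: "i < n"
  let ?p = "szego_poly \<alpha> n" and ?q = "szego_dual n (szego_poly \<alpha> n)"
  have q: "poly ?q z \<noteq> 0" if "z \<in> cball 0 1" for z
    using szego_poly_inside[OF \<alpha>, where z = z] that by auto
  have "(\<integral>z. (1 / (cmod (poly ?p z))\<^sup>2) *\<^sub>R (cnj (z ^ i) * poly ?p z) \<partial>arc_measure)
      = (\<integral>z. z ^ (n - i) / poly ?q z \<partial>arc_measure)"
  proof (rule integral_circle_cong[OF circle_prob_arc])
    fix z :: complex assume z: "z \<in> sphere 0 1"
    have p: "poly ?p z \<noteq> 0" using szego_poly_circle_nonzero[OF z] .
    have z0: "z \<noteq> 0" using z by auto
    have "(1 / (cmod (poly ?p z))\<^sup>2) *\<^sub>R (cnj (z ^ i) * poly ?p z) = cnj (z ^ i) * poly ?p z / (poly ?p z * cnj (poly ?p z))"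
      using complex_norm_square[of "poly ?p z"] by (simp add: scaleR_conv_of_real)
    also have "\<dots> = cnj (z ^ i) / cnj (poly ?p z)" using p by simp
    also have "\<dots> = (cnj (z ^ i) * z ^ n) / (z ^ n * cnj (poly ?p z))" using z0 by simp
    also have "\<dots> = z ^ (n - i) / poly ?q z"
      unfolding circle_power_cnj[OF z less_imp_le[OF i]] by (simp add: poly_szego_dual_circle[OF _ z])
    finally show "(1 / (cmod (poly ?p z))\<^sup>2) *\<^sub>R (cnj (z ^ i) * poly ?p z) = z ^ (n - i) / poly ?q z" .
  qed
  also have "\<dots> = 0 ^ (n - i) / poly ?q 0"
    using q by (intro arc_mean_value continuous_intros holomorphic_intros) auto
  also have "\<dots> = 0" using i by simp
  finally show "L2_inner (bs_measure \<alpha> n) (\<lambda>z. z ^ i) (poly ?p) = 0"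
    unfolding L2_inner_def by (subst integral_bs_aux) (auto intro!: continuous_intros)
qed

text \<open>Downward induction: orthogonality at the top passes to the earlier polynomials through
  the inverse recursion.\<close>

lemma orth_bs:
  assumes "j \<le> n"
  shows "orth (bs_measure \<alpha> n) j (szego_poly \<alpha> j)"
  using assms
proof (induction rule: inc_induct)
  case base
  show ?case by (rule orth_bs_top)
next
  case (step j)
  then show ?case
    using orth_szego_step_inverse[OF circle_prob_bs, of "szego_poly \<alpha> j" j "\<alpha> j"] \<alpha>[of j] by simp
qed

lemma norm_szego_poly_bs:
  assumes "j \<le> n"
  shows "(\<integral>z. (cmod (poly (szego_poly \<alpha> j) z))\<^sup>2 \<partial>bs_measure \<alpha> n) = rho_prod \<alpha> j"
  using assms
proof (induction j)
  case 0
  then show ?case using integral_circle_const[OF circle_prob_bs, of "1::real"] by (simp add: rho_prod_def)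
next
  case (Suc j)
  then show ?case
    using norm_szego_step[OF circle_prob_bs, of "szego_poly \<alpha> j" j "\<alpha> j"] orth_bs[of "Suc j"]
    by (simp add: rho_prod_def mult.commute)
qed

text \<open>Integrating \<open>|\<Phi>\<^sub>n|\<^sup>2\<close> against the normalized density
  leaves the constant \<open>1 / c\<close> with \<open>c\<close> the total mass, while the norm
  recursion gives \<open>rho_prod \<alpha> n\<close>.\<close>

lemma bs_normalization: "(\<integral>z. 1 / (cmod (poly (szego_poly \<alpha> n) z))\<^sup>2 \<partial>arc_measure) = 1 / rho_prod \<alpha> n"
proof -
  let ?c = "\<integral>z. 1 / (cmod (poly (szego_poly \<alpha> n) z))\<^sup>2 \<partial>arc_measure"
  have "rho_prod \<alpha> n = (1 / ?c) *\<^sub>R (\<integral>z. (1 / (cmod (poly (szego_poly \<alpha> n) z))\<^sup>2) *\<^sub>R (cmod (poly (szego_poly \<alpha> n) z))\<^sup>2 \<partial>arc_measure)"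
    by (subst norm_szego_poly_bs[symmetric, OF order_refl], rule integral_bs_aux) (intro continuous_intros)
  also have "(\<integral>z. (1 / (cmod (poly (szego_poly \<alpha> n) z))\<^sup>2) *\<^sub>R (cmod (poly (szego_poly \<alpha> n) z))\<^sup>2 \<partial>arc_measure)
      = (\<integral>z. 1 \<partial>arc_measure)"
    using szego_poly_circle_nonzero by (intro integral_circle_cong[OF circle_prob_arc]) auto
  also have "\<dots> = 1" by (rule integral_circle_const[OF circle_prob_arc])
  finally have "rho_prod \<alpha> n = 1 / ?c" by simp
  then show ?thesis by simp
qed

lemma integral_bs:
  fixes f :: "complex \<Rightarrow> 'a::{banach, second_countable_topology}"
  assumes "continuous_on (sphere 0 1) f"
  shows "(\<integral>z. f z \<partial>bs_measure \<alpha> n)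
    = (\<integral>z. (rho_prod \<alpha> n / (cmod (poly (szego_poly \<alpha> n) z))\<^sup>2) *\<^sub>R f z \<partial>arc_measure)"
  unfolding integral_bs_aux[OF assms] bs_normalization integral_scaleR_right[symmetric] by simp

end

lemma orth_mono: "orth \<mu> n p \<Longrightarrow> m \<le> n \<Longrightarrow> orth \<mu> m p"
  by (auto simp: orth_def)

lemma moments_eq_bs:
  assumes "circle_prob \<mu>" "\<And>j. j \<le> n \<Longrightarrow> orth \<mu> j (szego_poly \<alpha> j)"
    and "\<And>j. j < n \<Longrightarrow> cmod (\<alpha> j) < 1" "l \<le> n"
  shows "(\<integral>z. z ^ l \<partial>\<mu>) = (\<integral>z. z ^ l \<partial>bs_measure \<alpha> n)"
proof (rule moments_unique[OF assms(1) circle_prob_bs[OF assms(3)], where P = "szego_poly \<alpha>"])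
  fix j assume "0 < j" "j \<le> n"
  then show "orth \<mu> 1 (szego_poly \<alpha> j) \<and> orth (bs_measure \<alpha> n) 1 (szego_poly \<alpha> j)"
    using assms(2)[of j] orth_bs[OF assms(3), where j = j] orth_mono[of _ j _ 1] by auto
qed (use assms lead_coeff_szego_poly in auto)

lemma moments_bs:
  assumes "\<And>j. cmod (\<alpha> j) < 1" "l \<le> n" "l \<le> m"
  shows "(\<integral>z. z ^ l \<partial>bs_measure \<alpha> n) = (\<integral>z. z ^ l \<partial>bs_measure \<alpha> m)"
proof -
  have "(\<integral>z. z ^ l \<partial>bs_measure \<alpha> k) = (\<integral>z. z ^ l \<partial>bs_measure \<alpha> l)" if "l \<le> k" for k
    by (rule moments_eq_bs) (use that assms(1) in \<open>auto intro: circle_prob_bs orth_bs\<close>)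
  from this[OF assms(2)] this[OF assms(3)] show ?thesis by (simp only:)
qed

section \<open>Verblunsky coefficients\<close>

text \<open>The points outside the support are covered by those members of a countable base that are
  null sets.\<close>

lemma AE_circle_support:
  assumes \<mu>: "circle_prob \<mu>"
  shows "AE z in \<mu>. z \<in> circle_support \<mu>"
proof -
  note s = circle_probD[OF \<mu>]
  obtain B :: "complex set set" where B: "countable B" "topological_basis B"
    using ex_countable_basis by auto
  have os: "U \<inter> sphere 0 1 \<in> sets \<mu>" if "open U" for U
    using that s by (auto simp: circle_borel_def sets_restrict_space)
  define C where "C = {U \<in> B. emeasure \<mu> (U \<inter> sphere 0 1) = 0}"
  have "(\<Union>U\<in>C. U \<inter> sphere 0 1) \<in> null_sets \<mu>"
  proof (rule null_sets_UN')
    show "countable C" using B by (auto simp: C_def)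
    show "U \<inter> sphere 0 1 \<in> null_sets \<mu>" if "U \<in> C" for U
      using that os topological_basis_open[OF B(2)] by (auto simp: C_def intro: null_setsI)
  qed
  moreover have "{z \<in> space \<mu>. z \<notin> circle_support \<mu>} \<subseteq> (\<Union>U\<in>C. U \<inter> sphere 0 1)"
  proof safe
    fix z assume z: "z \<in> space \<mu>" "z \<notin> circle_support \<mu>"
    then obtain U where U: "open U" "z \<in> U" "\<not> emeasure \<mu> (U \<inter> sphere 0 1) > 0"
      using s by (auto simp: circle_support_def)
    obtain V where V: "V \<in> B" "z \<in> V" "V \<subseteq> U"
      using topological_basisE[OF B(2) U(1,2)] by metis
    have "emeasure \<mu> (V \<inter> sphere 0 1) \<le> emeasure \<mu> (U \<inter> sphere 0 1)"
      using V os[OF U(1)] by (intro emeasure_mono) auto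
    then have "V \<in> C" using U V by (auto simp: C_def)
    then show "z \<in> (\<Union>U\<in>C. U \<inter> sphere 0 1)" using V z s by auto
  qed
  ultimately show ?thesis by (rule AE_I')
qed

lemma circle_support_subset: "circle_support \<mu> \<subseteq> sphere 0 1"
  by (auto simp: circle_support_def)

lemma circle_support_nonempty:
  assumes "circle_prob \<mu>"
  shows "circle_support \<mu> \<noteq> {}"
proof
  interpret prob_space \<mu> using assms by (rule circle_probD)
  assume "circle_support \<mu> = {}"
  then have "AE z in \<mu>. False" using AE_circle_support[OF assms] by simp
  then show False using not_empty by auto
qed

lemma integral_zero_imp_zero_on_support:
  fixes f :: "complex \<Rightarrow> real"
  assumes \<mu>: "circle_prob \<mu>" and f: "continuous_on (sphere 0 1) f" "\<And>z. z \<in> sphere 0 1 \<Longrightarrow> f z \<ge> 0"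
    and "(\<integral>z. f z \<partial>\<mu>) = 0" and z: "z \<in> circle_support \<mu>"
  shows "f z = 0"
proof (rule ccontr)
  note s = circle_probD[OF \<mu>]
  have zc: "z \<in> sphere 0 1" using z circle_support_subset by blast
  assume "f z \<noteq> 0"
  with f(2)[OF zc] have pos: "f z > 0" by simp
  have "AE z in \<mu>. 0 \<le> f z" by (rule AE_I2) (use f s in auto)
  then have ae: "AE z in \<mu>. f z = 0"
    using assms(4) integral_nonneg_eq_0_iff_AE[OF integrable_continuous_circle[OF \<mu> f(1)]] by blast
  obtain U where U: "open U" "f -` {0<..} \<inter> sphere 0 1 = U \<inter> sphere 0 1"
    using f(1) unfolding continuous_on_open_invariant by (metis open_greaterThan)
  have "U \<inter> sphere 0 1 \<in> sets \<mu>"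
    using U(1) s by (auto simp: circle_borel_def sets_restrict_space)
  moreover have "AE z in \<mu>. z \<notin> U \<inter> sphere 0 1"
    using ae
  proof eventually_elim
    fix w assume "f w = 0"
    then have "w \<notin> f -` {0<..} \<inter> sphere 0 1" by simp
    then show "w \<notin> U \<inter> sphere 0 1" unfolding U(2) .
  qed
  ultimately have "emeasure \<mu> (U \<inter> sphere 0 1) = 0"
    using AE_iff_null_sets[of "U \<inter> sphere 0 1" \<mu>] by auto
  moreover have "z \<in> f -` {0<..} \<inter> sphere 0 1" using zc pos by simp
  then have "z \<in> U" unfolding U(2) by simp
  ultimately show False using z U(1) by (auto simp: circle_support_def)
qed

text \<open>Under this condition a nonzero polynomial of degree at most \<open>n\<close> cannot
  vanish on the whole support, so the inner product is positive definite on these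
  polynomials.\<close>

definition many_points :: "complex measure \<Rightarrow> nat \<Rightarrow> bool" where
  "many_points \<mu> n \<longleftrightarrow> infinite (circle_support \<mu>) \<or> n < card (circle_support \<mu>)"

lemma poly_norm_pos:
  assumes \<mu>: "circle_prob \<mu>" and "p \<noteq> 0" "many_points \<mu> (degree p)"
  shows "(\<integral>z. (cmod (poly p z))\<^sup>2 \<partial>\<mu>) > 0"
proof (rule ccontr)
  assume "\<not> ?thesis"
  moreover have "(\<integral>z. (cmod (poly p z))\<^sup>2 \<partial>\<mu>) \<ge> 0" by simp
  ultimately have "(\<integral>z. (cmod (poly p z))\<^sup>2 \<partial>\<mu>) = 0" by linarith
  from integral_zero_imp_zero_on_support[OF \<mu> _ _ this]
  have "(cmod (poly p z))\<^sup>2 = 0" if "z \<in> circle_support \<mu>" for z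
    using that by (simp add: continuous_on_poly_circle continuous_on_power continuous_on_norm)
  then have sub: "circle_support \<mu> \<subseteq> {z. poly p z = 0}" by auto
  have "finite {z. poly p z = 0}" "card {z. poly p z = 0} \<le> degree p"
    using poly_roots_finite[OF assms(2)] card_poly_roots_bound[OF assms(2)] by auto
  then have "finite (circle_support \<mu>)" "card (circle_support \<mu>) \<le> degree p"
    using finite_subset[OF sub] card_mono[OF _ sub] by auto
  then show False using assms(3) by (simp add: many_points_def)
qed

text \<open>The difference has degree below \<open>n\<close>, so it is orthogonal to both
  polynomials and hence to itself.\<close>

lemma orth_unique:
  assumes \<mu>: "circle_prob \<mu>"
    and p: "degree p = n" "lead_coeff p = 1" "orth \<mu> n p"
    and q: "degree q = n" "lead_coeff q = 1" "orth \<mu> n q"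
    and "many_points \<mu> n"
  shows "p = q"
proof (rule ccontr)
  assume "p \<noteq> q"
  define r where "r = p - q"
  have "r \<noteq> 0" using \<open>p \<noteq> q\<close> by (simp add: r_def)
  have "degree r \<le> n" unfolding r_def using p q by (intro degree_diff_le) auto
  moreover have "coeff r n = 0" unfolding r_def using p q by simp
  ultimately have deg: "degree r < n"
    using \<open>r \<noteq> 0\<close> by (metis le_neq_implies_less leading_coeff_0_iff)
  have "poly r = (\<lambda>z. poly p z + (- 1) * poly q z)" by (auto simp: r_def)
  then have "L2_inner \<mu> (poly r) (poly r) = L2_inner \<mu> (poly r) (poly p) + (- 1) * L2_inner \<mu> (poly r) (poly q)"
    by (metis L2_inner_add_right[OF \<mu>] continuous_on_poly_circle)
  also have "\<dots> = 0" using orth_poly[OF \<mu> p(3) deg] orth_poly[OF \<mu> q(3) deg] by simp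
  finally have "(\<integral>z. (cmod (poly r z))\<^sup>2 \<partial>\<mu>) = 0" unfolding L2_inner_self by simp
  moreover have "many_points \<mu> (degree r)" using deg assms(8) by (auto simp: many_points_def)
  ultimately show False using poly_norm_pos[OF \<mu> \<open>r \<noteq> 0\<close>] by simp
qed

lemma orth_lead:
  assumes \<mu>: "circle_prob \<mu>" and p: "degree p = n" "lead_coeff p = 1" "orth \<mu> n p"
  shows "L2_inner \<mu> (\<lambda>z. z ^ n) (poly p) = of_real (\<integral>z. (cmod (poly p z))\<^sup>2 \<partial>\<mu>)"
proof -
  have "coeff p n = 1" using p by simp
  then have "L2_inner \<mu> (poly p) (poly p) = (\<Sum>i<n. cnj (coeff p i) * L2_inner \<mu> (\<lambda>z. z ^ i) (poly p)) + L2_inner \<mu> (\<lambda>z. z ^ n) (poly p)"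
    using p(1) by (simp add: L2_inner_poly_left[OF \<mu> continuous_on_poly_circle] lessThan_Suc_atMost[symmetric])
  also have "(\<Sum>i<n. cnj (coeff p i) * L2_inner \<mu> (\<lambda>z. z ^ i) (poly p)) = 0"
    using orthD[OF p(3)] by (intro sum.neutral) auto
  finally show ?thesis by (simp add: L2_inner_self)
qed

text \<open>The coefficient solves the equation required by \<open>orth_szego_step\<close>; the
  divisor is, by \<open>orth_lead\<close>, the squared norm of \<open>p\<close>, which is
  positive.\<close>

lemma orth_step_exists:
  assumes \<mu>: "circle_prob \<mu>" and p: "degree p = n" "lead_coeff p = 1" "orth \<mu> n p"
    and "many_points \<mu> n"
  shows "\<exists>a. orth \<mu> (Suc n) (szego_step a n p)"
proof -
  have "p \<noteq> 0" using p by auto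
  then have "(\<integral>z. (cmod (poly p z))\<^sup>2 \<partial>\<mu>) > 0" using poly_norm_pos[OF \<mu>, of p] assms by auto
  then have "L2_inner \<mu> (\<lambda>z. z ^ n) (poly p) \<noteq> 0" using orth_lead[OF \<mu> p] by auto
  then show ?thesis
    using orth_szego_step[OF \<mu> _ p(3), of "cnj (L2_inner \<mu> (\<lambda>z. 1) (poly (pCons 0 p)) / cnj (L2_inner \<mu> (\<lambda>z. z ^ n) (poly p)))"] p(1)
    by (auto simp del: poly_pCons)
qed

lemma orth_exists:
  assumes \<mu>: "circle_prob \<mu>" and "many_points \<mu> n"
  shows "\<exists>p. degree p = n \<and> lead_coeff p = 1 \<and> orth \<mu> n p"
  using assms(2)
proof (induction n)
  case 0
  then show ?case by (intro exI[of _ 1]) (simp add: orth_def)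
next
  case (Suc n)
  then have b: "many_points \<mu> n" by (auto simp: many_points_def)
  then obtain p where p: "degree p = n" "lead_coeff p = 1" "orth \<mu> n p" using Suc.IH by blast
  obtain a where "orth \<mu> (Suc n) (szego_step a n p)" using orth_step_exists[OF \<mu> p b] by blast
  then show ?case using szego_step_monic[OF p(1,2)] by blast
qed

section \<open>Identification of \<open>monic_OP\<close> and \<open>verblunsky\<close>\<close>

lemma monic_OP_unique:
  assumes \<mu>: "circle_prob \<mu>" and p: "degree p = n" "lead_coeff p = 1" "orth \<mu> n p"
    and "many_points \<mu> n"
  shows "monic_OP \<mu> n = p"
proof -
  have "monic_OP \<mu> n = (THE p. degree p = n \<and> lead_coeff p = 1 \<and> orth \<mu> n p)"
    using assms(5) by (auto simp: monic_OP_def many_points_def orth_def)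
  also have "\<dots> = p"
    by (rule the_equality) (use p orth_unique[OF \<mu> _ _ _ p assms(5)] in blast)+
  finally show ?thesis .
qed

text \<open>The product \<open>q\<close> over the support vanishes almost everywhere, so
  \<open>r = p - q\<close> coincides with \<open>p\<close> almost everywhere, and \<open>p\<close>
  is orthogonal to \<open>r\<close>, which has lower degree. So the last polynomial of a finitely
  supported measure, defined by its zeros, also fits the recursion.\<close>

lemma monic_OP_card:
  assumes \<mu>: "circle_prob \<mu>" and p: "degree p = n" "lead_coeff p = 1" "orth \<mu> n p"
    and fin: "finite (circle_support \<mu>)" "n = card (circle_support \<mu>)"
  shows "monic_OP \<mu> n = p"
proof (rule ccontr)
  define q where "q = (\<Prod>z\<in>circle_support \<mu>. [:- z, 1:])"
  have q: "monic_OP \<mu> n = q" using fin by (simp add: monic_OP_def q_def)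
  have "degree q = n" using fin by (simp add: q_def degree_prod_sum_eq)
  moreover have "lead_coeff q = (\<Prod>z\<in>circle_support \<mu>. lead_coeff [:- z, 1:])"
    unfolding q_def by (rule lead_coeff_prod)
  ultimately have dq: "degree q = n" "lead_coeff q = 1" by simp_all
  assume "monic_OP \<mu> n \<noteq> p"
  then have "p \<noteq> q" using q by simp
  define r where "r = p - q"
  have "r \<noteq> 0" using \<open>p \<noteq> q\<close> by (simp add: r_def)
  have "degree r \<le> n" unfolding r_def using p dq by (intro degree_diff_le) auto
  moreover have "coeff r n = 0" unfolding r_def using p dq by simp
  ultimately have deg: "degree r < n"
    using \<open>r \<noteq> 0\<close> by (metis le_neq_implies_less leading_coeff_0_iff)
  have "AE z in \<mu>. poly q z = 0"
    using AE_circle_support[OF \<mu>] fin by (auto simp: q_def poly_prod elim!: eventually_mono)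
  then have "AE z in \<mu>. (cmod (poly r z))\<^sup>2 = Re (cnj (poly r z) * poly p z)"
  proof eventually_elim
    fix z assume "poly q z = 0"
    then show "(cmod (poly r z))\<^sup>2 = Re (cnj (poly r z) * poly p z)"
      unfolding cmod_power2 by (simp add: r_def power2_eq_square)
  qed
  then have "(\<integral>z. (cmod (poly r z))\<^sup>2 \<partial>\<mu>) = (\<integral>z. Re (cnj (poly r z) * poly p z) \<partial>\<mu>)"
    by (intro integral_cong_AE continuous_imp_borel_measurable[OF \<mu>] continuous_intros)
  also have "\<dots> = Re (L2_inner \<mu> (poly r) (poly p))"
    unfolding L2_inner_def by (intro integral_Re integrable_continuous_circle[OF \<mu>] continuous_intros)
  also have "\<dots> = 0" using orth_poly[OF \<mu> p(3) deg] by simp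
  finally have "(\<integral>z. (cmod (poly r z))\<^sup>2 \<partial>\<mu>) = 0" .
  moreover have "many_points \<mu> (degree r)" using deg fin by (auto simp: many_points_def)
  ultimately show False using poly_norm_pos[OF \<mu> \<open>r \<noteq> 0\<close>] by simp
qed

lemma monic_OP_eq:
  assumes "circle_prob \<mu>" "degree p = n" "lead_coeff p = 1" "orth \<mu> n p"
    and "infinite (circle_support \<mu>) \<or> n \<le> card (circle_support \<mu>)"
  shows "monic_OP \<mu> n = p"
proof (cases "many_points \<mu> n")
  case True
  then show ?thesis by (rule monic_OP_unique[OF assms(1-4)])
next
  case False
  then have "finite (circle_support \<mu>)" "n = card (circle_support \<mu>)"
    using assms(5) by (auto simp: many_points_def)
  then show ?thesis by (rule monic_OP_card[OF assms(1-4)])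
qed

lemma szego_step_inject:
  assumes "degree p = n" "lead_coeff p = 1" "szego_step a n p = szego_step b n p"
  shows "a = b"
proof -
  have "coeff (szego_step a n p) 0 = coeff (szego_step b n p) 0" by (simp only: assms(3))
  then show ?thesis using assms(1,2) by (simp add: szego_step_def coeff_szego_dual)
qed

lemma verblunsky_eq:
  assumes "degree (monic_OP \<mu> n) = n" "lead_coeff (monic_OP \<mu> n) = 1"
    and "monic_OP \<mu> (Suc n) = szego_step a n (monic_OP \<mu> n)"
  shows "verblunsky \<mu> n = a"
  unfolding verblunsky_def szego_step_altdef[symmetric]
proof (rule the_equality)
  fix b assume "monic_OP \<mu> (Suc n) = szego_step b n (monic_OP \<mu> n)"
  from szego_step_inject[OF assms(1,2) trans[OF sym[OF this] assms(3)]] show "b = a" .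
qed (fact assms(3))

lemma monic_OP_step:
  assumes \<mu>: "circle_prob \<mu>" and "many_points \<mu> n"
  shows "degree (monic_OP \<mu> n) = n" "lead_coeff (monic_OP \<mu> n) = 1" "orth \<mu> n (monic_OP \<mu> n)"
    "monic_OP \<mu> (Suc n) = szego_step (verblunsky \<mu> n) n (monic_OP \<mu> n)"
    "orth \<mu> (Suc n) (monic_OP \<mu> (Suc n))"
proof -
  obtain p where p: "degree p = n" "lead_coeff p = 1" "orth \<mu> n p"
    using orth_exists[OF assms] by blast
  have eq: "monic_OP \<mu> n = p" using monic_OP_unique[OF \<mu> p assms(2)] .
  obtain a where a: "orth \<mu> (Suc n) (szego_step a n p)"
    using orth_step_exists[OF \<mu> p assms(2)] by blast
  have eq': "monic_OP \<mu> (Suc n) = szego_step a n p"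
    using assms(2) by (intro monic_OP_eq[OF \<mu> szego_step_monic[OF p(1,2)] a]) (auto simp: many_points_def)
  show "degree (monic_OP \<mu> n) = n" "lead_coeff (monic_OP \<mu> n) = 1" "orth \<mu> n (monic_OP \<mu> n)"
    using eq p by auto
  show "monic_OP \<mu> (Suc n) = szego_step (verblunsky \<mu> n) n (monic_OP \<mu> n)"
    using verblunsky_eq[of \<mu> n a] eq eq' p by simp
  show "orth \<mu> (Suc n) (monic_OP \<mu> (Suc n))" using a eq' by simp
qed

lemma monic_OP_0:
  assumes "circle_prob \<mu>"
  shows "monic_OP \<mu> 0 = 1"
  by (rule monic_OP_eq[OF assms]) (auto simp: orth_def)

lemma monic_OP_eq_szego_poly:
  assumes "circle_prob \<mu>" "infinite (circle_support \<mu>) \<or> n \<le> card (circle_support \<mu>)"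
  shows "monic_OP \<mu> n = szego_poly (verblunsky \<mu>) n \<and> orth \<mu> n (szego_poly (verblunsky \<mu>) n)"
proof (cases n)
  case 0
  then show ?thesis using monic_OP_0[OF assms(1)] by (simp add: orth_def)
next
  case (Suc m)
  have "k \<le> m \<Longrightarrow> monic_OP \<mu> (Suc k) = szego_poly (verblunsky \<mu>) (Suc k)" for k
  proof (induction k)
    case 0
    then show ?case using monic_OP_step(4)[OF assms(1), of 0] monic_OP_0[OF assms(1)] assms(2) Suc
      by (auto simp: many_points_def)
  next
    case (Suc k)
    then show ?case using monic_OP_step(4)[OF assms(1), of "Suc k"] assms(2) \<open>n = Suc m\<close>
      by (auto simp: many_points_def)
  qed
  moreover have "orth \<mu> (Suc m) (monic_OP \<mu> (Suc m))"
    using monic_OP_step(5)[OF assms(1), of m] assms(2) Suc by (auto simp: many_points_def)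
  ultimately show ?thesis using Suc by simp
qed

text \<open>The squared norms of consecutive orthogonal polynomials have ratio
  \<open>1 - |\<alpha>\<^sub>n|\<^sup>2\<close>, and both are positive.\<close>

lemma verblunsky_less_1:
  assumes \<mu>: "circle_prob \<mu>" and "infinite (circle_support \<mu>)"
  shows "cmod (verblunsky \<mu> n) < 1"
proof -
  have m: "many_points \<mu> k" for k using assms by (simp add: many_points_def)
  note s = monic_OP_step[OF \<mu> m]
  have pos: "(\<integral>z. (cmod (poly (monic_OP \<mu> k) z))\<^sup>2 \<partial>\<mu>) > 0" for k
    using s(2)[of k] by (intro poly_norm_pos[OF \<mu> _ m]) auto
  have "(\<integral>z. (cmod (poly (monic_OP \<mu> (Suc n)) z))\<^sup>2 \<partial>\<mu>)
      = (1 - (cmod (verblunsky \<mu> n))\<^sup>2) * (\<integral>z. (cmod (poly (monic_OP \<mu> n) z))\<^sup>2 \<partial>\<mu>)"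
    unfolding s(4) using s(1,4,5)[of n] by (intro norm_szego_step[OF \<mu>]) auto
  then have "1 - (cmod (verblunsky \<mu> n))\<^sup>2 > 0" using pos[of n] pos[of "Suc n"]
    by (metis zero_less_mult_pos2)
  then have "(cmod (verblunsky \<mu> n))\<^sup>2 < 1\<^sup>2" by simp
  then show ?thesis by (rule power2_less_imp_less) simp
qed

section \<open>Weak limits of Bernstein--Szego measures\<close>

text \<open>On the circle, the functions \<open>cnj z ^ k * poly p z\<close> are the trigonometric polynomials.\<close>

lemma real_polynomial_function_trig:
  fixes g :: "complex \<Rightarrow> real"
  assumes "real_polynomial_function g"
  shows "\<exists>k p. \<forall>z\<in>sphere 0 1. complex_of_real (g z) = cnj z ^ k * poly p z"
  using assms
proof induction
  case (linear f)
  interpret bounded_linear f by fact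
  let ?p = "[:of_real (f 1) / 2 - of_real (f \<i>) / (2 * \<i>), 0, of_real (f 1) / 2 + of_real (f \<i>) / (2 * \<i>):]"
  have "complex_of_real (f z) = cnj z ^ 1 * poly ?p z" if z: "z \<in> sphere 0 1" for z
  proof -
    have "Re z *\<^sub>R 1 + Im z *\<^sub>R \<i> = z" by (simp add: complex_eq_iff)
    then have "f z = f (Re z *\<^sub>R 1 + Im z *\<^sub>R \<i>)" by simp
    also have "\<dots> = Re z * f 1 + Im z * f \<i>" by (simp only: add scaleR real_scaleR_def)
    finally have "f z = Re z * f 1 + Im z * f \<i>" .
    moreover have "cnj z * z\<^sup>2 = z" using circle_cnj[OF z] by (simp add: power2_eq_square mult.assoc[symmetric])
    moreover have "complex_of_real (Re z) = (z + cnj z) / 2" "complex_of_real (Im z) = (z - cnj z) / (2 * \<i>)"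
      by (simp_all add: complex_add_cnj complex_diff_cnj mult_ac)
    moreover have "cnj z ^ 1 * poly ?p z = (z + cnj z) / 2 * of_real (f 1) + (z - cnj z) / (2 * \<i>) * of_real (f \<i>)"
      if "cnj z * z\<^sup>2 = z"
    proof -
      have "cnj z ^ 1 * poly ?p z = cnj z * (of_real (f 1) / 2 - of_real (f \<i>) / (2 * \<i>))
          + (cnj z * z\<^sup>2) * (of_real (f 1) / 2 + of_real (f \<i>) / (2 * \<i>))"
        by (simp add: algebra_simps power2_eq_square)
      also have "\<dots> = (z + cnj z) / 2 * of_real (f 1) + (z - cnj z) / (2 * \<i>) * of_real (f \<i>)"
        unfolding that by (simp add: field_simps)
      finally show ?thesis .
    qed
    ultimately show ?thesis by simp
  qed
  then show ?case by blast
next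
  case (const c)
  have "complex_of_real c = cnj z ^ 0 * poly [:of_real c:] z" for z by simp
  then show ?case by blast
next
  case (add f g)
  then obtain k p m q where f: "\<And>z. z \<in> sphere 0 1 \<Longrightarrow> complex_of_real (f z) = cnj z ^ k * poly p z"
    and g: "\<And>z. z \<in> sphere 0 1 \<Longrightarrow> complex_of_real (g z) = cnj z ^ m * poly q z" by metis
  have "complex_of_real (f z + g z) = cnj z ^ (k + m) * poly (monom 1 m * p + monom 1 k * q) z"
    if z: "z \<in> sphere 0 1" for z
  proof -
    have c: "cnj z ^ n * (z ^ n * w) = w" for n w
      using circle_cnj[OF z] by (simp add: mult.assoc[symmetric] flip: power_mult_distrib)
    have "cnj z ^ (k + m) * poly (monom 1 m * p + monom 1 k * q) z
        = cnj z ^ k * (cnj z ^ m * (z ^ m * poly p z)) + cnj z ^ m * (cnj z ^ k * (z ^ k * poly q z))"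
      by (simp add: poly_monom power_add algebra_simps)
    then show ?thesis unfolding c using f[OF z] g[OF z] by simp
  qed
  then show ?case by blast
next
  case (mult f g)
  then obtain k p m q where f: "\<And>z. z \<in> sphere 0 1 \<Longrightarrow> complex_of_real (f z) = cnj z ^ k * poly p z"
    and g: "\<And>z. z \<in> sphere 0 1 \<Longrightarrow> complex_of_real (g z) = cnj z ^ m * poly q z" by metis
  have "complex_of_real (f z * g z) = cnj z ^ (k + m) * poly (p * q) z" if z: "z \<in> sphere 0 1" for z
    using f[OF z] g[OF z] by (simp add: power_add)
  then show ?case by blast
qed

lemma trig_moment:
  assumes "circle_prob \<mu>"
  shows "(\<integral>z. cnj z ^ k * z ^ i \<partial>\<mu>) = (if k \<le> i then (\<integral>z. z ^ (i - k) \<partial>\<mu>) else cnj (\<integral>z. z ^ (k - i) \<partial>\<mu>))"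
proof (cases "k \<le> i")
  case True
  have "(\<integral>z. cnj z ^ k * z ^ i \<partial>\<mu>) = (\<integral>z. z ^ (i - k) \<partial>\<mu>)"
    using circle_power_cnj[OF _ True] by (intro integral_circle_cong[OF assms]) simp
  then show ?thesis using True by simp
next
  case False
  have "(\<integral>z. cnj z ^ k * z ^ i \<partial>\<mu>) = (\<integral>z. cnj (z ^ (k - i)) \<partial>\<mu>)"
  proof (rule integral_circle_cong[OF assms])
    fix z :: complex assume "z \<in> sphere 0 1"
    then have "cnj (cnj (z ^ i) * z ^ k) = cnj (z ^ (k - i))"
      using circle_power_cnj[of z i k] False by simp
    then show "cnj z ^ k * z ^ i = cnj (z ^ (k - i))" by (simp add: mult.commute)
  qed
  then show ?thesis using False by (simp only: Bochner_Integration.integral_cnj if_False)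
qed

text \<open>Moments control trigonometric polynomials, and these approximate \<open>f\<close>
  uniformly, hence with the same error for all probability measures. Two families and an arbitrary
  filter are allowed so that the lemma covers both the Cauchy criterion, on pairs of indices, and
  the comparison with a fixed measure.\<close>

lemma weak_limit_diff:
  assumes P: "\<And>i. circle_prob (P i)" and Q: "\<And>i. circle_prob (Q i)"
    and mom: "\<And>l::nat. ((\<lambda>i. (\<integral>z. z ^ l \<partial>P i) - (\<integral>z. z ^ l \<partial>Q i)) \<longlongrightarrow> 0) F"
    and f: "continuous_on (sphere 0 1) (f :: complex \<Rightarrow> real)"
  shows "((\<lambda>i. (\<integral>z. f z \<partial>P i) - (\<integral>z. f z \<partial>Q i)) \<longlongrightarrow> 0) F"
proof -
  have mon: "((\<lambda>i. (\<integral>z. cnj z ^ k * z ^ j \<partial>P i) - (\<integral>z. cnj z ^ k * z ^ j \<partial>Q i)) \<longlongrightarrow> 0) F" for k j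
  proof (cases "k \<le> j")
    case True
    then show ?thesis using mom[of "j - k"] by (simp add: trig_moment[OF P] trig_moment[OF Q])
  next
    case False
    then show ?thesis using tendsto_cnj[OF mom[of "k - j"]] by (simp add: trig_moment[OF P] trig_moment[OF Q])
  qed
  have trig: "((\<lambda>i. (\<integral>z. g z \<partial>P i) - (\<integral>z. g z \<partial>Q i)) \<longlongrightarrow> 0) F"
    if g: "real_polynomial_function g" for g :: "complex \<Rightarrow> real"
  proof -
    obtain k p where kp: "\<And>z. z \<in> sphere 0 1 \<Longrightarrow> complex_of_real (g z) = cnj z ^ k * poly p z"
      using real_polynomial_function_trig[OF g] by metis
    have eq: "complex_of_real (\<integral>z. g z \<partial>\<mu>) = (\<Sum>j\<le>degree p. coeff p j * (\<integral>z. cnj z ^ k * z ^ j \<partial>\<mu>))"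
      if \<mu>: "circle_prob \<mu>" for \<mu>
    proof -
      have "complex_of_real (\<integral>z. g z \<partial>\<mu>) = (\<integral>z. complex_of_real (g z) \<partial>\<mu>)"
        by (rule integral_complex_of_real[symmetric])
      also have "\<dots> = (\<integral>z. (\<Sum>j\<le>degree p. coeff p j * (cnj z ^ k * z ^ j)) \<partial>\<mu>)"
        using kp by (intro integral_circle_cong[OF \<mu>]) (simp add: poly_altdef sum_distrib_left mult_ac)
      also have "\<dots> = (\<Sum>j\<le>degree p. \<integral>z. coeff p j * (cnj z ^ k * z ^ j) \<partial>\<mu>)"
        by (intro Bochner_Integration.integral_sum integrable_continuous_circle[OF \<mu>] continuous_intros)
      finally show ?thesis by simp
    qed
    have "((\<lambda>i. \<Sum>j\<le>degree p. coeff p j * ((\<integral>z. cnj z ^ k * z ^ j \<partial>P i) - (\<integral>z. cnj z ^ k * z ^ j \<partial>Q i))) \<longlongrightarrow> (\<Sum>j\<le>degree p. coeff p j * 0)) F"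
      by (intro tendsto_sum tendsto_mult tendsto_const mon)
    then have "((\<lambda>i. complex_of_real ((\<integral>z. g z \<partial>P i) - (\<integral>z. g z \<partial>Q i))) \<longlongrightarrow> of_real 0) F"
      by (simp add: eq[OF P] eq[OF Q] right_diff_distrib sum_subtractf)
    then show ?thesis by (simp only: tendsto_of_real_iff)
  qed
  show ?thesis
  proof (rule tendstoI)
    fix e :: real assume "e > 0"
    obtain g where g: "real_polynomial_function g" "\<And>x. x \<in> sphere 0 1 \<Longrightarrow> \<bar>f x - g x\<bar> < e / 4"
      using Stone_Weierstrass_real_polynomial_function[of "sphere 0 1" f "e / 4"] f \<open>e > 0\<close> by auto
    have cg: "continuous_on (sphere 0 1) g"
      using g(1) continuous_on_polymonial_function real_polynomial_function_eq by blast
    have close: "\<bar>(\<integral>z. f z \<partial>\<mu>) - (\<integral>z. g z \<partial>\<mu>)\<bar> \<le> e / 4" if \<mu>: "circle_prob \<mu>" for \<mu>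
    proof -
      have fg: "f z \<le> g z + e / 4" "g z \<le> f z + e / 4" if "z \<in> sphere 0 1" for z
        using g(2)[OF that] by linarith+
      have "(\<integral>z. f z \<partial>\<mu>) \<le> (\<integral>z. g z + e / 4 \<partial>\<mu>)"
        by (intro integral_circle_mono[OF \<mu>] continuous_intros f cg fg)
      moreover have "(\<integral>z. g z \<partial>\<mu>) \<le> (\<integral>z. f z + e / 4 \<partial>\<mu>)"
        by (intro integral_circle_mono[OF \<mu>] continuous_intros f cg fg)
      moreover have "(\<integral>z. g z + e / 4 \<partial>\<mu>) = (\<integral>z. g z \<partial>\<mu>) + (\<integral>z. e / 4 \<partial>\<mu>)"
        "(\<integral>z. f z + e / 4 \<partial>\<mu>) = (\<integral>z. f z \<partial>\<mu>) + (\<integral>z. e / 4 \<partial>\<mu>)"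
        by (intro Bochner_Integration.integral_add integrable_continuous_circle[OF \<mu>] f cg continuous_intros)+
      moreover have "(\<integral>z. e / 4 \<partial>\<mu>) = e / 4" by (rule integral_circle_const[OF \<mu>])
      ultimately show ?thesis by linarith
    qed
    have "eventually (\<lambda>i. dist ((\<integral>z. g z \<partial>P i) - (\<integral>z. g z \<partial>Q i)) 0 < e / 4) F"
      using trig[OF g(1)] \<open>e > 0\<close> by (intro tendstoD) auto
    then show "eventually (\<lambda>i. dist ((\<integral>z. f z \<partial>P i) - (\<integral>z. f z \<partial>Q i)) 0 < e) F"
    proof eventually_elim
      case (elim i)
      then show ?case using close[OF P[of i]] close[OF Q[of i]] \<open>e > 0\<close>
        unfolding dist_real_def by linarith
    qed
  qed
qed

text \<open>Integration against the measure with coefficients \<alpha>, once such a measure is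
  given, see \<open>bs_lim_eq_integral\<close>.\<close>

definition bs_lim :: "(nat \<Rightarrow> complex) \<Rightarrow> (complex \<Rightarrow> real) \<Rightarrow> real" where
  "bs_lim \<alpha> f = lim (\<lambda>n. \<integral>z. f z \<partial>bs_measure \<alpha> n)"

text \<open>Each moment of the Bernstein--Szego measures is constant from some index on, which
  yields the Cauchy criterion for all continuous functions.\<close>

lemma bs_lim_tendsto:
  assumes \<alpha>: "\<And>j. cmod (\<alpha> j) < 1" and f: "continuous_on (sphere 0 1) f"
  shows "(\<lambda>n. \<integral>z. f z \<partial>bs_measure \<alpha> n) \<longlonglongrightarrow> bs_lim \<alpha> f"
proof -
  have "((\<lambda>i. (\<integral>z. f z \<partial>bs_measure \<alpha> (fst i)) - (\<integral>z. f z \<partial>bs_measure \<alpha> (snd i))) \<longlongrightarrow> 0) (sequentially \<times>\<^sub>F sequentially)"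
  proof (rule weak_limit_diff[OF _ _ _ f])
    fix l :: nat
    have "eventually (\<lambda>i. (\<integral>z. z ^ l \<partial>bs_measure \<alpha> (fst i)) - (\<integral>z. z ^ l \<partial>bs_measure \<alpha> (snd i)) = 0) (sequentially \<times>\<^sub>F sequentially)"
      unfolding eventually_prod_sequentially
    proof (intro exI[of _ l] allI impI)
      fix m n assume "l \<le> m" "l \<le> n"
      from moments_bs[OF \<alpha> this]
      show "(\<integral>z. z ^ l \<partial>bs_measure \<alpha> (fst (m, n))) - (\<integral>z. z ^ l \<partial>bs_measure \<alpha> (snd (m, n))) = 0"
        by simp
    qed
    then show "((\<lambda>i. (\<integral>z. z ^ l \<partial>bs_measure \<alpha> (fst i)) - (\<integral>z. z ^ l \<partial>bs_measure \<alpha> (snd i))) \<longlongrightarrow> 0) (sequentially \<times>\<^sub>F sequentially)"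
      by (rule tendsto_eventually)
  qed (intro circle_prob_bs \<alpha>)+
  then have "Cauchy (\<lambda>n. \<integral>z. f z \<partial>bs_measure \<alpha> n)"
    unfolding tendsto_iff eventually_prod_sequentially Cauchy_def
    by (simp add: dist_real_def) (metis abs_minus_commute)
  then have "convergent (\<lambda>n. \<integral>z. f z \<partial>bs_measure \<alpha> n)" by (rule Cauchy_convergent)
  then show ?thesis unfolding bs_lim_def by (simp add: convergent_LIMSEQ_iff)
qed

lemma bs_lim_eq_integral:
  assumes \<alpha>: "\<And>j. cmod (\<alpha> j) < 1" and f: "continuous_on (sphere 0 1) f"
    and \<mu>: "circle_prob \<mu>" "\<And>j. orth \<mu> j (szego_poly \<alpha> j)"
  shows "bs_lim \<alpha> f = (\<integral>z. f z \<partial>\<mu>)"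
proof -
  have "(\<lambda>n. (\<integral>z. f z \<partial>bs_measure \<alpha> n) - (\<integral>z. f z \<partial>\<mu>)) \<longlonglongrightarrow> 0"
  proof (rule weak_limit_diff[OF _ _ _ f])
    fix l :: nat
    have "eventually (\<lambda>i. (\<integral>z. z ^ l \<partial>bs_measure \<alpha> i) - (\<integral>z. z ^ l \<partial>\<mu>) = 0) sequentially"
      using moments_eq_bs[OF \<mu>(1) \<mu>(2) \<alpha>, of l] by (intro eventually_sequentiallyI[of l]) auto
    then show "(\<lambda>i. (\<integral>z. z ^ l \<partial>bs_measure \<alpha> i) - (\<integral>z. z ^ l \<partial>\<mu>)) \<longlonglongrightarrow> 0"
      by (rule tendsto_eventually)
  qed (intro circle_prob_bs \<alpha> \<mu>)+
  then have "(\<lambda>n. \<integral>z. f z \<partial>bs_measure \<alpha> n) \<longlonglongrightarrow> (\<integral>z. f z \<partial>\<mu>)" by (rule LIM_zero_cancel)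
  then show ?thesis by (rule LIMSEQ_unique[OF bs_lim_tendsto[OF \<alpha> f]])
qed

abbreviation ccont :: "(complex \<Rightarrow> real) \<Rightarrow> bool" where
  "ccont f \<equiv> continuous_on (sphere 0 1) f"

lemma bs_lim_affine:
  assumes \<alpha>: "\<And>j. cmod (\<alpha> j) < 1" and f: "ccont f" and g: "ccont g"
  shows "bs_lim \<alpha> (\<lambda>z. a * f z + b * g z) = a * bs_lim \<alpha> f + b * bs_lim \<alpha> g"
proof -
  have "(\<lambda>n. a * (\<integral>z. f z \<partial>bs_measure \<alpha> n) + b * (\<integral>z. g z \<partial>bs_measure \<alpha> n)) \<longlonglongrightarrow> a * bs_lim \<alpha> f + b * bs_lim \<alpha> g"
    by (intro tendsto_intros bs_lim_tendsto \<alpha> f g)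
  moreover have "a * (\<integral>z. f z \<partial>bs_measure \<alpha> n) + b * (\<integral>z. g z \<partial>bs_measure \<alpha> n) = (\<integral>z. a * f z + b * g z \<partial>bs_measure \<alpha> n)" for n
    using integrable_continuous_circle[OF circle_prob_bs[OF \<alpha>] f] integrable_continuous_circle[OF circle_prob_bs[OF \<alpha>] g]
    by simp
  ultimately have "(\<lambda>n. \<integral>z. a * f z + b * g z \<partial>bs_measure \<alpha> n) \<longlonglongrightarrow> a * bs_lim \<alpha> f + b * bs_lim \<alpha> g" by simp
  moreover have "(\<lambda>n. \<integral>z. a * f z + b * g z \<partial>bs_measure \<alpha> n) \<longlonglongrightarrow> bs_lim \<alpha> (\<lambda>z. a * f z + b * g z)"
    by (intro bs_lim_tendsto \<alpha> continuous_intros f g)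
  ultimately show ?thesis using LIMSEQ_unique by blast
qed

lemma bs_lim_mono:
  assumes \<alpha>: "\<And>j. cmod (\<alpha> j) < 1" and f: "ccont f" and g: "ccont g" and "\<And>z. z \<in> sphere 0 1 \<Longrightarrow> f z \<le> g z"
  shows "bs_lim \<alpha> f \<le> bs_lim \<alpha> g"
  using assms(4)
  by (intro LIMSEQ_le[OF bs_lim_tendsto[OF \<alpha> f] bs_lim_tendsto[OF \<alpha> g]] exI[of _ 0] allI impI
     integral_circle_mono circle_prob_bs \<alpha> f g)

lemma bs_lim_1:
  assumes \<alpha>: "\<And>j. cmod (\<alpha> j) < 1"
  shows "bs_lim \<alpha> (\<lambda>z. 1) = 1"
proof -
  have "(\<integral>z. (1::real) \<partial>bs_measure \<alpha> n) = 1" for n by (rule integral_circle_const[OF circle_prob_bs[OF \<alpha>]])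
  then show ?thesis unfolding bs_lim_def by simp
qed

text \<open>The relative entropy of \<open>f d\<theta>/2\<pi>\<close> in its dual form; \<open>\<Lambda>\<close> stands for integration against the
  reference measure, which need not be constructed.\<close>

definition ent :: "(complex \<Rightarrow> real) \<Rightarrow> ((complex \<Rightarrow> real) \<Rightarrow> real) \<Rightarrow> ereal" where
  "ent f \<Lambda> = (SUP G\<in>{G. ccont G}. ereal ((\<integral>z. f z * G z \<partial>arc_measure) - \<Lambda> (\<lambda>z. exp (G z)) + 1))"

lemma entropy_dual_density:
  assumes "ccont f" "\<And>z. z \<in> sphere 0 1 \<Longrightarrow> f z \<ge> 0"
  shows "entropy_dual (density arc_measure (\<lambda>z. ennreal (f z))) \<Lambda> = ent f \<Lambda>"
proof -
  have "(\<integral>z. G z \<partial>density arc_measure (\<lambda>z. ennreal (f z))) = (\<integral>z. f z * G z \<partial>arc_measure)" if "ccont G" for G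
    using integral_density_circle[OF circle_prob_arc assms that] by simp
  then show ?thesis unfolding entropy_dual_def ent_def by (intro SUP_cong) auto
qed

lemma ent_upper:
  "ccont G \<Longrightarrow> ereal ((\<integral>z. f z * G z \<partial>arc_measure) - \<Lambda> (\<lambda>z. exp (G z)) + 1) \<le> ent f \<Lambda>"
  unfolding ent_def by (intro SUP_upper) auto

lemma ent_least:
  "(\<And>G. ccont G \<Longrightarrow> ereal ((\<integral>z. f z * G z \<partial>arc_measure) - \<Lambda> (\<lambda>z. exp (G z)) + 1) \<le> c) \<Longrightarrow> ent f \<Lambda> \<le> c"
  unfolding ent_def by (intro SUP_least) auto

lemma integrable_arc_mult: "ccont f \<Longrightarrow> ccont g \<Longrightarrow> integrable arc_measure (\<lambda>z. f z * g z)"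
  by (intro integrable_continuous_circle[OF circle_prob_arc] continuous_intros)

text \<open>\<open>\<Lambda>'\<close> has the reference measure of \<open>\<Lambda>\<close>
  multiplied by \<open>exp g\<close>. The test function \<open>G\<close> for
  \<open>\<Lambda>'\<close> corresponds to \<open>g + G\<close> for \<open>\<Lambda>\<close>, which
  gains \<open>\<integral> f g\<close>.\<close>

lemma ent_shift_le:
  assumes f: "ccont f" and g: "ccont g" and \<Lambda>: "\<And>u. ccont u \<Longrightarrow> \<Lambda>' u = \<Lambda> (\<lambda>z. exp (g z) * u z)"
  shows "ent f \<Lambda>' + ereal (\<integral>z. f z * g z \<partial>arc_measure) \<le> ent f \<Lambda>"
proof -
  have "ent f \<Lambda>' \<le> ent f \<Lambda> - ereal (\<integral>z. f z * g z \<partial>arc_measure)"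
  proof (rule ent_least)
    fix G :: "complex \<Rightarrow> real" assume G: "ccont G"
    have "\<Lambda>' (\<lambda>z. exp (G z)) = \<Lambda> (\<lambda>z. exp (g z) * exp (G z))"
      by (intro \<Lambda> continuous_intros G)
    then have "\<Lambda>' (\<lambda>z. exp (G z)) = \<Lambda> (\<lambda>z. exp (g z + G z))" by (simp add: exp_add)
    moreover have "(\<integral>z. f z * (g z + G z) \<partial>arc_measure) = (\<integral>z. f z * g z \<partial>arc_measure) + (\<integral>z. f z * G z \<partial>arc_measure)"
      using integrable_arc_mult[OF f g] integrable_arc_mult[OF f G] by (simp add: distrib_left)
    ultimately have "ereal ((\<integral>z. f z * G z \<partial>arc_measure) - \<Lambda>' (\<lambda>z. exp (G z)) + 1)
      = ereal ((\<integral>z. f z * (g z + G z) \<partial>arc_measure) - \<Lambda> (\<lambda>z. exp (g z + G z)) + 1) - ereal (\<integral>z. f z * g z \<partial>arc_measure)"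
      by simp
    also have "\<dots> \<le> ent f \<Lambda> - ereal (\<integral>z. f z * g z \<partial>arc_measure)"
      by (intro ereal_minus_mono ent_upper continuous_intros g G order_refl)
    finally show "ereal ((\<integral>z. f z * G z \<partial>arc_measure) - \<Lambda>' (\<lambda>z. exp (G z)) + 1) \<le> ent f \<Lambda> - ereal (\<integral>z. f z * g z \<partial>arc_measure)" .
  qed
  then show ?thesis by (simp add: ereal_le_minus)
qed

text \<open>\<open>- g\<close> undoes the change of reference, so the inequality holds in both
  directions.\<close>

lemma ent_shift:
  assumes f: "ccont f" and g: "ccont g" and \<Lambda>: "\<And>u. ccont u \<Longrightarrow> \<Lambda>' u = \<Lambda> (\<lambda>z. exp (g z) * u z)"
  shows "ent f \<Lambda>' + ereal (\<integral>z. f z * g z \<partial>arc_measure) = ent f \<Lambda>"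
proof (rule antisym)
  show "ent f \<Lambda>' + ereal (\<integral>z. f z * g z \<partial>arc_measure) \<le> ent f \<Lambda>"
    by (rule ent_shift_le[OF f g]) (rule \<Lambda>)
  have "ent f \<Lambda> + ereal (\<integral>z. f z * (- g z) \<partial>arc_measure) \<le> ent f \<Lambda>'"
  proof (rule ent_shift_le[OF f])
    show "ccont (\<lambda>z. - g z)" by (intro continuous_intros g)
    fix u :: "complex \<Rightarrow> real" assume "ccont u"
    then have "\<Lambda>' (\<lambda>z. exp (- g z) * u z) = \<Lambda> (\<lambda>z. exp (g z) * (exp (- g z) * u z))"
      by (intro \<Lambda> continuous_intros g)
    also have "(\<lambda>z. exp (g z) * (exp (- g z) * u z)) = u" by (auto simp: exp_minus)
    finally show "\<Lambda> u = \<Lambda>' (\<lambda>z. exp (- g z) * u z)" by simp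
  qed
  then show "ent f \<Lambda> \<le> ent f \<Lambda>' + ereal (\<integral>z. f z * g z \<partial>arc_measure)"
    by (cases "ent f \<Lambda>"; cases "ent f \<Lambda>'") auto
qed

text \<open>A single test function that witnesses \<open>c < ent f \<Lambda>\<close> still does so
  for \<open>L n\<close> once \<open>L n (exp G)\<close> is close to its limit.\<close>

lemma ent_lsc:
  assumes "\<And>G. ccont G \<Longrightarrow> ((\<lambda>n. L n G) \<longlongrightarrow> \<Lambda> G) F" "c < ent f \<Lambda>"
  shows "eventually (\<lambda>n. c < ent f (L n)) F"
proof -
  obtain G where G: "ccont G" "c < ereal ((\<integral>z. f z * G z \<partial>arc_measure) - \<Lambda> (\<lambda>z. exp (G z)) + 1)"
    using assms(2) unfolding ent_def less_SUP_iff by auto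
  have "((\<lambda>n. ereal ((\<integral>z. f z * G z \<partial>arc_measure) - L n (\<lambda>z. exp (G z)) + 1)) \<longlongrightarrow>
     ereal ((\<integral>z. f z * G z \<partial>arc_measure) - \<Lambda> (\<lambda>z. exp (G z)) + 1)) F"
    by (intro tendsto_intros assms(1) continuous_intros G)
  then have "eventually (\<lambda>n. c < ereal ((\<integral>z. f z * G z \<partial>arc_measure) - L n (\<lambda>z. exp (G z)) + 1)) F"
    using G(2) by (rule order_tendstoD)
  then show ?thesis by eventually_elim (use ent_upper[OF G(1)] less_le_trans in blast)
qed

lemma ent_nonneg: "\<Lambda> (\<lambda>z. 1) = 1 \<Longrightarrow> 0 \<le> ent f \<Lambda>"
  using ent_upper[of "\<lambda>z. 0" f \<Lambda>] by (simp add: zero_ereal_def)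

text \<open>Young's inequality bounds the entropy by \<open>\<integral> f ln f\<close>, and
  \<open>ln f \<le> ln K\<close> where \<open>f\<close> is positive.\<close>

lemma ent_arc_le:
  assumes f: "ccont f" "\<And>z. z \<in> sphere 0 1 \<Longrightarrow> 0 \<le> f z \<and> f z \<le> K" "(\<integral>z. f z \<partial>arc_measure) = 1"
  shows "ent f (\<lambda>u. \<integral>z. u z \<partial>arc_measure) \<le> ereal (ln K)"
proof (rule ent_least)
  fix G :: "complex \<Rightarrow> real" assume G: "ccont G"
  have "(\<integral>z. f z * G z - exp (G z) \<partial>arc_measure) \<le> (\<integral>z. f z * ln K - f z \<partial>arc_measure)"
  proof (intro integral_circle_mono[OF circle_prob_arc] continuous_intros f(1) G)
    fix z :: complex assume z: "z \<in> sphere 0 1"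
    have "f z * G z - exp (G z) \<le> f z * ln (f z) - f z" using f(2)[OF z] by (intro young_exp) simp
    also have "f z * ln (f z) \<le> f z * ln K"
      using f(2)[OF z] by (cases "f z = 0") (auto intro!: mult_left_mono)
    finally show "f z * G z - exp (G z) \<le> f z * ln K - f z" by simp
  qed
  moreover have "integrable arc_measure (\<lambda>z. exp (G z))" "integrable arc_measure f"
    by (intro integrable_continuous_circle[OF circle_prob_arc] continuous_intros G f)+
  ultimately show "ereal ((\<integral>z. f z * G z \<partial>arc_measure) - (\<integral>z. exp (G z) \<partial>arc_measure) + 1) \<le> ereal (ln K)"
    using integrable_arc_mult[OF f(1) G] f(3) by simp
qed

text \<open>Writing \<open>h = t f + (1 - t) f'\<close>, the test function \<open>ln (t e\<^sup>G + 1 - t)\<close> for \<open>h\<close>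
  controls the test function \<open>G\<close> for \<open>f\<close>.\<close>

lemma ent_dominated:
  assumes f: "ccont f" "\<And>z. z \<in> sphere 0 1 \<Longrightarrow> 0 \<le> f z \<and> f z \<le> c * h z" "(\<integral>z. f z \<partial>arc_measure) = 1"
    and h: "ccont h" "(\<integral>z. h z \<partial>arc_measure) = 1" and "c \<ge> 1"
    and \<Lambda>: "\<And>u a b. ccont u \<Longrightarrow> \<Lambda> (\<lambda>z. a * u z + b) = a * \<Lambda> u + b"
    and fin: "ent h \<Lambda> < \<infinity>"
  shows "ent f \<Lambda> < \<infinity>"
proof -
  have "0 \<le> ent h \<Lambda>" using \<Lambda>[of "\<lambda>_. 0" 0 1] by (intro ent_nonneg) simp
  then obtain b where b: "ent h \<Lambda> = ereal b" using fin by (cases "ent h \<Lambda>") auto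
  \<comment> \<open>Half of \<open>1/c\<close>, so that \<open>t < 1\<close> and
    \<open>ln (1 - t)\<close> is finite also for \<open>c = 1\<close>.\<close>
  define t where "t = 1 / (2 * c)"
  have t: "0 < t" "t < 1" using \<open>c \<ge> 1\<close> by (auto simp: t_def field_simps)
  have tf: "0 \<le> t * f z" "t * f z \<le> h z" if "z \<in> sphere 0 1" for z
  proof -
    show "0 \<le> t * f z" using t f(2)[OF that] by simp
    have "0 \<le> c * h z" using f(2)[OF that] by linarith
    then have "h z \<ge> 0" using \<open>c \<ge> 1\<close> by (simp add: zero_le_mult_iff)
    have "t * f z \<le> t * (c * h z)" using t f(2)[OF that] by (intro mult_left_mono) auto
    also have "\<dots> = h z / 2" using \<open>c \<ge> 1\<close> by (simp add: t_def)
    finally show "t * f z \<le> h z" using \<open>h z \<ge> 0\<close> by simp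
  qed
  have "ent f \<Lambda> \<le> ereal ((b - t * ln t - (1 - t) * ln (1 - t)) / t)"
  proof (rule ent_least)
    fix G :: "complex \<Rightarrow> real" assume G: "ccont G"
    define H where "H z = ln (t * exp (G z) + (1 - t))" for z
    have pos: "t * exp (G z) + (1 - t) > 0" for z using t by (intro add_pos_pos mult_pos_pos) auto
    have H: "ccont H" unfolding H_def using pos by (intro continuous_intros G) (metis less_irrefl)
    have "ereal ((\<integral>z. h z * H z \<partial>arc_measure) - \<Lambda> (\<lambda>z. exp (H z)) + 1) \<le> ereal b"
      using ent_upper[OF H, of h \<Lambda>] b by simp
    moreover have "\<Lambda> (\<lambda>z. exp (H z)) = t * \<Lambda> (\<lambda>z. exp (G z)) + (1 - t)"
      unfolding H_def using pos by (simp add: \<Lambda> continuous_on_exp[OF G])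
    moreover have "(\<integral>z. t * (f z * G z) + (ln t - ln (1 - t)) * (t * f z) + ln (1 - t) * h z \<partial>arc_measure) \<le> (\<integral>z. h z * H z \<partial>arc_measure)"
    proof (intro integral_circle_mono[OF circle_prob_arc] continuous_intros f(1) G h(1) H)
      fix z :: complex assume z: "z \<in> sphere 0 1"
      have "ln (t * exp (G z)) \<le> H z" unfolding H_def using t pos[of z] by (subst ln_le_cancel_iff) auto
      then have 1: "G z + ln t \<le> H z" using t by (simp add: ln_mult)
      have 2: "ln (1 - t) \<le> H z" unfolding H_def using t pos[of z] by (subst ln_le_cancel_iff) auto
      \<comment> \<open>\<open>h\<close> splits into the nonnegative parts \<open>t f\<close> and
        \<open>h - t f\<close>; \<open>H\<close> is bounded below by \<open>G + ln t\<close> on the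
        first and by \<open>ln (1 - t)\<close> on the second.\<close>
      have "(t * f z) * (G z + ln t) + (h z - t * f z) * ln (1 - t) \<le> (t * f z) * H z + (h z - t * f z) * H z"
        using tf[OF z] 1 2 by (intro add_mono mult_left_mono) auto
      then show "t * (f z * G z) + (ln t - ln (1 - t)) * (t * f z) + ln (1 - t) * h z \<le> h z * H z"
        by (simp add: algebra_simps)
    qed
    moreover have "(\<integral>z. t * (f z * G z) + (ln t - ln (1 - t)) * (t * f z) + ln (1 - t) * h z \<partial>arc_measure)
      = t * (\<integral>z. f z * G z \<partial>arc_measure) + (ln t - ln (1 - t)) * t + ln (1 - t)"
      using integrable_arc_mult[OF f(1) G] integrable_continuous_circle[OF circle_prob_arc f(1)]
        integrable_continuous_circle[OF circle_prob_arc h(1)] f(3) h(2) by simp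
    ultimately have "t * ((\<integral>z. f z * G z \<partial>arc_measure) - \<Lambda> (\<lambda>z. exp (G z)) + 1) \<le> b - t * ln t - (1 - t) * ln (1 - t)"
      by (simp add: algebra_simps)
    then show "ereal ((\<integral>z. f z * G z \<partial>arc_measure) - \<Lambda> (\<lambda>z. exp (G z)) + 1) \<le> ereal ((b - t * ln t - (1 - t) * ln (1 - t)) / t)"
      using t by (simp add: pos_le_divide_eq mult.commute)
  qed
  then show ?thesis using le_less_trans by fastforce
qed

text \<open>The function \<open>min (k h) 1\<close>, divided by its mean \<open>Z\<close>, is at
  most \<open>(k / Z) h\<close> and at most \<open>1 / Z\<close>. As \<open>h\<close> is almost
  nowhere 0, \<open>Z\<close> tends to 1 with growing \<open>k\<close>, so the entropy bound
  \<open>ln (1 / Z)\<close> becomes small.\<close>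

lemma approx_uniform:
  assumes h: "ccont h" "\<And>z. z \<in> sphere 0 1 \<Longrightarrow> 0 \<le> h z" "AE z in arc_measure. h z \<noteq> 0" and "d > 0"
  obtains f c where "ccont f" "c \<ge> 1" "\<forall>z\<in>sphere 0 1. 0 \<le> f z \<and> f z \<le> c * h z"
    "(\<integral>z. f z \<partial>arc_measure) = 1" "ent f (\<lambda>u. \<integral>z. u z \<partial>arc_measure) \<le> ereal d"
    "(\<integral>z. \<bar>f z - 1\<bar> \<partial>arc_measure) \<le> d"
proof -
  define g where "g k z = min (real k * h z) 1" for k z
  have g: "ccont (g k)" for k unfolding g_def by (intro continuous_intros h)
  have g01: "0 \<le> g k z" "g k z \<le> 1" if "z \<in> sphere 0 1" for k z
    using h(2)[OF that] by (auto simp: g_def)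
  have sp: "space arc_measure = sphere 0 1" by (rule circle_probD[OF circle_prob_arc])
  have "(\<lambda>k. \<integral>z. g k z \<partial>arc_measure) \<longlonglongrightarrow> (\<integral>z. 1 \<partial>arc_measure)"
  proof (rule integral_dominated_convergence[where w = "\<lambda>_. 1"])
    show "integrable arc_measure (\<lambda>_. 1 :: real)"
      by (intro integrable_continuous_circle[OF circle_prob_arc] continuous_intros)
    show "AE z in arc_measure. (\<lambda>k. g k z) \<longlonglongrightarrow> 1"
      using h(3) AE_space
    proof eventually_elim
      fix z assume "h z \<noteq> 0" "z \<in> space arc_measure"
      then have "h z > 0" using h(2)[of z] sp by auto
      obtain N :: nat where "1 / h z < N" using reals_Archimedean2 by blast
      then have "g k z = 1" if "k \<ge> N" for k
      proof -
        have "1 \<le> real N * h z" using \<open>1 / h z < N\<close> \<open>h z > 0\<close> by (simp add: field_simps)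
        also have "\<dots> \<le> real k * h z" using that \<open>h z > 0\<close> by (intro mult_right_mono) auto
        finally show ?thesis by (simp add: g_def)
      qed
      then show "(\<lambda>k. g k z) \<longlonglongrightarrow> 1"
        by (intro tendsto_eventually eventually_sequentiallyI[of N])
    qed
    show "AE z in arc_measure. norm (g k z) \<le> 1" for k
      using AE_space by eventually_elim (use g01 sp in auto)
  qed (auto intro: continuous_imp_borel_measurable[OF circle_prob_arc g])
  moreover have "(\<integral>z. (1::real) \<partial>arc_measure) = 1" by (rule integral_circle_const[OF circle_prob_arc])
  ultimately have lim: "(\<lambda>k. \<integral>z. g k z \<partial>arc_measure) \<longlonglongrightarrow> 1" by simp
  \<comment> \<open>The first bound makes \<open>- ln Z \<le> d\<close>, the second makes the mean
    deviation \<open>2 (1 - Z)\<close> at most \<open>d\<close>.\<close>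
  have ev: "eventually (\<lambda>k. max (exp (- d)) (1 - d / 2) < (\<integral>z. g k z \<partial>arc_measure)) sequentially"
    using lim \<open>d > 0\<close> by (intro order_tendstoD) auto
  obtain k where k: "k \<ge> 1" "max (exp (- d)) (1 - d / 2) < (\<integral>z. g k z \<partial>arc_measure)"
    using eventually_happens'[OF sequentially_bot eventually_conj[OF eventually_ge_at_top[of 1] ev]] by blast
  define Z where "Z = (\<integral>z. g k z \<partial>arc_measure)"
  have Z: "exp (- d) < Z" "1 - d / 2 < Z" using k by (auto simp: Z_def)
  have "Z > 0" using Z(1) exp_gt_zero less_trans by blast
  have "Z \<le> (\<integral>z. 1 \<partial>arc_measure)" unfolding Z_def
    using g01 by (intro integral_circle_mono[OF circle_prob_arc] g continuous_intros)
  then have "Z \<le> 1" using integral_circle_const[OF circle_prob_arc, of "1::real"] by simp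
  define f where "f z = g k z / Z" for z
  have f: "ccont f" unfolding f_def using \<open>Z > 0\<close> by (intro continuous_intros g) auto
  have fi: "(\<integral>z. f z \<partial>arc_measure) = 1" unfolding f_def using \<open>Z > 0\<close> by (simp add: Z_def[symmetric])
  show ?thesis
  proof (rule that[OF f _ _ fi])
    have "1 \<le> real k" using k by simp
    then show "1 \<le> real k / Z" using \<open>Z > 0\<close> \<open>Z \<le> 1\<close> by (simp add: field_simps)
    show "\<forall>z\<in>sphere 0 1. 0 \<le> f z \<and> f z \<le> real k / Z * h z"
    proof
      fix z :: complex assume "z \<in> sphere 0 1"
      then show "0 \<le> f z \<and> f z \<le> real k / Z * h z"
        using g01[of z k] \<open>Z > 0\<close> by (auto simp: f_def g_def divide_right_mono)
    qed
    have "ent f (\<lambda>u. \<integral>z. u z \<partial>arc_measure) \<le> ereal (ln (1 / Z))"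
      using g01 \<open>Z > 0\<close> by (intro ent_arc_le f fi) (auto simp: f_def divide_right_mono)
    also have "ln (1 / Z) \<le> d"
    proof -
      have "ln (exp (- d)) < ln Z" using Z(1) \<open>Z > 0\<close> by (subst ln_less_cancel_iff) auto
      then show ?thesis using \<open>Z > 0\<close> by (simp add: ln_div)
    qed
    finally show "ent f (\<lambda>u. \<integral>z. u z \<partial>arc_measure) \<le> ereal d" by simp
    \<comment> \<open>\<open>g k\<close> lies below both \<open>f\<close> and 1, and each gap has
      mean \<open>1 - Z\<close>.\<close>
    have "(\<integral>z. \<bar>f z - 1\<bar> \<partial>arc_measure) \<le> (\<integral>z. (f z - g k z) + (1 - g k z) \<partial>arc_measure)"
    proof (intro integral_circle_mono[OF circle_prob_arc] continuous_intros f g)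
      fix z :: complex assume z: "z \<in> sphere 0 1"
      have "g k z \<le> f z" using g01[OF z, of k] \<open>Z > 0\<close> \<open>Z \<le> 1\<close>
        by (simp add: f_def pos_le_divide_eq mult_left_le)
      then show "\<bar>f z - 1\<bar> \<le> (f z - g k z) + (1 - g k z)" using g01[OF z, of k] by linarith
    qed
    also have "\<dots> = (1 - Z) + (1 - Z)"
      using integrable_continuous_circle[OF circle_prob_arc f] integrable_continuous_circle[OF circle_prob_arc g[of k]]
        integral_circle_const[OF circle_prob_arc, of "1::real"]
        integrable_continuous_circle[OF circle_prob_arc, of "\<lambda>_. 1::real"]
      by (simp add: fi Z_def)
    also have "\<dots> \<le> d" using Z(2) by simp
    finally show "(\<integral>z. \<bar>f z - 1\<bar> \<partial>arc_measure) \<le> d" .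
  qed
qed

section \<open>Convergence of the entropies\<close>

text \<open>For negative \<open>x\<close>, multiplying by \<open>1 - x\<close> reduces the claim to
  \<open>(1 - x) exp x \<le> 1 \<le> 1 - x\<^sup>3\<close>.\<close>

lemma exp_le_quadratic:
  fixes x :: real
  assumes "x \<le> 1"
  shows "exp x \<le> 1 + x + x\<^sup>2"
proof (cases "x \<ge> 0")
  case True
  then show ?thesis using assms by (rule exp_bound)
next
  case False
  have "(1 - x) * exp x \<le> exp (- x) * exp x"
    using exp_ge_add_one_self[of "- x"] by (intro mult_right_mono) auto
  also have "\<dots> = 1" by (simp flip: exp_add)
  also have "1 \<le> 1 - x * x\<^sup>2" using False by (simp add: mult_nonpos_nonneg)
  also have "\<dots> = (1 - x) * (1 + x + x\<^sup>2)" by (simp add: algebra_simps power2_eq_square)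
  finally show ?thesis using False by simp
qed

lemma abs_ln_diff_le:
  fixes p q a :: real
  assumes "p > 0" "q > 0" "0 \<le> a" "a < 1" "q \<le> p * (1 + a)" "p * (1 - a) \<le> q"
  shows "\<bar>ln q - ln p\<bar> \<le> - ln (1 - a)"
proof -
  have "ln q \<le> ln (p * (1 + a))" using assms by simp
  then have 1: "ln q - ln p \<le> ln (1 + a)" using assms by (simp add: ln_mult_pos)
  have "ln (p * (1 - a)) \<le> ln q" using assms by simp
  then have 2: "ln (1 - a) \<le> ln q - ln p" using assms by (simp add: ln_mult_pos)
  have "ln (1 + a) + ln (1 - a) = ln ((1 + a) * (1 - a))" using assms by (simp add: ln_mult_pos)
  also have "(1 + a) * (1 - a) = 1 - a\<^sup>2" by (simp add: algebra_simps power2_eq_square)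
  also have "ln (1 - a\<^sup>2) \<le> 0" using assms by (simp add: ln_le_zero_iff abs_square_less_1)
  finally show ?thesis using 1 2 by linarith
qed

section \<open>Logarithmic means of Szego polynomials\<close>

lemma szego_poly_factor:
  assumes "\<And>j. j < n \<Longrightarrow> cmod (\<alpha> j) < 1"
  obtains as where "szego_poly \<alpha> n = (\<Prod>a\<leftarrow>as. [:- a, 1:])" "length as = n" "\<forall>a\<in>set as. cmod a < 1"
proof -
  let ?p = "szego_poly \<alpha> n"
  obtain as where as: "mset as = proots ?p" using ex_mset by blast
  have "?p = Polynomial.smult (lead_coeff ?p) (\<Prod>x\<in>#proots ?p. [:- x, 1:])"
    by (rule complex_poly_decompose_multiset[symmetric])
  also have "\<dots> = (\<Prod>x\<in>#proots ?p. [:- x, 1:])" by (simp only: lead_coeff_szego_poly smult_1_left)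
  also have "\<dots> = (\<Prod>x\<leftarrow>as. [:- x, 1:])"
    by (subst prod_mset_prod_list[symmetric]) (simp add: as)
  finally have eq: "?p = (\<Prod>x\<leftarrow>as. [:- x, 1:])" .
  have "(\<Prod>x\<leftarrow>xs. [:- x, 1:]) \<noteq> 0 \<and> degree (\<Prod>x\<leftarrow>xs. [:- x, 1:]) = length xs" for xs :: "complex list"
    by (induction xs) (simp_all add: degree_mult_eq del: mult_pCons_left)
  then have "length as = n" using eq degree_szego_poly[of \<alpha> n] by metis
  moreover have "cmod a < 1" if "a \<in> set as" for a
  proof -
    have "a \<in># proots ?p" using that as by (metis set_mset_mset)
    then have "poly ?p a = 0" by simp
    then show ?thesis using szego_poly_outside[OF assms, where z = a] by force
  qed
  ultimately show ?thesis using that eq by blast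
qed

lemma ln_norm_poly_list:
  assumes "\<And>a. a \<in> set as \<Longrightarrow> z \<noteq> a"
  shows "poly (\<Prod>a\<leftarrow>as. [:- a, 1:]) z \<noteq> 0 \<and> ln (cmod (poly (\<Prod>a\<leftarrow>as. [:- a, 1:]) z)) = (\<Sum>a\<leftarrow>as. ln (cmod (z - a)))"
  using assms by (induction as) (auto simp: norm_mult ln_mult simp del: mult_pCons_left)

lemma ccont_ln_norm_diff: "cmod a < 1 \<Longrightarrow> ccont (\<lambda>z. ln (cmod (z - a)))"
  by (intro continuous_intros) auto

lemma integral_ln_norm_poly_list:
  assumes \<mu>: "circle_prob \<mu>" and as: "\<And>a. a \<in> set as \<Longrightarrow> cmod a < 1"
  shows "(\<integral>z. ln (cmod (poly (\<Prod>a\<leftarrow>as. [:- a, 1:]) z)) \<partial>\<mu>) = (\<Sum>a\<leftarrow>as. \<integral>z. ln (cmod (z - a)) \<partial>\<mu>)"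
proof -
  have "(\<integral>z. ln (cmod (poly (\<Prod>a\<leftarrow>as. [:- a, 1:]) z)) \<partial>\<mu>) = (\<integral>z. (\<Sum>a\<leftarrow>as. ln (cmod (z - a))) \<partial>\<mu>)"
    by (intro integral_circle_cong[OF \<mu>] ln_norm_poly_list[THEN conjunct2]) (use as in force)
  also have "integrable \<mu> (\<lambda>z. \<Sum>a\<leftarrow>as. ln (cmod (z - a))) \<and> \<dots> = (\<Sum>a\<leftarrow>as. \<integral>z. ln (cmod (z - a)) \<partial>\<mu>)"
    using as
  proof (induction as)
    case (Cons a as)
    have "integrable \<mu> (\<lambda>z. ln (cmod (z - a)))"
      using Cons.prems by (intro integrable_continuous_circle[OF \<mu>] ccont_ln_norm_diff) simp
    then show ?case using Cons by simp
  qed simp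
  then have "(\<integral>z. (\<Sum>a\<leftarrow>as. ln (cmod (z - a))) \<partial>\<mu>) = (\<Sum>a\<leftarrow>as. \<integral>z. ln (cmod (z - a)) \<partial>\<mu>)" ..
  finally show ?thesis .
qed

lemma norm_diff_circle:
  assumes "z \<in> sphere 0 1"
  shows "cmod (z - a) = cmod (1 - cnj a * z)"
proof -
  have "cnj (z - a) * z = 1 - cnj a * z" using circle_cnj[OF assms] by (simp add: algebra_simps)
  then have "cmod (cnj (z - a) * z) = cmod (1 - cnj a * z)" by simp
  then show ?thesis using assms by (simp add: norm_mult del: complex_cnj_diff)
qed

lemma Re_pos_one_minus:
  assumes "cmod w < 1" shows "1 - w \<notin> \<real>\<^sub>\<le>\<^sub>0"
proof -
  have "Re w < 1" using assms complex_Re_le_cmod[of w] by linarith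
  then show ?thesis by (auto simp: complex_nonpos_Reals_iff)
qed

text \<open>On the circle \<open>|z - a| = |1 - cnj a z|\<close>, and
  \<open>Ln (1 - cnj a z)\<close> is holomorphic in the disk with value 0 at the origin.\<close>

lemma integral_arc_ln_norm_diff:
  assumes "cmod a < 1"
  shows "(\<integral>z. ln (cmod (z - a)) \<partial>arc_measure) = 0"
proof -
  have lt: "cmod (cnj a * z) < 1" if "cmod z \<le> 1" for z
  proof -
    have "cmod (cnj a * z) \<le> cmod a * 1" using mult_left_mono[OF that norm_ge_zero[of a]] by (simp add: norm_mult)
    then show ?thesis using assms by simp
  qed
  have c: "continuous_on (cball 0 1) (\<lambda>z. Ln (1 - cnj a * z))"
    using Re_pos_one_minus[OF lt] by (intro continuous_intros) auto
  have "(\<integral>z. Ln (1 - cnj a * z) \<partial>arc_measure) = Ln (1 - cnj a * 0)"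
    using Re_pos_one_minus[OF lt] by (intro arc_mean_value c holomorphic_intros) auto
  then have "Re (\<integral>z. Ln (1 - cnj a * z) \<partial>arc_measure) = 0" by simp
  also have "Re (\<integral>z. Ln (1 - cnj a * z) \<partial>arc_measure) = (\<integral>z. Re (Ln (1 - cnj a * z)) \<partial>arc_measure)"
    by (intro integral_Re[symmetric] integrable_continuous_circle[OF circle_prob_arc] continuous_on_subset[OF c]) auto
  also have "\<dots> = (\<integral>z. ln (cmod (z - a)) \<partial>arc_measure)"
  proof (rule integral_circle_cong[OF circle_prob_arc])
    fix z :: complex assume z: "z \<in> sphere 0 1"
    then have "1 - cnj a * z \<noteq> 0" using lt[of z] by auto
    then show "Re (Ln (1 - cnj a * z)) = ln (cmod (z - a))"
      using norm_diff_circle[OF z] by (simp add: Re_Ln)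
  qed
  finally show ?thesis .
qed

lemma integral_arc_ln_szego_poly:
  assumes "\<And>j. j < n \<Longrightarrow> cmod (\<alpha> j) < 1"
  shows "(\<integral>z. ln (cmod (poly (szego_poly \<alpha> n) z)) \<partial>arc_measure) = 0"
proof -
  obtain as where as: "szego_poly \<alpha> n = (\<Prod>a\<leftarrow>as. [:- a, 1:])" "\<forall>a\<in>set as. cmod a < 1"
    by (rule szego_poly_factor[of n \<alpha>]) (use assms that in blast)+
  have "(\<Sum>a\<leftarrow>as. \<integral>z. ln (cmod (z - a)) \<partial>arc_measure) = 0"
    using as(2) by (induction as) (auto simp: integral_arc_ln_norm_diff)
  then show ?thesis unfolding as(1) using integral_ln_norm_poly_list[OF circle_prob_arc, of as] as(2) by simp
qed

text \<open>The function \<open>ln |\<phi>\<^sub>n|\<^sup>2\<close>, where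
  \<open>\<phi>\<^sub>n\<close> is \<open>\<Phi>\<^sub>n\<close> divided by its norm.\<close>

definition ln_weight :: "(nat \<Rightarrow> complex) \<Rightarrow> nat \<Rightarrow> complex \<Rightarrow> real" where
  "ln_weight \<alpha> n z = 2 * ln (cmod (poly (szego_poly \<alpha> n) z)) - ln (rho_prod \<alpha> n)"

context
  fixes \<alpha> :: "nat \<Rightarrow> complex"
  assumes \<alpha>: "\<And>j. cmod (\<alpha> j) < 1"
begin

lemma szego_nonzero: "z \<in> sphere 0 1 \<Longrightarrow> poly (szego_poly \<alpha> n) z \<noteq> 0"
  using szego_poly_circle_nonzero \<alpha> by blast

lemma ccont_ln_szego: "ccont (\<lambda>z. ln (cmod (poly (szego_poly \<alpha> n) z)))"
  by (intro continuous_intros) (use szego_nonzero in auto)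

lemma ccont_ln_weight: "ccont (ln_weight \<alpha> n)"
  unfolding ln_weight_def by (intro continuous_intros ccont_ln_szego)

lemma exp_ln_weight:
  assumes "z \<in> sphere 0 1"
  shows "exp (ln_weight \<alpha> n z) = (cmod (poly (szego_poly \<alpha> n) z))\<^sup>2 / rho_prod \<alpha> n"
proof -
  have "exp (2 * ln (cmod (poly (szego_poly \<alpha> n) z))) = (cmod (poly (szego_poly \<alpha> n) z))\<^sup>2"
    using szego_nonzero[OF assms] by (simp add: exp_double)
  then show ?thesis using rho_prod_pos[of n \<alpha>] \<alpha> by (simp add: ln_weight_def exp_diff)
qed

text \<open>The Bernstein--Szego measure has density \<open>exp (- ln_weight \<alpha> n)\<close>, so
  this is a change of reference in \<open>ent_shift\<close>.\<close>

lemma ent_bs: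
  assumes f: "ccont f"
  shows "ent f (\<lambda>u. \<integral>z. u z \<partial>bs_measure \<alpha> n)
    = ent f (\<lambda>u. \<integral>z. u z \<partial>arc_measure) + ereal (\<integral>z. f z * ln_weight \<alpha> n z \<partial>arc_measure)"
proof -
  have "ent f (\<lambda>u. \<integral>z. u z \<partial>bs_measure \<alpha> n) + ereal (\<integral>z. f z * (- ln_weight \<alpha> n z) \<partial>arc_measure)
      = ent f (\<lambda>u. \<integral>z. u z \<partial>arc_measure)"
  proof (rule ent_shift[OF f])
    show "ccont (\<lambda>z. - ln_weight \<alpha> n z)" by (intro continuous_intros ccont_ln_weight)
    fix u assume u: "ccont u"
    have "(\<integral>z. u z \<partial>bs_measure \<alpha> n) = (\<integral>z. (rho_prod \<alpha> n / (cmod (poly (szego_poly \<alpha> n) z))\<^sup>2) *\<^sub>R u z \<partial>arc_measure)"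
      by (rule integral_bs[OF \<alpha> u])
    also have "\<dots> = (\<integral>z. exp (- ln_weight \<alpha> n z) * u z \<partial>arc_measure)"
      by (rule integral_circle_cong[OF circle_prob_arc]) (simp add: exp_minus exp_ln_weight)
    finally show "(\<integral>z. u z \<partial>bs_measure \<alpha> n) = (\<integral>z. exp (- ln_weight \<alpha> n z) * u z \<partial>arc_measure)" .
  qed
  then show ?thesis
    by (cases "ent f (\<lambda>u. \<integral>z. u z \<partial>bs_measure \<alpha> n)"; cases "ent f (\<lambda>u. \<integral>z. u z \<partial>arc_measure)") auto
qed

text \<open>\<open>|\<phi>\<^sub>n|\<^sup>2\<close> has integral 1 against every Bernstein--Szego
  measure of index at least \<open>n\<close>, because these share the first \<open>n\<close>
  norms.\<close>

lemma bs_lim_norm: "bs_lim \<alpha> (\<lambda>z. exp (ln_weight \<alpha> n z)) = 1"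
proof -
  have "eventually (\<lambda>m. (\<integral>z. exp (ln_weight \<alpha> n z) \<partial>bs_measure \<alpha> m) = 1) sequentially"
  proof (rule eventually_sequentiallyI[of n])
    fix m assume m: "n \<le> m"
    have "(\<integral>z. exp (ln_weight \<alpha> n z) \<partial>bs_measure \<alpha> m) = (\<integral>z. (cmod (poly (szego_poly \<alpha> n) z))\<^sup>2 / rho_prod \<alpha> n \<partial>bs_measure \<alpha> m)"
      by (rule integral_circle_cong[OF circle_prob_bs[OF \<alpha>] exp_ln_weight])
    also have "\<dots> = (\<integral>z. (cmod (poly (szego_poly \<alpha> n) z))\<^sup>2 \<partial>bs_measure \<alpha> m) / rho_prod \<alpha> n" by simp
    also have "\<dots> = 1" using norm_szego_poly_bs[OF \<alpha> m] rho_prod_pos[of n \<alpha>] \<alpha> by simp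
    finally show "(\<integral>z. exp (ln_weight \<alpha> n z) \<partial>bs_measure \<alpha> m) = 1" .
  qed
  then have "(\<lambda>m. \<integral>z. exp (ln_weight \<alpha> n z) \<partial>bs_measure \<alpha> m) \<longlonglongrightarrow> 1" by (rule tendsto_eventually)
  moreover have "(\<lambda>m. \<integral>z. exp (ln_weight \<alpha> n z) \<partial>bs_measure \<alpha> m) \<longlonglongrightarrow> bs_lim \<alpha> (\<lambda>z. exp (ln_weight \<alpha> n z))"
    by (intro bs_lim_tendsto \<alpha> continuous_intros ccont_ln_weight)
  ultimately show ?thesis using LIMSEQ_unique by blast
qed

lemma ent_arc_finite:
  assumes f: "ccont f" "\<And>z. z \<in> sphere 0 1 \<Longrightarrow> 0 \<le> f z" "(\<integral>z. f z \<partial>arc_measure) = 1"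
  obtains l where "l \<ge> 0" "ent f (\<lambda>u. \<integral>z. u z \<partial>arc_measure) = ereal l"
proof -
  obtain B where B: "\<And>z. z \<in> sphere 0 1 \<Longrightarrow> norm (f z) \<le> B"
    using continuous_on_circle_bounded[OF f(1)] by metis
  have "ent f (\<lambda>u. \<integral>z. u z \<partial>arc_measure) \<le> ereal (ln B)"
    using B f by (intro ent_arc_le) force+
  moreover have "0 \<le> ent f (\<lambda>u. \<integral>z. u z \<partial>arc_measure)"
    by (rule ent_nonneg) (rule integral_circle_const[OF circle_prob_arc])
  ultimately show ?thesis using that by (cases "ent f (\<lambda>u. \<integral>z. u z \<partial>arc_measure)") auto
qed

lemma ent_bs_lim_infinite:
  assumes h: "ccont h" "\<And>z. z \<in> sphere 0 1 \<Longrightarrow> 0 \<le> h z" "(\<integral>z. h z \<partial>arc_measure) = 1"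
    and inf: "ent h (bs_lim \<alpha>) = \<infinity>"
  shows "filterlim (\<lambda>n. \<integral>z. h z * ln_weight \<alpha> n z \<partial>arc_measure) at_top sequentially"
  unfolding filterlim_at_top
proof
  fix Z :: real
  obtain l where l: "ent h (\<lambda>u. \<integral>z. u z \<partial>arc_measure) = ereal l" using ent_arc_finite[OF h] by metis
  have "eventually (\<lambda>n. ereal (l + Z) < ent h (\<lambda>u. \<integral>z. u z \<partial>bs_measure \<alpha> n)) sequentially"
    by (rule ent_lsc[OF bs_lim_tendsto[OF \<alpha>]]) (simp_all add: inf)
  then show "eventually (\<lambda>n. Z \<le> (\<integral>z. h z * ln_weight \<alpha> n z \<partial>arc_measure)) sequentially"
    by eventually_elim (simp add: ent_bs[OF h(1)] l)
qed

section \<open>The case of finite entropy\<close>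

context
  fixes h :: "complex \<Rightarrow> real"
  assumes h: "ccont h" "\<And>z. z \<in> sphere 0 1 \<Longrightarrow> 0 \<le> h z" "(\<integral>z. h z \<partial>arc_measure) = 1"
    and ae: "AE z in arc_measure. h z \<noteq> 0" and fin: "ent h (bs_lim \<alpha>) < \<infinity>"
begin

text \<open>The densities for which the relative entropies below are finite.\<close>

definition dominated_density :: "(complex \<Rightarrow> real) \<Rightarrow> bool" where
  "dominated_density f \<longleftrightarrow> ccont f \<and> (\<exists>c\<ge>1. \<forall>z\<in>sphere 0 1. 0 \<le> f z \<and> f z \<le> c * h z) \<and> (\<integral>z. f z \<partial>arc_measure) = 1"

lemma dominatedD: "dominated_density f \<Longrightarrow> ccont f" "dominated_density f \<Longrightarrow> z \<in> sphere 0 1 \<Longrightarrow> 0 \<le> f z" "dominated_density f \<Longrightarrow> (\<integral>z. f z \<partial>arc_measure) = 1"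
  by (auto simp: dominated_density_def)

lemma dominated_h: "dominated_density h"
  unfolding dominated_density_def using h by (auto intro!: exI[of _ 1])

definition ent_arc :: "(complex \<Rightarrow> real) \<Rightarrow> real" where
  "ent_arc f = real_of_ereal (ent f (\<lambda>u. \<integral>z. u z \<partial>arc_measure))"

definition ent_lim :: "(complex \<Rightarrow> real) \<Rightarrow> real" where
  "ent_lim f = real_of_ereal (ent f (bs_lim \<alpha>))"

definition mean_ln_weight :: "nat \<Rightarrow> (complex \<Rightarrow> real) \<Rightarrow> real" where
  "mean_ln_weight n f = (\<integral>z. f z * ln_weight \<alpha> n z \<partial>arc_measure)"

text \<open>Integration against \<open>|\<phi>\<^sub>n|\<^sup>2 d\<mu>\<close> if
  \<open>bs_lim \<alpha>\<close> is integration against \<mu>.\<close>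

definition shifted :: "nat \<Rightarrow> (complex \<Rightarrow> real) \<Rightarrow> real" where
  "shifted n u = bs_lim \<alpha> (\<lambda>z. exp (ln_weight \<alpha> n z) * u z)"

lemma ent_arc: "dominated_density f \<Longrightarrow> ent f (\<lambda>u. \<integral>z. u z \<partial>arc_measure) = ereal (ent_arc f)"
  using ent_arc_finite[of f] dominatedD unfolding ent_arc_def by (metis real_of_ereal.simps(1))

lemma ent_lim:
  assumes "dominated_density f" shows "ent f (bs_lim \<alpha>) = ereal (ent_lim f)"
proof -
  obtain c where c: "c \<ge> 1" "\<And>z. z \<in> sphere 0 1 \<Longrightarrow> 0 \<le> f z \<and> f z \<le> c * h z"
    using assms unfolding dominated_density_def by metis
  have "ent f (bs_lim \<alpha>) < \<infinity>"
  proof (rule ent_dominated[OF dominatedD(1)[OF assms] c(2) dominatedD(3)[OF assms] h(1,3) c(1) _ fin])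
    fix u :: "complex \<Rightarrow> real" and a b assume "ccont u"
    then show "bs_lim \<alpha> (\<lambda>z. a * u z + b) = a * bs_lim \<alpha> u + b"
      using bs_lim_affine[OF \<alpha>, where f = u and g = "\<lambda>_. 1" and a = a and b = b] bs_lim_1[OF \<alpha>] by (simp add: continuous_on_const)
  qed
  moreover have "0 \<le> ent f (bs_lim \<alpha>)" by (rule ent_nonneg) (rule bs_lim_1[OF \<alpha>])
  ultimately show ?thesis unfolding ent_lim_def by (cases "ent f (bs_lim \<alpha>)") auto
qed

lemma ent_shifted:
  assumes "dominated_density f" shows "ent f (shifted n) = ereal (ent_lim f - mean_ln_weight n f)"
proof -
  have "ent f (shifted n) + ereal (mean_ln_weight n f) = ent f (bs_lim \<alpha>)"
    unfolding mean_ln_weight_def by (rule ent_shift[OF dominatedD(1)[OF assms] ccont_ln_weight]) (simp add: shifted_def)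
  then show ?thesis unfolding ent_lim[OF assms] by (cases "ent f (shifted n)") auto
qed

text \<open>Lower semicontinuity along the Bernstein--Szego measures, whose entropies are
  \<open>ent_arc f + mean_ln_weight n f\<close>. Read through \<open>ent_shifted\<close>, it bounds
  the entropy relative to \<open>shifted n\<close> from above.\<close>

lemma mean_ln_weight_lower:
  assumes "dominated_density f" "e > 0"
  shows "eventually (\<lambda>n. ent_lim f - mean_ln_weight n f < ent_arc f + e) sequentially"
proof -
  have "eventually (\<lambda>n. ereal (ent_lim f - e) < ent f (\<lambda>u. \<integral>z. u z \<partial>bs_measure \<alpha> n)) sequentially"
    using assms(2) by (intro ent_lsc[OF bs_lim_tendsto[OF \<alpha>]]) (simp_all add: ent_lim[OF assms(1)])
  then show ?thesis
    by eventually_elim (simp add: ent_bs[OF dominatedD(1)[OF assms(1)]] ent_arc[OF assms(1)] mean_ln_weight_def)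
qed

lemma dominated_approx:
  assumes "d > 0"
  obtains f where "dominated_density f" "ent_arc f \<le> d" "(\<integral>z. \<bar>f z - 1\<bar> \<partial>arc_measure) \<le> d"
proof -
  obtain f c where f: "ccont f" "c \<ge> 1" "\<forall>z\<in>sphere 0 1. 0 \<le> f z \<and> f z \<le> c * h z"
    "(\<integral>z. f z \<partial>arc_measure) = 1" "ent f (\<lambda>u. \<integral>z. u z \<partial>arc_measure) \<le> ereal d"
    "(\<integral>z. \<bar>f z - 1\<bar> \<partial>arc_measure) \<le> d"
    by (rule approx_uniform[OF h(1,2) ae assms]) (use that in blast)+
  have "dominated_density f" using f unfolding dominated_density_def by blast
  then show ?thesis using that f ent_arc[of f] by auto
qed

text \<open>A variant of Pinsker's inequality. For a dominated \<open>f\<close> of small entropy,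
  the entropy of \<open>f\<close> relative to \<open>shifted n\<close> is eventually small as well.
  Testing it with \<open>s u\<close> for a small \<open>s\<close>, expanding the exponential and
  dividing by \<open>s\<close> bounds \<open>\<integral> f u - shifted n u\<close> from
  above.\<close>

lemma shifted_lower:
  assumes u: "ccont u" and "e > 0"
  shows "eventually (\<lambda>n. shifted n u > (\<integral>z. u z \<partial>arc_measure) - e) sequentially"
proof -
  obtain M where M: "M > 0" "\<And>z. z \<in> sphere 0 1 \<Longrightarrow> norm (u z) \<le> M"
    using continuous_on_circle_bounded[OF u] by metis
  \<comment> \<open>\<open>s M \<le> 1\<close> admits \<open>exp_le_quadratic\<close>, and
    \<open>s M\<^sup>2 \<le> e / 4\<close> bounds the quadratic term after division by
    \<open>s\<close>.\<close>
  define s where "s = min (1 / M) (e / (4 * M\<^sup>2))"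
  have s: "s > 0" "s * M \<le> 1" "s * M\<^sup>2 \<le> e / 4"
  proof -
    show "s > 0" using M \<open>e > 0\<close> by (simp add: s_def)
    have "s * M \<le> 1 / M * M" using M by (intro mult_right_mono) (auto simp: s_def)
    then show "s * M \<le> 1" using M by simp
    have "s * M\<^sup>2 \<le> e / (4 * M\<^sup>2) * M\<^sup>2" using M by (intro mult_right_mono) (auto simp: s_def)
    then show "s * M\<^sup>2 \<le> e / 4" using M by simp
  qed
  \<comment> \<open>After division by \<open>s\<close>, the entropy \<open>d\<close> and the slack
    \<open>s e / 4\<close> take \<open>e / 2\<close>; replacing \<open>f\<close> by 1 costs
    \<open>M d \<le> e / 4\<close>.\<close>
  define d where "d = min (s * e / 4) (e / (4 * M))"
  have d: "d > 0" "d \<le> s * e / 4" "M * d \<le> e / 4"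
  proof -
    show "d > 0" using s M \<open>e > 0\<close> by (simp add: d_def)
    show "d \<le> s * e / 4" by (simp add: d_def)
    have "M * d \<le> M * (e / (4 * M))" using M by (intro mult_left_mono) (auto simp: d_def)
    then show "M * d \<le> e / 4" using M by simp
  qed
  obtain f where f: "dominated_density f" "ent_arc f \<le> d" "(\<integral>z. \<bar>f z - 1\<bar> \<partial>arc_measure) \<le> d"
    using dominated_approx[OF d(1)] by metis
  note fc = dominatedD(1)[OF f(1)]
  have I: "(\<integral>z. u z \<partial>arc_measure) - e / 4 \<le> (\<integral>z. f z * u z \<partial>arc_measure)"
  proof -
    have "(\<integral>z. u z - M * \<bar>f z - 1\<bar> \<partial>arc_measure) \<le> (\<integral>z. f z * u z \<partial>arc_measure)"
    proof (intro integral_circle_mono[OF circle_prob_arc] continuous_intros fc u)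
      fix z :: complex assume z: "z \<in> sphere 0 1"
      have "\<bar>(f z - 1) * u z\<bar> \<le> \<bar>f z - 1\<bar> * M" unfolding abs_mult using M(2)[OF z] by (intro mult_left_mono) auto
      then have "- (M * \<bar>f z - 1\<bar>) \<le> (f z - 1) * u z" by (simp add: mult.commute abs_le_iff)
      then show "u z - M * \<bar>f z - 1\<bar> \<le> f z * u z" by (simp add: algebra_simps)
    qed
    moreover have "(\<integral>z. u z - M * \<bar>f z - 1\<bar> \<partial>arc_measure) = (\<integral>z. u z \<partial>arc_measure) - M * (\<integral>z. \<bar>f z - 1\<bar> \<partial>arc_measure)"
    proof -
      have "integrable arc_measure u" "integrable arc_measure (\<lambda>z. \<bar>f z - 1\<bar>)"
        by (intro integrable_continuous_circle[OF circle_prob_arc] continuous_intros u fc)+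
      then show ?thesis by simp
    qed
    moreover have "M * (\<integral>z. \<bar>f z - 1\<bar> \<partial>arc_measure) \<le> M * d" using M f(3) by (intro mult_left_mono) auto
    ultimately show ?thesis using d(3) by linarith
  qed
  have "eventually (\<lambda>n. ent_lim f - mean_ln_weight n f < ent_arc f + s * e / 4) sequentially"
    using s \<open>e > 0\<close> by (intro mean_ln_weight_lower f) auto
  then show ?thesis
  proof eventually_elim
    fix n assume n: "ent_lim f - mean_ln_weight n f < ent_arc f + s * e / 4"
    have E: "ccont (\<lambda>z. exp (ln_weight \<alpha> n z))" by (intro continuous_intros ccont_ln_weight)
    have "shifted n (\<lambda>z. exp (s * u z)) \<le> bs_lim \<alpha> (\<lambda>z. (1 + s\<^sup>2 * M\<^sup>2) * exp (ln_weight \<alpha> n z) + s * (exp (ln_weight \<alpha> n z) * u z))"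
      unfolding shifted_def
    proof (intro bs_lim_mono \<alpha> continuous_intros ccont_ln_weight u)
      fix z :: complex assume z: "z \<in> sphere 0 1"
      have su: "\<bar>s * u z\<bar> \<le> s * M" unfolding abs_mult using s M(2)[OF z] by simp
      then have "s * u z \<le> 1" using s(2) by linarith
      have "exp (s * u z) \<le> 1 + s * u z + (s * u z)\<^sup>2"
        using exp_le_quadratic[OF \<open>s * u z \<le> 1\<close>] by simp
      also have "(s * u z)\<^sup>2 \<le> (s * M)\<^sup>2" using su by (intro abs_le_square_iff[THEN iffD1]) linarith
      finally have "exp (s * u z) \<le> 1 + s * u z + s\<^sup>2 * M\<^sup>2" by (simp add: power_mult_distrib)
      then have "exp (ln_weight \<alpha> n z) * exp (s * u z) \<le> exp (ln_weight \<alpha> n z) * (1 + s * u z + s\<^sup>2 * M\<^sup>2)"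
        by (intro mult_left_mono) auto
      then show "exp (ln_weight \<alpha> n z) * exp (s * u z) \<le> (1 + s\<^sup>2 * M\<^sup>2) * exp (ln_weight \<alpha> n z) + s * (exp (ln_weight \<alpha> n z) * u z)"
        by (simp add: algebra_simps)
    qed
    also have "\<dots> = (1 + s\<^sup>2 * M\<^sup>2) + s * shifted n u"
      unfolding shifted_def
      by (subst bs_lim_affine) (simp_all add: \<alpha> E u bs_lim_norm continuous_on_mult)
    finally have "shifted n (\<lambda>z. exp (s * u z)) \<le> (1 + s\<^sup>2 * M\<^sup>2) + s * shifted n u" .
    moreover have "(\<integral>z. f z * (s * u z) \<partial>arc_measure) - shifted n (\<lambda>z. exp (s * u z)) + 1 \<le> ent_lim f - mean_ln_weight n f"
      using ent_upper[of "\<lambda>z. s * u z" f "shifted n"] u ent_shifted[OF f(1)]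
      by (simp add: continuous_on_mult continuous_on_const)
    moreover have "(\<integral>z. f z * (s * u z) \<partial>arc_measure) = s * (\<integral>z. f z * u z \<partial>arc_measure)"
      by (simp add: mult.left_commute)
    ultimately have "s * (\<integral>z. f z * u z \<partial>arc_measure) - s\<^sup>2 * M\<^sup>2 - s * shifted n u < d + s * e / 4"
      using n f(2) by linarith
    then have "s * ((\<integral>z. f z * u z \<partial>arc_measure) - s * M\<^sup>2 - shifted n u) < s * (e / 2)"
      using d(2) by (simp add: algebra_simps power2_eq_square)
    then have "(\<integral>z. f z * u z \<partial>arc_measure) - s * M\<^sup>2 - shifted n u < e / 2" using s(1) by simp
    then show "shifted n u > (\<integral>z. u z \<partial>arc_measure) - e" using I s(3) by linarith
  qed
qed

lemma shifted_tendsto: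
  assumes u: "ccont u"
  shows "(\<lambda>n. shifted n u) \<longlonglongrightarrow> (\<integral>z. u z \<partial>arc_measure)"
proof (rule tendstoI)
  fix e :: real assume "e > 0"
  have neg: "shifted n (\<lambda>z. - u z) = - shifted n u" for n
    unfolding shifted_def using bs_lim_affine[OF \<alpha>, where f = "\<lambda>z. exp (ln_weight \<alpha> n z) * u z" and g = "\<lambda>_. 1" and a = "-1" and b = 0]
    by (simp add: continuous_on_mult continuous_on_exp ccont_ln_weight u continuous_on_const)
  have "eventually (\<lambda>n. shifted n (\<lambda>z. - u z) > (\<integral>z. - u z \<partial>arc_measure) - e) sequentially"
    by (intro shifted_lower continuous_intros u \<open>e > 0\<close>)
  with shifted_lower[OF u \<open>e > 0\<close>]
  show "eventually (\<lambda>n. dist (shifted n u) (\<integral>z. u z \<partial>arc_measure) < e) sequentially"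
    by eventually_elim (simp add: neg dist_real_def abs_less_iff)
qed

text \<open>Lower semicontinuity is used twice: along the Bernstein--Szego measures it bounds the
  mean from below, and along \<open>shifted n\<close>, which tends to the uniform measure, it bounds
  \<open>ent_lim f - mean_ln_weight n f\<close> from below by nearly
  \<open>ent_arc f\<close>.\<close>

lemma mean_ln_weight_tendsto:
  assumes "dominated_density f"
  shows "(\<lambda>n. mean_ln_weight n f) \<longlonglongrightarrow> ent_lim f - ent_arc f"
proof (rule tendstoI)
  fix e :: real assume "e > 0"
  have "eventually (\<lambda>n. ereal (ent_arc f - e) < ent f (shifted n)) sequentially"
    using \<open>e > 0\<close> by (intro ent_lsc[where \<Lambda> = "\<lambda>u. \<integral>z. u z \<partial>arc_measure"] shifted_tendsto) (simp_all add: ent_arc[OF assms])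
  with mean_ln_weight_lower[OF assms \<open>e > 0\<close>]
  show "eventually (\<lambda>n. dist (mean_ln_weight n f) (ent_lim f - ent_arc f) < e) sequentially"
    by eventually_elim (simp add: ent_shifted[OF assms] dist_real_def abs_less_iff)
qed

text \<open>On the circle \<open>|\<Phi>\<^sub>n\<^sup>*| = |\<Phi>\<^sub>n|\<close>, so one step of
  the recursion changes the modulus by a factor between \<open>1 - |\<alpha>\<^sub>n|\<close> and
  \<open>1 + |\<alpha>\<^sub>n|\<close>.\<close>

lemma ln_ratio_bound:
  assumes z: "z \<in> sphere 0 1"
  shows "\<bar>ln (cmod (poly (szego_poly \<alpha> (Suc n)) z)) - ln (cmod (poly (szego_poly \<alpha> n) z))\<bar> \<le> - ln (1 - cmod (\<alpha> n))"
proof -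
  let ?p = "cmod (poly (szego_poly \<alpha> n) z)" and ?q = "cmod (poly (szego_poly \<alpha> (Suc n)) z)" and ?a = "cmod (\<alpha> n)"
  have pos: "?p > 0" "?q > 0" using szego_nonzero[OF z, of n] szego_nonzero[OF z, of "Suc n"]
    by (simp_all del: szego_poly.simps)
  have a: "0 \<le> ?a" "?a < 1" using \<alpha> by auto
  have d: "cmod (poly (szego_dual n (szego_poly \<alpha> n)) z) = ?p"
    by (rule norm_poly_szego_dual_circle[OF _ z]) simp
  have e: "poly (szego_poly \<alpha> (Suc n)) z = z * poly (szego_poly \<alpha> n) z - cnj (\<alpha> n) * poly (szego_dual n (szego_poly \<alpha> n)) z"
    by (simp add: szego_step_def)
  have z1: "cmod z = 1" using z by simp
  have "?q \<le> cmod (z * poly (szego_poly \<alpha> n) z) + cmod (cnj (\<alpha> n) * poly (szego_dual n (szego_poly \<alpha> n)) z)"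
    unfolding e by (rule norm_triangle_ineq4)
  then have up: "?q \<le> ?p * (1 + ?a)" by (simp add: norm_mult d z1 algebra_simps)
  have "cmod (z * poly (szego_poly \<alpha> n) z) - cmod (cnj (\<alpha> n) * poly (szego_dual n (szego_poly \<alpha> n)) z) \<le> ?q"
    unfolding e by (rule norm_triangle_ineq2)
  then have lo: "?p * (1 - ?a) \<le> ?q" by (simp add: norm_mult d z1 algebra_simps)
  show ?thesis by (rule abs_ln_diff_le[OF pos a up lo])
qed

lemma rho_prod_Suc: "ln (rho_prod \<alpha> (Suc n)) = ln (rho_prod \<alpha> n) + ln (1 - (cmod (\<alpha> n))\<^sup>2)"
proof -
  have "rho_prod \<alpha> (Suc n) = rho_prod \<alpha> n * (1 - (cmod (\<alpha> n))\<^sup>2)" by (simp add: rho_prod_def mult.commute)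
  moreover have "1 - (cmod (\<alpha> n))\<^sup>2 > 0" using \<alpha> by (simp add: abs_square_less_1)
  ultimately show ?thesis using rho_prod_pos[of n \<alpha>] \<alpha> by (simp add: ln_mult_pos)
qed

text \<open>Since \<open>ln |\<Phi>\<^sub>n|\<close> has mean zero, comparing the averages of \<open>ln |\<phi>\<^sub>n\<^sub>+\<^sub>1/\<phi>\<^sub>n|\<^sup>2\<close> against
  \<open>f\<close> and against the uniform density isolates \<open>ln (1 - |\<alpha>\<^sub>n|\<^sup>2)\<close>.\<close>

lemma verblunsky_ln_tendsto_0: "(\<lambda>n. ln (1 - (cmod (\<alpha> n))\<^sup>2)) \<longlonglongrightarrow> 0"
proof (rule tendstoI)
  fix e :: real assume "e > 0"
  \<comment> \<open>In \<open>y < e / 4 + 2 d y + 2 d\<close> below, \<open>d \<le> 1 / 4\<close>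
    absorbs \<open>2 d y\<close> into \<open>y / 2\<close>, and \<open>d \<le> e / 16\<close> leaves
    \<open>y / 2 < e / 4 + e / 8\<close>.\<close>
  define d where "d = min (1 / 4) (e / 16)"
  have d: "d > 0" "d \<le> 1 / 4" "d \<le> e / 16" using \<open>e > 0\<close> by (auto simp: d_def)
  obtain f where f: "dominated_density f" "(\<integral>z. \<bar>f z - 1\<bar> \<partial>arc_measure) \<le> d"
    using dominated_approx[OF d(1)] by metis
  note fc = dominatedD(1)[OF f(1)]
  have "(\<lambda>n. mean_ln_weight (Suc n) f - mean_ln_weight n f) \<longlonglongrightarrow> (ent_lim f - ent_arc f) - (ent_lim f - ent_arc f)"
    by (intro tendsto_diff mean_ln_weight_tendsto f LIMSEQ_Suc)
  then have "eventually (\<lambda>n. mean_ln_weight (Suc n) f - mean_ln_weight n f < e / 4) sequentially"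
    using \<open>e > 0\<close> by (intro order_tendstoD(2)) auto
  then show "eventually (\<lambda>n. dist (ln (1 - (cmod (\<alpha> n))\<^sup>2)) 0 < e) sequentially"
  proof eventually_elim
    fix n assume n: "mean_ln_weight (Suc n) f - mean_ln_weight n f < e / 4"
    define D where "D z = ln (cmod (poly (szego_poly \<alpha> (Suc n)) z)) - ln (cmod (poly (szego_poly \<alpha> n) z))" for z
    define y where "y = - ln (1 - (cmod (\<alpha> n))\<^sup>2)"
    define b where "b = - ln (1 - cmod (\<alpha> n))"
    have a: "0 \<le> cmod (\<alpha> n)" "cmod (\<alpha> n) < 1" using \<alpha> by auto
    have a2: "(cmod (\<alpha> n))\<^sup>2 < 1" using a by (simp add: abs_square_less_1)
    have y0: "y \<ge> 0" unfolding y_def using a2 by (simp add: ln_le_zero_iff)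
    \<comment> \<open>No bound on \<open>|\<alpha>\<^sub>n|\<close> away from 1 is known yet, so
      \<open>b\<close> is controlled by \<open>y\<close> itself, through \<open>1 -
      |\<alpha>\<^sub>n|\<^sup>2 = (1 - |\<alpha>\<^sub>n|) (1 +
      |\<alpha>\<^sub>n|)\<close>.\<close>
    have bb: "0 \<le> b" "b \<le> y + 1"
    proof -
      show "0 \<le> b" unfolding b_def using a by (simp add: ln_le_zero_iff)
      have "1 - (cmod (\<alpha> n))\<^sup>2 = (1 - cmod (\<alpha> n)) * (1 + cmod (\<alpha> n))" by (simp add: algebra_simps power2_eq_square)
      then have "ln (1 - (cmod (\<alpha> n))\<^sup>2) = ln (1 - cmod (\<alpha> n)) + ln (1 + cmod (\<alpha> n))"
        using a add_pos_nonneg[of 1 "cmod (\<alpha> n)"] by (simp add: ln_mult_pos)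
      moreover have "ln (1 + cmod (\<alpha> n)) \<le> cmod (\<alpha> n)" using a by (intro ln_add_one_self_le_self) auto
      ultimately show "b \<le> y + 1" unfolding b_def y_def using a by linarith
    qed
    have D: "ccont D" unfolding D_def by (intro continuous_intros ccont_ln_szego)
    have D0: "(\<integral>z. D z \<partial>arc_measure) = 0"
      unfolding D_def using integral_arc_ln_szego_poly[where \<alpha> = \<alpha>] \<alpha>
      by (subst Bochner_Integration.integral_diff) (auto intro!: integrable_continuous_circle[OF circle_prob_arc] ccont_ln_szego simp del: szego_poly.simps)
    have wD: "mean_ln_weight (Suc n) f - mean_ln_weight n f = y + 2 * (\<integral>z. f z * D z \<partial>arc_measure)"
    proof -
      have "mean_ln_weight (Suc n) f - mean_ln_weight n f = (\<integral>z. f z * ln_weight \<alpha> (Suc n) z - f z * ln_weight \<alpha> n z \<partial>arc_measure)"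
        unfolding mean_ln_weight_def by (intro Bochner_Integration.integral_diff[symmetric] integrable_arc_mult fc ccont_ln_weight)
      also have "\<dots> = (\<integral>z. y * f z + 2 * (f z * D z) \<partial>arc_measure)"
        by (simp add: ln_weight_def rho_prod_Suc D_def y_def algebra_simps del: szego_poly.simps)
      also have "\<dots> = y * (\<integral>z. f z \<partial>arc_measure) + 2 * (\<integral>z. f z * D z \<partial>arc_measure)"
        using integrable_continuous_circle[OF circle_prob_arc fc] integrable_arc_mult[OF fc D] by simp
      finally show ?thesis using dominatedD(3)[OF f(1)] by simp
    qed
    have "(\<integral>z. D z - b * \<bar>f z - 1\<bar> \<partial>arc_measure) \<le> (\<integral>z. f z * D z \<partial>arc_measure)"
    proof (intro integral_circle_mono[OF circle_prob_arc] continuous_intros fc D)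
      fix z :: complex assume z: "z \<in> sphere 0 1"
      have "\<bar>D z\<bar> \<le> b" unfolding D_def b_def by (rule ln_ratio_bound[OF z])
      then have "\<bar>(f z - 1) * D z\<bar> \<le> \<bar>f z - 1\<bar> * b" unfolding abs_mult by (intro mult_left_mono) auto
      then have "- (b * \<bar>f z - 1\<bar>) \<le> (f z - 1) * D z" by (simp add: mult.commute abs_le_iff)
      then show "D z - b * \<bar>f z - 1\<bar> \<le> f z * D z" by (simp add: algebra_simps)
    qed
    moreover have "(\<integral>z. D z - b * \<bar>f z - 1\<bar> \<partial>arc_measure) = - b * (\<integral>z. \<bar>f z - 1\<bar> \<partial>arc_measure)"
    proof -
      have "integrable arc_measure D" "integrable arc_measure (\<lambda>z. \<bar>f z - 1\<bar>)"
        by (intro integrable_continuous_circle[OF circle_prob_arc] continuous_intros D fc)+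
      then show ?thesis by (simp add: D0)
    qed
    moreover have "b * (\<integral>z. \<bar>f z - 1\<bar> \<partial>arc_measure) \<le> (y + 1) * d"
      using bb f(2) y0 d by (intro mult_mono) auto
    ultimately have "- ((y + 1) * d) \<le> (\<integral>z. f z * D z \<partial>arc_measure)" by simp
    then have "y - 2 * ((y + 1) * d) < e / 4" using n wD by linarith
    moreover have "y * d \<le> y * (1 / 4)" using y0 d by (intro mult_left_mono) auto
    ultimately have "y < e" using d(3) \<open>e > 0\<close> by (simp add: algebra_simps)
    then show "dist (ln (1 - (cmod (\<alpha> n))\<^sup>2)) 0 < e" using y0 by (simp add: y_def dist_real_def)
  qed
qed

lemma verblunsky_tendsto_0: "\<alpha> \<longlonglongrightarrow> 0"
proof -
  have "(\<lambda>n. (cmod (\<alpha> n))\<^sup>2) \<longlonglongrightarrow> 0"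
  proof (rule tendsto_sandwich[OF _ _ tendsto_const])
    show "(\<lambda>n. - ln (1 - (cmod (\<alpha> n))\<^sup>2)) \<longlonglongrightarrow> 0" using tendsto_minus[OF verblunsky_ln_tendsto_0] by simp
    have "(cmod (\<alpha> n))\<^sup>2 \<le> - ln (1 - (cmod (\<alpha> n))\<^sup>2)" for n
      using ln_le_minus_one[of "1 - (cmod (\<alpha> n))\<^sup>2"] \<alpha>[of n] by (simp add: abs_square_less_1)
    then show "eventually (\<lambda>n. (cmod (\<alpha> n))\<^sup>2 \<le> - ln (1 - (cmod (\<alpha> n))\<^sup>2)) sequentially" by simp
  qed simp
  from tendsto_real_sqrt[OF this] have "(\<lambda>n. cmod (\<alpha> n)) \<longlonglongrightarrow> 0" by simp
  then show ?thesis by (rule tendsto_norm_zero_cancel)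
qed

end

end

section \<open>Logarithmic potentials\<close>

text \<open>\<open>cis\<close> is injective on \<open>{0..<2 * pi}\<close>, so a point of the circle
  corresponds to at most one angle.\<close>

lemma AE_arc_neq: "AE z in arc_measure. z \<noteq> a"
proof -
  have "\<exists>t0. \<forall>t\<in>{0..<2 * pi}. cis t = a \<longrightarrow> t = t0"
  proof (cases "\<exists>t\<in>{0..<2 * pi}. cis t = a")
    case True
    then obtain t0 where t0: "t0 \<in> {0..<2 * pi}" "cis t0 = a" by blast
    have "t = t0" if "t \<in> {0..<2 * pi}" "cis t = a" for t
    proof -
      have "sin t = sin t0 \<and> cos t = cos t0" using that t0 by (metis cis.sel)
      then obtain n :: int where n: "t = t0 + 2 * pi * n" using sin_cos_eq_iff by metis
      have "\<bar>2 * pi * n\<bar> < 2 * pi * 1" using n that t0 by auto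
      then have "\<bar>real_of_int n\<bar> < 1" by (simp add: abs_mult)
      then have "n = 0" by linarith
      then show ?thesis using n by simp
    qed
    then show ?thesis by blast
  qed auto
  then obtain t0 where t0: "\<And>t. t \<in> {0..<2 * pi} \<Longrightarrow> cis t = a \<Longrightarrow> t = t0" by blast
  have "AE t in lborel. t \<noteq> t0" by (rule AE_lborel_singleton)
  then have "AE t in lborel. t \<in> {0..<2 * pi} \<longrightarrow> cis t \<noteq> a"
    by eventually_elim (use t0 in auto)
  then have "AE t in uniform_measure lborel {0..<2 * pi}. cis t \<noteq> a"
    by (intro AE_uniform_measureI) auto
  moreover have "{z \<in> space circle_borel. z \<noteq> a} \<in> sets circle_borel"
    unfolding circle_borel_def sets_restrict_space
    by (rule image_eqI[of _ _ "- {a}"]) (auto simp: space_restrict_space)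
  ultimately show ?thesis unfolding arc_measure_def
    by (subst AE_distr_iff[OF cis_measurable_circle']) auto
qed

lemma AE_not_in_finite:
  assumes "\<And>a. AE z in M. z \<noteq> a" "finite S"
  shows "AE z in M. z \<notin> S"
  using assms(2)
proof (induction S rule: finite_induct)
  case (insert a S)
  show ?case using insert.IH assms(1)[of a] by eventually_elim auto
qed simp

lemma infinite_circle_support:
  assumes \<eta>: "circle_prob \<eta>" and atom: "\<And>a. AE z in \<eta>. z \<noteq> a"
  shows "infinite (circle_support \<eta>)"
proof
  interpret prob_space \<eta> using \<eta> by (rule circle_probD)
  assume "finite (circle_support \<eta>)"
  from AE_not_in_finite[OF atom this] AE_circle_support[OF \<eta>] have "AE z in \<eta>. False" by eventually_elim simp
  then show False by simp
qed

text \<open>Twice the real part of the expansion of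
  \<open>\<integral> Ln (1 - a cnj w) d\<eta>(w)\<close> in powers of \<open>a\<close>, cut off at
  order \<open>M\<close>: a harmonic polynomial in \<open>a\<close>. It is the logarithmic potential
  in the closed disk if the moments beyond \<open>M\<close> vanish and \<eta> has no atoms.\<close>

definition pot :: "complex measure \<Rightarrow> nat \<Rightarrow> complex \<Rightarrow> real" where
  "pot \<eta> M a = - 2 * Re (\<Sum>i=1..M. a ^ i * cnj (\<integral>w. w ^ i \<partial>\<eta>) / of_nat i)"

context
  fixes \<eta> :: "complex measure" and M :: nat
  assumes \<eta>: "circle_prob \<eta>" and atom: "\<And>a. AE z in \<eta>. z \<noteq> a"
    and mom: "\<And>l. l > M \<Longrightarrow> (\<integral>w. w ^ l \<partial>\<eta>) = 0"
begin

text \<open>On the circle \<open>|a - w| = |1 - a cnj w|\<close>, and for \<open>|a| < 1\<close> the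
  series of \<open>Ln (1 - a cnj w)\<close> is dominated by a geometric one, so it may be integrated
  term by term; the vanishing moments make it finite.\<close>

lemma log_integral_inside:
  assumes a: "cmod a < 1"
  shows "2 * (\<integral>w. ln (cmod (a - w)) \<partial>\<eta>) = pot \<eta> M a"
proof -
  \<comment> \<open>The terms of \<open>Ln_series\<close> at \<open>- (a * cnj w)\<close>; the one
    for \<open>i = 0\<close> is 0, as division by zero gives 0.\<close>
  define f where "f i w = (- 1) ^ Suc i / of_nat i * (- (a * cnj w)) ^ i" for i :: nat and w :: complex
  have sp: "space \<eta> = sphere 0 1" using \<eta> by (rule circle_probD)
  have f_eq: "f i w = - (a ^ i / of_nat i) * cnj (w ^ i)" for i w
  proof -
    have "(- 1) ^ Suc i * (- (a * cnj w)) ^ i = - (((- 1) * (- (a * cnj w))) ^ i)"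
      by (simp only: power_mult_distrib power_Suc) simp
    then have "(- 1) ^ Suc i * (- (a * cnj w)) ^ i = - (a ^ i * cnj w ^ i)" by (simp add: power_mult_distrib)
    then show ?thesis unfolding f_def by (simp add: field_simps)
  qed
  have fi: "integrable \<eta> (f i)" for i
    unfolding f_eq by (intro integrable_continuous_circle[OF \<eta>] continuous_intros)
  have nf: "norm (f i w) \<le> cmod a ^ i" if "w \<in> sphere 0 1" for i w
  proof (cases "i = 0")
    case False
    then have "1 \<le> real i" by simp
    then have "cmod a ^ i / real i \<le> cmod a ^ i" by (simp add: divide_le_eq mult_le_cancel_left1)
    then show ?thesis using that by (simp add: f_eq norm_mult norm_divide norm_power)
  qed (simp add: f_eq)
  have geo: "summable (\<lambda>i. cmod a ^ i)" using a by (intro summable_geometric) simp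
  have sumAE: "AE w in \<eta>. summable (\<lambda>i. norm (f i w))"
    using nf sp by (intro AE_I2 summable_comparison_test'[OF geo, of 0]) auto
  have "(\<lambda>i. integral\<^sup>L \<eta> (f i)) sums (\<integral>w. suminf (\<lambda>i. f i w) \<partial>\<eta>)"
  proof (rule sums_integral[OF fi sumAE])
    show "summable (\<lambda>i. \<integral>w. norm (f i w) \<partial>\<eta>)"
    proof (rule summable_comparison_test'[OF geo, of 0])
      fix i
      have "(\<integral>w. norm (f i w) \<partial>\<eta>) \<le> (\<integral>w. cmod a ^ i \<partial>\<eta>)"
        using nf unfolding f_eq by (intro integral_circle_mono[OF \<eta>] continuous_intros) auto
      also have "\<dots> = cmod a ^ i" by (rule integral_circle_const[OF \<eta>])
      finally show "norm (\<integral>w. norm (f i w) \<partial>\<eta>) \<le> cmod a ^ i" by simp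
    qed
  qed
  moreover have "(\<integral>w. suminf (\<lambda>i. f i w) \<partial>\<eta>) = (\<integral>w. Ln (1 - a * cnj w) \<partial>\<eta>)"
  proof (rule integral_circle_cong[OF \<eta>])
    fix w :: complex assume "w \<in> sphere 0 1"
    then have "cmod (- (a * cnj w)) < 1" using a by (simp add: norm_mult)
    from Ln_series[OF this] have "(\<lambda>i. f i w) sums Ln (1 - a * cnj w)" unfolding f_def by simp
    then show "suminf (\<lambda>i. f i w) = Ln (1 - a * cnj w)" by (rule sums_unique[symmetric])
  qed
  moreover have fint: "integral\<^sup>L \<eta> (f i) = - (a ^ i * cnj (\<integral>w. w ^ i \<partial>\<eta>) / of_nat i)" for i
  proof -
    have "integral\<^sup>L \<eta> (f i) = (\<integral>w. - (a ^ i / of_nat i) * cnj (w ^ i) \<partial>\<eta>)"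
      by (rule integral_circle_cong[OF \<eta>]) (rule f_eq)
    also have "\<dots> = - (a ^ i / of_nat i) * (\<integral>w. cnj (w ^ i) \<partial>\<eta>)" by (rule integral_mult_right_zero)
    also have "(\<integral>w. cnj (w ^ i) \<partial>\<eta>) = cnj (\<integral>w. w ^ i \<partial>\<eta>)" by (rule Bochner_Integration.integral_cnj)
    finally show ?thesis by simp
  qed
  ultimately have "(\<lambda>i. - (a ^ i * cnj (\<integral>w. w ^ i \<partial>\<eta>) / of_nat i)) sums (\<integral>w. Ln (1 - a * cnj w) \<partial>\<eta>)"
    by simp
  moreover have "(\<lambda>i. - (a ^ i * cnj (\<integral>w. w ^ i \<partial>\<eta>) / of_nat i)) sums (\<Sum>i=1..M. - (a ^ i * cnj (\<integral>w. w ^ i \<partial>\<eta>) / of_nat i))"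
    using mom by (intro sums_finite) (auto simp: not_le Suc_le_eq)
  ultimately have L: "(\<integral>w. Ln (1 - a * cnj w) \<partial>\<eta>) = (\<Sum>i=1..M. - (a ^ i * cnj (\<integral>w. w ^ i \<partial>\<eta>) / of_nat i))"
    by (rule sums_unique2)
  have nz: "1 - a * cnj w \<notin> \<real>\<^sub>\<le>\<^sub>0" if "w \<in> sphere 0 1" for w
    using that a by (intro Re_pos_one_minus) (simp add: norm_mult)
  have "(\<integral>w. ln (cmod (a - w)) \<partial>\<eta>) = (\<integral>w. Re (Ln (1 - a * cnj w)) \<partial>\<eta>)"
  proof (rule integral_circle_cong[OF \<eta>])
    fix w :: complex assume w: "w \<in> sphere 0 1"
    have "cmod (a - w) = cmod (cnj (1 - cnj a * w))" using norm_diff_circle[OF w, of a]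
      by (simp add: norm_minus_commute del: complex_cnj_diff)
    then have "cmod (a - w) = cmod (1 - a * cnj w)" by simp
    moreover have "1 - a * cnj w \<noteq> 0" using nz[OF w] by auto
    ultimately show "ln (cmod (a - w)) = Re (Ln (1 - a * cnj w))" by simp
  qed
  also have "\<dots> = Re (\<integral>w. Ln (1 - a * cnj w) \<partial>\<eta>)"
    using nz by (intro integral_Re integrable_continuous_circle[OF \<eta>] continuous_intros) auto
  finally show ?thesis unfolding L pot_def by (simp add: sum_negf)
qed

text \<open>On the circle the logarithm is unbounded: Fatou's lemma along \<open>r a\<close>, \<open>r \<longrightarrow> 1\<close>, gives its
  integrability, and then \<open>|r a - w| \<ge> |a - w| / 2\<close> allows dominated convergence.\<close>

lemma log_integral_boundary:
  assumes a: "cmod a = 1"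
  shows "2 * (\<integral>w. ln (cmod (a - w)) \<partial>\<eta>) = pot \<eta> M a"
proof -
  have sp: "space \<eta> = sphere 0 1" using \<eta> by (rule circle_probD)
  have int1: "(\<integral>w. c \<partial>\<eta>) = c" for c :: real by (rule integral_circle_const[OF \<eta>])
  have i1: "integrable \<eta> (\<lambda>w. c)" for c :: real
    by (intro integrable_continuous_circle[OF \<eta>] continuous_intros)
  define r where "r n = 1 - 1 / real (Suc n)" for n
  have r: "0 \<le> r n" "r n < 1" for n by (auto simp: r_def field_simps)
  have rlim: "r \<longlonglongrightarrow> 1"
    unfolding r_def using tendsto_diff[OF tendsto_const[of 1] LIMSEQ_Suc[OF lim_1_over_n]] by simp
  define b where "b n = of_real (r n) * a" for n
  have b: "cmod (b n) < 1" for n using r[of n] a by (simp add: b_def norm_mult)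
  have blim: "b \<longlonglongrightarrow> a"
    unfolding b_def using tendsto_mult[OF tendsto_of_real[OF rlim] tendsto_const[of a]] by simp
  \<comment> \<open>Distances within the closed disk are at most 2, so subtracting from
    \<open>ln 2\<close> gives the nonnegative functions that Fatou's lemma requires.\<close>
  define g where "g n w = ln 2 - ln (cmod (b n - w))" for n w
  define G where "G w = ln 2 - ln (cmod (a - w))" for w
  have gc: "ccont (g n)" for n
  proof -
    have "b n \<noteq> w" if "w \<in> sphere 0 1" for w using b[of n] that by auto
    then show ?thesis unfolding g_def by (intro continuous_intros) auto
  qed
  have gm: "g n \<in> borel_measurable \<eta>" for n by (rule continuous_imp_borel_measurable[OF \<eta> gc])
  have Gm: "G \<in> borel_measurable \<eta>"
  proof -
    have "(\<lambda>w. cmod (a - w)) \<in> borel_measurable \<eta>"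
      by (intro continuous_imp_borel_measurable[OF \<eta>] continuous_intros)
    then show ?thesis unfolding G_def by measurable
  qed
  have gG: "0 \<le> g n w" "g n w \<le> ln 2 + G w" "0 \<le> G w" if w: "w \<in> sphere 0 1" "w \<noteq> a" for n w
  proof -
    have pos: "cmod (b n - w) > 0" "cmod (a - w) > 0" using w b[of n] by auto
    have w1: "cmod w = 1" using w by simp
    have "cmod (b n - w) \<le> cmod (b n) + cmod w" "cmod (a - w) \<le> cmod a + cmod w" by (rule norm_triangle_ineq4)+
    then have "cmod (b n - w) \<le> 2" "cmod (a - w) \<le> 2" using b[of n] a w1 by linarith+
    then have "ln (cmod (b n - w)) \<le> ln 2" "ln (cmod (a - w)) \<le> ln 2" using pos by (subst ln_le_cancel_iff; simp)+
    then show "0 \<le> g n w" "0 \<le> G w" by (auto simp: g_def G_def)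
    \<comment> \<open>\<open>b n\<close> lies on the radius of \<open>a\<close>, so
      \<open>|a - b n| = 1 - r n = |w| - |b n| \<le> |b n - w|\<close>, and hence
      \<open>|a - w| \<le> 2 |b n - w|\<close>.\<close>
    have "cmod (a - b n) = 1 - r n"
    proof -
      have "a - b n = of_real (1 - r n) * a" by (simp add: b_def algebra_simps)
      then show ?thesis using r[of n] a by (simp only: norm_mult norm_of_real) simp
    qed
    moreover have "cmod (b n) = r n" using r[of n] a by (simp add: b_def norm_mult)
    moreover have "cmod w - cmod (b n) \<le> cmod (b n - w)" by (metis norm_minus_commute norm_triangle_ineq2)
    moreover have "cmod (a - w) \<le> cmod (a - b n) + cmod (b n - w)" using norm_triangle_ineq[of "a - b n" "b n - w"] by simp
    ultimately have "cmod (a - w) \<le> 2 * cmod (b n - w)" using w1 by linarith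
    then have "ln (cmod (a - w)) \<le> ln (2 * cmod (b n - w))" using pos by (subst ln_le_cancel_iff) auto
    then show "g n w \<le> ln 2 + G w" using pos by (simp add: g_def G_def ln_mult_pos)
  qed
  have glim: "(\<lambda>n. g n w) \<longlonglongrightarrow> G w" if "w \<noteq> a" for w
    unfolding g_def G_def using that by (intro tendsto_intros blim) auto
  have gint: "(\<integral>w. g n w \<partial>\<eta>) = ln 2 - pot \<eta> M (b n) / 2" for n
  proof -
    have "integrable \<eta> (\<lambda>w. ln (cmod (b n - w)))"
    proof (intro integrable_continuous_circle[OF \<eta>] continuous_intros)
      show "\<forall>w\<in>sphere 0 1. cmod (b n - w) \<noteq> 0" using b[of n] by auto
    qed
    then have "(\<integral>w. g n w \<partial>\<eta>) = ln 2 - (\<integral>w. ln (cmod (b n - w)) \<partial>\<eta>)"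
      unfolding g_def by (subst Bochner_Integration.integral_diff) (simp_all only: i1 int1)
    then show ?thesis using log_integral_inside[OF b[of n]] by simp
  qed
  have plim: "(\<lambda>n. ln 2 - pot \<eta> M (b n) / 2) \<longlonglongrightarrow> ln 2 - pot \<eta> M a / 2"
    unfolding pot_def divide_inverse by (intro tendsto_intros blim)
  have ae: "AE w in \<eta>. w \<in> sphere 0 1 \<and> w \<noteq> a"
    using atom[of a] AE_space by eventually_elim (use sp in auto)
  have "(\<integral>\<^sup>+w. ennreal (G w) \<partial>\<eta>) = (\<integral>\<^sup>+w. liminf (\<lambda>n. ennreal (g n w)) \<partial>\<eta>)"
  proof (rule nn_integral_cong_AE)
    show "AE w in \<eta>. ennreal (G w) = liminf (\<lambda>n. ennreal (g n w))"
      using ae by eventually_elim (intro lim_imp_Liminf[symmetric] tendsto_ennrealI glim; simp)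
  qed
  also have "\<dots> \<le> liminf (\<lambda>n. \<integral>\<^sup>+w. ennreal (g n w) \<partial>\<eta>)"
    using gm by (intro nn_integral_liminf) auto
  also have "\<dots> = liminf (\<lambda>n. ennreal (ln 2 - pot \<eta> M (b n) / 2))"
  proof -
    have "(\<integral>\<^sup>+w. ennreal (g n w) \<partial>\<eta>) = ennreal (ln 2 - pot \<eta> M (b n) / 2)" for n
    proof -
      have "AE w in \<eta>. 0 \<le> g n w" using ae by eventually_elim (use gG(1) in auto)
      then show ?thesis unfolding gint[symmetric]
        by (intro nn_integral_eq_integral integrable_continuous_circle[OF \<eta> gc])
    qed
    then show ?thesis by simp
  qed
  also have "\<dots> = ennreal (ln 2 - pot \<eta> M a / 2)"
    by (intro lim_imp_Liminf tendsto_ennrealI plim) simp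
  finally have "(\<integral>\<^sup>+w. ennreal (G w) \<partial>\<eta>) < \<infinity>" by (rule le_less_trans) simp
  moreover have "AE w in \<eta>. 0 \<le> G w" using ae by eventually_elim (use gG(3) in auto)
  ultimately have Gi: "integrable \<eta> G" using Gm by (intro integrableI_nonneg)
  have "(\<lambda>n. \<integral>w. g n w \<partial>\<eta>) \<longlonglongrightarrow> (\<integral>w. G w \<partial>\<eta>)"
  proof (rule integral_dominated_convergence[where w = "\<lambda>w. ln 2 + G w"])
    show "integrable \<eta> (\<lambda>w. ln 2 + G w)" by (intro Bochner_Integration.integrable_add i1 Gi)
    show "AE w in \<eta>. (\<lambda>n. g n w) \<longlonglongrightarrow> G w" using ae by eventually_elim (use glim in auto)
    show "AE w in \<eta>. norm (g n w) \<le> ln 2 + G w" for n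
      using ae by eventually_elim (use gG in auto)
  qed (use gm Gm in auto)
  then have "(\<lambda>n. ln 2 - pot \<eta> M (b n) / 2) \<longlonglongrightarrow> (\<integral>w. G w \<partial>\<eta>)" by (simp only: gint)
  then have "(\<integral>w. G w \<partial>\<eta>) = ln 2 - pot \<eta> M a / 2" using plim LIMSEQ_unique by blast
  moreover have "(\<integral>w. ln (cmod (a - w)) \<partial>\<eta>) = (\<integral>w. ln 2 - G w \<partial>\<eta>)" by (simp add: G_def)
  moreover have "\<dots> = ln 2 - (\<integral>w. G w \<partial>\<eta>)" by (subst Bochner_Integration.integral_diff[OF i1 Gi]) (simp only: int1)
  ultimately show ?thesis by simp
qed

text \<open>Since \<open>- 2 Re x = - x - cnj x\<close> and \<open>cnj z = 1 / z\<close> on the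
  circle, positive exponents carry the terms of \<open>pot\<close> and negative ones their
  conjugates.\<close>

definition laurent_pot :: "int \<Rightarrow> complex" where
  "laurent_pot l = (if l = 0 \<or> nat \<bar>l\<bar> > M then 0
     else if l > 0 then - cnj (\<integral>w. w ^ nat l \<partial>\<eta>) / of_nat (nat l)
     else - (\<integral>w. w ^ nat (- l) \<partial>\<eta>) / of_nat (nat (- l)))"

lemma laurent_pot_exists:
  obtains V :: laurent_poly where "Poly_Mapping.lookup V 0 = 0"
    "\<forall>z\<in>sphere 0 1. laurent_eval V z = complex_of_real (pot \<eta> M z)"
proof -
  define V where "V = Poly_Mapping.Abs_poly_mapping laurent_pot"
  have nz: "{l. laurent_pot l \<noteq> 0} \<subseteq> {- int M..int M}"
    by (auto simp: laurent_pot_def split: if_splits)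
  then have fin: "finite {l. laurent_pot l \<noteq> 0}" by (rule finite_subset) simp
  then have V: "Poly_Mapping.lookup V = laurent_pot"
    unfolding V_def by (intro Poly_Mapping.Abs_poly_mapping_inverse) simp
  have "laurent_eval V z = complex_of_real (pot \<eta> M z)" if z: "z \<in> sphere 0 1" for z
  proof -
    have keys: "Poly_Mapping.keys V \<subseteq> {- int M..int M}"
      using nz by (auto simp: in_keys_iff V)
    have "laurent_eval V z = (\<Sum>l\<in>{- int M..int M}. laurent_pot l * z powi l)"
      unfolding laurent_eval_def V
      by (rule sum.mono_neutral_left) (use keys in \<open>auto simp: in_keys_iff V\<close>)
    also have "{- int M..int M} = {1..int M} \<union> {0} \<union> {- int M..- 1}" by auto
    also have "(\<Sum>l\<in>\<dots>. laurent_pot l * z powi l)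
        = (\<Sum>l\<in>{1..int M}. laurent_pot l * z powi l) + (\<Sum>l\<in>{- int M..- 1}. laurent_pot l * z powi l)"
      by (subst sum.union_disjoint; (subst sum.union_disjoint)?) (auto simp: laurent_pot_def)
    also have "(\<Sum>l\<in>{1..int M}. laurent_pot l * z powi l) = (\<Sum>i=1..M. - (z ^ i * cnj (\<integral>w. w ^ i \<partial>\<eta>) / of_nat i))"
      by (rule sum.reindex_bij_witness[of _ int nat]) (auto simp: laurent_pot_def power_int_def nat_le_iff)
    also have "(\<Sum>l\<in>{- int M..- 1}. laurent_pot l * z powi l) = (\<Sum>i=1..M. cnj (- (z ^ i * cnj (\<integral>w. w ^ i \<partial>\<eta>) / of_nat i)))"
    proof (rule sum.reindex_bij_witness[of _ "\<lambda>i. - int i" "\<lambda>l. nat (- l)"])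
      fix l assume l: "l \<in> {- int M..- 1}"
      have "inverse z = cnj z" using circle_cnj[OF z] by (metis inverse_unique mult.commute)
      then have "z powi l = cnj (z ^ nat (- l))" using l by (simp add: power_int_def)
      then show "cnj (- (z ^ nat (- l) * cnj (\<integral>w. w ^ nat (- l) \<partial>\<eta>) / of_nat (nat (- l)))) = laurent_pot l * z powi l"
        using l by (auto simp: laurent_pot_def not_less nat_le_iff)
    qed auto
    also have "(\<Sum>i=1..M. - (z ^ i * cnj (\<integral>w. w ^ i \<partial>\<eta>) / of_nat i)) + (\<Sum>i=1..M. cnj (- (z ^ i * cnj (\<integral>w. w ^ i \<partial>\<eta>) / of_nat i)))
        = complex_of_real (pot \<eta> M z)"
      unfolding cnj_sum[symmetric] complex_add_cnj pot_def by (simp add: sum_negf)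
    finally show ?thesis .
  qed
  moreover have "Poly_Mapping.lookup V 0 = 0" by (simp add: V laurent_pot_def)
  ultimately show ?thesis using that by blast
qed

end

section \<open>Power sums\<close>

text \<open>The reciprocal polynomial of \<open>\<Prod>(z - a)\<close>: its low coefficients are the
  leading ones of that product, see \<open>nth_rev_fps\<close>. This makes the zeros of polynomials
  of different degrees comparable.\<close>

definition rev_fps :: "complex list \<Rightarrow> complex fps" where
  "rev_fps as = (\<Prod>a\<leftarrow>as. 1 - fps_const a * fps_X)"

text \<open>Entry \<open>l\<close> is the power sum of order \<open>l + 1\<close>; with this shift
  the series is minus the logarithmic derivative of \<open>rev_fps\<close>.\<close>

definition power_sum_fps :: "complex list \<Rightarrow> complex fps" where
  "power_sum_fps as = Abs_fps (\<lambda>l. \<Sum>a\<leftarrow>as. a ^ Suc l)"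

lemma power_sum_single: "(1 - fps_const a * fps_X) * Abs_fps (\<lambda>l. a ^ Suc l) = fps_const a"
  for a :: complex
proof (rule fps_ext)
  fix n
  show "fps_nth ((1 - fps_const a * fps_X) * Abs_fps (\<lambda>l. a ^ Suc l)) n = fps_nth (fps_const a) n"
    by (cases n) (simp_all add: left_diff_distrib mult.assoc)
qed

lemma fps_deriv_rev_fps: "fps_deriv (rev_fps as) = - (rev_fps as * power_sum_fps as)"
proof (induction as)
  case Nil
  show ?case by (simp add: rev_fps_def power_sum_fps_def fps_eq_iff)
next
  case (Cons a as)
  have r: "rev_fps (a # as) = (1 - fps_const a * fps_X) * rev_fps as" by (simp add: rev_fps_def)
  have s: "power_sum_fps (a # as) = Abs_fps (\<lambda>l. a ^ Suc l) + power_sum_fps as"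
    by (simp add: power_sum_fps_def fps_eq_iff)
  have "fps_deriv (rev_fps (a # as)) = (1 - fps_const a * fps_X) * fps_deriv (rev_fps as) - fps_const a * rev_fps as"
    unfolding r by (simp flip: fps_const_neg)
  also have "\<dots> = - ((1 - fps_const a * fps_X) * rev_fps as * power_sum_fps as)
      - ((1 - fps_const a * fps_X) * Abs_fps (\<lambda>l. a ^ Suc l)) * rev_fps as"
    unfolding Cons.IH power_sum_single by (simp add: mult.assoc)
  also have "\<dots> = - (rev_fps (a # as) * power_sum_fps (a # as))"
    unfolding r s by (simp add: algebra_simps)
  finally show ?case .
qed

lemma degree_linear_prod: "degree (\<Prod>a\<leftarrow>as. [:- a, 1:]) = length as" for as :: "complex list"
proof -
  have "(\<Prod>a\<leftarrow>as. [:- a, 1:]) \<noteq> 0 \<and> degree (\<Prod>a\<leftarrow>as. [:- a, 1:]) = length as"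
    by (induction as) (simp_all add: degree_mult_eq del: mult_pCons_left)
  then show ?thesis ..
qed

lemma nth_rev_fps:
  "fps_nth (rev_fps as) i = (if i \<le> length as then coeff (\<Prod>a\<leftarrow>as. [:- a, 1:]) (length as - i) else 0)"
proof (induction as arbitrary: i)
  case Nil
  show ?case by (auto simp: rev_fps_def)
next
  case (Cons a as)
  let ?P = "\<Prod>a\<leftarrow>as. [:- a, 1:]"
  have r: "rev_fps (a # as) = rev_fps as - fps_const a * (fps_X * rev_fps as)"
    by (simp add: rev_fps_def algebra_simps)
  have c: "coeff (\<Prod>a\<leftarrow>a # as. [:- a, 1:]) j = coeff (pCons 0 ?P) j - a * coeff ?P j" for j
    by simp
  show ?case
  proof (cases i)
    case 0
    have "coeff ?P (Suc (length as)) = 0" by (rule coeff_eq_0) (simp add: degree_linear_prod)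
    then show ?thesis unfolding r c using Cons.IH[of 0] 0 by simp
  next
    case (Suc k)
    have n: "fps_nth (rev_fps (a # as)) (Suc k) = fps_nth (rev_fps as) (Suc k) - a * fps_nth (rev_fps as) k"
      unfolding r by simp
    show ?thesis
    proof (cases "k < length as")
      case True
      then have "length as - k = Suc (length as - Suc k)" by simp
      then show ?thesis unfolding Suc n c using Cons.IH[of "Suc k"] Cons.IH[of k] True by (simp add: coeff_pCons)
    next
      case False
      then show ?thesis unfolding Suc n c using Cons.IH[of "Suc k"] Cons.IH[of k] by simp
    qed
  qed
qed

text \<open>Newton's identities, in the form of the logarithmic derivative of \<open>\<Prod>(1 - a X)\<close>.\<close>

lemma power_sum_unique:
  assumes "\<And>i. i \<le> m \<Longrightarrow> fps_nth (rev_fps as) i = fps_nth (rev_fps bs) i" "l < m"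
  shows "(\<Sum>a\<leftarrow>as. a ^ Suc l) = (\<Sum>b\<leftarrow>bs. b ^ Suc l)"
  using assms(2)
proof (induction l rule: less_induct)
  case (less l)
  have rec: "(\<Sum>a\<leftarrow>cs. a ^ Suc l) = - (of_nat (Suc l) * fps_nth (rev_fps cs) (Suc l))
      - (\<Sum>j<l. (\<Sum>a\<leftarrow>cs. a ^ Suc j) * fps_nth (rev_fps cs) (l - j))" for cs
  proof -
    have r0: "fps_nth (rev_fps cs) 0 = 1" by (induction cs) (simp_all add: rev_fps_def)
    have "of_nat (Suc l) * fps_nth (rev_fps cs) (Suc l) = fps_nth (fps_deriv (rev_fps cs)) l"
      by simp
    also have "\<dots> = - fps_nth (power_sum_fps cs * rev_fps cs) l"
      unfolding fps_deriv_rev_fps by (simp add: mult.commute)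
    also have "fps_nth (power_sum_fps cs * rev_fps cs) l = (\<Sum>j\<le>l. (\<Sum>a\<leftarrow>cs. a ^ Suc j) * fps_nth (rev_fps cs) (l - j))"
      by (simp add: fps_mult_nth power_sum_fps_def atLeast0AtMost)
    also have "\<dots> = (\<Sum>j<l. (\<Sum>a\<leftarrow>cs. a ^ Suc j) * fps_nth (rev_fps cs) (l - j)) + (\<Sum>a\<leftarrow>cs. a ^ Suc l)"
      by (simp add: lessThan_Suc_atMost[symmetric] r0)
    finally have *: "of_nat (Suc l) * fps_nth (rev_fps cs) (Suc l)
      = - ((\<Sum>j<l. (\<Sum>a\<leftarrow>cs. a ^ Suc j) * fps_nth (rev_fps cs) (l - j)) + (\<Sum>a\<leftarrow>cs. a ^ Suc l))" .
    show ?thesis unfolding * by simp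
  qed
  show ?case unfolding rec[of as] rec[of bs]
    using less assms(1) by (auto intro!: arg_cong2[where f = "(-)"] sum.cong)
qed

section \<open>Finitely supported measures\<close>

text \<open>The other support points form a finite and hence closed set, so some open set meets the
  support in \<open>z\<close> alone, and its positive mass sits at \<open>z\<close>.\<close>

lemma AE_support_imp_measure:
  assumes \<mu>: "circle_prob \<mu>" and fin: "finite (circle_support \<mu>)" and z: "z \<in> circle_support \<mu>"
  shows "{z} \<in> sets \<mu>" "measure \<mu> {z} > 0"
proof -
  interpret prob_space \<mu> using \<mu> by (rule circle_probD)
  note s = circle_probD[OF \<mu>]
  have zc: "z \<in> sphere 0 1" using z circle_support_subset by blast
  have os: "U \<inter> sphere 0 1 \<in> sets \<mu>" if "U \<in> sets borel" for U
    using that s by (auto simp: circle_borel_def sets_restrict_space)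
  have "{z} \<inter> sphere 0 1 \<in> sets \<mu>" by (rule os) simp
  then show zs: "{z} \<in> sets \<mu>" using zc by (simp add: Int_absorb2)
  define U where "U = - (circle_support \<mu> - {z})"
  have U: "open U" "z \<in> U"
    using fin finite_imp_closed[of "circle_support \<mu> - {z}"] unfolding U_def
    by (blast intro: open_Compl)+
  then have pos: "emeasure \<mu> (U \<inter> sphere 0 1) > 0" using z by (auto simp: circle_support_def)
  have "AE w in \<mu>. w \<in> U \<inter> sphere 0 1 \<longleftrightarrow> w \<in> {z}"
    using AE_circle_support[OF \<mu>] by eventually_elim (use zc in \<open>auto simp: U_def\<close>)
  then have "emeasure \<mu> (U \<inter> sphere 0 1) = emeasure \<mu> {z}"
    using os[of U] U zs by (intro emeasure_eq_AE) auto
  then show "measure \<mu> {z} > 0" using pos by (simp add: emeasure_eq_measure)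
qed

lemma integral_finite_support:
  fixes f :: "complex \<Rightarrow> 'a::{banach, second_countable_topology}"
  assumes \<mu>: "circle_prob \<mu>" and fin: "finite (circle_support \<mu>)" and f: "f \<in> borel_measurable \<mu>"
  shows "(\<integral>z. f z \<partial>\<mu>) = (\<Sum>z\<in>circle_support \<mu>. measure \<mu> {z} *\<^sub>R f z)"
proof -
  interpret prob_space \<mu> using \<mu> by (rule circle_probD)
  let ?Z = "circle_support \<mu>"
  have i: "integrable \<mu> (\<lambda>w. indicator {z} w *\<^sub>R f z)" if "z \<in> ?Z" for z
    using AE_support_imp_measure(1)[OF \<mu> fin that] emeasure_finite
    by (intro integrable_scaleR_left integrable_real_indicator) (auto simp: less_top[symmetric])
  have "(\<integral>z. f z \<partial>\<mu>) = (\<integral>w. (\<Sum>z\<in>?Z. indicator {z} w *\<^sub>R f z) \<partial>\<mu>)"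
  proof (rule integral_cong_AE[OF f])
    show "(\<lambda>w. \<Sum>z\<in>?Z. indicator {z} w *\<^sub>R f z) \<in> borel_measurable \<mu>"
      using i by (intro borel_measurable_sum) auto
    show "AE w in \<mu>. f w = (\<Sum>z\<in>?Z. indicator {z} w *\<^sub>R f z)"
      using AE_circle_support[OF \<mu>]
    proof eventually_elim
      fix w assume "w \<in> ?Z"
      have "(\<Sum>z\<in>?Z. indicator {z} w *\<^sub>R f z) = (\<Sum>z\<in>?Z. if z = w then f w else 0)"
        by (intro sum.cong) (auto simp: indicator_def)
      then show "f w = (\<Sum>z\<in>?Z. indicator {z} w *\<^sub>R f z)" using fin \<open>w \<in> ?Z\<close> by simp
    qed
  qed
  also have "\<dots> = (\<Sum>z\<in>?Z. \<integral>w. indicator {z} w *\<^sub>R f z \<partial>\<mu>)"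
    by (rule Bochner_Integration.integral_sum) (rule i)
  also have "\<dots> = (\<Sum>z\<in>?Z. measure \<mu> {z} *\<^sub>R f z)"
    using AE_support_imp_measure(1)[OF \<mu> fin] emeasure_finite
    by (intro sum.cong refl) (auto simp: less_top[symmetric] integral_scaleR_left integrable_real_indicator)
  finally show ?thesis .
qed

text \<open>Invertibility of the Vandermonde matrix, shown by testing with the polynomial of degree
  \<open>n\<close> that vanishes at all other nodes.\<close>

lemma sum_poly_zero_imp_zero:
  fixes x :: "complex \<Rightarrow> complex"
  assumes Z: "finite Z" "card Z = Suc n" and x: "\<And>l. l \<le> n \<Longrightarrow> (\<Sum>z\<in>Z. x z * z ^ l) = 0" and z: "z \<in> Z"
  shows "x z = 0"
proof -
  define q where "q = (\<Prod>y\<in>Z - {z}. [:- y, 1:])"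
  have dq: "degree q \<le> n" using Z z by (simp add: q_def degree_prod_sum_eq)
  have "(\<Sum>y\<in>Z. x y * poly q y) = (\<Sum>y\<in>Z. \<Sum>l\<le>degree q. coeff q l * (x y * y ^ l))"
    by (simp add: poly_altdef sum_distrib_left mult_ac)
  also have "\<dots> = (\<Sum>l\<le>degree q. coeff q l * (\<Sum>y\<in>Z. x y * y ^ l))"
    by (subst sum.swap) (simp add: sum_distrib_left)
  also have "\<dots> = 0" using x dq by (intro sum.neutral) auto
  finally have "(\<Sum>y\<in>Z. x y * poly q y) = 0" .
  moreover have "(\<Sum>y\<in>Z. x y * poly q y) = x z * poly q z"
  proof -
    have "poly q y = 0" if "y \<in> Z" "y \<noteq> z" for y using that Z by (auto simp: q_def poly_prod)
    then have "(\<Sum>y\<in>Z. x y * poly q y) = (\<Sum>y\<in>{z}. x y * poly q y)"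
      using Z z by (intro sum.mono_neutral_right) auto
    then show ?thesis by simp
  qed
  moreover have "poly q z \<noteq> 0" using Z by (auto simp: q_def poly_prod)
  ultimately show ?thesis by simp
qed

lemma finite_support_unique:
  assumes \<mu>: "circle_prob \<mu>" and \<nu>: "circle_prob \<nu>"
    and sup: "circle_support \<mu> = Z" "circle_support \<nu> = Z" and Z: "finite Z" "card Z = Suc n"
    and mom: "\<And>l. l \<le> n \<Longrightarrow> (\<integral>z. z ^ l \<partial>\<mu>) = (\<integral>z. z ^ l \<partial>\<nu>)"
  shows "\<mu> = \<nu>"
proof -
  interpret \<mu>: prob_space \<mu> using \<mu> by (rule circle_probD)
  interpret \<nu>: prob_space \<nu> using \<nu> by (rule circle_probD)
  have eqw: "measure \<mu> {z} = measure \<nu> {z}" if z: "z \<in> Z" for z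
  proof -
    have "complex_of_real (measure \<mu> {z} - measure \<nu> {z}) = 0"
    proof (rule sum_poly_zero_imp_zero[OF Z _ z])
      fix l assume l: "l \<le> n"
      have "(\<lambda>z. z ^ l) \<in> borel_measurable \<mu>" "(\<lambda>z. z ^ l) \<in> borel_measurable \<nu>"
        by (intro continuous_imp_borel_measurable \<mu> \<nu> continuous_intros)+
      then have "(\<Sum>z\<in>Z. measure \<mu> {z} *\<^sub>R z ^ l) = (\<Sum>z\<in>Z. measure \<nu> {z} *\<^sub>R z ^ l)"
        using integral_finite_support[OF \<mu>] integral_finite_support[OF \<nu>] sup Z mom[OF l] by metis
      then show "(\<Sum>z\<in>Z. complex_of_real (measure \<mu> {z} - measure \<nu> {z}) * z ^ l) = 0"
        by (simp add: scaleR_conv_of_real left_diff_distrib sum_subtractf)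
    qed
    then show ?thesis by simp
  qed
  show ?thesis
  proof (rule measure_eqI)
    show s: "sets \<mu> = sets \<nu>" using circle_probD(2)[OF \<mu>] circle_probD(2)[OF \<nu>] by simp
    fix A assume A: "A \<in> sets \<mu>"
    have "measure \<mu> A = (\<Sum>z\<in>Z. measure \<mu> {z} *\<^sub>R indicator A z)"
      using A integral_finite_support[OF \<mu>, of "indicator A :: _ \<Rightarrow> real"] sup Z by simp
    also have "\<dots> = (\<Sum>z\<in>Z. measure \<nu> {z} *\<^sub>R indicator A z)" using eqw by simp
    also have "\<dots> = measure \<nu> A"
      using A s integral_finite_support[OF \<nu>, of "indicator A :: _ \<Rightarrow> real"] sup Z by simp
    finally show "emeasure \<mu> A = emeasure \<nu> A" by (simp add: \<mu>.emeasure_eq_measure \<nu>.emeasure_eq_measure)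
  qed
qed

text \<open>Justifies the \<open>THE\<close> in \<open>finite_verblunsky_measure\<close>: the
  coefficients determine the last orthogonal polynomial, whose zeros are the support, and by
  orthogonality the moments up to order \<open>n\<close>, which fix the \<open>n + 1\<close>
  masses.\<close>

lemma finite_verblunsky_unique:
  assumes \<mu>: "circle_prob \<mu>" and \<nu>: "circle_prob \<nu>"
    and fin: "finite (circle_support \<mu>)" "card (circle_support \<mu>) = Suc n"
      "finite (circle_support \<nu>)" "card (circle_support \<nu>) = Suc n"
    and ver: "\<And>j. j \<le> n \<Longrightarrow> verblunsky \<mu> j = \<alpha> j" "\<And>j. j \<le> n \<Longrightarrow> verblunsky \<nu> j = \<alpha> j"
  shows "\<mu> = \<nu>"
proof -
  have op: "monic_OP \<kappa> j = szego_poly \<alpha> j \<and> orth \<kappa> j (szego_poly \<alpha> j)"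
    if "circle_prob \<kappa>" "card (circle_support \<kappa>) = Suc n" "\<And>j. j \<le> n \<Longrightarrow> verblunsky \<kappa> j = \<alpha> j" "j \<le> Suc n" for \<kappa> j
  proof -
    have "szego_poly (verblunsky \<kappa>) j = szego_poly \<alpha> j"
      by (rule szego_poly_cong) (use that in auto)
    then show ?thesis using monic_OP_eq_szego_poly[OF that(1), of j] that by simp
  qed
  have sup: "circle_support \<kappa> = {z. poly (szego_poly \<alpha> (Suc n)) z = 0}"
    if k: "circle_prob \<kappa>" "card (circle_support \<kappa>) = Suc n" "\<And>j. j \<le> n \<Longrightarrow> verblunsky \<kappa> j = \<alpha> j" "finite (circle_support \<kappa>)" for \<kappa>
  proof -
    have "szego_poly \<alpha> (Suc n) = (\<Prod>z\<in>circle_support \<kappa>. [:- z, 1:])"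
      using op[OF k(1-3), of "Suc n"] k by (simp add: monic_OP_def)
    then show ?thesis using k(4) by (auto simp: poly_prod)
  qed
  show ?thesis
  proof (rule finite_support_unique[OF \<mu> \<nu>])
    show "circle_support \<nu> = circle_support \<mu>" using sup[OF \<mu> fin(2) ver(1) fin(1)] sup[OF \<nu> fin(4) ver(2) fin(3)] by simp
    fix l assume l: "l \<le> n"
    show "(\<integral>z. z ^ l \<partial>\<mu>) = (\<integral>z. z ^ l \<partial>\<nu>)"
    proof (rule moments_unique[OF \<mu> \<nu>, where P = "szego_poly \<alpha>" and n = n])
      fix j assume "0 < j" "j \<le> n"
      then show "orth \<mu> 1 (szego_poly \<alpha> j) \<and> orth \<nu> 1 (szego_poly \<alpha> j)"
        using op[OF \<mu> fin(2) ver(1), of j] op[OF \<nu> fin(4) ver(2), of j] orth_mono[of _ j _ 1] by auto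
    qed (use lead_coeff_szego_poly l in auto)
  qed (use fin in auto)
qed

section \<open>Quadrature at the zeros of a paraorthogonal polynomial\<close>

context
  fixes \<alpha> :: "nat \<Rightarrow> complex" and n :: nat
  assumes \<alpha>: "\<And>j. j < n \<Longrightarrow> cmod (\<alpha> j) < 1" and \<beta>: "cmod (\<alpha> n) = 1"
begin

abbreviation "bsm \<equiv> bs_measure \<alpha> n"
abbreviation "ppoly \<equiv> szego_poly \<alpha> (Suc n)"

lemma circle_prob_bsm: "circle_prob bsm"
  using circle_prob_bs[of n \<alpha>] \<alpha> by blast

lemma many_points_bs: "many_points bsm k"
proof -
  have "AE z in bsm. z \<noteq> a" for a
    unfolding bs_measure_def
  proof (subst AE_density)
    show "(\<lambda>z. ennreal (1 / (cmod (poly (szego_poly \<alpha> n) z))\<^sup>2 / (\<integral>z. 1 / (cmod (poly (szego_poly \<alpha> n) z))\<^sup>2 \<partial>arc_measure))) \<in> borel_measurable arc_measure"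
      using continuous_imp_borel_measurable[OF circle_prob_arc continuous_bs_density[of n \<alpha>]] \<alpha> by measurable
  qed (use AE_arc_neq[of a] in auto)
  then show ?thesis using infinite_circle_support[OF circle_prob_bsm] by (simp add: many_points_def)
qed

text \<open>\<open>z \<Phi>\<^sub>n\<close> and \<open>\<Phi>\<^sub>n\<^sup>*\<close> are both
  orthogonal to \<open>z, ..., z\<^sup>n\<close>.\<close>

lemma ppoly_orth:
  assumes "0 < i" "i \<le> n"
  shows "L2_inner bsm (\<lambda>z. z ^ i) (poly ppoly) = 0"
proof -
  let ?p = "szego_poly \<alpha> n"
  have o: "orth bsm n ?p" using orth_bs_top[of n \<alpha>] \<alpha> by blast
  have "L2_inner bsm (\<lambda>z. z ^ i) (poly ppoly) = L2_inner bsm (\<lambda>z. z ^ i) (poly (pCons 0 ?p + Polynomial.smult (- cnj (\<alpha> n)) (szego_dual n ?p)))"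
    by (simp add: szego_step_def)
  also have "\<dots> = L2_inner bsm (\<lambda>z. z ^ i) (poly (pCons 0 ?p)) + (- cnj (\<alpha> n)) * L2_inner bsm (\<lambda>z. z ^ i) (poly (szego_dual n ?p))"
    unfolding poly_fun_add_smult by (intro L2_inner_add_right circle_prob_bsm continuous_intros)
  also have "L2_inner bsm (\<lambda>z. z ^ i) (poly (szego_dual n ?p)) = cnj (L2_inner bsm (\<lambda>z. z ^ (n - i)) (poly ?p))"
    using assms by (intro L2_inner_szego_dual[OF circle_prob_bsm]) auto
  also have "L2_inner bsm (\<lambda>z. z ^ (n - i)) (poly ?p) = 0" using assms by (intro orthD[OF o]) simp
  also have "L2_inner bsm (\<lambda>z. z ^ i) (poly (pCons 0 ?p)) = 0"
    using L2_inner_pCons[OF circle_prob_bsm, of "i - 1" ?p] orthD[OF o, of "i - 1"] assms by (simp del: power_Suc poly_pCons)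
  finally show ?thesis by simp
qed

text \<open>At a zero \<open>|z| |\<Phi>\<^sub>n| = |\<Phi>\<^sub>n\<^sup>*|\<close>, because
  \<open>|\<alpha>\<^sub>n| = 1\<close>. Outside the closed disk the left side is larger and inside
  the open disk the right side, by \<open>szego_poly_outside\<close> and
  \<open>szego_poly_inside\<close>.\<close>

lemma para_roots_circle:
  assumes "poly ppoly z = 0" shows "z \<in> sphere 0 1"
proof -
  let ?p = "poly (szego_poly \<alpha> n) z" and ?q = "poly (szego_dual n (szego_poly \<alpha> n)) z"
  have "z * ?p = cnj (\<alpha> n) * ?q" using assms by (simp add: szego_step_def)
  then have e: "cmod z * cmod ?p = cmod ?q" using \<beta> by (metis norm_mult complex_mod_cnj mult_1)
  have "\<not> cmod z > 1"
  proof
    assume z: "cmod z > 1"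
    have "?p \<noteq> 0 \<and> cmod ?q \<le> cmod ?p" by (rule szego_poly_outside) (use \<alpha> z in auto)
    moreover from this have "1 * cmod ?p < cmod z * cmod ?p" using z by (intro mult_strict_right_mono) auto
    ultimately show False using e by linarith
  qed
  moreover have "\<not> cmod z < 1"
  proof
    assume z: "cmod z < 1"
    have q: "?q \<noteq> 0 \<and> cmod ?p \<le> cmod ?q" by (rule szego_poly_inside) (use \<alpha> z in auto)
    have "cmod z * cmod ?p \<le> cmod z * cmod ?q" using q by (intro mult_left_mono) auto
    also have "\<dots> < 1 * cmod ?q" using z q by (intro mult_strict_right_mono) auto
    finally show False using e by linarith
  qed
  ultimately show ?thesis by simp
qed

text \<open>A double zero \<open>a\<close> would give \<open>\<Phi> = (z - a)\<^sup>2 q\<close>; as \<open>(z - a)\<^sup>2 = - a z |z - a|\<^sup>2\<close> on the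
  circle, \<open>\<Phi>\<close> could not be orthogonal to \<open>z q\<close>.\<close>

lemma para_no_double_root: "ppoly \<noteq> [:- a, 1:] * ([:- a, 1:] * q)"
proof
  assume eq: "ppoly = [:- a, 1:] * ([:- a, 1:] * q)"
  have "q \<noteq> 0" using eq szego_poly_nonzero[of \<alpha> "Suc n"] by auto
  have "Suc n = 1 + (1 + degree q)"
    using \<open>q \<noteq> 0\<close> degree_szego_poly[of \<alpha> "Suc n"] unfolding eq
    by (subst (asm) degree_mult_eq; (subst (asm) degree_mult_eq)?) (auto simp del: mult_pCons_left)
  then have dq: "n = Suc (degree q)" by simp
  have "poly ppoly a = 0" unfolding eq by simp
  then have a: "a \<in> sphere 0 1" by (rule para_roots_circle)
  have cq: "coeff (pCons 0 q) 0 = 0" by simp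
  have "L2_inner bsm (poly (pCons 0 q)) (poly ppoly) = (\<Sum>i\<le>degree (pCons 0 q). cnj (coeff (pCons 0 q) i) * L2_inner bsm (\<lambda>z. z ^ i) (poly ppoly))"
    by (rule L2_inner_poly_left[OF circle_prob_bsm continuous_on_poly_circle])
  also have "\<dots> = 0"
  proof (intro sum.neutral ballI)
    fix i assume "i \<in> {..degree (pCons 0 q)}"
    then have "i \<le> n" using dq \<open>q \<noteq> 0\<close> by simp
    then show "cnj (coeff (pCons 0 q) i) * L2_inner bsm (\<lambda>z. z ^ i) (poly ppoly) = 0"
      using ppoly_orth[of i] cq by (cases "i = 0") (simp_all del: szego_poly.simps)
  qed
  finally have 0: "L2_inner bsm (poly (pCons 0 q)) (poly ppoly) = 0" .
  have "L2_inner bsm (poly (pCons 0 q)) (poly ppoly) = (\<integral>z. - a * complex_of_real ((cmod (poly ([:- a, 1:] * q) z))\<^sup>2) \<partial>bsm)"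
    unfolding L2_inner_def
  proof (rule integral_circle_cong[OF circle_prob_bsm])
    fix z :: complex assume z: "z \<in> sphere 0 1"
    have *: "cnj z * (z - a)\<^sup>2 = - a * ((z - a) * cnj (z - a))"
    proof -
      have "cnj z * (z - a)\<^sup>2 = (cnj z * z) * (z - a) - a * (cnj z * z) + a * (a * cnj z)"
        by (simp add: algebra_simps power2_eq_square)
      moreover have "- a * ((z - a) * cnj (z - a)) = - a * (z * cnj z) + (a * cnj a) * z + a * (a * cnj z) - a * (a * cnj a)"
        by (simp add: algebra_simps)
      ultimately show ?thesis using circle_cnj[OF z] circle_cnj[OF a] by simp
    qed
    have "cnj (poly (pCons 0 q) z) * poly ppoly z = (cnj z * (z - a)\<^sup>2) * (poly q z * cnj (poly q z))"
      unfolding eq by (simp add: power2_eq_square algebra_simps)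
    also have "\<dots> = - a * (((z - a) * poly q z) * cnj ((z - a) * poly q z))"
      unfolding * by (simp add: mult_ac)
    also have "(z - a) * poly q z = poly ([:- a, 1:] * q) z" by (simp add: algebra_simps)
    finally show "cnj (poly (pCons 0 q) z) * poly ppoly z = - a * complex_of_real ((cmod (poly ([:- a, 1:] * q) z))\<^sup>2)"
      by (simp only: complex_norm_square)
  qed
  also have "\<dots> = - a * complex_of_real (\<integral>z. (cmod (poly ([:- a, 1:] * q) z))\<^sup>2 \<partial>bsm)"
    by (simp only: integral_mult_right_zero integral_complex_of_real)
  finally have "(\<integral>z. (cmod (poly ([:- a, 1:] * q) z))\<^sup>2 \<partial>bsm) = 0"
    using 0 a by auto
  moreover have "(\<integral>z. (cmod (poly ([:- a, 1:] * q) z))\<^sup>2 \<partial>bsm) > 0"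
    using \<open>q \<noteq> 0\<close> by (intro poly_norm_pos[OF circle_prob_bsm _ many_points_bs]) (simp del: mult_pCons_left)
  ultimately show False by simp
qed

definition "pzeros = {z. poly ppoly z = 0}"

lemma finite_pzeros: "finite pzeros"
  unfolding pzeros_def by (rule poly_roots_finite) (rule szego_poly_nonzero)

lemma pzeros_circle: "pzeros \<subseteq> sphere 0 1"
  unfolding pzeros_def using para_roots_circle by blast

lemma card_pzeros: "card pzeros = Suc n" and ppoly_eq: "ppoly = (\<Prod>z\<in>pzeros. [:- z, 1:])"
proof -
  obtain as where as: "mset as = proots ppoly" using ex_mset by blast
  have "ppoly = Polynomial.smult (lead_coeff ppoly) (\<Prod>x\<in>#proots ppoly. [:- x, 1:])"
    by (rule complex_poly_decompose_multiset[symmetric])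
  also have "\<dots> = (\<Prod>x\<in>#proots ppoly. [:- x, 1:])" by (simp only: lead_coeff_szego_poly smult_1_left)
  also have "\<dots> = (\<Prod>x\<leftarrow>as. [:- x, 1:])"
    by (subst prod_mset_prod_list[symmetric]) (simp add: as)
  finally have eq: "ppoly = (\<Prod>x\<leftarrow>as. [:- x, 1:])" .
  then have len: "length as = Suc n" using degree_linear_prod[of as] degree_szego_poly[of \<alpha> "Suc n"] by simp
  have dist: "distinct as"
  proof (rule ccontr)
    assume "\<not> distinct as"
    then obtain xs ys zs a where "as = xs @ [a] @ ys @ [a] @ zs" using not_distinct_decomp by blast
    then have "ppoly = [:- a, 1:] * ([:- a, 1:] * (\<Prod>x\<leftarrow>xs @ ys @ zs. [:- x, 1:]))"
      unfolding eq by (simp only: map_append prod_list.append list.map prod_list.Cons prod_list.Nil mult_ac mult_1_right mult_1_left)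
    then show False using para_no_double_root by blast
  qed
  have "poly (\<Prod>x\<leftarrow>xs. [:- x, 1:]) z = 0 \<longleftrightarrow> z \<in> set xs" for xs and z :: complex
    by (induction xs) (auto simp del: mult_pCons_left)
  then have Zs: "pzeros = set as" unfolding pzeros_def eq by blast
  then show "card pzeros = Suc n" using dist len by (simp add: distinct_card)
  show "ppoly = (\<Prod>z\<in>pzeros. [:- z, 1:])" unfolding eq Zs by (rule prod.distinct_set_conv_list[OF dist, symmetric])
qed

definition node_poly :: "complex \<Rightarrow> complex poly" where
  "node_poly z = (\<Prod>y\<in>pzeros - {z}. [:- y, 1:])"

lemma node_poly: "z \<in> pzeros \<Longrightarrow> degree (node_poly z) = n" "poly (node_poly z) z \<noteq> 0" "y \<in> pzeros \<Longrightarrow> y \<noteq> z \<Longrightarrow> poly (node_poly z) y = 0"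
  using finite_pzeros card_pzeros by (auto simp: node_poly_def degree_prod_sum_eq poly_prod)

text \<open>For \<open>degree s \<le> 2 * n\<close> the integrand is a trigonometric polynomial with
  exponents from \<open>-n\<close> to \<open>n\<close>, written as
  \<open>z\<^sup>-\<^sup>n s(z)\<close> so that division with remainder applies.\<close>

definition quad :: "complex poly \<Rightarrow> complex" where
  "quad s = (\<integral>w. cnj w ^ n * poly s w \<partial>bsm)"

lemma quad_add: "quad (s + t) = quad s + quad t"
proof -
  have "quad (s + t) = (\<integral>w. cnj w ^ n * poly s w + cnj w ^ n * poly t w \<partial>bsm)"
    unfolding quad_def by (simp add: distrib_left)
  also have "\<dots> = quad s + quad t"
    unfolding quad_def by (intro Bochner_Integration.integral_add integrable_continuous_circle[OF circle_prob_bsm] continuous_intros)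
  finally show ?thesis .
qed

lemma quad_smult: "quad (Polynomial.smult c s) = c * quad s"
  unfolding quad_def by (simp add: mult.left_commute)

lemma quad_sum: "quad (\<Sum>i\<in>A. f i) = (\<Sum>i\<in>A. quad (f i))"
proof (induction A rule: infinite_finite_induct)
  case (insert x A)
  then show ?case by (simp add: quad_add)
qed (simp_all add: quad_def)

lemma quad_monom_mult:
  assumes "i \<le> n"
  shows "quad (monom 1 i * s) = L2_inner bsm (\<lambda>z. z ^ (n - i)) (poly s)"
  unfolding quad_def L2_inner_def
proof (rule integral_circle_cong[OF circle_prob_bsm])
  fix w :: complex assume w: "w \<in> sphere 0 1"
  have "cnj w ^ n * poly (monom 1 i * s) w = cnj (cnj (w ^ i) * w ^ n) * poly s w"
    by (simp add: poly_monom mult_ac)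
  then show "cnj w ^ n * poly (monom 1 i * s) w = cnj (w ^ (n - i)) * poly s w"
    unfolding circle_power_cnj[OF w assms] .
qed

text \<open>The interpolatory weight; the factor \<open>z ^ n\<close> compensates the
  \<open>cnj z ^ n\<close> that \<open>quad\<close> attaches to the node value.\<close>

definition weight :: "complex \<Rightarrow> complex" where
  "weight z = z ^ n * quad (node_poly z) / poly (node_poly z) z"

text \<open>Gauss quadrature on the circle. Divide \<open>s\<close> by \<open>ppoly\<close>: the
  quotient has degree below \<open>n\<close>, so its contribution consists of inner products of
  \<open>ppoly\<close> with \<open>z, ..., z\<^sup>n\<close> and vanishes; the remainder has degree
  at most \<open>n\<close> and is its Lagrange interpolant at the \<open>n + 1\<close>
  nodes.\<close>

lemma quadrature:
  assumes "degree s \<le> 2 * n"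
  shows "quad s = (\<Sum>z\<in>pzeros. weight z * (cnj z ^ n * poly s z))"
proof -
  define q r where "q = s div ppoly" and "r = s mod ppoly"
  have s: "s = q * ppoly + r" by (simp add: q_def r_def)
  have P0: "ppoly \<noteq> 0" by (rule szego_poly_nonzero)
  have dr: "degree r \<le> n"
    using degree_mod_less'[of ppoly s] P0 degree_szego_poly[of \<alpha> "Suc n"] unfolding r_def
    by (cases "s mod ppoly = 0") (simp_all del: szego_poly.simps)
  have qP: "quad (q * ppoly) = 0"
  proof (cases "q = 0")
    case False
    have "degree (q * ppoly) = degree q + Suc n" using False P0 by (simp add: degree_mult_eq del: szego_poly.simps)
    moreover have "degree (q * ppoly) \<le> 2 * n"
    proof -
      have "q * ppoly = s - r" using s by simp
      then show ?thesis using degree_diff_le[of s "2 * n" r] assms dr by simp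
    qed
    ultimately have dq: "degree q < n" by simp
    have "quad (q * ppoly) = quad (\<Sum>i\<le>degree q. Polynomial.smult (coeff q i) (monom 1 i * ppoly))"
      by (subst (1) poly_as_sum_of_monoms[of q, symmetric])
        (simp add: sum_distrib_right smult_monom del: szego_poly.simps flip: mult_smult_left)
    also have "\<dots> = (\<Sum>i\<le>degree q. coeff q i * quad (monom 1 i * ppoly))"
      by (simp only: quad_sum quad_smult)
    also have "\<dots> = 0"
      using dq by (intro sum.neutral) (auto simp: quad_monom_mult ppoly_orth simp del: szego_poly.simps)
    finally show ?thesis .
  qed (simp add: quad_def)
  define L where "L = (\<Sum>z\<in>pzeros. Polynomial.smult (poly r z / poly (node_poly z) z) (node_poly z))"
  have ry: "poly r y = poly L y" if y: "y \<in> pzeros" for y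
  proof -
    have "poly L y = (\<Sum>z\<in>pzeros. poly r z / poly (node_poly z) z * poly (node_poly z) y)" by (simp add: L_def poly_sum)
    also have "\<dots> = (\<Sum>z\<in>pzeros. if z = y then poly r y else 0)"
      using y node_poly by (intro sum.cong) auto
    finally show ?thesis using y finite_pzeros by simp
  qed
  have "degree L \<le> n"
    unfolding L_def
  proof (rule degree_sum_le[OF finite_pzeros])
    fix z assume "z \<in> pzeros"
    then show "degree (Polynomial.smult (poly r z / poly (node_poly z) z) (node_poly z)) \<le> n"
      using node_poly(1)[of z] degree_smult_le[of _ "node_poly z"] by simp
  qed
  then have "r = L" using ry dr card_pzeros by (intro poly_eqI_degree[of pzeros]) auto
  then have "quad r = quad L" by simp
  also have "\<dots> = (\<Sum>z\<in>pzeros. poly r z / poly (node_poly z) z * quad (node_poly z))"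
    unfolding L_def quad_sum quad_smult ..
  also have "\<dots> = (\<Sum>z\<in>pzeros. weight z * (cnj z ^ n * poly s z))"
  proof (rule sum.cong[OF refl])
    fix z assume z: "z \<in> pzeros"
    have "poly s z = poly r z" using z unfolding s pzeros_def by simp
    moreover have "z ^ n * cnj z ^ n = 1" using circle_cnj[of z] z pzeros_circle by (auto simp flip: power_mult_distrib)
    ultimately have "weight z * (cnj z ^ n * poly s z) = (z ^ n * cnj z ^ n) * (quad (node_poly z) * poly r z / poly (node_poly z) z)"
      unfolding weight_def by (simp add: mult_ac)
    then show "poly r z / poly (node_poly z) z * quad (node_poly z) = weight z * (cnj z ^ n * poly s z)"
      using \<open>z ^ n * cnj z ^ n = 1\<close> by simp
  qed
  finally show ?thesis using qP quad_add[of "q * ppoly" r] s by simp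
qed

definition rweight :: "complex \<Rightarrow> real" where
  "rweight z = (\<integral>w. (cmod (poly (node_poly z) w))\<^sup>2 \<partial>bsm) / (cmod (poly (node_poly z) z))\<^sup>2"

text \<open>The quadrature is exact for \<open>|l|\<^sup>2\<close> with \<open>l\<close> the node
  polynomial, since this is \<open>z\<^sup>-\<^sup>n l l\<^sup>*\<close> on the circle. Only the
  node \<open>z\<close> contributes, which expresses the weight by a positive integral.\<close>

lemma weight_eq:
  assumes z: "z \<in> pzeros"
  shows "weight z = of_real (rweight z)" "rweight z > 0"
proof -
  let ?l = "node_poly z" and ?s = "node_poly z * szego_dual n (node_poly z)"
  have dl: "degree ?l \<le> n" using node_poly(1)[OF z] by simp
  have sq: "cnj w ^ n * poly ?s w = of_real ((cmod (poly ?l w))\<^sup>2)" if w: "w \<in> sphere 0 1" for w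
  proof -
    have "cnj w ^ n * poly ?s w = (cnj w * w) ^ n * (poly ?l w * cnj (poly ?l w))"
      by (simp add: poly_szego_dual_circle[OF dl w] power_mult_distrib mult_ac)
    then show ?thesis using circle_cnj[OF w] by (simp only: complex_norm_square) simp
  qed
  have "of_real (\<integral>w. (cmod (poly ?l w))\<^sup>2 \<partial>bsm) = quad ?s"
    unfolding quad_def integral_complex_of_real[symmetric]
    by (rule integral_circle_cong[OF circle_prob_bsm]) (rule sq[symmetric])
  also have "degree ?s \<le> n + n"
    by (rule order_trans[OF degree_mult_le add_mono[OF dl degree_szego_dual]])
  then have "quad ?s = (\<Sum>y\<in>pzeros. weight y * (cnj y ^ n * poly ?s y))"
    by (intro quadrature) simp
  also have "\<dots> = (\<Sum>y\<in>{z}. weight y * (cnj y ^ n * poly ?s y))"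
    using z finite_pzeros node_poly(3) by (intro sum.mono_neutral_right) auto
  also have "\<dots> = weight z * of_real ((cmod (poly ?l z))\<^sup>2)"
    using sq[of z] z pzeros_circle by auto
  finally show "weight z = of_real (rweight z)"
    using node_poly(2)[of z] by (simp add: rweight_def field_simps)
  have "?l \<noteq> 0" using node_poly(2)[of z] by auto
  then show "rweight z > 0"
    unfolding rweight_def using node_poly(2)[of z] poly_norm_pos[OF circle_prob_bsm _ many_points_bs] by (intro divide_pos_pos) auto
qed

section \<open>The quadrature measure and its coefficients\<close>

definition quad_measure :: "complex measure" where
  "quad_measure = distr (point_measure pzeros (\<lambda>z. ennreal (rweight z))) circle_borel (\<lambda>z. z)"

lemma id_measurable_pzeros: "(\<lambda>z. z) \<in> measurable (point_measure pzeros f) circle_borel"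
  using pzeros_circle by (auto simp: measurable_def space_point_measure sets_point_measure)

lemma emeasure_quad_measure:
  assumes "A \<in> sets circle_borel"
  shows "emeasure quad_measure A = ennreal (\<Sum>z\<in>A \<inter> pzeros. rweight z)"
proof -
  have "emeasure quad_measure A = emeasure (point_measure pzeros (\<lambda>z. ennreal (rweight z))) (A \<inter> pzeros)"
    unfolding quad_measure_def using assms id_measurable_pzeros
    by (subst emeasure_distr) (auto simp: space_point_measure)
  also have "\<dots> = (\<Sum>z\<in>A \<inter> pzeros. ennreal (rweight z))"
    using finite_pzeros by (subst emeasure_point_measure_finite) auto
  also have "\<dots> = ennreal (\<Sum>z\<in>A \<inter> pzeros. rweight z)"
    using weight_eq(2) by (intro sum_ennreal) (auto intro: less_imp_le)
  finally show ?thesis .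
qed

lemma integral_quad_measure:
  fixes f :: "complex \<Rightarrow> complex"
  assumes "continuous_on (sphere 0 1) f"
  shows "(\<integral>z. f z \<partial>quad_measure) = (\<Sum>z\<in>pzeros. rweight z *\<^sub>R f z)"
  unfolding quad_measure_def
  using integral_distr[OF id_measurable_pzeros continuous_imp_borel_measurable_circle[OF assms]]
    lebesgue_integral_point_measure_finite[OF finite_pzeros, of rweight f] weight_eq(2)
  by (simp add: less_imp_le)

lemma quad_quad_measure:
  assumes "degree s \<le> 2 * n"
  shows "(\<integral>z. cnj z ^ n * poly s z \<partial>quad_measure) = quad s"
proof -
  have "(\<integral>z. cnj z ^ n * poly s z \<partial>quad_measure) = (\<Sum>z\<in>pzeros. rweight z *\<^sub>R (cnj z ^ n * poly s z))"
    by (intro integral_quad_measure continuous_intros)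
  also have "\<dots> = quad s"
    unfolding quadrature[OF assms] using weight_eq(1) by (intro sum.cong) (simp_all add: scaleR_conv_of_real)
  finally show ?thesis .
qed

lemma sum_rweight: "(\<Sum>z\<in>pzeros. rweight z) = 1"
proof -
  have "(\<Sum>z\<in>pzeros. weight z * (cnj z ^ n * poly (monom 1 n * 1) z)) = quad (monom 1 n * 1)"
    by (rule quadrature[symmetric]) (simp add: degree_monom_eq)
  also have "\<dots> = (\<integral>z. 1 \<partial>bsm)" by (subst quad_monom_mult) (simp_all add: L2_inner_def del: mult_1_right)
  also have "\<dots> = 1" by (rule integral_circle_const[OF circle_prob_bsm])
  also have "(\<Sum>z\<in>pzeros. weight z * (cnj z ^ n * poly (monom 1 n * 1) z)) = (\<Sum>z\<in>pzeros. of_real (rweight z))"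
  proof (rule sum.cong[OF refl])
    fix z assume z: "z \<in> pzeros"
    have "cnj z ^ n * z ^ n = 1" using circle_cnj[of z] z pzeros_circle by (auto simp flip: power_mult_distrib)
    then show "weight z * (cnj z ^ n * poly (monom 1 n * 1) z) = of_real (rweight z)"
      using weight_eq(1)[OF z] by (simp add: poly_monom)
  qed
  finally have "complex_of_real (\<Sum>z\<in>pzeros. rweight z) = 1" by simp
  then show ?thesis by (simp only: of_real_eq_1_iff)
qed

lemma circle_prob_quad_measure: "circle_prob quad_measure"
proof -
  have "emeasure quad_measure (space quad_measure) = 1"
  proof -
    have "space quad_measure = sphere 0 1" by (simp add: quad_measure_def)
    moreover have "sphere 0 1 \<in> sets circle_borel" by (metis sets.top space_circle_borel)
    moreover have "sphere 0 1 \<inter> pzeros = pzeros" using pzeros_circle by blast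
    ultimately show ?thesis using emeasure_quad_measure[of "sphere 0 1"] sum_rweight by simp
  qed
  then show ?thesis by (auto simp: circle_prob_def quad_measure_def intro!: prob_spaceI)
qed

lemma support_quad_measure: "circle_support quad_measure = pzeros"
proof -
  have os: "U \<inter> sphere 0 1 \<in> sets circle_borel" if "open U" for U
    using that by (auto simp: circle_borel_def sets_restrict_space)
  have e: "emeasure quad_measure (U \<inter> sphere 0 1) = ennreal (\<Sum>z\<in>U \<inter> pzeros. rweight z)" if "open U" for U
  proof -
    have "U \<inter> sphere 0 1 \<inter> pzeros = U \<inter> pzeros" using pzeros_circle by blast
    then show ?thesis using emeasure_quad_measure[OF os[OF that]] by simp
  qed
  show ?thesis
  proof (intro equalityI subsetI)
    fix z assume z: "z \<in> circle_support quad_measure"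
    show "z \<in> pzeros"
    proof (rule ccontr)
      assume "z \<notin> pzeros"
      have o: "open (- pzeros)" using finite_pzeros by (simp add: finite_imp_closed open_Compl)
      then have "emeasure quad_measure (- pzeros \<inter> sphere 0 1) > 0" using z \<open>z \<notin> pzeros\<close> by (auto simp: circle_support_def)
      then show False using e[OF o] by simp
    qed
  next
    fix z assume z: "z \<in> pzeros"
    have "emeasure quad_measure (U \<inter> sphere 0 1) > 0" if U: "open U" "z \<in> U" for U
    proof -
      have "(\<Sum>y\<in>U \<inter> pzeros. rweight y) > 0"
        using finite_pzeros z U weight_eq(2) by (intro sum_pos) auto
      then show ?thesis using e[OF U(1)] by simp
    qed
    then show "z \<in> circle_support quad_measure" using z pzeros_circle by (auto simp: circle_support_def)
  qed
qed

text \<open>For \<open>i < j \<le> n\<close> the product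
  \<open>z\<^sup>-\<^sup>i \<Phi>\<^sub>j\<close> is within the exactness range, so orthogonality
  carries over from \<open>bsm\<close>; for \<open>j = n + 1\<close> the polynomial vanishes at all
  nodes.\<close>

lemma orth_quad_measure:
  assumes "j \<le> Suc n" shows "orth quad_measure j (szego_poly \<alpha> j)"
proof (cases "j = Suc n")
  case True
  have "L2_inner quad_measure (\<lambda>z. z ^ i) (poly ppoly) = 0" for i
  proof -
    have "L2_inner quad_measure (\<lambda>z. z ^ i) (poly ppoly) = (\<Sum>z\<in>pzeros. rweight z *\<^sub>R (cnj (z ^ i) * poly ppoly z))"
      unfolding L2_inner_def by (intro integral_quad_measure continuous_intros)
    also have "\<dots> = 0" by (intro sum.neutral) (simp add: pzeros_def del: szego_poly.simps)
    finally show ?thesis .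
  qed
  then show ?thesis unfolding True orth_def by blast
next
  case False
  then have j: "j \<le> n" using assms by simp
  show ?thesis unfolding orth_def
  proof (intro allI impI)
    fix i assume i: "i < j"
    let ?s = "monom 1 (n - i) * szego_poly \<alpha> j"
    have d: "degree ?s \<le> 2 * n"
      using i j degree_mult_le[of "monom 1 (n - i) :: complex poly" "szego_poly \<alpha> j"] by (simp add: degree_monom_eq)
    have "L2_inner quad_measure (\<lambda>z. z ^ i) (poly (szego_poly \<alpha> j)) = (\<integral>z. cnj z ^ n * poly ?s z \<partial>quad_measure)"
      unfolding L2_inner_def
    proof (rule integral_circle_cong[OF circle_prob_quad_measure])
      fix z :: complex assume z: "z \<in> sphere 0 1"
      have "cnj (cnj (z ^ (n - i)) * z ^ n) = cnj (z ^ i)"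
        using circle_power_cnj[OF z, of "n - i" n] i j by simp
      then show "cnj (z ^ i) * poly (szego_poly \<alpha> j) z = cnj z ^ n * poly ?s z"
        by (simp add: poly_monom mult_ac)
    qed
    also have "\<dots> = quad ?s" by (rule quad_quad_measure[OF d])
    also have "\<dots> = L2_inner bsm (\<lambda>z. z ^ (n - (n - i))) (poly (szego_poly \<alpha> j))"
      by (rule quad_monom_mult) simp
    also have "n - (n - i) = i" using i j by simp
    also have "L2_inner bsm (\<lambda>z. z ^ i) (poly (szego_poly \<alpha> j)) = 0"
      using orth_bs[of n \<alpha> j] \<alpha> j i by (intro orthD) auto
    finally show "L2_inner quad_measure (\<lambda>z. z ^ i) (poly (szego_poly \<alpha> j)) = 0" .
  qed
qed

lemma verblunsky_quad_measure:
  assumes "j \<le> n" shows "verblunsky quad_measure j = \<alpha> j"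
proof -
  have m: "monic_OP quad_measure j = szego_poly \<alpha> j" if "j \<le> Suc n" for j
    using that card_pzeros lead_coeff_szego_poly[of \<alpha> j]
    by (intro monic_OP_eq[OF circle_prob_quad_measure _ _ orth_quad_measure]) (auto simp: support_quad_measure)
  show ?thesis
    using assms lead_coeff_szego_poly[of \<alpha> j] by (intro verblunsky_eq) (simp_all add: m)
qed

lemma finite_verblunsky_measure_eq: "finite_verblunsky_measure (Suc n) \<alpha> = quad_measure"
  unfolding finite_verblunsky_measure_def
proof (rule the_equality)
  show "circle_prob quad_measure \<and> finite (circle_support quad_measure) \<and> card (circle_support quad_measure) = Suc n
      \<and> (\<forall>j<Suc n. verblunsky quad_measure j = \<alpha> j)"
    using circle_prob_quad_measure finite_pzeros card_pzeros verblunsky_quad_measure by (simp add: support_quad_measure)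
  fix \<mu> assume \<mu>: "circle_prob \<mu> \<and> finite (circle_support \<mu>) \<and> card (circle_support \<mu>) = Suc n \<and> (\<forall>j<Suc n. verblunsky \<mu> j = \<alpha> j)"
  show "\<mu> = quad_measure"
    by (rule finite_verblunsky_unique[where n = n and \<alpha> = \<alpha>])
      (use \<mu> circle_prob_quad_measure finite_pzeros card_pzeros verblunsky_quad_measure in \<open>auto simp: support_quad_measure\<close>)
qed

end

lemma finite_verblunsky_measure:
  assumes "\<And>j. j < n \<Longrightarrow> cmod (\<alpha> j) < 1" "cmod (\<alpha> n) = 1"
  obtains Z where "circle_prob (finite_verblunsky_measure (Suc n) \<alpha>)" "circle_support (finite_verblunsky_measure (Suc n) \<alpha>) = Z"
    "finite Z" "card Z = Suc n" "Z \<subseteq> sphere 0 1" "szego_poly \<alpha> (Suc n) = (\<Prod>z\<in>Z. [:- z, 1:])"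
  using finite_verblunsky_measure_eq[of n \<alpha>] circle_prob_quad_measure[of n \<alpha>] support_quad_measure[of n \<alpha>]
    finite_pzeros[of n \<alpha>] card_pzeros[of n \<alpha>] pzeros_circle[of n \<alpha>] ppoly_eq[of n \<alpha>] assms by metis

section \<open>Traces of CMV matrices\<close>

definition cmv_low :: "nat \<Rightarrow> int" where "cmv_low n = - int (n div 2)"

text \<open>The first \<open>n + 1\<close> functions of the basis span \<open>z\<^sup>l p(z)\<close> with \<open>l = cmv_low n\<close> and
  \<open>degree p \<le> n\<close>; the last of them adds the coefficient of \<open>p\<close> at \<open>cmv_new n\<close>.\<close>

definition cmv_new :: "nat \<Rightarrow> nat" where "cmv_new n = (if odd n then n else 0)"

definition cmv_rep :: "nat \<Rightarrow> (complex \<Rightarrow> complex) \<Rightarrow> complex poly \<Rightarrow> bool" where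
  "cmv_rep n f p \<longleftrightarrow> degree p \<le> n \<and> (\<forall>z\<in>sphere 0 1. f z = z powi cmv_low n * poly p z)"

lemma cmv_rep_exponent: "cmv_rep n (\<lambda>z. z powi cmv_exponent n) (monom 1 (cmv_new n))"
proof -
  have "z powi cmv_exponent n = z powi cmv_low n * z ^ cmv_new n" if "z \<in> sphere 0 1" for z :: complex
  proof -
    have z: "z \<noteq> 0" using that by auto
    have "cmv_exponent n = cmv_low n + int (cmv_new n)"
      by (auto simp: cmv_exponent_def cmv_low_def cmv_new_def elim: oddE)
    then show ?thesis using z by (simp add: power_int_add)
  qed
  then show ?thesis unfolding cmv_rep_def
    by (auto simp: poly_monom cmv_new_def degree_monom_eq)
qed

text \<open>For even \<open>n\<close> the next function adds a power at the top, where
  \<open>p\<close> has no coefficient; for odd \<open>n\<close> it adds one at the bottom, and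
  multiplying \<open>p\<close> by \<open>z\<close> frees the coefficient at 0.\<close>

lemma cmv_rep_Suc:
  assumes "cmv_rep n f p"
  obtains q where "cmv_rep (Suc n) f q" "coeff q (cmv_new (Suc n)) = 0"
proof (cases "even n")
  case True
  then have "cmv_low (Suc n) = cmv_low n" by (simp add: cmv_low_def)
  moreover have "coeff p (Suc n) = 0" using assms by (intro coeff_eq_0) (simp add: cmv_rep_def)
  ultimately show ?thesis using that[of p] assms True by (simp add: cmv_rep_def cmv_new_def)
next
  case False
  then have "cmv_low (Suc n) = cmv_low n - 1" by (auto simp: cmv_low_def elim: oddE)
  moreover have "z powi cmv_low n * poly p z = z powi (cmv_low n - 1) * poly (pCons 0 p) z"
    if "z \<in> sphere 0 1" for z
  proof -
    have "z powi cmv_low n = z powi (cmv_low n - 1) * z" using that by (subst power_int_diff) auto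
    then show ?thesis by simp
  qed
  moreover have "degree (pCons 0 p) \<le> Suc n"
    using assms degree_pCons_le[of 0 p] by (simp add: cmv_rep_def)
  ultimately have "cmv_rep (Suc n) f (pCons 0 p)"
    using assms unfolding cmv_rep_def by (simp del: poly_pCons)
  then show ?thesis using that[of "pCons 0 p"] False by (simp add: cmv_new_def)
qed

lemma cmv_rep_mono:
  assumes "i \<le> n" "cmv_rep i f p"
  shows "\<exists>q. cmv_rep n f q"
  using assms
proof (induction n rule: dec_induct)
  case (step n)
  then show ?case using cmv_rep_Suc by metis
qed auto

lemma cmv_rep_less:
  assumes "i < n" "cmv_rep i f p"
  shows "\<exists>q. cmv_rep n f q \<and> coeff q (cmv_new n) = 0"
proof -
  obtain m where m: "n = Suc m" "i \<le> m" using assms(1) by (cases n) auto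
  then show ?thesis using cmv_rep_mono[OF m(2) assms(2)] cmv_rep_Suc by metis
qed

lemma cmv_rep_combine:
  assumes "cmv_rep n f p" "finite I" "\<And>i. i \<in> I \<Longrightarrow> cmv_rep n (g i) (q i)"
  shows "cmv_rep n (\<lambda>z. f z - (\<Sum>i\<in>I. c i * g i z)) (p - (\<Sum>i\<in>I. Polynomial.smult (c i) (q i)))"
proof -
  have "degree (\<Sum>i\<in>I. Polynomial.smult (c i) (q i)) \<le> n"
    using assms(3) by (intro degree_sum_le[OF assms(2)]) (auto simp: cmv_rep_def intro: degree_smult_le[THEN order_trans])
  then show ?thesis using assms
    by (auto simp: cmv_rep_def poly_sum sum_distrib_left algebra_simps intro!: degree_diff_le sum.cong)
qed

lemma cmv_rep_scale: "cmv_rep n f p \<Longrightarrow> cmv_rep n (\<lambda>z. f z / c) (Polynomial.smult (1 / c) p)"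
  by (auto simp: cmv_rep_def intro: degree_smult_le[THEN order_trans])

definition cmv_residual :: "complex measure \<Rightarrow> nat \<Rightarrow> complex \<Rightarrow> complex" where
  "cmv_residual \<mu> n z = z powi cmv_exponent n
     - (\<Sum>i<n. L2_inner \<mu> (cmv_basis \<mu> i) (\<lambda>z. z powi cmv_exponent n) * cmv_basis \<mu> i z)"

lemma cmv_basis_eq:
  "cmv_basis \<mu> n = (\<lambda>z. cmv_residual \<mu> n z / csqrt (L2_inner \<mu> (cmv_residual \<mu> n) (cmv_residual \<mu> n)))"
  by (subst cmv_basis.simps) (simp add: Let_def cmv_residual_def[abs_def])

text \<open>The earlier basis functions have coefficient 0 at the new exponent, so subtracting them
  leaves it at 1. The residual thus comes from a nonzero polynomial, and Gram-Schmidt does not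
  degenerate.\<close>

lemma cmv_residual_rep:
  "\<exists>p. cmv_rep n (cmv_residual \<mu> n) p \<and> coeff p (cmv_new n) = 1"
proof (induction n rule: less_induct)
  case (less n)
  have "\<exists>q. cmv_rep n (cmv_basis \<mu> i) q \<and> coeff q (cmv_new n) = 0" if "i < n" for i
    using less[OF that] cmv_rep_less[OF that] cmv_rep_scale unfolding cmv_basis_eq[of \<mu> i] by metis
  then obtain q where q: "\<And>i. i < n \<Longrightarrow> cmv_rep n (cmv_basis \<mu> i) (q i)" "\<And>i. i < n \<Longrightarrow> coeff (q i) (cmv_new n) = 0"
    by metis
  let ?c = "\<lambda>i. L2_inner \<mu> (cmv_basis \<mu> i) (\<lambda>z. z powi cmv_exponent n)"
  have "cmv_rep n (\<lambda>z. z powi cmv_exponent n - (\<Sum>i\<in>{..<n}. ?c i * cmv_basis \<mu> i z))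
      (monom 1 (cmv_new n) - (\<Sum>i\<in>{..<n}. Polynomial.smult (?c i) (q i)))"
    using q by (intro cmv_rep_combine cmv_rep_exponent) auto
  moreover have "coeff (monom 1 (cmv_new n) - (\<Sum>i\<in>{..<n}. Polynomial.smult (?c i) (q i))) (cmv_new n) = 1"
    using q by (simp add: coeff_sum)
  ultimately show ?case unfolding cmv_residual_def[abs_def] by blast
qed

lemma continuous_cmv_residual: "continuous_on (sphere 0 1) (cmv_residual \<mu> n)"
proof -
  obtain p where "cmv_rep n (cmv_residual \<mu> n) p" using cmv_residual_rep by blast
  then have "continuous_on (sphere 0 1) (cmv_residual \<mu> n) \<longleftrightarrow> continuous_on (sphere 0 1) (\<lambda>z. z powi cmv_low n * poly p z)"
    by (intro continuous_on_cong) (auto simp: cmv_rep_def)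
  moreover have "continuous_on (sphere 0 1) (\<lambda>z. z powi cmv_low n * poly p z)"
    by (intro continuous_intros) auto
  ultimately show ?thesis by simp
qed

lemma continuous_cmv_basis: "continuous_on (sphere 0 1) (cmv_basis \<mu> n)"
  unfolding cmv_basis_eq divide_inverse by (intro continuous_on_mult_right continuous_cmv_residual)

lemma continuous_cmv_exponent: "continuous_on (sphere 0 1) (\<lambda>z::complex. z powi l)"
  by (intro continuous_intros) auto

section \<open>Orthonormality of the CMV basis\<close>

context
  fixes \<mu> :: "complex measure" and N :: nat
  assumes \<mu>: "circle_prob \<mu>" and N: "many_points \<mu> (N - 1)" "N > 0"
begin

text \<open>The power of \<open>z\<close> in \<open>cmv_rep\<close> has modulus 1 on the circle, so
  this is the norm of a nonzero polynomial whose degree is below the number of support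
  points.\<close>

lemma cmv_norm_pos:
  assumes n: "n < N"
  shows "(\<integral>z. (cmod (cmv_residual \<mu> n z))\<^sup>2 \<partial>\<mu>) > 0"
proof -
  obtain p where p: "cmv_rep n (cmv_residual \<mu> n) p" "coeff p (cmv_new n) = 1" using cmv_residual_rep by blast
  have "p \<noteq> 0" using p(2) by auto
  have "(\<integral>z. (cmod (cmv_residual \<mu> n z))\<^sup>2 \<partial>\<mu>) = (\<integral>z. (cmod (poly p z))\<^sup>2 \<partial>\<mu>)"
    using p(1) by (intro integral_circle_cong[OF \<mu>]) (simp add: cmv_rep_def norm_mult norm_power_int)
  moreover have "many_points \<mu> (degree p)"
    using p(1) n N by (auto simp: many_points_def cmv_rep_def)
  ultimately show ?thesis using poly_norm_pos[OF \<mu> \<open>p \<noteq> 0\<close>] by simp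
qed

lemma L2_inner_sum_right:
  assumes "continuous_on (sphere 0 1) f" "finite I" "\<And>i. i \<in> I \<Longrightarrow> continuous_on (sphere 0 1) (g i)" "continuous_on (sphere 0 1) e"
  shows "L2_inner \<mu> f (\<lambda>z. e z - (\<Sum>i\<in>I. c i * g i z)) = L2_inner \<mu> f e - (\<Sum>i\<in>I. c i * L2_inner \<mu> f (g i))"
proof -
  have i: "integrable \<mu> (\<lambda>z. c i * (cnj (f z) * g i z))" if "i \<in> I" for i
    using that by (intro integrable_continuous_circle[OF \<mu>] continuous_intros assms)
  have ie: "integrable \<mu> (\<lambda>z. cnj (f z) * e z)"
    by (intro integrable_continuous_circle[OF \<mu>] continuous_intros assms)
  have "L2_inner \<mu> f (\<lambda>z. e z - (\<Sum>i\<in>I. c i * g i z)) = (\<integral>z. cnj (f z) * e z - (\<Sum>i\<in>I. c i * (cnj (f z) * g i z)) \<partial>\<mu>)"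
    unfolding L2_inner_def by (simp add: right_diff_distrib sum_distrib_left mult.left_commute)
  also have "\<dots> = (\<integral>z. cnj (f z) * e z \<partial>\<mu>) - (\<integral>z. (\<Sum>i\<in>I. c i * (cnj (f z) * g i z)) \<partial>\<mu>)"
    using i ie by (intro Bochner_Integration.integral_diff Bochner_Integration.integrable_sum) auto
  also have "(\<integral>z. (\<Sum>i\<in>I. c i * (cnj (f z) * g i z)) \<partial>\<mu>) = (\<Sum>i\<in>I. \<integral>z. c i * (cnj (f z) * g i z) \<partial>\<mu>)"
    using i by (intro Bochner_Integration.integral_sum) auto
  finally show ?thesis unfolding L2_inner_def by simp
qed

lemma cmv_orthonormal_le:
  "n < N \<Longrightarrow> i \<le> n \<Longrightarrow> L2_inner \<mu> (cmv_basis \<mu> i) (cmv_basis \<mu> n) = (if i = n then 1 else 0)"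
proof (induction n arbitrary: i rule: less_induct)
  case (less n)
  define R where "R = (\<integral>z. (cmod (cmv_residual \<mu> n z))\<^sup>2 \<partial>\<mu>)"
  have R: "R > 0" unfolding R_def by (rule cmv_norm_pos[OF less.prems(1)])
  have rr: "L2_inner \<mu> (cmv_residual \<mu> n) (cmv_residual \<mu> n) = of_real R"
    unfolding R_def by (rule L2_inner_self)
  have s: "csqrt (of_real R) = of_real (sqrt R)" using R by simp
  have b: "cmv_basis \<mu> n = (\<lambda>z. cmv_residual \<mu> n z / of_real (sqrt R))"
    unfolding cmv_basis_eq rr s ..
  show ?case
  proof (cases "i = n")
    case True
    have "L2_inner \<mu> (cmv_basis \<mu> n) (cmv_basis \<mu> n) = of_real (\<integral>z. (cmod (cmv_residual \<mu> n z / of_real (sqrt R)))\<^sup>2 \<partial>\<mu>)"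
      unfolding b by (rule L2_inner_self)
    also have "(\<integral>z. (cmod (cmv_residual \<mu> n z / of_real (sqrt R)))\<^sup>2 \<partial>\<mu>) = (\<integral>z. (cmod (cmv_residual \<mu> n z))\<^sup>2 / R \<partial>\<mu>)"
      using R by (intro integral_circle_cong[OF \<mu>]) (simp add: norm_divide power_divide)
    also have "\<dots> = 1" using R by (simp add: R_def[symmetric])
    finally show ?thesis using True by simp
  next
    case False
    then have i: "i < n" using less.prems by simp
    have "L2_inner \<mu> (cmv_basis \<mu> i) (cmv_residual \<mu> n)
      = L2_inner \<mu> (cmv_basis \<mu> i) (\<lambda>z. z powi cmv_exponent n)
        - (\<Sum>k<n. L2_inner \<mu> (cmv_basis \<mu> k) (\<lambda>z. z powi cmv_exponent n) * L2_inner \<mu> (cmv_basis \<mu> i) (cmv_basis \<mu> k))"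
      unfolding cmv_residual_def[abs_def]
      by (intro L2_inner_sum_right continuous_cmv_basis continuous_cmv_exponent) simp
    also have "(\<Sum>k<n. L2_inner \<mu> (cmv_basis \<mu> k) (\<lambda>z. z powi cmv_exponent n) * L2_inner \<mu> (cmv_basis \<mu> i) (cmv_basis \<mu> k))
      = (\<Sum>k<n. if k = i then L2_inner \<mu> (cmv_basis \<mu> i) (\<lambda>z. z powi cmv_exponent n) else 0)"
    proof (rule sum.cong[OF refl])
      fix k assume k: "k \<in> {..<n}"
      have "L2_inner \<mu> (cmv_basis \<mu> i) (cmv_basis \<mu> k) = (if k = i then 1 else 0)"
      proof (cases "i \<le> k")
        case True
        then show ?thesis using less.IH[of k i] k less.prems by auto
      next
        case False
        then have "L2_inner \<mu> (cmv_basis \<mu> k) (cmv_basis \<mu> i) = 0" using less.IH[of i k] i less.prems by auto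
        then show ?thesis using False L2_inner_commute[of \<mu> "cmv_basis \<mu> i" "cmv_basis \<mu> k"] by simp
      qed
      then show "L2_inner \<mu> (cmv_basis \<mu> k) (\<lambda>z. z powi cmv_exponent n) * L2_inner \<mu> (cmv_basis \<mu> i) (cmv_basis \<mu> k)
        = (if k = i then L2_inner \<mu> (cmv_basis \<mu> i) (\<lambda>z. z powi cmv_exponent n) else 0)" by simp
    qed
    also have "\<dots> = L2_inner \<mu> (cmv_basis \<mu> i) (\<lambda>z. z powi cmv_exponent n)" using i by simp
    finally have "L2_inner \<mu> (cmv_basis \<mu> i) (cmv_residual \<mu> n) = 0" by simp
    then show ?thesis using False unfolding b L2_inner_def by simp
  qed
qed

lemma cmv_orthonormal:
  assumes "i < N" "j < N"
  shows "L2_inner \<mu> (cmv_basis \<mu> i) (cmv_basis \<mu> j) = (if i = j then 1 else 0)"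
proof (cases "i \<le> j")
  case True
  then show ?thesis using cmv_orthonormal_le assms by simp
next
  case False
  then have "L2_inner \<mu> (cmv_basis \<mu> j) (cmv_basis \<mu> i) = 0" using cmv_orthonormal_le[of i j] assms by simp
  then show ?thesis using False L2_inner_commute[of \<mu> "cmv_basis \<mu> i" "cmv_basis \<mu> j"] by auto
qed

end

text \<open>Functional calculus: \<open>A * D f * B\<close> is multiplicative in \<open>f\<close>
  because \<open>B * A\<close> is the identity, so powers and inverses act on the diagonal
  entries.\<close>

lemma mat_powi_conj:
  fixes A B :: "complex mat"
  assumes A: "A \<in> carrier_mat N N" and B: "B \<in> carrier_mat N N" and AB: "A * B = 1\<^sub>m N"
    and \<zeta>: "\<And>k. k < N \<Longrightarrow> \<zeta> k \<noteq> 0"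
  defines "D \<equiv> \<lambda>f. mat N N (\<lambda>(i, j). if i = j then f (\<zeta> i :: complex) else (0 :: complex))"
  shows "mat_powi (A * D (\<lambda>z. z) * B) l = A * D (\<lambda>z. z powi l) * B"
proof -
  have BA: "B * A = 1\<^sub>m N" by (rule mat_mult_left_right_inverse[OF A B AB])
  have D: "D f \<in> carrier_mat N N" for f by (simp add: D_def)
  have DD: "D f * D g = D (\<lambda>z. f z * g z)" for f g
  proof (rule eq_matI)
    fix i j assume "i < dim_row (D (\<lambda>z. f z * g z))" "j < dim_col (D (\<lambda>z. f z * g z))"
    then have ij: "i < N" "j < N" by (simp_all add: D_def)
    have "(D f * D g) $$ (i, j) = (\<Sum>k<N. (if i = k then f (\<zeta> i) else 0) * (if k = j then g (\<zeta> k) else 0))"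
      using ij by (simp add: D_def scalar_prod_def atLeast0LessThan)
    also have "\<dots> = (\<Sum>k<N. if k = i then (if i = j then f (\<zeta> i) * g (\<zeta> i) else 0) else 0)"
      by (intro sum.cong) auto
    also have "\<dots> = D (\<lambda>z. f z * g z) $$ (i, j)" using ij by (simp add: D_def)
    finally show "(D f * D g) $$ (i, j) = D (\<lambda>z. f z * g z) $$ (i, j)" .
  qed (simp_all add: D_def)
  define E where "E f = A * D f * B" for f
  have AD: "A * D f \<in> carrier_mat N N" for f by (rule mult_carrier_mat[OF A D])
  have E: "E f \<in> carrier_mat N N" for f unfolding E_def by (rule mult_carrier_mat[OF AD B])
  have EE: "E f * E g = E (\<lambda>z. f z * g z)" for f g
  proof -
    have "E f * E g = A * D f * (B * E g)"
      using assoc_mult_mat[OF AD B E[of g], of f] unfolding E_def[of f] .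
    also have "B * E g = B * (A * D g) * B"
      using assoc_mult_mat[OF B AD B, of g] unfolding E_def[of g] by simp
    also have "B * (A * D g) = B * A * D g" by (rule assoc_mult_mat[OF B A D, symmetric])
    also have "\<dots> * B = D g * B" unfolding BA using D[of g] by simp
    also have "A * D f * (D g * B) = A * D f * D g * B" by (rule assoc_mult_mat[OF AD D B, symmetric])
    also have "A * D f * D g = A * (D f * D g)" by (rule assoc_mult_mat[OF A D D])
    finally show ?thesis unfolding DD E_def .
  qed
  have Econg: "E f = E g" if "\<And>k. k < N \<Longrightarrow> f (\<zeta> k) = g (\<zeta> k)" for f g
  proof -
    have "D f = D g" using that unfolding D_def by (intro cong_mat) auto
    then show ?thesis by (simp add: E_def)
  qed
  have E1: "E (\<lambda>z. 1) = 1\<^sub>m N"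
  proof -
    have "D (\<lambda>z. 1) = 1\<^sub>m N" unfolding D_def one_mat_def by (rule refl)
    then show ?thesis using A AB by (simp add: E_def)
  qed
  have pow: "E f ^\<^sub>m k = E (\<lambda>z. f z ^ k)" for f k
  proof (induction k)
    case 0
    then show ?case using E1 E[of f] by (simp add: E1)
  next
    case (Suc k)
    have "E f ^\<^sub>m Suc k = E (\<lambda>z. f z ^ k) * E f" by (simp add: Suc)
    also have "\<dots> = E (\<lambda>z. f z ^ Suc k)" unfolding EE by (simp add: mult.commute)
    finally show ?case .
  qed
  have inv: "matrix_inverse (E (\<lambda>z. z)) = E (\<lambda>z. inverse z)"
    unfolding matrix_inverse_def
  proof (rule the_equality)
    have 1: "E (\<lambda>z. z) * E (\<lambda>z. inverse z) = 1\<^sub>m N" "E (\<lambda>z. inverse z) * E (\<lambda>z. z) = 1\<^sub>m N"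
      unfolding EE E1[symmetric] using \<zeta> by (auto intro!: Econg)
    have dr: "dim_row (E f) = N" for f using E[of f] by auto
    show "E (\<lambda>z. inverse z) \<in> carrier_mat (dim_row (E (\<lambda>z. z))) (dim_row (E (\<lambda>z. z)))
        \<and> inverts_mat (E (\<lambda>z. z)) (E (\<lambda>z. inverse z)) \<and> inverts_mat (E (\<lambda>z. inverse z)) (E (\<lambda>z. z))"
      using 1 E by (simp add: inverts_mat_def dr)
    fix C assume "C \<in> carrier_mat (dim_row (E (\<lambda>z. z))) (dim_row (E (\<lambda>z. z))) \<and> inverts_mat (E (\<lambda>z. z)) C \<and> inverts_mat C (E (\<lambda>z. z))"
    then have C: "C \<in> carrier_mat N N" "C * E (\<lambda>z. z) = 1\<^sub>m N" by (auto simp: dr inverts_mat_def)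
    have "C = C * (E (\<lambda>z. z) * E (\<lambda>z. inverse z))" unfolding 1 using C by simp
    also have "\<dots> = (C * E (\<lambda>z. z)) * E (\<lambda>z. inverse z)" using C E by (intro assoc_mult_mat[symmetric]) auto
    also have "\<dots> = E (\<lambda>z. inverse z)" unfolding C(2) by (rule left_mult_one_mat[OF E])
    finally show "C = E (\<lambda>z. inverse z)" .
  qed
  have "mat_powi (E (\<lambda>z. z)) l = E (\<lambda>z. z powi l)"
    by (cases "l \<ge> 0") (simp_all add: mat_powi_def inv pow power_int_def)
  then show ?thesis by (simp add: E_def)
qed

lemma conj_diag_entry:
  fixes A B :: "complex mat"
  assumes A: "A \<in> carrier_mat N N" and B: "B \<in> carrier_mat N N" and ij: "i < N" "j < N"
  shows "(A * mat N N (\<lambda>(i, j). if i = j then f i else 0) * B) $$ (i, j) = (\<Sum>k<N. A $$ (i, k) * f k * B $$ (k, j))"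
proof -
  let ?D = "mat N N (\<lambda>(i, j). if i = j then f i else 0) :: complex mat"
  have AD: "(A * ?D) $$ (i, k) = A $$ (i, k) * f k" if "k < N" for k
  proof -
    have "(A * ?D) $$ (i, k) = (\<Sum>j<N. A $$ (i, j) * (if j = k then f j else 0))"
      using that ij A by (simp add: scalar_prod_def atLeast0LessThan)
    also have "\<dots> = (\<Sum>j<N. if j = k then A $$ (i, k) * f k else 0)" by (intro sum.cong) auto
    finally show ?thesis using that by simp
  qed
  have "(A * ?D * B) $$ (i, j) = (\<Sum>k<N. (A * ?D) $$ (i, k) * B $$ (k, j))"
    using ij A B by (subst index_mult_mat) (auto simp: scalar_prod_def atLeast0LessThan)
  also have "\<dots> = (\<Sum>k<N. A $$ (i, k) * f k * B $$ (k, j))"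
    using AD by (intro sum.cong) auto
  finally show ?thesis .
qed

lemma trace_conj:
  fixes A B :: "complex mat"
  assumes A: "A \<in> carrier_mat N N" and B: "B \<in> carrier_mat N N" and AB: "A * B = 1\<^sub>m N"
  shows "(\<Sum>i<N. (A * mat N N (\<lambda>(i, j). if i = j then f i else 0) * B) $$ (i, i)) = (\<Sum>k<N. f k)"
proof -
  have BA: "B * A = 1\<^sub>m N" by (rule mat_mult_left_right_inverse[OF A B AB])
  have "(\<Sum>i<N. (A * mat N N (\<lambda>(i, j). if i = j then f i else 0) * B) $$ (i, i))
      = (\<Sum>i<N. \<Sum>k<N. A $$ (i, k) * f k * B $$ (k, i))"
    by (intro sum.cong refl conj_diag_entry[OF A B]) auto
  also have "\<dots> = (\<Sum>k<N. f k * (\<Sum>i<N. B $$ (k, i) * A $$ (i, k)))"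
    by (subst sum.swap) (simp add: sum_distrib_left mult_ac)
  also have "\<dots> = (\<Sum>k<N. f k * (B * A) $$ (k, k))"
    using A B by (intro sum.cong) (auto simp: scalar_prod_def atLeast0LessThan)
  also have "\<dots> = (\<Sum>k<N. f k)" unfolding BA by (intro sum.cong) auto
  finally show ?thesis .
qed

text \<open>The values of the basis functions at the support points, scaled by the square roots of
  the masses, form a unitary matrix that diagonalizes multiplication by \<open>z\<close>. The
  eigenvalues are the support points.\<close>

lemma trace_laurent_cmv:
  assumes \<mu>: "circle_prob \<mu>" and Z: "circle_support \<mu> = Z" "finite Z" "card Z = N"
  shows "mat_trace (laurent_eval_mat V (mat N N (\<lambda>(i, j). L2_inner \<mu> (cmv_basis \<mu> i) (\<lambda>z. z * cmv_basis \<mu> j z))))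
    = (\<Sum>z\<in>Z. laurent_eval V z)"
proof -
  have "N > 0" using Z circle_support_nonempty[OF \<mu>] by (auto simp: card_gt_0_iff)
  then have mp: "many_points \<mu> (N - 1)" using Z by (simp add: many_points_def)
  obtain zs where zs: "set zs = Z" "distinct zs" using finite_distinct_list[OF Z(2)] by blast
  then have len: "length zs = N" using Z(3) distinct_card by force
  define \<zeta> where "\<zeta> k = zs ! k" for k
  have bij: "bij_betw \<zeta> {..<N} Z"
    unfolding \<zeta>_def using bij_betw_nth[OF zs(2)] zs(1) len by auto
  have \<zeta>0: "\<zeta> k \<noteq> 0" if "k < N" for k
  proof -
    have "\<zeta> k \<in> Z" using bij that by (auto simp: bij_betw_def)
    then show ?thesis using circle_support_subset[of \<mu>] Z(1) by auto
  qed
  define w where "w k = measure \<mu> {\<zeta> k}" for k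
  have w: "w k \<ge> 0" for k by (simp add: w_def)
  have inner: "L2_inner \<mu> f g = (\<Sum>k<N. of_real (w k) * (cnj (f (\<zeta> k)) * g (\<zeta> k)))"
    if "continuous_on (sphere 0 1) f" "continuous_on (sphere 0 1) g" for f g
  proof -
    have "(\<lambda>z. cnj (f z) * g z) \<in> borel_measurable \<mu>"
      by (intro continuous_imp_borel_measurable[OF \<mu>] continuous_intros that)
    then have "L2_inner \<mu> f g = (\<Sum>z\<in>Z. measure \<mu> {z} *\<^sub>R (cnj (f z) * g z))"
      unfolding L2_inner_def using integral_finite_support[OF \<mu>] Z by metis
    also have "\<dots> = (\<Sum>k<N. measure \<mu> {\<zeta> k} *\<^sub>R (cnj (f (\<zeta> k)) * g (\<zeta> k)))"
      by (rule sum.reindex_bij_betw[OF bij, symmetric])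
    finally show ?thesis by (simp add: w_def scaleR_conv_of_real)
  qed
  let ?\<chi> = "cmv_basis \<mu>"
  define A where "A = mat N N (\<lambda>(i, k). cnj (?\<chi> i (\<zeta> k)) * of_real (sqrt (w k)))"
  define B where "B = mat N N (\<lambda>(k, j). ?\<chi> j (\<zeta> k) * of_real (sqrt (w k)))"
  have A: "A \<in> carrier_mat N N" and B: "B \<in> carrier_mat N N" by (simp_all add: A_def B_def)
  have sq: "complex_of_real (sqrt (w k)) * complex_of_real (sqrt (w k)) = of_real (w k)" for k
    using w[of k] by (simp flip: of_real_mult)
  have entry: "A $$ (i, k) * c * B $$ (k, j) = of_real (w k) * (cnj (?\<chi> i (\<zeta> k)) * (c * ?\<chi> j (\<zeta> k)))"
    if "i < N" "j < N" "k < N" for i j k c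
  proof -
    have "A $$ (i, k) * c * B $$ (k, j) = (complex_of_real (sqrt (w k)) * complex_of_real (sqrt (w k))) * (cnj (?\<chi> i (\<zeta> k)) * (c * ?\<chi> j (\<zeta> k)))"
      using that by (simp add: A_def B_def)
    then show ?thesis unfolding sq .
  qed
  have AB: "A * B = 1\<^sub>m N"
  proof (rule eq_matI)
    fix i j assume "i < dim_row (1\<^sub>m N :: complex mat)" "j < dim_col (1\<^sub>m N :: complex mat)"
    then have ij: "i < N" "j < N" by simp_all
    have "(A * B) $$ (i, j) = (\<Sum>k<N. A $$ (i, k) * 1 * B $$ (k, j))"
      using ij A B by (subst index_mult_mat) (auto simp: scalar_prod_def atLeast0LessThan)
    also have "\<dots> = L2_inner \<mu> (?\<chi> i) (?\<chi> j)"
      unfolding inner[OF continuous_cmv_basis continuous_cmv_basis] using ij by (intro sum.cong) (simp_all only: entry lessThan_iff mult_1_left)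
    also have "\<dots> = 1\<^sub>m N $$ (i, j)"
      using cmv_orthonormal[OF \<mu> mp \<open>N > 0\<close> ij] ij by simp
    finally show "(A * B) $$ (i, j) = 1\<^sub>m N $$ (i, j)" .
  qed (use A B in auto)
  define D where "D f = mat N N (\<lambda>(i, j). if i = j then f (\<zeta> i :: complex) else (0 :: complex))" for f
  have U: "mat N N (\<lambda>(i, j). L2_inner \<mu> (?\<chi> i) (\<lambda>z. z * ?\<chi> j z)) = A * D (\<lambda>z. z) * B" (is "?U = _")
  proof (rule eq_matI)
    fix i j assume "i < dim_row (A * D (\<lambda>z. z) * B)" "j < dim_col (A * D (\<lambda>z. z) * B)"
    then have ij: "i < N" "j < N" using A B by auto
    have "?U $$ (i, j) = L2_inner \<mu> (?\<chi> i) (\<lambda>z. z * ?\<chi> j z)" using ij by simp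
    also have "\<dots> = (\<Sum>k<N. of_real (w k) * (cnj (?\<chi> i (\<zeta> k)) * (\<zeta> k * ?\<chi> j (\<zeta> k))))"
      by (intro inner continuous_intros continuous_cmv_basis)
    also have "\<dots> = (\<Sum>k<N. A $$ (i, k) * \<zeta> k * B $$ (k, j))"
      using ij by (intro sum.cong) (simp_all only: entry lessThan_iff)
    also have "\<dots> = (A * D (\<lambda>z. z) * B) $$ (i, j)"
      unfolding D_def by (rule conj_diag_entry[OF A B ij, symmetric])
    finally show "?U $$ (i, j) = (A * D (\<lambda>z. z) * B) $$ (i, j)" .
  qed (use A B in auto)
  have powi: "mat_powi ?U l = A * D (\<lambda>z. z powi l) * B" for l
    unfolding U D_def by (rule mat_powi_conj[OF A B AB \<zeta>0])
  have "mat_trace (laurent_eval_mat V ?U) = (\<Sum>i<N. \<Sum>l\<in>Poly_Mapping.keys V. Poly_Mapping.lookup V l * (A * D (\<lambda>z. z powi l) * B) $$ (i, i))"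
    unfolding mat_trace_def laurent_eval_mat_def powi by simp
  also have "\<dots> = (\<Sum>l\<in>Poly_Mapping.keys V. Poly_Mapping.lookup V l * (\<Sum>i<N. (A * D (\<lambda>z. z powi l) * B) $$ (i, i)))"
    by (subst sum.swap) (simp add: sum_distrib_left)
  also have "\<dots> = (\<Sum>l\<in>Poly_Mapping.keys V. Poly_Mapping.lookup V l * (\<Sum>k<N. \<zeta> k powi l))"
    unfolding D_def trace_conj[OF A B AB] ..
  also have "\<dots> = (\<Sum>k<N. laurent_eval V (\<zeta> k))"
    unfolding laurent_eval_def by (subst sum.swap) (simp add: sum_distrib_left)
  also have "\<dots> = (\<Sum>z\<in>Z. laurent_eval V z)" by (rule sum.reindex_bij_betw[OF bij])
  finally show ?thesis .
qed

section \<open>The sum rule\<close>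

lemma conj_poly_eval_cong:
  assumes "conj_poly_in n P" "\<And>i. i < n \<Longrightarrow> \<alpha> i = \<beta> i"
  shows "conj_poly_eval P \<alpha> = conj_poly_eval P \<beta>"
  unfolding conj_poly_eval_def
proof (intro sum.cong arg_cong2[where f = "(*)"] prod.cong refl)
  fix e v assume "e \<in> Poly_Mapping.keys P" "v \<in> Poly_Mapping.keys e"
  then have "v \<in> Inl ` {..<n} \<union> Inr ` {..<n}" using assms(1) by (auto simp: conj_poly_in_def)
  then show "case_sum \<alpha> (\<lambda>i. cnj (\<alpha> i)) v ^ Poly_Mapping.lookup e v = case_sum \<beta> (\<lambda>i. cnj (\<beta> i)) v ^ Poly_Mapping.lookup e v"
    using assms(2) by auto
qed

lemma conj_poly_eval_bounded:
  assumes "\<And>i. cmod (\<alpha> i) \<le> 1"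
  shows "cmod (conj_poly_eval P \<alpha>) \<le> (\<Sum>e\<in>Poly_Mapping.keys P. cmod (Poly_Mapping.lookup P e))"
  unfolding conj_poly_eval_def
proof (rule sum_norm_le)
  fix e assume "e \<in> Poly_Mapping.keys P"
  have "cmod (\<Prod>v\<in>Poly_Mapping.keys e. case_sum \<alpha> (\<lambda>i. cnj (\<alpha> i)) v ^ Poly_Mapping.lookup e v) \<le> 1"
    unfolding prod_norm[symmetric] using assms
    by (intro prod_le_1) (auto simp: norm_power power_le_one split: sum.split)
  then show "cmod (Poly_Mapping.lookup P e * (\<Prod>v\<in>Poly_Mapping.keys e. case_sum \<alpha> (\<lambda>i. cnj (\<alpha> i)) v ^ Poly_Mapping.lookup e v)) \<le> cmod (Poly_Mapping.lookup P e)"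
    by (simp add: norm_mult mult_left_le)
qed

lemma conj_poly_eval_tendsto:
  assumes "\<And>i. ((\<lambda>n. \<alpha> n i) \<longlongrightarrow> \<beta> i) F"
  shows "((\<lambda>n. conj_poly_eval P (\<alpha> n)) \<longlongrightarrow> conj_poly_eval P \<beta>) F"
proof -
  have "((\<lambda>n. case_sum (\<alpha> n) (\<lambda>i. cnj (\<alpha> n i)) v) \<longlongrightarrow> case_sum \<beta> (\<lambda>i. cnj (\<beta> i)) v) F" for v
    using assms by (cases v) (auto intro: tendsto_cnj)
  then show ?thesis unfolding conj_poly_eval_def by (intro tendsto_intros)
qed

text \<open>The coefficient sequence of the Bernstein--Szego measure of index
  \<open>n\<close>.\<close>

definition truncate :: "nat \<Rightarrow> (nat \<Rightarrow> complex) \<Rightarrow> nat \<Rightarrow> complex" where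
  "truncate n \<alpha> i = (if i < n then \<alpha> i else 0)"

lemma szego_poly_zero_tail:
  assumes "\<And>j. n \<le> j \<Longrightarrow> j < n + k \<Longrightarrow> \<beta> j = 0"
  shows "szego_poly \<beta> (n + k) = monom 1 k * szego_poly \<beta> n"
  using assms
proof (induction k)
  case (Suc k)
  have "szego_poly \<beta> (n + Suc k) = pCons 0 (szego_poly \<beta> (n + k))"
    using Suc.prems[of "n + k"] by (simp add: szego_step_def)
  also have "\<dots> = pCons 0 (monom 1 k * szego_poly \<beta> n)" using Suc by simp
  also have "\<dots> = monom 1 (Suc k) * szego_poly \<beta> n" by (simp add: monom_Suc)
  finally show ?case .
qed (simp add: monom_0)

text \<open>\<open>\<Phi>\<^sub>n\<close> followed by zero coefficients and one of modulus one is \<open>z\<^sup>N\<^sup>-\<^sup>n \<Phi>\<^sub>n - c \<Phi>\<^sub>n\<^sup>*\<close>, which shares its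
  leading coefficients with \<open>z\<^sup>N\<^sup>-\<^sup>n \<Phi>\<^sub>n\<close>; so its zeros have the same first power sums.\<close>

lemma power_sum_para:
  assumes zero: "\<And>j. n \<le> j \<Longrightarrow> j < m \<Longrightarrow> \<beta> j = 0" and nm: "n + M < Suc m" "n \<le> m"
    and as: "szego_poly \<beta> n = (\<Prod>a\<leftarrow>as. [:- a, 1:])"
    and zs: "szego_poly \<beta> (Suc m) = (\<Prod>a\<leftarrow>zs. [:- a, 1:])"
    and l: "0 < l" "l \<le> M"
  shows "(\<Sum>a\<leftarrow>zs. a ^ l) = (\<Sum>a\<leftarrow>as. a ^ l)"
proof -
  let ?p = "szego_poly \<beta> n"
  have len: "length as = n" "length zs = Suc m"
    using as zs degree_linear_prod[of as] degree_linear_prod[of zs] degree_szego_poly by metis+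
  have pm: "szego_poly \<beta> m = monom 1 (m - n) * ?p"
    using szego_poly_zero_tail[of n "m - n" \<beta>] zero nm(2) by simp
  have eq: "fps_nth (rev_fps zs) i = fps_nth (rev_fps as) i" if i: "i \<le> M" for i
  proof -
    have "fps_nth (rev_fps zs) i = coeff (szego_poly \<beta> (Suc m)) (Suc m - i)"
      using i nm by (simp add: nth_rev_fps len zs[symmetric] del: szego_poly.simps)
    also have "\<dots> = coeff (szego_poly \<beta> m) (m - i) - cnj (\<beta> m) * coeff (szego_dual m (szego_poly \<beta> m)) (Suc m - i)"
      using i nm by (simp add: szego_step_def Suc_diff_le)
    \<comment> \<open>The dual of \<open>z\<^sup>m\<^sup>-\<^sup>n \<Phi>\<^sub>n\<close> at degree
      \<open>m\<close> is that of \<open>\<Phi>\<^sub>n\<close>, of degree at most \<open>n\<close>,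
      and \<open>n < Suc m - i\<close>.\<close>
    also have "coeff (szego_dual m (szego_poly \<beta> m)) (Suc m - i) = 0"
      using i nm unfolding pm by (auto simp: coeff_szego_dual coeff_monom_mult)
    also have "coeff (szego_poly \<beta> m) (m - i) = (if i \<le> n then coeff ?p (n - i) else 0)"
      using i nm unfolding pm by (auto simp: coeff_monom_mult intro!: arg_cong[of _ _ "coeff ?p"])
    finally show ?thesis by (simp add: nth_rev_fps len as)
  qed
  have "(\<Sum>a\<leftarrow>zs. a ^ Suc (l - 1)) = (\<Sum>a\<leftarrow>as. a ^ Suc (l - 1))"
    by (rule power_sum_unique[OF eq]) (use l in auto)
  then show ?thesis using l by simp
qed

lemma sum_list_pot:
  "(\<Sum>a\<leftarrow>as. pot \<eta> M a) = - 2 * Re (\<Sum>i=1..M. (\<Sum>a\<leftarrow>as. a ^ i) * cnj (\<integral>w. w ^ i \<partial>\<eta>) / of_nat i)"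
  by (induction as) (simp_all add: pot_def sum.distrib distrib_right add_divide_distrib)

text \<open>Applied to \<alpha> cut off at \<open>n\<close> and continued by zeros and a final 1,
  the decomposition separates: \<open>Fp\<close> and the last term of \<open>G\<close> see only
  zeros and the final 1 and make up \<open>K\<close>, and the windows consisting of zeros vanish by
  \<open>G(0) = 0\<close>. The condition \<open>d \<le> n\<close> keeps the arguments of
  \<open>Fm\<close> untouched.\<close>

lemma trace_formula:
  assumes \<eta>: "circle_prob \<eta>" and atom: "\<And>a. AE z in \<eta>. z \<noteq> a"
    and mom: "\<And>l. l > M \<Longrightarrow> (\<integral>w. w ^ l \<partial>\<eta>) = 0"
    and V: "\<forall>z\<in>sphere 0 1. laurent_eval V z = complex_of_real (pot \<eta> M z)"
    and dec: "trace_decomposition V Fm Fp G" and d: "d = laurent_degree V"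
  obtains K where "\<And>\<alpha> n. (\<And>j. cmod (\<alpha> j) < 1) \<Longrightarrow> d \<le> n \<Longrightarrow>
    2 * (\<integral>z. ln (cmod (poly (szego_poly \<alpha> n) z)) \<partial>\<eta>)
      = Re (conj_poly_eval Fm \<alpha>) + (\<Sum>j<n. Re (conj_poly_eval G (\<lambda>i. truncate n \<alpha> (j + i)))) + K"
proof -
  define K where "K = Re (conj_poly_eval Fp (\<lambda>i. if Suc i = d then 1 else 0)) + Re (conj_poly_eval G (\<lambda>i. if i = d then 1 else 0))"
  note dec' = dec[unfolded trace_decomposition_def Let_def, folded d]
  have "2 * (\<integral>z. ln (cmod (poly (szego_poly \<alpha> n) z)) \<partial>\<eta>)
      = Re (conj_poly_eval Fm \<alpha>) + (\<Sum>j<n. Re (conj_poly_eval G (\<lambda>i. truncate n \<alpha> (j + i)))) + K"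
    if \<alpha>: "\<And>j. cmod (\<alpha> j) < 1" and n: "d \<le> n" for \<alpha> n
  proof -
    \<comment> \<open>At least \<open>M\<close> zeros keep the power sums up to order
      \<open>M\<close>, and more than \<open>d\<close> zeros ensure that no window of
      \<open>G\<close> meets both \<alpha> and the final 1.\<close>
    define m where "m = n + d + M + 1"
    define \<beta> where "\<beta> j = (if j < n then \<alpha> j else if j = m then 1 else 0)" for j
    have \<beta>1: "cmod (\<beta> j) < 1" if "j < m" for j using that \<alpha> by (simp add: \<beta>_def)
    have \<beta>m: "cmod (\<beta> m) = 1" by (simp add: \<beta>_def m_def)
    obtain Z where Z: "circle_prob (finite_verblunsky_measure (Suc m) \<beta>)"
      "circle_support (finite_verblunsky_measure (Suc m) \<beta>) = Z"
      "finite Z" "card Z = Suc m" "Z \<subseteq> sphere 0 1" "szego_poly \<beta> (Suc m) = (\<Prod>z\<in>Z. [:- z, 1:])"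
      by (rule finite_verblunsky_measure[of m \<beta>]) (use \<beta>1 \<beta>m that in blast)+
    obtain zs where zs: "set zs = Z" "distinct zs" using finite_distinct_list[OF Z(3)] by blast
    have zp: "szego_poly \<beta> (Suc m) = (\<Prod>a\<leftarrow>zs. [:- a, 1:])"
      unfolding Z(6) zs(1)[symmetric] by (rule prod.distinct_set_conv_list[OF zs(2)])
    obtain as where as: "szego_poly \<alpha> n = (\<Prod>a\<leftarrow>as. [:- a, 1:])" "\<forall>a\<in>set as. cmod a < 1"
      by (rule szego_poly_factor[of n \<alpha>]) (use \<alpha> that in blast)+
    have pn: "szego_poly \<beta> n = szego_poly \<alpha> n" by (rule szego_poly_cong) (simp add: \<beta>_def)
    have ps: "(\<Sum>a\<leftarrow>zs. a ^ l) = (\<Sum>a\<leftarrow>as. a ^ l)" if "0 < l" "l \<le> M" for l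
      by (rule power_sum_para[where n = n and m = m and \<beta> = \<beta> and M = M])
        (use that zp as(1) pn in \<open>auto simp: \<beta>_def m_def simp del: szego_poly.simps\<close>)
    have tr: "mat_trace (laurent_eval_mat V (cmv_matrix (Suc m) \<beta>)) = (\<Sum>z\<in>Z. laurent_eval V z)"
      unfolding cmv_matrix_def Let_def by (rule trace_laurent_cmv[OF Z(1-4)])
    also have "\<dots> = (\<Sum>z\<in>Z. complex_of_real (pot \<eta> M z))" using V Z(5) by (intro sum.cong) auto
    also have "\<dots> = of_real (\<Sum>z\<leftarrow>zs. pot \<eta> M z)"
      unfolding zs(1)[symmetric] by (simp add: sum_list_distinct_conv_sum_set[OF zs(2)])
    also have "(\<Sum>z\<leftarrow>zs. pot \<eta> M z) = (\<Sum>a\<leftarrow>as. pot \<eta> M a)"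
      unfolding sum_list_pot using ps by simp
    also have "\<dots> = 2 * (\<integral>z. ln (cmod (poly (szego_poly \<alpha> n) z)) \<partial>\<eta>)"
    proof -
      have "(\<integral>z. ln (cmod (poly (szego_poly \<alpha> n) z)) \<partial>\<eta>) = (\<Sum>a\<leftarrow>as. \<integral>z. ln (cmod (z - a)) \<partial>\<eta>)"
        unfolding as(1) using as(2) by (intro integral_ln_norm_poly_list[OF \<eta>]) auto
      moreover have "pot \<eta> M a = 2 * (\<integral>z. ln (cmod (z - a)) \<partial>\<eta>)" if "a \<in> set as" for a
        using log_integral_inside[OF \<eta> atom mom, where a = a] as(2) that by (simp add: norm_minus_commute)
      then have "(\<Sum>a\<leftarrow>as. pot \<eta> M a) = (\<Sum>a\<leftarrow>as. 2 * (\<integral>z. ln (cmod (z - a)) \<partial>\<eta>))"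
        by (intro arg_cong[of _ _ sum_list] map_cong) auto
      ultimately show ?thesis by (simp add: sum_list_const_mult)
    qed
    finally have L: "mat_trace (laurent_eval_mat V (cmv_matrix (Suc m) \<beta>))
      = of_real (2 * (\<integral>z. ln (cmod (poly (szego_poly \<alpha> n) z)) \<partial>\<eta>))" .
    have "mat_trace (laurent_eval_mat V (cmv_matrix (Suc m) \<beta>)) =
        conj_poly_eval Fm \<beta> + conj_poly_eval Fp (\<lambda>i. \<beta> (Suc m - d + i)) +
        (\<Sum>j = 0..Suc m - 1 - d. conj_poly_eval G (\<lambda>i. \<beta> (j + i)))"
      using dec' \<beta>1 \<beta>m by (auto simp: m_def ac_simps)
    also have "conj_poly_eval Fm \<beta> = conj_poly_eval Fm \<alpha>"
      using dec' n by (intro conj_poly_eval_cong[where n = d]) (auto simp: \<beta>_def)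
    also have "conj_poly_eval Fp (\<lambda>i. \<beta> (Suc m - d + i)) = conj_poly_eval Fp (\<lambda>i. if Suc i = d then 1 else 0)"
      using dec' by (intro conj_poly_eval_cong[where n = d]) (auto simp: \<beta>_def m_def)
    also have "(\<Sum>j = 0..Suc m - 1 - d. conj_poly_eval G (\<lambda>i. \<beta> (j + i)))
        = (\<Sum>j\<in>{..<m - d}. conj_poly_eval G (\<lambda>i. \<beta> (j + i))) + conj_poly_eval G (\<lambda>i. \<beta> (m - d + i))"
      by (simp add: atLeast0AtMost lessThan_Suc_atMost[symmetric])
    also have "(\<Sum>j\<in>{..<m - d}. conj_poly_eval G (\<lambda>i. \<beta> (j + i))) = (\<Sum>j<n. conj_poly_eval G (\<lambda>i. truncate n \<alpha> (j + i)))"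
    proof (rule sum.mono_neutral_cong_right)
      show "{..<n} \<subseteq> {..<m - d}" by (auto simp: m_def)
      show "\<forall>j\<in>{..<m - d} - {..<n}. conj_poly_eval G (\<lambda>i. \<beta> (j + i)) = 0"
      proof
        fix j assume j: "j \<in> {..<m - d} - {..<n}"
        have "conj_poly_eval G (\<lambda>i. \<beta> (j + i)) = conj_poly_eval G (\<lambda>_. 0)"
          using dec' j by (intro conj_poly_eval_cong[where n = "d + 1"]) (auto simp: \<beta>_def)
        then show "conj_poly_eval G (\<lambda>i. \<beta> (j + i)) = 0" using dec' by simp
      qed
      fix j assume "j \<in> {..<n}"
      then show "conj_poly_eval G (\<lambda>i. \<beta> (j + i)) = conj_poly_eval G (\<lambda>i. truncate n \<alpha> (j + i))"
        using dec' by (intro conj_poly_eval_cong[where n = "d + 1"]) (auto simp: \<beta>_def truncate_def m_def)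
    qed simp
    also have "conj_poly_eval G (\<lambda>i. \<beta> (m - d + i)) = conj_poly_eval G (\<lambda>i. if i = d then 1 else 0)"
      using dec' by (intro conj_poly_eval_cong[where n = "d + 1"]) (auto simp: \<beta>_def m_def)
    finally have "Re (of_real (2 * (\<integral>z. ln (cmod (poly (szego_poly \<alpha> n) z)) \<partial>\<eta>)))
      = Re (conj_poly_eval Fm \<alpha> + conj_poly_eval Fp (\<lambda>i. if Suc i = d then 1 else 0)
          + ((\<Sum>j<n. conj_poly_eval G (\<lambda>i. truncate n \<alpha> (j + i))) + conj_poly_eval G (\<lambda>i. if i = d then 1 else 0)))"
      unfolding L by (rule arg_cong)
    then show ?thesis by (simp add: K_def)
  qed
  then show ?thesis using that by blast
qed

section \<open>Boundary terms caused by truncation\<close>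

definition boundary_error :: "conj_poly \<Rightarrow> (nat \<Rightarrow> complex) \<Rightarrow> nat \<Rightarrow> real" where
  "boundary_error G \<alpha> n = (\<Sum>j<n. Re (conj_poly_eval G (\<lambda>i. \<alpha> (j + i))) - Re (conj_poly_eval G (\<lambda>i. truncate n \<alpha> (j + i))))"

text \<open>A window of length \<open>d + 1\<close> starting before \<open>n - d\<close> does not
  reach index \<open>n\<close>. So \<open>d\<close> terms remain, a number independent of
  \<open>n\<close>, which gives the boundedness and the limit below.\<close>

lemma boundary_error_eq:
  assumes "conj_poly_in (d + 1) G" "d \<le> n"
  shows "boundary_error G \<alpha> n = (\<Sum>k<d. Re (conj_poly_eval G (\<lambda>i. \<alpha> (n - d + k + i)))
    - Re (conj_poly_eval G (\<lambda>i. truncate n \<alpha> (n - d + k + i))))" (is "_ = (\<Sum>k<d. ?f (n - d + k))")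
proof -
  have "boundary_error G \<alpha> n = (\<Sum>j\<in>{n - d..<n}. ?f j)"
    unfolding boundary_error_def
  proof (rule sum.mono_neutral_right)
    show "\<forall>j\<in>{..<n} - {n - d..<n}. ?f j = 0"
    proof
      fix j assume "j \<in> {..<n} - {n - d..<n}"
      then have "conj_poly_eval G (\<lambda>i. \<alpha> (j + i)) = conj_poly_eval G (\<lambda>i. truncate n \<alpha> (j + i))"
        by (intro conj_poly_eval_cong[OF assms(1)]) (auto simp: truncate_def)
      then show "?f j = 0" by simp
    qed
  qed auto
  also have "\<dots> = (\<Sum>k<d. ?f (n - d + k))"
    using assms(2) by (intro sum.reindex_bij_witness[of _ "\<lambda>k. n - d + k" "\<lambda>j. j - (n - d)"]) auto
  finally show ?thesis .
qed

lemma boundary_error_bounded: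
  assumes "conj_poly_in (d + 1) G" "\<And>j. cmod (\<alpha> j) < 1"
  obtains B where "\<And>n. d \<le> n \<Longrightarrow> \<bar>boundary_error G \<alpha> n\<bar> \<le> B"
proof
  let ?C = "\<Sum>e\<in>Poly_Mapping.keys G. cmod (Poly_Mapping.lookup G e)"
  fix n assume n: "d \<le> n"
  have "\<bar>boundary_error G \<alpha> n\<bar> \<le> (\<Sum>k<d. ?C + ?C)"
    unfolding boundary_error_eq[OF assms(1) n]
  proof (rule sum_abs[THEN order_trans], rule sum_mono)
    fix k
    have 1: "cmod (conj_poly_eval G (\<lambda>i. \<alpha> (n - d + k + i))) \<le> ?C"
      "cmod (conj_poly_eval G (\<lambda>i. truncate n \<alpha> (n - d + k + i))) \<le> ?C"
      using assms(2) by (intro conj_poly_eval_bounded; auto simp: truncate_def intro: less_imp_le)+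
    show "\<bar>Re (conj_poly_eval G (\<lambda>i. \<alpha> (n - d + k + i))) - Re (conj_poly_eval G (\<lambda>i. truncate n \<alpha> (n - d + k + i)))\<bar> \<le> ?C + ?C"
      using 1 abs_Re_le_cmod[of "conj_poly_eval G (\<lambda>i. \<alpha> (n - d + k + i))"]
        abs_Re_le_cmod[of "conj_poly_eval G (\<lambda>i. truncate n \<alpha> (n - d + k + i))"] by linarith
  qed
  then show "\<bar>boundary_error G \<alpha> n\<bar> \<le> (\<Sum>k<d. ?C + ?C)" .
qed

lemma boundary_error_tendsto_0:
  assumes G: "conj_poly_in (d + 1) G" and \<alpha>: "\<alpha> \<longlonglongrightarrow> 0"
  shows "(\<lambda>n. boundary_error G \<alpha> n) \<longlonglongrightarrow> 0"
proof -
  have lim1: "(\<lambda>n. \<alpha> (n - d + k + i)) \<longlonglongrightarrow> 0" for k i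
  proof -
    have "filterlim (\<lambda>n. n - d + k + i) at_top sequentially"
      by (rule filterlim_at_top_mono[OF filterlim_minus_const_nat_at_top[of d]]) simp
    then show ?thesis by (rule filterlim_compose[OF \<alpha>])
  qed
  have lim2: "(\<lambda>n. truncate n \<alpha> (n - d + k + i)) \<longlonglongrightarrow> 0" for k i
    by (rule Lim_null_comparison[OF _ tendsto_norm_zero[OF lim1[of k i]]]) (simp add: truncate_def)
  have "(\<lambda>n. \<Sum>k<d. Re (conj_poly_eval G (\<lambda>i. \<alpha> (n - d + k + i))) - Re (conj_poly_eval G (\<lambda>i. truncate n \<alpha> (n - d + k + i))))
     \<longlonglongrightarrow> (\<Sum>k<d. Re (conj_poly_eval G (\<lambda>_. 0)) - Re (conj_poly_eval G (\<lambda>_. 0)))"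
    by (intro tendsto_sum tendsto_diff tendsto_Re conj_poly_eval_tendsto lim1 lim2)
  moreover have "eventually (\<lambda>n. (\<Sum>k<d. Re (conj_poly_eval G (\<lambda>i. \<alpha> (n - d + k + i))) - Re (conj_poly_eval G (\<lambda>i. truncate n \<alpha> (n - d + k + i))))
      = boundary_error G \<alpha> n) sequentially"
    using boundary_error_eq[OF G] by (intro eventually_sequentiallyI[of d]) simp
  ultimately show ?thesis using Lim_transform_eventually by fastforce
qed

lemma atomless_density_arc:
  assumes "ccont h"
  shows "AE z in density arc_measure (\<lambda>z. ennreal (h z)). z \<noteq> a"
  using AE_arc_neq[of a] continuous_imp_borel_measurable[OF circle_prob_arc assms]
  by (subst AE_density) auto

section \<open>The limit of the partial sums and the sum rule\<close>

context
  fixes h :: "complex \<Rightarrow> real" and V :: laurent_poly and Fm Fp G :: conj_poly and M d :: nat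
  assumes h: "ccont h" "\<And>z. z \<in> sphere 0 1 \<Longrightarrow> 0 \<le> h z" "(\<integral>z. h z \<partial>arc_measure) = 1"
    and ae: "AE z in arc_measure. h z \<noteq> 0"
    and mom: "\<And>l. l > M \<Longrightarrow> (\<integral>w. w ^ l \<partial>density arc_measure (\<lambda>z. ennreal (h z))) = 0"
    and V: "\<forall>z\<in>sphere 0 1. laurent_eval V z = complex_of_real (pot (density arc_measure (\<lambda>z. ennreal (h z))) M z)"
    and dec: "trace_decomposition V Fm Fp G" and d: "d = laurent_degree V"
begin

lemma circle_prob_h: "circle_prob (density arc_measure (\<lambda>z. ennreal (h z)))"
  by (rule circle_prob_density[OF circle_prob_arc h])

text \<open>Up to \<open>Fm\<close>, a constant and the boundary error, the partial sums are the
  means of \<open>ln_weight\<close> under \<eta>, whose limit the entropy lemmas supply. That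
  \<open>K\<close> is chosen before \<alpha> matters: it cancels in differences of values of
  \<open>S\<close>.\<close>

lemma S_partial_limit:
  "\<exists>K. \<forall>\<alpha>. (\<forall>j. cmod (\<alpha> j) < 1) \<longrightarrow>
     (\<lambda>N. ereal (S_partial G \<alpha> N)) \<longlonglongrightarrow> ent h (bs_lim \<alpha>) - ereal (Re (conj_poly_eval Fm \<alpha>) + K)"
proof -
  let ?\<eta> = "density arc_measure (\<lambda>z. ennreal (h z))"
  obtain K where K: "\<And>\<alpha> n. (\<And>j. cmod (\<alpha> j) < 1) \<Longrightarrow> d \<le> n \<Longrightarrow>
    2 * (\<integral>z. ln (cmod (poly (szego_poly \<alpha> n) z)) \<partial>?\<eta>)
      = Re (conj_poly_eval Fm \<alpha>) + (\<Sum>j<n. Re (conj_poly_eval G (\<lambda>i. truncate n \<alpha> (j + i)))) + K"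
    by (rule trace_formula[OF circle_prob_h atomless_density_arc[OF h(1)] mom V dec d]) (use that in blast)+
  have G: "conj_poly_in (d + 1) G" using dec d by (simp add: trace_decomposition_def Let_def)
  define l where "l = real_of_ereal (ent h (\<lambda>u. \<integral>z. u z \<partial>arc_measure))"
  have "(\<lambda>N. ereal (S_partial G \<alpha> N)) \<longlonglongrightarrow> ent h (bs_lim \<alpha>) - ereal (Re (conj_poly_eval Fm \<alpha>) + (K + l))"
    if \<alpha>: "\<And>j. cmod (\<alpha> j) < 1" for \<alpha>
  proof -
    define x where "x n = (\<integral>z. h z * ln_weight \<alpha> n z \<partial>arc_measure)" for n
    obtain l' where "ent h (\<lambda>u. \<integral>z. u z \<partial>arc_measure) = ereal l'"
      by (rule ent_arc_finite[where \<alpha> = \<alpha>, OF \<alpha> h]) (use that in blast)+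
    then have l: "ent h (\<lambda>u. \<integral>z. u z \<partial>arc_measure) = ereal l" by (simp add: l_def)
    \<comment> \<open>The sum up to index \<open>N\<close> involves \<open>N + 1\<close> steps of
      the recursion, hence the shift to \<open>Suc N\<close>.\<close>
    have S: "S_partial G \<alpha> N = (x (Suc N) - Re (conj_poly_eval Fm \<alpha>) - K) + boundary_error G \<alpha> (Suc N)"
      if N: "d \<le> Suc N" for N
    proof -
      define n where "n = Suc N"
      have sq: "(cmod (\<alpha> j))\<^sup>2 < 1" for j using \<alpha> by (simp add: abs_square_less_1)
      have lr: "ln (rho_prod \<alpha> n) = (\<Sum>j<n. ln (1 - (cmod (\<alpha> j))\<^sup>2))"
        unfolding rho_prod_def by (intro ln_prod) (auto simp: less_imp_neq[OF sq])
      have "x n = 2 * (\<integral>z. h z * ln (cmod (poly (szego_poly \<alpha> n) z)) \<partial>arc_measure) - ln (rho_prod \<alpha> n)"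
      proof -
        have "x n = (\<integral>z. 2 * (h z * ln (cmod (poly (szego_poly \<alpha> n) z))) - ln (rho_prod \<alpha> n) * h z \<partial>arc_measure)"
          unfolding x_def ln_weight_def by (simp add: algebra_simps)
        also have "\<dots> = 2 * (\<integral>z. h z * ln (cmod (poly (szego_poly \<alpha> n) z)) \<partial>arc_measure) - ln (rho_prod \<alpha> n) * (\<integral>z. h z \<partial>arc_measure)"
          using integrable_arc_mult[OF h(1) ccont_ln_szego[where \<alpha> = \<alpha>, OF \<alpha>]] integrable_continuous_circle[OF circle_prob_arc h(1)]
          by simp
        finally show ?thesis using h(3) by simp
      qed
      moreover have "(\<integral>z. h z * ln (cmod (poly (szego_poly \<alpha> n) z)) \<partial>arc_measure) = (\<integral>z. ln (cmod (poly (szego_poly \<alpha> n) z)) \<partial>?\<eta>)"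
        using integral_density_circle[OF circle_prob_arc h(1,2) ccont_ln_szego[where \<alpha> = \<alpha>, OF \<alpha>]] by simp
      moreover have "S_partial G \<alpha> N = (\<Sum>j<n. Re (conj_poly_eval G (\<lambda>i. \<alpha> (j + i)))) - (\<Sum>j<n. ln (1 - (cmod (\<alpha> j))\<^sup>2))"
        unfolding S_partial_def n_def by (simp add: atLeast0AtMost lessThan_Suc_atMost sum_subtractf)
      moreover have "boundary_error G \<alpha> n = (\<Sum>j<n. Re (conj_poly_eval G (\<lambda>i. \<alpha> (j + i))))
          - (\<Sum>j<n. Re (conj_poly_eval G (\<lambda>i. truncate n \<alpha> (j + i))))"
        by (simp add: boundary_error_def sum_subtractf)
      moreover have "2 * (\<integral>z. ln (cmod (poly (szego_poly \<alpha> n) z)) \<partial>?\<eta>)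
          = Re (conj_poly_eval Fm \<alpha>) + (\<Sum>j<n. Re (conj_poly_eval G (\<lambda>i. truncate n \<alpha> (j + i)))) + K"
        using K[of \<alpha> n] \<alpha> N by (simp add: n_def)
      ultimately show ?thesis unfolding n_def[symmetric] lr by linarith
    qed
    have S_ev: "eventually (\<lambda>N. (x (Suc N) - Re (conj_poly_eval Fm \<alpha>) - K) + boundary_error G \<alpha> (Suc N) = S_partial G \<alpha> N) sequentially"
      using S by (intro eventually_sequentiallyI[of d]) simp
    show ?thesis
    proof (cases "ent h (bs_lim \<alpha>) = \<infinity>")
      case True
      then have "filterlim x at_top sequentially"
        unfolding x_def by (intro ent_bs_lim_infinite[where \<alpha> = \<alpha>, OF \<alpha> h])
      then have x: "filterlim (\<lambda>N. x (Suc N)) at_top sequentially" by (rule filterlim_compose) (rule filterlim_Suc)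
      obtain B where B: "\<And>n. d \<le> n \<Longrightarrow> \<bar>boundary_error G \<alpha> n\<bar> \<le> B"
        by (rule boundary_error_bounded[of d G \<alpha>]) (use G \<alpha> that in blast)+
      have "filterlim (S_partial G \<alpha>) at_top sequentially"
        unfolding filterlim_at_top
      proof
        fix c :: real
        have "eventually (\<lambda>N. c + Re (conj_poly_eval Fm \<alpha>) + K + B \<le> x (Suc N)) sequentially"
          using x unfolding filterlim_at_top by blast
        then show "eventually (\<lambda>N. c \<le> S_partial G \<alpha> N) sequentially"
          using eventually_ge_at_top[of d]
        proof eventually_elim
          fix N assume N: "c + Re (conj_poly_eval Fm \<alpha>) + K + B \<le> x (Suc N)" "d \<le> N"
          then show "c \<le> S_partial G \<alpha> N" using S[of N] B[of "Suc N"] by auto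
        qed
      qed
      then have "(\<lambda>N. ereal (S_partial G \<alpha> N)) \<longlonglongrightarrow> \<infinity>"
        unfolding tendsto_PInfty filterlim_at_top_dense by simp
      then show ?thesis using True by simp
    next
      case False
      then have fin: "ent h (bs_lim \<alpha>) < \<infinity>" by simp
      have w: "mean_ln_weight \<alpha> n h = x n" for n
        unfolding x_def by (rule mean_ln_weight_def[where \<alpha> = \<alpha> and h = h]) (use \<alpha> h ae fin in auto)
      have el: "ent_arc h = l"
        unfolding l_def by (rule ent_arc_def[where \<alpha> = \<alpha> and h = h]) (use \<alpha> h ae fin in auto)
      have "dominated_density h h" by (rule dominated_h[where \<alpha> = \<alpha> and h = h, OF \<alpha> h ae fin])
      have e: "ent h (bs_lim \<alpha>) = ereal (ent_lim \<alpha> h)" by (rule ent_lim[where \<alpha> = \<alpha> and h = h, OF \<alpha> h ae fin \<open>dominated_density h h\<close>])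
      have "(\<lambda>n. mean_ln_weight \<alpha> n h) \<longlonglongrightarrow> ent_lim \<alpha> h - ent_arc h"
        by (rule mean_ln_weight_tendsto[where \<alpha> = \<alpha> and h = h, OF \<alpha> h ae fin \<open>dominated_density h h\<close>])
      then have "x \<longlonglongrightarrow> ent_lim \<alpha> h - l" by (simp add: w el)
      then have "(\<lambda>N. x (Suc N)) \<longlonglongrightarrow> ent_lim \<alpha> h - l" by (rule LIMSEQ_Suc)
      moreover have "(\<lambda>N. boundary_error G \<alpha> (Suc N)) \<longlonglongrightarrow> 0"
        by (intro LIMSEQ_Suc boundary_error_tendsto_0[OF G] verblunsky_tendsto_0[where \<alpha> = \<alpha> and h = h, OF \<alpha> h ae fin])
      ultimately have "(\<lambda>N. (x (Suc N) - Re (conj_poly_eval Fm \<alpha>) - K) + boundary_error G \<alpha> (Suc N))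
          \<longlonglongrightarrow> (ent_lim \<alpha> h - l - Re (conj_poly_eval Fm \<alpha>) - K) + 0"
        by (intro tendsto_intros)
      then have "S_partial G \<alpha> \<longlonglongrightarrow> (ent_lim \<alpha> h - l - Re (conj_poly_eval Fm \<alpha>) - K) + 0"
        using S_ev by (rule Lim_transform_eventually)
      then have "(\<lambda>N. ereal (S_partial G \<alpha> N)) \<longlonglongrightarrow> ereal (ent_lim \<alpha> h - l - Re (conj_poly_eval Fm \<alpha>) - K + 0)"
        by (intro tendsto_intros)
      then show ?thesis unfolding e by (simp add: algebra_simps)
    qed
  qed
  then show ?thesis by blast
qed

text \<open>For the coefficients of \<mu>, \<open>bs_lim\<close> is integration against \<mu>, so
  \<open>S\<close> is the relative entropy minus a fixed constant. Its value at \<eta> is minus this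
  constant, since the entropy of \<eta> relative to itself is 0.\<close>

lemma sum_rule:
  "(\<forall>\<alpha>. (\<forall>j. \<alpha> j \<in> ball 0 1) \<longrightarrow> (\<exists>L. L \<noteq> -\<infinity> \<and> (\<lambda>N. ereal (S_partial G \<alpha> N)) \<longlonglongrightarrow> L)) \<and>
   \<bar>S_functional Fm G (verblunsky (density arc_measure (\<lambda>z. ennreal (h z))))\<bar> \<noteq> \<infinity> \<and>
   (\<forall>\<mu>. circle_prob \<mu> \<and> infinite (circle_support \<mu>) \<longrightarrow>
      relative_entropy (density arc_measure (\<lambda>z. ennreal (h z))) \<mu> =
        S_functional Fm G (verblunsky \<mu>) - S_functional Fm G (verblunsky (density arc_measure (\<lambda>z. ennreal (h z)))))"
proof -
  let ?\<eta> = "density arc_measure (\<lambda>z. ennreal (h z))"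
  obtain K where K: "\<And>\<alpha>. (\<And>j. cmod (\<alpha> j) < 1) \<Longrightarrow>
     (\<lambda>N. ereal (S_partial G \<alpha> N)) \<longlonglongrightarrow> ent h (bs_lim \<alpha>) - ereal (Re (conj_poly_eval Fm \<alpha>) + K)"
    using S_partial_limit by blast
  have nn: "0 \<le> ent h (bs_lim \<alpha>)" if "\<And>j. cmod (\<alpha> j) < 1" for \<alpha>
    by (rule ent_nonneg) (rule bs_lim_1[OF that])
  have S: "S_functional Fm G \<alpha> = ent h (bs_lim \<alpha>) - ereal K" if "\<And>j. cmod (\<alpha> j) < 1" for \<alpha>
  proof -
    have "lim (\<lambda>N. ereal (S_partial G \<alpha> N)) = ent h (bs_lim \<alpha>) - ereal (Re (conj_poly_eval Fm \<alpha>) + K)"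
      by (rule limI, rule K, rule that)
    then show ?thesis unfolding S_functional_def using nn[of \<alpha>] that by (cases "ent h (bs_lim \<alpha>)") auto
  qed
  have H: "relative_entropy ?\<eta> \<mu> = ent h (bs_lim (verblunsky \<mu>))"
    and v: "\<And>j. cmod (verblunsky \<mu> j) < 1" if \<mu>: "circle_prob \<mu>" "infinite (circle_support \<mu>)" for \<mu>
  proof -
    show v: "cmod (verblunsky \<mu> j) < 1" for j by (rule verblunsky_less_1[OF \<mu>])
    have o: "orth \<mu> j (szego_poly (verblunsky \<mu>) j)" for j
      using monic_OP_eq_szego_poly[OF \<mu>(1)] \<mu>(2) by blast
    have "relative_entropy ?\<eta> \<mu> = ent h (\<lambda>f. \<integral>z. f z \<partial>\<mu>)"
      unfolding relative_entropy_eq_entropy_dual[OF \<mu>(1) circle_prob_h] by (rule entropy_dual_density[OF h(1,2)])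
    also have "\<dots> = ent h (bs_lim (verblunsky \<mu>))"
    proof -
      have "bs_lim (verblunsky \<mu>) (\<lambda>z. exp (G z)) = (\<integral>z. exp (G z) \<partial>\<mu>)" if "ccont G" for G
        by (rule bs_lim_eq_integral[OF v _ \<mu>(1) o]) (intro continuous_intros that)
      then show ?thesis unfolding ent_def by (intro SUP_cong) auto
    qed
    finally show "relative_entropy ?\<eta> \<mu> = ent h (bs_lim (verblunsky \<mu>))" .
  qed
  have inf: "infinite (circle_support ?\<eta>)" by (rule infinite_circle_support[OF circle_prob_h atomless_density_arc[OF h(1)]])
  have zero: "ent h (bs_lim (verblunsky ?\<eta>)) = 0"
  proof (rule antisym)
    have "ent h (\<lambda>f. \<integral>z. f z \<partial>?\<eta>) \<le> 0"
    proof (rule ent_least)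
      fix G :: "complex \<Rightarrow> real" assume G: "ccont G"
      have "(\<integral>z. G z \<partial>?\<eta>) + 1 \<le> (\<integral>z. exp (G z) \<partial>?\<eta>)"
      proof -
        have "(\<integral>z. 1 + G z \<partial>?\<eta>) \<le> (\<integral>z. exp (G z) \<partial>?\<eta>)"
          by (intro integral_circle_mono[OF circle_prob_h] continuous_intros G exp_ge_add_one_self)
        moreover have "(\<integral>z. 1 + G z \<partial>?\<eta>) = (\<integral>z. 1 \<partial>?\<eta>) + (\<integral>z. G z \<partial>?\<eta>)"
          by (intro Bochner_Integration.integral_add integrable_continuous_circle[OF circle_prob_h] continuous_intros G)
        moreover have "(\<integral>z. (1::real) \<partial>?\<eta>) = 1" by (rule integral_circle_const[OF circle_prob_h])
        ultimately show ?thesis by linarith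
      qed
      moreover have "(\<integral>z. G z \<partial>?\<eta>) = (\<integral>z. h z * G z \<partial>arc_measure)"
        using integral_density_circle[OF circle_prob_arc h(1,2) G] by simp
      ultimately show "ereal ((\<integral>z. h z * G z \<partial>arc_measure) - (\<integral>z. exp (G z) \<partial>?\<eta>) + 1) \<le> 0"
        by (simp add: zero_ereal_def)
    qed
    also have "ent h (\<lambda>f. \<integral>z. f z \<partial>?\<eta>) = relative_entropy ?\<eta> ?\<eta>"
      unfolding relative_entropy_eq_entropy_dual[OF circle_prob_h circle_prob_h] by (rule entropy_dual_density[OF h(1,2), symmetric])
    finally show "ent h (bs_lim (verblunsky ?\<eta>)) \<le> 0" using H[OF circle_prob_h inf] by simp
  qed (intro nn v[OF circle_prob_h inf])
  have S\<eta>: "S_functional Fm G (verblunsky ?\<eta>) = - ereal K"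
    using S[of "verblunsky ?\<eta>"] v[OF circle_prob_h inf] zero by simp
  show ?thesis
  proof (intro conjI allI impI)
    fix \<alpha> :: "nat \<Rightarrow> complex" assume "\<forall>j. \<alpha> j \<in> ball 0 1"
    then have \<alpha>: "\<And>j. cmod (\<alpha> j) < 1" by simp
    have "ent h (bs_lim \<alpha>) - ereal (Re (conj_poly_eval Fm \<alpha>) + K) \<noteq> -\<infinity>"
      using nn[of \<alpha>] \<alpha> by (cases "ent h (bs_lim \<alpha>)") auto
    then show "\<exists>L. L \<noteq> -\<infinity> \<and> (\<lambda>N. ereal (S_partial G \<alpha> N)) \<longlonglongrightarrow> L" using K[of \<alpha>] \<alpha> by blast
  next
    show "\<bar>S_functional Fm G (verblunsky ?\<eta>)\<bar> \<noteq> \<infinity>"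
      unfolding S\<eta> by simp
  next
    fix \<mu> assume \<mu>: "circle_prob \<mu> \<and> infinite (circle_support \<mu>)"
    show "relative_entropy ?\<eta> \<mu> = S_functional Fm G (verblunsky \<mu>) - S_functional Fm G (verblunsky ?\<eta>)"
      using \<mu> H[of \<mu>] S[of "verblunsky \<mu>"] v[of \<mu>] S\<eta> nn[of "verblunsky \<mu>"]
      by (cases "ent h (bs_lim (verblunsky \<mu>))") auto
  qed
qed

end

lemma norm_diff_circle_sq:
  assumes "w \<in> sphere 0 1"
  shows "(cmod (cis t - w))\<^sup>2 / 2 = 1 - (cos t * Re w + sin t * Im w)"
proof -
  have "(Re w)\<^sup>2 + (Im w)\<^sup>2 = 1" using assms by (simp flip: cmod_power2)
  moreover have "(cmod (cis t - w))\<^sup>2 = (cos t)\<^sup>2 + (sin t)\<^sup>2 + ((Re w)\<^sup>2 + (Im w)\<^sup>2) - 2 * (cos t * Re w + sin t * Im w)"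
    unfolding cmod_power2 by (simp add: power2_eq_square algebra_simps)
  ultimately show ?thesis by simp
qed

text \<open>Uses \<open>1 - cos (t - \<theta>) = |cis t - cis \<theta>|\<^sup>2 / 2\<close>, which
  makes the weight a polynomial in the real and imaginary parts of the point.\<close>

definition cos_weight_circle :: "nat \<Rightarrow> (nat \<Rightarrow> real) \<Rightarrow> (nat \<Rightarrow> nat) \<Rightarrow> complex \<Rightarrow> real" where
  "cos_weight_circle k \<theta> m z = (\<Prod>j = 1..k. ((cmod (z - cis (\<theta> j)))\<^sup>2 / 2) ^ m j)"

lemma cos_weight_eq: "cos_weight k \<theta> m = (\<lambda>t. cos_weight_circle k \<theta> m (cis t))"
  unfolding cos_weight_def cos_weight_circle_def
  by (subst norm_diff_circle_sq) (simp_all add: cos_diff)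

lemma cos_weight_circle_nonneg: "0 \<le> cos_weight_circle k \<theta> m z"
  unfolding cos_weight_circle_def by (intro prod_nonneg) auto

text \<open>Input to \<open>real_polynomial_function_trig\<close>, which bounds the frequencies of
  the weight.\<close>

lemma real_polynomial_function_cos_weight: "real_polynomial_function (cos_weight_circle k \<theta> m)"
proof -
  have 1: "real_polynomial_function (\<lambda>z. ((cmod (z - w))\<^sup>2 / 2) ^ l)" for w :: complex and l
    unfolding cmod_power2 minus_complex.sel
    by (intro real_polynomial_function_power real_polynomial_function_divide real_polynomial_function.intros(3)
          real_polynomial_function_diff real_polynomial_function.intros(1) real_polynomial_function.intros(2)
          bounded_linear_Re bounded_linear_Im)
  have "real_polynomial_function (\<lambda>z. \<Prod>j\<in>J. ((cmod (z - cis (\<theta> j)))\<^sup>2 / 2) ^ m j)" if "finite J" for J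
    using that by (induction J rule: finite_induct) (auto intro: 1 real_polynomial_function.intros(4) real_polynomial_function.intros(2))
  then show ?thesis unfolding cos_weight_circle_def by simp
qed

text \<open>A Laurent polynomial is determined by its values on the circle, so the existential
  quantifier singles out the potential. Finiteness of \<open>S\<close> at \<eta> makes the
  difference of extended reals meaningful.\<close>

theorem theorem3p6:
  fixes k :: nat and \<theta> :: "nat \<Rightarrow> real" and m :: "nat \<Rightarrow> nat" and \<eta> :: "complex measure"
  assumes "k \<ge> 1"
    and "\<forall>j\<in>{1..k}. \<theta> j \<in> {0..<2 * pi}"
    and "inj_on \<theta> {1..k}"
    and "\<forall>j\<in>{1..k}. m j > 0"
    and "\<eta> = circle_weight_measure (cos_weight k \<theta> m)"
  shows "\<exists>V :: laurent_poly.
    (\<forall>z\<in>sphere 0 1. laurent_eval V z = complex_of_real (log_potential \<eta> z)) \<and>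
    Poly_Mapping.lookup V 0 = 0 \<and>
    (\<forall>F\<^sub>m F\<^sub>p G. trace_decomposition V F\<^sub>m F\<^sub>p G \<longrightarrow>
      (\<forall>\<alpha>. (\<forall>j. \<alpha> j \<in> ball 0 1) \<longrightarrow>
         (\<exists>L. L \<noteq> -\<infinity> \<and> (\<lambda>N. ereal (S_partial G \<alpha> N)) \<longlonglongrightarrow> L)) \<and>
      \<bar>S_functional F\<^sub>m G (verblunsky \<eta>)\<bar> \<noteq> \<infinity> \<and>
      (\<forall>\<mu>. circle_prob \<mu> \<and> infinite (circle_support \<mu>) \<longrightarrow>
         relative_entropy \<eta> \<mu> =
           S_functional F\<^sub>m G (verblunsky \<mu>) - S_functional F\<^sub>m G (verblunsky \<eta>)))"
proof -
  define W where "W = cos_weight_circle k \<theta> m"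
  define c where "c = (\<integral>z. W z \<partial>arc_measure)"
  define h where "h z = W z / c" for z
  have W0: "0 \<le> W z" for z by (simp add: W_def cos_weight_circle_nonneg)
  have Wc: "ccont W"
    unfolding W_def cos_weight_circle_def by (intro continuous_intros) auto
  have W_ae: "AE z in arc_measure. W z \<noteq> 0"
  proof -
    have "AE z in arc_measure. z \<notin> (cis \<circ> \<theta>) ` {1..k}"
      by (rule AE_not_in_finite[OF AE_arc_neq]) simp
    then show ?thesis by eventually_elim (auto simp: W_def cos_weight_circle_def)
  qed
  have "c \<noteq> 0"
  proof
    assume "c = 0"
    then have "AE z in arc_measure. W z = 0"
      unfolding c_def using integral_nonneg_eq_0_iff_AE[OF integrable_continuous_circle[OF circle_prob_arc Wc]] W0 by simp
    with W_ae have "AE z in arc_measure. False" by eventually_elim simp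
    then show False using prob_space.AE_False[of arc_measure] circle_prob_arc by (simp add: circle_prob_def)
  qed
  then have c: "0 < c" using W0 by (simp add: c_def order_less_le)
  have h: "ccont h" "\<And>z. z \<in> sphere 0 1 \<Longrightarrow> 0 \<le> h z" "(\<integral>z. h z \<partial>arc_measure) = 1"
    unfolding h_def using c W0 Wc by (auto intro!: continuous_intros simp: c_def[symmetric])
  have ae: "AE z in arc_measure. h z \<noteq> 0" using W_ae c by (simp add: h_def)
  have \<eta>_eq: "\<eta> = density arc_measure (\<lambda>z. ennreal (h z))"
    using assms(5) circle_weight_measure_eq[OF Wc] by (simp add: cos_weight_eq W_def c_def h_def)
  \<comment> \<open>\<open>M\<close> bounds the negative frequencies of the weight. A moment of
    order \<open>l > M\<close> is therefore the mean of a multiple of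
    \<open>z\<^sup>l\<^sup>-\<^sup>M p(z)\<close>, which vanishes at the origin.\<close>
  obtain M p where Mp: "\<forall>z\<in>sphere 0 1. complex_of_real (W z) = cnj z ^ M * poly p z"
    using real_polynomial_function_trig[OF real_polynomial_function_cos_weight] unfolding W_def by blast
  have mom: "(\<integral>w. w ^ l \<partial>\<eta>) = 0" if l: "l > M" for l
  proof -
    have "(\<integral>w. w ^ l \<partial>\<eta>) = (\<integral>w. h w *\<^sub>R w ^ l \<partial>arc_measure)"
      unfolding \<eta>_eq by (intro integral_density_circle[OF circle_prob_arc] h continuous_intros)
    also have "\<dots> = (\<integral>w. w ^ (l - M) * poly p w / of_real c \<partial>arc_measure)"
    proof (rule integral_circle_cong[OF circle_prob_arc])
      fix w :: complex assume w: "w \<in> sphere 0 1"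
      have "h w *\<^sub>R w ^ l = (cnj (w ^ M) * w ^ l) * poly p w / of_real c"
        using Mp w by (simp add: h_def scaleR_conv_of_real)
      then show "h w *\<^sub>R w ^ l = w ^ (l - M) * poly p w / of_real c"
        using circle_power_cnj[OF w, of M l] l by simp
    qed
    also have "\<dots> = 0 ^ (l - M) * poly p 0 / of_real c"
      using c by (intro arc_mean_value continuous_intros holomorphic_intros) auto
    finally show ?thesis using l by simp
  qed
  have \<eta>: "circle_prob \<eta>" unfolding \<eta>_eq by (rule circle_prob_density[OF circle_prob_arc h])
  have atom: "AE z in \<eta>. z \<noteq> a" for a unfolding \<eta>_eq by (rule atomless_density_arc[OF h(1)])
  obtain V where V: "Poly_Mapping.lookup V 0 = 0"
    "\<forall>z\<in>sphere 0 1. laurent_eval V z = complex_of_real (pot \<eta> M z)"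
    by (rule laurent_pot_exists[OF \<eta> atom mom])
  have V_pot: "\<forall>z\<in>sphere 0 1. laurent_eval V z = complex_of_real (log_potential \<eta> z)"
    using V(2) log_integral_boundary[OF \<eta> atom mom] by (simp add: log_potential_def)
  show ?thesis
    by (rule exI[of _ V], rule conjI[OF V_pot conjI[OF V(1)]], intro allI impI,
        rule sum_rule[OF h ae mom[unfolded \<eta>_eq] V(2)[unfolded \<eta>_eq] _ refl, folded \<eta>_eq])
qed

end
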